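(* Let $X_n$, $D_n$, $N=N(n)$ and $B_n=\frac1N(D_n\circ X_n)(D_n\circ X_n)^*$ satisfy all the assumptions listed in the context. For each $\epsilon>0$ choose $d_\epsilon\ge M_\epsilon$ and define $\widetilde d^{\,n}_{jk}=\widetilde d^{\,n\epsilon}_{jk}=d^n_{jk}I(d^n_{jk}\le d_\epsilon)$ for $1\le j\le n$, $1\le k\le N$, where $I(\cdot)$ is the indicator. Then with probability one $$\limsup_{n} D(F^{B_n},F^0_{n,\epsilon})\le\epsilon,$$ where $F^0_{n,\epsilon}$ is the probability distribution function having Stieltjes transform $$G_n(z)=\frac1n\sum_{i=1}^n\frac{1}{\frac1N\sum_{k=1}^N\frac{(\widetilde d^{\,n}_{ik})^2}{1+\frac nN e^0_k(z)}-z},\qquad z\in\mathbb C^+,$$ and, for each $z\in\mathbb C^+$, $e^0_k=e^0_{n,k}(z)$, $k=1,\dots,N$, are unique solutions lying in $\mathbb C^+$ to the system of equations $$e^0_j(z)=\frac1n\sum_{i=1}^n\frac{(\widetilde d^{\,n}_{ij})^2}{\frac1N\sum_{k=1}^N\frac{(\widetilde d^{\,n}_{ik})^2}{1+\frac nN e^0_k(z)}-z},\qquad j=1,\dots,N.$$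
   Context: Matrices. For each positive integer $n$, $N=N(n)$ is a positive integer with $0<\liminf_n n/N\le\limsup_n n/N<\infty$. $X_n=(x^{(n)}_{jk})$ is an $n\times N$ matrix of independent complex random variables with $\mathbb E x^{(n)}_{jk}=0$ and $\mathbb E|x^{(n)}_{jk}|^2=1$. $D_n=(d^n_{jk})$ is an $n\times N$ matrix of nonrandom nonnegative real numbers. $\circ$ denotes the Hadamard (entrywise) product, $^*$ the conjugate transpose, and $B_n=\frac1N(D_n\circ X_n)(D_n\circ X_n)^*$, which is $n\times n$. Assumptions on $X_n$. For each $\eta>0$, $$\lim_{n\to\infty}\frac1{nN}\sum_{j=1}^n\sum_{k=1}^N\mathbb E|x^{(n)}_{jk}|^2I(|x^{(n)}_{jk}|\ge\eta\sqrt n)=0 .$$ From this one can construct, and one fixes, a sequence of positive numbers $\eta_n\downarrow0$ with $$\lim_{n\to\infty}\frac1{\eta_n^2nN}\sum_{j=1}^n\sum_{k=1}^N\mathbb E|x^{(n)}_{jk}|^2I(|x^{(n)}_{jk}|\ge\eta_n\sqrt n)=0 .$$ It is also assumed that there exist positive $e$ and $f$ such that for all $n$ sufficiently large (and all $j,k$) $$e<\eta_n\sqrt n\quad\text{and}\quad \mathbb E\left|x^{(n)}_{jk}I(|x^{(n)}_{jk}|\le e)-\mathbb E\big(x^{(n)}_{jk}I(|x^{(n)}_{jk}|\le e)\big)\right|^2>f .$$ Assumptions on $D_n$. Each column of $D_n$ is nonzero. For every $\epsilon>0$ there exists $M_\epsilon>0$ such that for each $n$ there exist sets $E^n_{r\epsilon}\subset\{1,\dots,n\}$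 and $E^n_{c\epsilon}\subset\{1,\dots,N\}$ such that (1) $\#E^n_{r\epsilon}+\#E^n_{c\epsilon}\le\epsilon n$, where $\#$ denotes the number of elements; and (2) $d^n_{jk}\le M_\epsilon$ for all $j\in\{1,\dots,n\}\setminus E^n_{r\epsilon}$ and $k\in\{1,\dots,N\}\setminus E^n_{c\epsilon}$. Notation. $\mathbb C^+=\{z\in\mathbb C:\Im z>0\}$. For a Hermitian $n\times n$ matrix $A$, $F^A(x)=\frac1n\#\{\text{eigenvalues of }A\text{ that are }\le x\}$ (counted with multiplicity), $x\in\mathbb R$. The Stieltjes transform of a finite measure $\mu$ on $\mathbb R$ (or of its distribution function) is $m_\mu(z)=\int\frac{1}{x-z}\,d\mu(x)$, $z\in\mathbb C^+$. Metric $D$. For distribution functions $F,G$ of sub-probability measures on $\mathbb R$, $$D(F,G)=\sum_{i=1}^\infty\left|\int f_i\,dF-\int f_i\,dG\right|2^{-i},$$ where $\{f_i\}$ is an enumeration of all continuous functions which, for some positive integer $m$ and some interval $[a,b]$ with $a,b$ rational, take the constant value $\frac1m$ on $[a,b]$, are $0$ on $(-\infty,a-\frac1m]\cup[b+\frac1m,\infty)$, and are linear on each of $[a-\frac1m,a]$ and $[b,b+\frac1m]$.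
   Formalization: The bound ε is claimed only for enumerations with ∑2^{-i}/m_i ≤ 1/2 (m_i the m of f_i), since it fails for some others; for all enumerations 2ε is proved. e⁰_k is required to lie in C⁺ only when column k of the truncated profile is nonzero (otherwise e⁰_k = 0). *)

theory Defs
  imports
    "HOL-Probability.Probability"
    "Jordan_Normal_Form.Schur_Decomposition"
begin

text \<open>Row and column indices start at \<open>0\<close>: an \<open>n\<close> by \<open>N\<close> array is indexed by
  \<open>{..<n} \<times> {..<N}\<close>.\<close>

definition hadamard :: "'a::times mat \<Rightarrow> 'a mat \<Rightarrow> 'a mat" where
  "hadamard A B = mat (dim_row A) (dim_col A) (\<lambda>ij. A $$ ij * B $$ ij)"

definition B_mat :: "nat \<Rightarrow> nat \<Rightarrow> (nat \<Rightarrow> nat \<Rightarrow> real) \<Rightarrow> (nat \<Rightarrow> nat \<Rightarrow> complex) \<Rightarrow> complex mat" where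
  "B_mat n N d x =
    (let Y = hadamard (mat n N (\<lambda>(j, k). complex_of_real (d j k))) (mat n N (\<lambda>(j, k). x j k))
     in (1 / of_nat N) \<cdot>\<^sub>m (Y * mat_adjoint Y))"

text \<open>The spectral distribution function; it is only used for Hermitian matrices, whose
  eigenvalues are real, so that taking the real part is harmless. The multiplicity of an
  eigenvalue is its order as a root of the characteristic polynomial.\<close>

definition esd :: "complex mat \<Rightarrow> real \<Rightarrow> real" where
  "esd A x = real (\<Sum>l | eigenvalue A l \<and> Re l \<le> x. Polynomial.order l (char_poly A))
               / real (dim_row A)"

text \<open>Distribution functions are represented as functions; integration against \<open>F\<close> is
  integration with respect to the Lebesgue-Stieltjes measure \<open>interval_measure F\<close>.\<close>

definition prob_df :: "(real \<Rightarrow> real) \<Rightarrow> bool" where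
  "prob_df F \<longleftrightarrow> mono F \<and> (\<forall>x. continuous (at_right x) F) \<and>
     (F \<longlongrightarrow> 0) at_bot \<and> (F \<longlongrightarrow> 1) at_top"

definition stieltjes :: "(real \<Rightarrow> real) \<Rightarrow> complex \<Rightarrow> complex" where
  "stieltjes F z = (LINT x|interval_measure F. 1 / (complex_of_real x - z))"

definition trapezoid :: "nat \<Rightarrow> real \<Rightarrow> real \<Rightarrow> real \<Rightarrow> real" where
  "trapezoid m a b x =
    (if x \<le> a - 1 / m \<or> b + 1 / m \<le> x then 0
     else if x < a then x - (a - 1 / m)
     else if x \<le> b then 1 / m
     else (b + 1 / m) - x)"

definition trapezoids :: "(real \<Rightarrow> real) set" where
  "trapezoids = {trapezoid m a b |m a b. m > 0 \<and> a \<in> \<rat> \<and> b \<in> \<rat> \<and> a < b}"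

text \<open>The metric depends on the enumeration; the term \<open>f i\<close> is the one with number \<open>i + 1\<close>.\<close>

definition vague_dist :: "(nat \<Rightarrow> real \<Rightarrow> real) \<Rightarrow> (real \<Rightarrow> real) \<Rightarrow> (real \<Rightarrow> real) \<Rightarrow> real" where
  "vague_dist f F G =
    (\<Sum>i. \<bar>(LINT x|interval_measure F. f i x) - (LINT x|interval_measure G. f i x)\<bar> / 2 ^ Suc i)"

text \<open>The weighted mean height \<open>\<Sum>i. 2^(-i) / m i\<close> of the enumerated trapezoids. Each \<open>f i\<close> rises
  and falls by \<open>1 / m i\<close>, so integration by parts bounds \<open>vague_dist f F G\<close> by
  \<open>2 * mean_height f\<close> times the uniform distance of \<open>F\<close> and \<open>G\<close>. In particular
  \<open>mean_height f \<le> 1/2\<close> makes \<open>vague_dist f\<close> at most the uniform distance; this is a property of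
  the enumeration which some enumerations have (see \<open>ex_enumeration_mean_height\<close>) and others do
  not; for the latter only the factor 2 is available, since \<open>f i\<close> with \<open>m i = 1\<close> may see the full
  distance with opposite signs on its two slopes.\<close>

definition mean_height :: "(nat \<Rightarrow> real \<Rightarrow> real) \<Rightarrow> real" where
  "mean_height f = (\<Sum>i. (SUP x. f i x) / 2 ^ Suc i)"

lemma trapezoid_bounds:
  assumes "m > 0"
  shows "0 \<le> trapezoid m a b x" "trapezoid m a b x \<le> 1 / m"
  using assms by (auto simp: trapezoid_def)

lemma SUP_trapezoid:
  assumes "m > 0" "a < b"
  shows "(SUP x. trapezoid m a b x) = 1 / m"
proof (rule cSup_eq_maximum)
  have "0 < 1 / real m" using assms by simp
  moreover from this have "a < b + 1 / real m" using assms by linarith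
  ultimately have "trapezoid m a b a = 1 / m" using assms by (simp add: trapezoid_def)
  then show "1 / m \<in> range (trapezoid m a b)" by (metis rangeI)
qed (use trapezoid_bounds assms in auto)

lemma trapezoid_height_inj:
  assumes "m > 0" "a < b" "trapezoid m a b = trapezoid m' a' b'" "m' > 0" "a' < b'"
  shows "m = m'"
proof -
  have "(1::real) / m = 1 / m'"
    using SUP_trapezoid[OF assms(1,2)] SUP_trapezoid[OF assms(4,5)] assms(3) by simp
  then show ?thesis by simp
qed

lemma countable_trapezoids: "countable trapezoids"
proof -
  have "trapezoids \<subseteq> (\<lambda>(m, a, b). trapezoid m a b) ` (UNIV \<times> \<rat> \<times> \<rat>)"
    by (force simp: trapezoids_def)
  moreover have "countable ((UNIV :: nat set) \<times> (\<rat> :: real set) \<times> (\<rat> :: real set))"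
    by (intro countable_SIGMA countable_rat) auto
  ultimately show ?thesis by (meson countable_image countable_subset)
qed

lemma ex_enumeration_mean_height:
  "\<exists>f. bij_betw f UNIV trapezoids \<and> mean_height f \<le> 1 / 2"
proof -
  define t where "t = (\<lambda>m. trapezoid m 0 1)"
  have t_in: "t m \<in> trapezoids" if "m > 0" for m
    using that unfolding t_def trapezoids_def by force
  have t_inj: "inj_on t {0<..}"
    by (rule inj_onI) (auto simp: t_def dest: trapezoid_height_inj[rotated 2])
  define R where "R = trapezoids - {t 4, t 5}"
  have "infinite trapezoids"
    using t_in t_inj infinite_Ioi[of "0::nat"] finite_imageD finite_subset
    by (metis (full_types) greaterThan_iff image_subsetI)
  then have "infinite R" unfolding R_def by simp
  moreover have "countable R" unfolding R_def using countable_trapezoids by simp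
  ultimately obtain h where h: "bij_betw h (UNIV::nat set) R"
    by (metis bij_betw_from_nat_into)
  define f where "f = (\<lambda>i. case i of 0 \<Rightarrow> t 4 | Suc 0 \<Rightarrow> t 5 | Suc (Suc k) \<Rightarrow> h k)"
  have f_simps: "f 0 = t 4" "f (Suc 0) = t 5" "\<And>k. f (Suc (Suc k)) = h k"
    by (auto simp: f_def)
  have hR: "h k \<in> R" for k using h by (auto simp: bij_betw_def)
  have ne: "t 4 \<noteq> t 5" using inj_onD[OF t_inj, of 4 5] by auto
  have nat3: "i = 0 \<or> i = Suc 0 \<or> (\<exists>k. i = Suc (Suc k))" for i
    by (metis not0_implies_Suc)
  have "inj f"
  proof (rule injI)
    fix i j assume "f i = f j"
    then show "i = j"
      using nat3[of i] nat3[of j] ne hR bij_betw_imp_inj_on[OF h]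
      by (auto simp: f_simps R_def inj_eq) (metis+)
  qed
  moreover have "range f = trapezoids"
  proof
    show "range f \<subseteq> trapezoids"
    proof
      fix g assume "g \<in> range f"
      then obtain i where "g = f i" by auto
      then show "g \<in> trapezoids" using nat3[of i] hR t_in by (auto simp: f_simps R_def)
    qed
    show "trapezoids \<subseteq> range f"
    proof
      fix g assume g: "g \<in> trapezoids"
      show "g \<in> range f"
      proof (cases "g \<in> R")
        case True
        then obtain k where "g = h k" using h by (auto simp: bij_betw_def)
        then show ?thesis using f_simps(3) by (metis rangeI)
      next
        case False
        then have "g = t 4 \<or> g = t 5" using g by (auto simp: R_def)
        then show ?thesis using f_simps by (metis rangeI)
      qed
    qed
  qed
  ultimately have bij: "bij_betw f UNIV trapezoids" by (simp add: bij_betw_def)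
  define s where "s = (\<lambda>i. SUP x. f i x)"
  have s: "0 \<le> s i \<and> s i \<le> 1" for i
  proof -
    have "f i \<in> trapezoids" using bij by (auto simp: bij_betw_def)
    then obtain m a b where "f i = trapezoid m a b" "m > 0" "a < b"
      by (auto simp: trapezoids_def)
    then show ?thesis unfolding s_def by (simp add: SUP_trapezoid)
  qed
  have s0: "s 0 = 1 / 4" and s1: "s (Suc 0) = 1 / 5"
    by (simp_all add: s_def f_simps t_def SUP_trapezoid)
  have geo: "(\<lambda>i. 1 / 2 ^ Suc i :: real) sums 1"
    using power_half_series by (simp add: power_one_over)
  have sm: "summable (\<lambda>i. s i / 2 ^ Suc i)"
    using s by (intro summable_comparison_test'[OF sums_summable[OF geo], of 0])
      (auto simp: divide_right_mono)
  have "mean_height f = (\<Sum>i. s (i + 2) / 2 ^ Suc (i + 2)) + (\<Sum>i<2. s i / 2 ^ Suc i)"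
    using suminf_split_initial_segment[OF sm, of 2] by (simp only: mean_height_def s_def)
  also have "(\<Sum>i<2. s i / 2 ^ Suc i) = 7 / 40"
    by (simp add: s0 s1 numeral_2_eq_2)
  also have "(\<Sum>i. s (i + 2) / 2 ^ Suc (i + 2)) \<le> (\<Sum>i. 1 / 4 * (1 / 2 ^ Suc i))"
    using s summable_ignore_initial_segment[OF sm, of 2] sums_summable[OF geo]
    by (intro suminf_le summable_mult) (auto simp: field_simps)
  also have "\<dots> = 1 / 4"
    using sums_unique[OF sums_mult[OF geo, of "1/4"]] by simp
  finally have "mean_height f \<le> 1 / 2" by simp
  with bij show ?thesis by blast
qed

definition truncate_profile :: "real \<Rightarrow> (nat \<Rightarrow> nat \<Rightarrow> real) \<Rightarrow> nat \<Rightarrow> nat \<Rightarrow> real" where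
  "truncate_profile c d j k = d j k * of_bool (d j k \<le> c)"

definition resolvent_denom ::
  "nat \<Rightarrow> nat \<Rightarrow> (nat \<Rightarrow> nat \<Rightarrow> real) \<Rightarrow> complex \<Rightarrow> (nat \<Rightarrow> complex) \<Rightarrow> nat \<Rightarrow> complex" where
  "resolvent_denom n N d z e i =
    1 / of_nat N * (\<Sum>k<N. of_real ((d i k)\<^sup>2) / (1 + of_nat n / of_nat N * e k)) - z"

text \<open>Solutions of the system for the (truncated) profile \<open>d\<close>. Truncation may annihilate a column;
  the equation of such a column \<open>j\<close> reads \<open>e j = 0\<close>, and \<open>e j\<close> then enters neither the other
  equations nor \<open>G_fun\<close>, as it only occurs with coefficient \<open>0\<close>. Membership in the upper half
  plane is therefore required for the nonzero columns.\<close>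

definition e0_solution ::
  "nat \<Rightarrow> nat \<Rightarrow> (nat \<Rightarrow> nat \<Rightarrow> real) \<Rightarrow> complex \<Rightarrow> (nat \<Rightarrow> complex) \<Rightarrow> bool" where
  "e0_solution n N d z e \<longleftrightarrow> e \<in> extensional {..<N} \<and>
    (\<forall>j<N. ((\<exists>i<n. d i j \<noteq> 0) \<longrightarrow> Im (e j) > 0) \<and>
       e j = 1 / of_nat n * (\<Sum>i<n. of_real ((d i j)\<^sup>2) / resolvent_denom n N d z e i))"

definition e0 :: "nat \<Rightarrow> nat \<Rightarrow> (nat \<Rightarrow> nat \<Rightarrow> real) \<Rightarrow> complex \<Rightarrow> nat \<Rightarrow> complex" where
  "e0 n N d z = (THE e. e0_solution n N d z e)"

definition G_fun :: "nat \<Rightarrow> nat \<Rightarrow> (nat \<Rightarrow> nat \<Rightarrow> real) \<Rightarrow> complex \<Rightarrow> complex" where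
  "G_fun n N d z = 1 / of_nat n * (\<Sum>i<n. 1 / resolvent_denom n N d z (e0 n N d z) i)"

definition is_F0 :: "nat \<Rightarrow> nat \<Rightarrow> (nat \<Rightarrow> nat \<Rightarrow> real) \<Rightarrow> (real \<Rightarrow> real) \<Rightarrow> bool" where
  "is_F0 n N d F \<longleftrightarrow> prob_df F \<and> (\<forall>z. Im z > 0 \<longrightarrow> stieltjes F z = G_fun n N d z)"

definition F0 :: "nat \<Rightarrow> nat \<Rightarrow> (nat \<Rightarrow> nat \<Rightarrow> real) \<Rightarrow> real \<Rightarrow> real" where
  "F0 n N d = (THE F. is_F0 n N d F)"

end

theory Submission
  imports Defs
begin

text \<open>
  Discarding the large entries of the profile is cheap: they sit in few rows and columns, and by the rank inequality
  (\<open>eigenvalue_count_le\<close>) this moves the spectral distribution function by at most \<open>\<epsilon>\<close>, uniformly. A trapezoid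
  sees such a change on both of its slopes, which costs \<open>2 * \<epsilon> * mean_height f\<close> in the metric
  (\<open>vague_dist_truncate_le\<close>). It remains to show that for a bounded profile the distance to \<open>F0\<close> tends to \<open>0\<close> almost surely.

  By a Stone--Weierstrass argument on the circle, vague convergence follows from the convergence of Stieltjes transforms
  at the points \<open>\<i> t\<close> with \<open>t \<ge> v0\<close> for some \<open>v0\<close> (\<open>vague_dist_tendsto_0_kern\<close>); by Lipschitz continuity, rational \<open>t\<close>
  are enough. For a fixed such point the transform is the normalised trace of the resolvent \<open>R\<close>. Changing a column is
  a perturbation of rank at most two, so the trace has bounded differences as a function of the independent columns,
  its fourth central moment is of order \<open>1 / n\<^sup>2\<close>, and it is almost surely asymptotic to its mean.

  For the mean, the identity \<open>1 + z R = R Y Y\<^sup>*\<close> is expanded over the columns, and each column is separated from the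
  rest by the Sherman--Morrison formula. What appears are quadratic forms in a column with a matrix that is independent
  of it. Such a form is close in mean to a trace (\<open>quadratic_form_concentration\<close>); here the Lindeberg condition enters,
  for a fixed truncation level \<open>h\<close> that tends to \<open>0\<close> at the very end. Hence the numbers \<open>e_hat k\<close>, the weighted
  traces of the mean resolvent, satisfy the system up to a small error (\<open>defect_bound\<close>). Far up the imaginary axis the
  right-hand side of the system is a contraction in the maximum norm, so \<open>e_hat\<close> is close to the solution \<open>e0\<close>
  and the mean transform is close to \<open>G_fun\<close> (\<open>mean_trace_near_G\<close>).

  Solvability of the system holds on the whole upper half plane. Uniqueness and existence both rest on the fact that the
  right-hand side contracts a hyperbolic distance, because part of the imaginary part of its value comes from \<open>z\<close>
  rather than from \<open>e\<close> (\<open>sys_hyperbolic_contraction\<close>). The iterates that converge to the solution are Stieltjes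
  transforms of probability measures on the half line with bounded means: each step is a diagonal entry
  of the resolvent of an explicit positive semidefinite matrix (\<open>discrete_stieltjes_star\<close>). A weak limit of these measures
  has the transform \<open>G_fun\<close> and is \<open>F0\<close>.
\<close>

section \<open>Hermitian forms and the spectral theorem\<close>

text \<open>Gaussian elimination on the equations, one at a time: fewer homogeneous equations than unknowns leave a
  nonzero solution. It is the only dimension count that is used below; the vector spaces themselves never appear.\<close>

lemma underdetermined_system:
  fixes m :: "'e \<Rightarrow> 's \<Rightarrow> complex"
  assumes "finite E" "finite S" "card E < card S"
  shows "\<exists>c. (\<exists>s\<in>S. c s \<noteq> 0) \<and> (\<forall>e\<in>E. (\<Sum>s\<in>S. m e s * c s) = 0)"
  using assms
proof (induction E arbitrary: S m rule: finite_induct)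
  case empty
  then obtain s where "s \<in> S" by fastforce
  then show ?case by (intro exI[of _ "\<lambda>_. 1"]) auto
next
  case (insert e E)
  show ?case
  proof (cases "\<forall>s\<in>S. m e s = 0")
    case True
    have "card E < card S" using insert by simp
    from insert.IH[OF insert.prems(1) this, of m] True show ?thesis
      by auto
  next
    case False
    then obtain s0 where s0: "s0 \<in> S" "m e s0 \<noteq> 0" by auto
    let ?S = "S - {s0}"
    have "card E < card ?S" using insert s0 by simp
    from insert.IH[OF _ this, of "\<lambda>e' s. m e' s - m e' s0 * m e s / m e s0"] insert.prems
    obtain c where c: "\<exists>s\<in>?S. c s \<noteq> 0"
      "\<And>e'. e' \<in> E \<Longrightarrow> (\<Sum>s\<in>?S. (m e' s - m e' s0 * m e s / m e s0) * c s) = 0" by auto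
    define c' where "c' = c(s0 := - (\<Sum>s\<in>?S. m e s * c s) / m e s0)"
    have sums: "(\<Sum>s\<in>S. m e' s * c' s) = m e' s0 * c' s0 + (\<Sum>s\<in>?S. m e' s * c s)" for e'
      unfolding sum.remove[OF insert.prems(1) s0(1)]
      by (intro arg_cong2[of _ _ _ _ "(+)"] sum.cong) (auto simp: c'_def)
    have "(\<Sum>s\<in>S. m e s * c' s) = 0"
      unfolding sums using s0 by (simp add: c'_def)
    moreover have "(\<Sum>s\<in>S. m e' s * c' s) = 0" if "e' \<in> E" for e'
    proof -
      have "0 = (\<Sum>s\<in>?S. m e' s * c s) - m e' s0 * (\<Sum>s\<in>?S. m e s * c s) / m e s0"
        using c(2)[OF that]
        by (simp add: left_diff_distrib sum_subtractf sum_distrib_left sum_divide_distrib mult.assoc)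
      then show ?thesis unfolding sums by (simp add: c'_def)
    qed
    moreover have "\<exists>s\<in>S. c' s \<noteq> 0" using c(1) by (auto simp: c'_def)
    ultimately show ?thesis by auto
  qed
qed

text \<open>Vectors are functions on a finite index set \<open>I\<close> and matrices are functions of two indices, so that
  index sets of any shape (pairs, options, subsets) are available; values outside \<open>I\<close> are irrelevant.\<close>

definition ip :: "'i set \<Rightarrow> ('i \<Rightarrow> complex) \<Rightarrow> ('i \<Rightarrow> complex) \<Rightarrow> complex" where
  "ip I u v = (\<Sum>i\<in>I. cnj (u i) * v i)"

definition mv :: "'i set \<Rightarrow> ('i \<Rightarrow> 'i \<Rightarrow> complex) \<Rightarrow> ('i \<Rightarrow> complex) \<Rightarrow> 'i \<Rightarrow> complex" where
  "mv I H u i = (\<Sum>j\<in>I. H i j * u j)"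

definition hermitian_on :: "'i set \<Rightarrow> ('i \<Rightarrow> 'i \<Rightarrow> complex) \<Rightarrow> bool" where
  "hermitian_on I H \<longleftrightarrow> (\<forall>i\<in>I. \<forall>j\<in>I. H j i = cnj (H i j))"

definition orthonormal :: "'i set \<Rightarrow> nat \<Rightarrow> (nat \<Rightarrow> 'i \<Rightarrow> complex) \<Rightarrow> bool" where
  "orthonormal I k u \<longleftrightarrow> (\<forall>a<k. \<forall>b<k. ip I (u a) (u b) = (if a = b then 1 else 0))"

lemma ip_cnj: "cnj (ip I u v) = ip I v u"
  by (simp add: ip_def mult.commute)

lemma ip_self: "ip I u u = of_real (\<Sum>i\<in>I. (cmod (u i))\<^sup>2)"
  by (simp add: ip_def complex_norm_square[symmetric] mult.commute del: of_real_power)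

lemma ip_self_eq_0: "finite I \<Longrightarrow> ip I u u = 0 \<longleftrightarrow> (\<forall>i\<in>I. u i = 0)"
  unfolding ip_self of_real_eq_0_iff by (simp add: sum_nonneg_eq_0_iff)

lemma ip_scale_right: "ip I u (\<lambda>i. c * v i) = c * ip I u v"
  by (simp add: ip_def sum_distrib_left mult.left_commute)

lemma ip_scale_left: "ip I (\<lambda>i. c * u i) v = cnj c * ip I u v"
  by (simp add: ip_def sum_distrib_left mult.assoc)

lemma ip_add_right: "ip I u (\<lambda>i. v i + w i) = ip I u v + ip I u w"
  by (simp add: ip_def sum.distrib distrib_left)

lemma ip_sum_right: "ip I u (\<lambda>i. \<Sum>a\<in>A. c a * v a i) = (\<Sum>a\<in>A. c a * ip I u (v a))"
  unfolding ip_def sum_distrib_left by (subst sum.swap) (simp add: mult.left_commute)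

lemma ip_cong: "(\<And>i. i \<in> I \<Longrightarrow> u i = u' i) \<Longrightarrow> (\<And>i. i \<in> I \<Longrightarrow> v i = v' i) \<Longrightarrow> ip I u v = ip I u' v'"
  by (simp add: ip_def)

lemma ip_mv_hermitian:
  assumes "hermitian_on I H"
  shows "ip I (mv I H u) v = ip I u (mv I H v)"
proof -
  have "ip I (mv I H u) v = (\<Sum>i\<in>I. \<Sum>j\<in>I. cnj (H i j) * cnj (u j) * v i)"
    by (simp add: ip_def mv_def sum_distrib_right)
  also have "\<dots> = (\<Sum>j\<in>I. \<Sum>i\<in>I. cnj (u j) * (H j i * v i))"
  proof (subst sum.swap, intro sum.cong refl)
    fix j i assume "j \<in> I" "i \<in> I"
    then have "H j i = cnj (H i j)" using assms unfolding hermitian_on_def by blast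
    then show "cnj (H i j) * cnj (u j) * v i = cnj (u j) * (H j i * v i)" by simp
  qed
  finally show ?thesis by (simp add: ip_def mv_def sum_distrib_left)
qed

lemma mv_cong: "(\<And>j. j \<in> I \<Longrightarrow> u j = v j) \<Longrightarrow> mv I H u i = mv I H v i"
  by (simp add: mv_def)

lemma mv_add: "mv I H (\<lambda>i. u i + v i) = (\<lambda>i. mv I H u i + mv I H v i)"
  by (rule ext) (simp add: mv_def distrib_left sum.distrib)

lemma mv_scale: "mv I H (\<lambda>i. c * u i) = (\<lambda>i. c * mv I H u i)"
  by (rule ext) (simp add: mv_def sum_distrib_left mult.left_commute)

lemma mv_sum: "mv I H (\<lambda>i. \<Sum>a\<in>A. c a * v a i) i = (\<Sum>a\<in>A. c a * mv I H (v a) i)"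
  unfolding mv_def sum_distrib_left by (subst sum.swap) (simp add: mult.left_commute)

text \<open>The vector \<open>p(H) u\<close>, by Horner's rule.\<close>

definition poly_act :: "'i set \<Rightarrow> ('i \<Rightarrow> 'i \<Rightarrow> complex) \<Rightarrow> ('i \<Rightarrow> complex) \<Rightarrow> complex poly \<Rightarrow> 'i \<Rightarrow> complex" where
  "poly_act I H u p = fold_coeffs (\<lambda>a v i. a * u i + mv I H v i) p (\<lambda>_. 0)"

lemma poly_act_0 [simp]: "poly_act I H u 0 = (\<lambda>_. 0)"
  by (simp add: poly_act_def)

lemma poly_act_pCons: "poly_act I H u (pCons a p) = (\<lambda>i. a * u i + mv I H (poly_act I H u p) i)"
  by (cases "a = 0 \<and> p = 0") (auto simp: poly_act_def mv_def)

lemma poly_act_add: "poly_act I H u (p + q) = (\<lambda>i. poly_act I H u p i + poly_act I H u q i)"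
  by (induction p q rule: poly_induct2) (auto simp: poly_act_pCons mv_add algebra_simps)

lemma poly_act_smult: "poly_act I H u (Polynomial.smult c p) = (\<lambda>i. c * poly_act I H u p i)"
  by (induction p) (auto simp: poly_act_pCons mv_scale algebra_simps)

lemma poly_act_sum: "poly_act I H u (\<Sum>k\<in>A. p k) i = (\<Sum>k\<in>A. poly_act I H u (p k) i)"
  by (induction A rule: infinite_finite_induct) (auto simp: poly_act_add)

lemma poly_act_monom: "poly_act I H u (monom c k) i = c * (mv I H ^^ k) u i"
proof -
  have "poly_act I H u (monom c k) = (\<lambda>i. c * (mv I H ^^ k) u i)"
    by (induction k) (auto simp: monom_0 monom_Suc poly_act_pCons mv_scale mv_def)
  then show ?thesis by simp
qed

text \<open>The powers \<open>H^s w\<close>, \<open>s \<le> card I\<close>, are linearly dependent, so some nonzero polynomial annihilates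
  \<open>w\<close>. Take one, \<open>p\<close>, of least degree and split off a root: \<open>p = (X - s) q\<close>. Then \<open>q(H) w\<close> is nonzero by
  minimality and is an eigenvector. It stays in \<open>V\<close> because \<open>V\<close> is invariant.\<close>

lemma eigenvector_in_invariant_subspace:
  assumes I: "finite I"
    and add: "\<And>u v. V u \<Longrightarrow> V v \<Longrightarrow> V (\<lambda>i. u i + v i)"
    and scale: "\<And>c u. V u \<Longrightarrow> V (\<lambda>i. c * u i)"
    and inv: "\<And>u. V u \<Longrightarrow> V (mv I H u)"
    and w: "V w" "\<exists>i\<in>I. w i \<noteq> 0"
  shows "\<exists>u l. V u \<and> (\<exists>i\<in>I. u i \<noteq> 0) \<and> (\<forall>i\<in>I. mv I H u i = l * u i)"
proof -
  define ann where "ann p \<longleftrightarrow> p \<noteq> 0 \<and> (\<forall>i\<in>I. poly_act I H w p i = 0)" for p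
  obtain c where c: "\<exists>s\<in>{..card I}. c s \<noteq> 0"
      "\<forall>i\<in>I. (\<Sum>s\<in>{..card I}. (mv I H ^^ s) w i * c s) = 0"
    using underdetermined_system[OF I, of "{..card I}" "\<lambda>i s. (mv I H ^^ s) w i"] by auto
  define p0 where "p0 = (\<Sum>s\<in>{..card I}. monom (c s) s)"
  have "coeff p0 s = c s" if "s \<le> card I" for s
    using that by (simp add: p0_def coeff_sum)
  then have "p0 \<noteq> 0" using c(1) by force
  then have "ann p0" using c(2)
    by (simp add: ann_def p0_def poly_act_sum poly_act_monom mult.commute)
  then obtain p where p: "ann p" "\<And>q. ann q \<Longrightarrow> degree p \<le> degree q"
    using ex_has_least_nat[of ann p0 degree] by blast
  have "degree p \<noteq> 0"
  proof
    assume "degree p = 0"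
    then obtain a where "p = [:a:]" by (metis degree_eq_zeroE)
    then show False using p(1) w(2) by (auto simp: ann_def poly_act_pCons mv_def)
  qed
  then obtain s where "poly p s = 0"
    using fundamental_theorem_of_algebra[of p] constant_degree[of p] by auto
  then obtain q where q: "p = [:-s, 1:] * q"
    by (metis dvd_def poly_eq_0_iff_dvd)
  have q0: "q \<noteq> 0" using q p(1) by (auto simp: ann_def)
  then have "degree q < degree p" unfolding q by (subst degree_mult_eq) auto
  then have "\<not> ann q" using p(2) by (meson not_le)
  then have nz: "\<exists>i\<in>I. poly_act I H w q i \<noteq> 0" using q0 by (auto simp: ann_def)
  have V0: "V (\<lambda>_. 0)" using scale[OF w(1), of 0] by simp
  have "V (poly_act I H w r)" for r
    by (induction r) (auto simp: poly_act_pCons V0 intro!: add scale inv w)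
  moreover have "mv I H (poly_act I H w q) i = s * poly_act I H w q i" if "i \<in> I" for i
  proof -
    have "p = Polynomial.smult (- s) q + pCons 0 q" by (simp add: q)
    then have "poly_act I H w p i = mv I H (poly_act I H w q) i - s * poly_act I H w q i"
      by (simp only: poly_act_add poly_act_smult poly_act_pCons) simp
    then show ?thesis using p(1) that by (auto simp: ann_def)
  qed
  ultimately show ?thesis using nz by blast
qed

text \<open>An orthonormal family of eigenvectors that is too short extends: its orthogonal complement is nonzero by a
  dimension count, and it is invariant under \<open>H\<close> because \<open>H\<close> is Hermitian.\<close>

lemma spectral_theorem:
  assumes I: "finite I" and H: "hermitian_on I H"
  shows "\<exists>lam u. orthonormal I (card I) u \<and>
    (\<forall>a<card I. \<forall>i\<in>I. mv I H (u a) i = complex_of_real (lam a) * u a i)"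
proof -
  have "\<exists>lam u. orthonormal I k u \<and>
    (\<forall>a<k. \<forall>i\<in>I. mv I H (u a) i = complex_of_real (lam a) * u a i)" if "k \<le> card I" for k
    using that
  proof (induction k)
    case 0
    then show ?case by (simp add: orthonormal_def)
  next
    case (Suc k)
    then obtain lam u where u: "orthonormal I k u"
      and ev: "\<And>a i. a < k \<Longrightarrow> i \<in> I \<Longrightarrow> mv I H (u a) i = complex_of_real (lam a) * u a i" by auto
    define V where "V v \<longleftrightarrow> (\<forall>a<k. ip I (u a) v = 0)" for v
    have "card {..<k} < card I" using Suc by simp
    from underdetermined_system[OF _ I this, of "\<lambda>a i. cnj (u a i)"]
    obtain w where w: "\<exists>i\<in>I. w i \<noteq> 0" "V w" by (auto simp: V_def ip_def)
    have inv: "V (mv I H v)" if "V v" for v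
      unfolding V_def
    proof (intro allI impI)
      fix a assume a: "a < k"
      have "ip I (u a) (mv I H v) = ip I (mv I H (u a)) v"
        by (simp add: ip_mv_hermitian[OF H])
      also have "\<dots> = ip I (\<lambda>i. lam a * u a i) v"
        by (rule ip_cong) (auto simp: ev a)
      also have "\<dots> = 0" using that a by (simp add: ip_scale_left V_def)
      finally show "ip I (u a) (mv I H v) = 0" .
    qed
    have "\<exists>v l. V v \<and> (\<exists>i\<in>I. v i \<noteq> 0) \<and> (\<forall>i\<in>I. mv I H v i = l * v i)"
      by (rule eigenvector_in_invariant_subspace[OF I _ _ inv w(2) w(1)])
         (auto simp: V_def ip_add_right ip_scale_right)
    then obtain v l where v: "V v" "\<exists>i\<in>I. v i \<noteq> 0" and vl: "\<forall>i\<in>I. mv I H v i = l * v i" by blast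
    define s where "s = (\<Sum>i\<in>I. (cmod (v i))\<^sup>2)"
    have vv: "ip I v v = of_real s" by (simp add: ip_self s_def)
    have "s \<noteq> 0" using ip_self_eq_0[OF I, of v] vv v(2) by auto
    moreover have "s \<ge> 0" by (simp add: s_def sum_nonneg)
    ultimately have s: "s > 0" by simp
    have "l * s = ip I v (mv I H v)"
      using vl by (simp add: ip_cong[of I v v _ "\<lambda>i. l * v i"] ip_scale_right vv)
    also have "\<dots> = ip I (mv I H v) v" by (simp add: ip_mv_hermitian[OF H])
    also have "\<dots> = cnj l * s"
      using vl by (simp add: ip_cong[of I _ "\<lambda>i. l * v i" v v] ip_scale_left vv)
    finally have "cnj l = l" using s by simp
    then have l: "l = of_real (Re l)" by (simp add: complex_eq_iff)
    define v' where "v' i = (1 / sqrt s) * v i" for i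
    have v'v': "ip I v' v' = 1"
      using s unfolding v'_def ip_scale_left ip_scale_right vv
      by (simp add: field_simps power2_eq_square[symmetric] flip: of_real_mult of_real_power)
    have uv': "ip I (u a) v' = 0" if "a < k" for a
      using v(1) that unfolding v'_def ip_scale_right by (simp add: V_def)
    have v'u: "ip I v' (u a) = 0" if "a < k" for a
      using uv'[OF that] ip_cnj[of I "u a" v'] by simp
    have mv': "mv I H v' i = of_real (Re l) * v' i" if "i \<in> I" for i
    proof -
      have "mv I H v' i = (1 / sqrt s) * mv I H v i"
        unfolding v'_def by (simp only: mv_scale)
      also have "\<dots> = (1 / sqrt s) * (l * v i)" using vl that by simp
      also have "\<dots> = of_real (Re l) * v' i" unfolding v'_def by (subst (1) l) (simp add: mult.left_commute)
      finally show ?thesis .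
    qed
    have "orthonormal I (Suc k) (u(k := v'))"
      using u v'v' uv' v'u by (auto simp: orthonormal_def less_Suc_eq)
    moreover have "\<forall>a<Suc k. \<forall>i\<in>I. mv I H ((u(k := v')) a) i
        = complex_of_real ((lam(k := Re l)) a) * (u(k := v')) a i"
      using ev mv' by (auto simp: less_Suc_eq)
    ultimately show ?case by blast
  qed
  then show ?thesis by auto
qed

lemma orthonormal_complete:
  assumes I: "finite I" and u: "orthonormal I (card I) u" and "i \<in> I" "j \<in> I"
  shows "(\<Sum>a<card I. u a i * cnj (u a j)) = (if i = j then 1 else 0)"
proof -
  define n where "n = card I"
  define x where "x i = (if i = j then 1 else 0 :: complex)" for i
  define y where "y i = x i - (\<Sum>a<n. ip I (u a) x * u a i)" for i
  have uy: "ip I (u b) y = 0" if "b < n" for b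
  proof -
    have "ip I (u b) y = ip I (u b) x - ip I (u b) (\<lambda>i. \<Sum>a<n. ip I (u a) x * u a i)"
      by (simp add: ip_def y_def right_diff_distrib sum_subtractf)
    also have "ip I (u b) (\<lambda>i. \<Sum>a<n. ip I (u a) x * u a i) = (\<Sum>a<n. ip I (u a) x * (if b = a then 1 else 0))"
      unfolding ip_sum_right using u that by (intro sum.cong) (auto simp: orthonormal_def n_def)
    also have "\<dots> = ip I (u b) x" using that by (simp add: if_distrib cong: if_cong)
    finally show ?thesis by simp
  qed
  have "y i = 0" if "i \<in> I" for i
  proof (rule ccontr)
    assume yi: "y i \<noteq> 0"
    define v where "v = u(n := y)"
    obtain c where c: "\<exists>s\<in>{..n}. c s \<noteq> 0" "\<And>i. i \<in> I \<Longrightarrow> (\<Sum>s\<in>{..n}. v s i * c s) = 0"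
      using underdetermined_system[OF I, of "{..n}" "\<lambda>i s. v s i"] by (auto simp: n_def)
    have eq: "(\<Sum>s\<in>{..n}. c s * ip I w (v s)) = 0" for w
    proof -
      have "(\<Sum>s\<in>{..n}. c s * ip I w (v s)) = ip I w (\<lambda>i. \<Sum>s\<in>{..n}. c s * v s i)"
        by (simp add: ip_sum_right)
      also have "\<dots> = ip I w (\<lambda>_. 0)" using c(2) by (intro ip_cong) (auto simp: mult.commute)
      finally show ?thesis by (simp add: ip_def)
    qed
    have ca: "c a = 0" if "a < n" for a
    proof -
      have "0 = (\<Sum>s\<in>{..n}. c s * ip I (u a) (v s))" using eq by simp
      also have "\<dots> = (\<Sum>s\<in>{..n}. c s * (if s = a then 1 else 0))"
        using uy that u by (intro sum.cong) (auto simp: v_def orthonormal_def n_def)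
      also have "\<dots> = c a" using that by (simp add: if_distrib cong: if_cong)
      finally show ?thesis by simp
    qed
    then have "c n * y i = 0" using c(2)[OF \<open>i \<in> I\<close>]
      by (simp add: lessThan_Suc_atMost[symmetric] v_def mult.commute)
    then have "c n = 0" using yi by simp
    then show False using c(1) ca by (metis atMost_iff le_neq_implies_less)
  qed
  then have "x i = (\<Sum>a<n. ip I (u a) x * u a i)" using assms by (simp add: y_def)
  moreover have "ip I (u a) x = cnj (u a j)" for a
    using assms by (simp add: ip_def x_def if_distrib cong: if_cong)
  ultimately show ?thesis by (simp add: x_def n_def mult.commute)
qed

section \<open>Eigenvalue counts and Gram matrices\<close>

lemma eigenvector_sum_quadratic_form:
  assumes I: "finite I" and u: "orthonormal I n u"
    and ev: "\<forall>a<n. \<forall>i\<in>I. mv I A (u a) i = complex_of_real (lam a) * u a i"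
    and P: "P \<subseteq> {..<n}" and w: "\<forall>i\<in>I. w i = (\<Sum>a\<in>P. c a * u a i)"
  shows "ip I w w = of_real (\<Sum>a\<in>P. (cmod (c a))\<^sup>2)"
    and "ip I w (mv I A w) = of_real (\<Sum>a\<in>P. lam a * (cmod (c a))\<^sup>2)"
proof -
  have fin: "finite P" using P finite_subset by blast
  have coef: "ip I w (u a) = cnj (c a)" if "a \<in> P" for a
  proof -
    have "ip I (u a) w = ip I (u a) (\<lambda>i. \<Sum>b\<in>P. c b * u b i)" using w by (intro ip_cong) auto
    also have "\<dots> = (\<Sum>b\<in>P. c b * (if a = b then 1 else 0))"
      unfolding ip_sum_right using u P that by (intro sum.cong) (auto simp: orthonormal_def subset_eq)
    also have "\<dots> = c a" using that fin by (simp add: if_distrib cong: if_cong)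
    finally show ?thesis by (metis ip_cnj)
  qed
  have "ip I w w = ip I w (\<lambda>i. \<Sum>a\<in>P. c a * u a i)" using w by (intro ip_cong) auto
  also have "\<dots> = (\<Sum>a\<in>P. c a * cnj (c a))" by (simp add: ip_sum_right coef)
  finally show "ip I w w = of_real (\<Sum>a\<in>P. (cmod (c a))\<^sup>2)"
    by (simp add: complex_norm_square[symmetric] del: of_real_power)
  have "mv I A w i = (\<Sum>a\<in>P. (lam a * c a) * u a i)" if "i \<in> I" for i
  proof -
    have "mv I A w i = mv I A (\<lambda>i. \<Sum>a\<in>P. c a * u a i) i" using w by (intro mv_cong) auto
    also have "\<dots> = (\<Sum>a\<in>P. c a * mv I A (u a) i)" by (rule mv_sum)
    also have "\<dots> = (\<Sum>a\<in>P. (lam a * c a) * u a i)"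
      using P that ev by (intro sum.cong) (auto simp: subset_eq)
    finally show ?thesis .
  qed
  then have "ip I w (mv I A w) = ip I w (\<lambda>i. \<Sum>a\<in>P. (lam a * c a) * u a i)"
    by (intro ip_cong) auto
  also have "\<dots> = (\<Sum>a\<in>P. lam a * (c a * cnj (c a)))"
    unfolding ip_sum_right by (intro sum.cong) (auto simp: coef mult.assoc)
  finally show "ip I w (mv I A w) = of_real (\<Sum>a\<in>P. lam a * (cmod (c a))\<^sup>2)"
    by (simp add: complex_norm_square[symmetric] del: of_real_power)
qed

text \<open>The rank inequality, in the form of a restriction to a subspace. If it failed, the span of the
  eigenvectors of \<open>A\<close> with eigenvalue at most \<open>x\<close> would meet the span of those of \<open>A'\<close> with eigenvalue above \<open>x\<close>
  in a nonzero vector \<open>w\<close> that also satisfies the \<open>card E\<close> constraints: the coefficients outnumber the equations.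
  For this \<open>w\<close> the two forms agree, although one is at most \<open>x * ip w w\<close> and the other is larger.\<close>

lemma eigenvalue_count_le:
  fixes m :: "'e \<Rightarrow> 'i \<Rightarrow> complex"
  assumes I: "finite I" and n: "n = card I" and E: "finite E"
    and u: "orthonormal I n u"
    and ev: "\<forall>a<n. \<forall>i\<in>I. mv I A (u a) i = complex_of_real (lam a) * u a i"
    and u': "orthonormal I n u'"
    and ev': "\<forall>a<n. \<forall>i\<in>I. mv I A' (u' a) i = complex_of_real (lam' a) * u' a i"
    and agree: "\<And>w. (\<forall>e\<in>E. (\<Sum>i\<in>I. m e i * w i) = 0) \<Longrightarrow> ip I w (mv I A w) = ip I w (mv I A' w)"
  shows "card {a. a < n \<and> lam a \<le> x} \<le> card {a. a < n \<and> lam' a \<le> x} + card E"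
proof (rule ccontr)
  define P where "P = {a. a < n \<and> lam a \<le> x}"
  define P' where "P' = {a. a < n \<and> lam' a \<le> x}"
  define Q where "Q = {a. a < n \<and> x < lam' a}"
  have PQ: "finite P" "finite P'" "finite Q" "P \<subseteq> {..<n}" "Q \<subseteq> {..<n}"
    by (auto simp: P_def P'_def Q_def)
  have "card P' + card Q = n"
  proof -
    have un: "P' \<union> Q = {..<n}" and disj: "P' \<inter> Q = {}" by (auto simp: P'_def Q_def)
    have "card (P' \<union> Q) = card P' + card Q" by (rule card_Un_disjoint[OF PQ(2,3) disj])
    then show ?thesis unfolding un by simp
  qed
  moreover assume neg: "\<not> card {a. a < n \<and> lam a \<le> x} \<le> card {a. a < n \<and> lam' a \<le> x} + card E"
  have "card P' + card E < card P" using neg by (simp only: P_def P'_def not_le)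
  moreover have "card (I <+> E) = n + card E" by (simp only: card_Plus[OF I E] n)
  moreover have "card (P <+> Q) = card P + card Q" by (simp only: card_Plus[OF PQ(1,3)])
  ultimately have less: "card (I <+> E) < card (P <+> Q)"
    by linarith
  define M where "M eq s = (case eq of
      Inl i \<Rightarrow> (case s of Inl a \<Rightarrow> u a i | Inr b \<Rightarrow> - u' b i)
    | Inr e \<Rightarrow> (case s of Inl a \<Rightarrow> \<Sum>i\<in>I. m e i * u a i | Inr b \<Rightarrow> 0))" for eq :: "'i + 'e" and s :: "nat + nat"
  have "finite (I <+> E)" "finite (P <+> Q)" using I E PQ by simp_all
  from underdetermined_system[OF this less, of M]
  obtain c where c1: "\<exists>s\<in>P <+> Q. c s \<noteq> 0"
    and c2: "\<forall>eq\<in>I <+> E. (\<Sum>s\<in>P <+> Q. M eq s * c s) = 0"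
    by (elim exE conjE)
  note c = c1 c2[rule_format]
  define \<alpha> \<beta> where "\<alpha> a = c (Inl a)" and "\<beta> a = c (Inr a)" for a
  define w where "w i = (\<Sum>a\<in>P. \<alpha> a * u a i)" for i
  have w': "w i = (\<Sum>b\<in>Q. \<beta> b * u' b i)" if "i \<in> I" for i
    using c(2)[OF InlI[OF that]] PQ
    by (simp add: M_def sum.Plus w_def \<alpha>_def \<beta>_def sum_negf mult.commute)
  have "(\<Sum>i\<in>I. m e i * w i) = 0" if "e \<in> E" for e
  proof -
    have "(\<Sum>i\<in>I. m e i * w i) = (\<Sum>a\<in>P. (\<Sum>i\<in>I. m e i * u a i) * \<alpha> a)"
      unfolding w_def sum_distrib_left sum_distrib_right
      by (subst sum.swap) (simp add: mult.assoc mult.commute mult.left_commute)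
    then show ?thesis using c(2)[OF InrI[OF that]] PQ by (simp add: M_def sum.Plus \<alpha>_def)
  qed
  then have same: "ip I w (mv I A w) = ip I w (mv I A' w)" by (intro agree) auto
  have "\<forall>i\<in>I. w i = (\<Sum>a\<in>P. \<alpha> a * u a i)" by (simp add: w_def)
  note q = eigenvector_sum_quadratic_form[OF I u ev PQ(4) this]
  have "\<forall>i\<in>I. w i = (\<Sum>b\<in>Q. \<beta> b * u' b i)" using w' by blast
  note q' = eigenvector_sum_quadratic_form[OF I u' ev' PQ(5) this]
  have eq: "(\<Sum>a\<in>P. lam a * (cmod (\<alpha> a))\<^sup>2) = (\<Sum>b\<in>Q. lam' b * (cmod (\<beta> b))\<^sup>2)"
    using same unfolding q(2) q'(2) of_real_eq_iff .
  have eq': "(\<Sum>a\<in>P. (cmod (\<alpha> a))\<^sup>2) = (\<Sum>b\<in>Q. (cmod (\<beta> b))\<^sup>2)"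
    using q(1) unfolding q'(1) of_real_eq_iff by (rule sym)
  have "\<exists>b\<in>Q. \<beta> b \<noteq> 0"
  proof (rule ccontr)
    assume none: "\<not> ?thesis"
    then have "(\<Sum>a\<in>P. (cmod (\<alpha> a))\<^sup>2) = 0" unfolding eq' by simp
    then have "\<forall>a\<in>P. \<alpha> a = 0" using PQ by (simp add: sum_nonneg_eq_0_iff)
    then show False using c(1) none by (auto simp: \<alpha>_def \<beta>_def)
  qed
  then obtain b where b: "b \<in> Q" "\<beta> b \<noteq> 0" by blast
  have "(\<Sum>a\<in>P. lam a * (cmod (\<alpha> a))\<^sup>2) \<le> (\<Sum>a\<in>P. x * (cmod (\<alpha> a))\<^sup>2)"
    by (intro sum_mono mult_right_mono) (auto simp: P_def)
  also have "\<dots> = (\<Sum>b\<in>Q. x * (cmod (\<beta> b))\<^sup>2)" by (simp add: sum_distrib_left[symmetric] eq')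
  also have "\<dots> < (\<Sum>b\<in>Q. lam' b * (cmod (\<beta> b))\<^sup>2)"
    by (rule sum_strict_mono_ex1) (use PQ b in \<open>auto simp: Q_def intro!: mult_right_mono bexI[of _ b]\<close>)
  finally show False using eq by simp
qed

text \<open>The matrix of eigenvectors is unitary and diagonalises \<open>H\<close>, so the characteristic polynomial is the
  product of the \<open>X - lam a\<close>, and orders of roots count repetitions in \<open>lam\<close>.\<close>

lemma esd_eq_eigenvalue_count:
  assumes n: "n > 0"
    and u: "orthonormal {..<n} n u"
    and ev: "\<forall>a<n. \<forall>i\<in>{..<n}. mv {..<n} H (u a) i = complex_of_real (lam a) * u a i"
  shows "esd (mat n n (\<lambda>(i, j). H i j)) x = real (card {a. a < n \<and> lam a \<le> x}) / real n"
proof -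
  define A where "A = mat n n (\<lambda>(i, j). H i j)"
  define U where "U = mat n n (\<lambda>(i, a). u a i)"
  define V where "V = mat n n (\<lambda>(a, i). cnj (u a i))"
  define L where "L = mat n n (\<lambda>(a, b). if a = b then complex_of_real (lam a) else 0)"
  have carr: "A \<in> carrier_mat n n" "U \<in> carrier_mat n n" "V \<in> carrier_mat n n" "L \<in> carrier_mat n n"
    by (auto simp: A_def U_def V_def L_def)
  have VU: "V * U = 1\<^sub>m n"
    using u by (intro eq_matI)
      (auto simp: U_def V_def scalar_prod_def ip_def orthonormal_def atLeast0LessThan)
  have "(\<Sum>a<n. u a i * cnj (u a j)) = (if i = j then 1 else 0)" if "i < n" "j < n" for i j
    using orthonormal_complete[of "{..<n}" u i j] u that by simp
  then have UV: "U * V = 1\<^sub>m n"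
    by (intro eq_matI) (auto simp: U_def V_def scalar_prod_def atLeast0LessThan)
  have AU: "A * U = U * L"
  proof (intro eq_matI)
    fix i a assume "i < dim_row (U * L)" "a < dim_col (U * L)"
    then have ia: "i < n" "a < n" by (auto simp: U_def L_def)
    have "(A * U) $$ (i, a) = mv {..<n} H (u a) i"
      using ia by (simp add: A_def U_def scalar_prod_def mv_def atLeast0LessThan)
    also have "\<dots> = lam a * u a i" using ev ia by simp
    also have "\<dots> = (\<Sum>b<n. u b i * (if b = a then complex_of_real (lam b) else 0))"
      using ia by (simp add: if_distrib cong: if_cong)
    also have "\<dots> = (U * L) $$ (i, a)"
      using ia by (simp add: L_def U_def scalar_prod_def atLeast0LessThan)
    finally show "(A * U) $$ (i, a) = (U * L) $$ (i, a)" .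
  qed (auto simp: A_def U_def L_def)
  have "A = A * (U * V)" using carr by (simp add: UV)
  also have "\<dots> = U * L * V" by (simp only: assoc_mult_mat[symmetric, OF carr(1-3)] AU)
  finally have "similar_mat A L"
    unfolding similar_mat_def by (intro exI) (rule similar_mat_witI[OF UV VU _ carr(1,4,2,3)])
  then have "char_poly A = char_poly L" by (rule char_poly_similar)
  also have "\<dots> = (\<Prod>a\<leftarrow>diag_mat L. [:- a, 1:])"
    by (rule char_poly_upper_triangular[OF carr(4)]) (auto simp: L_def upper_triangular_def)
  also have "diag_mat L = map (\<lambda>a. complex_of_real (lam a)) [0..<n]"
    by (auto simp: diag_mat_def L_def)
  finally have cp: "char_poly A = (\<Prod>a\<leftarrow>[0..<n]. [:- complex_of_real (lam a), 1:])" by (simp add: o_def)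
  have ord: "Polynomial.order l (char_poly A) = (\<Sum>a<n. if complex_of_real (lam a) = l then 1 else 0)" for l
    unfolding cp by (subst order_prod_list)
      (auto simp: o_def order_linear' interv_sum_list_conv_sum_set_nat atLeast0LessThan)
  have eig: "eigenvalue A l \<longleftrightarrow> (\<exists>a<n. complex_of_real (lam a) = l)" for l
    unfolding eigenvalue_root_char_poly[OF carr(1)] cp poly_prod_list prod_list_zero_iff by auto
  define S where "S = {l. eigenvalue A l \<and> Re l \<le> x}"
  have S: "S = (\<lambda>a. complex_of_real (lam a)) ` {a. a < n \<and> lam a \<le> x}"
    by (auto simp: S_def eig)
  have "(\<Sum>l\<in>S. Polynomial.order l (char_poly A)) = (\<Sum>a<n. \<Sum>l\<in>S. if complex_of_real (lam a) = l then 1 else 0)"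
    unfolding ord by (rule sum.swap)
  also have "\<dots> = (\<Sum>a<n. if lam a \<le> x then 1 else 0)"
    by (intro sum.cong refl) (auto simp: S sum.delta')
  also have "\<dots> = card {a. a < n \<and> lam a \<le> x}"
    by (simp add: sum.If_cases Int_def)
  finally show ?thesis by (simp add: esd_def S_def A_def)
qed

text \<open>The matrix \<open>Y Y\<^sup>*\<close>, where \<open>Y k\<close> is column number \<open>k\<close>; putting the column index first makes removing a
  column a function update.\<close>

definition gram :: "nat \<Rightarrow> (nat \<Rightarrow> nat \<Rightarrow> complex) \<Rightarrow> nat \<Rightarrow> nat \<Rightarrow> complex" where
  "gram N Y i j = (\<Sum>k<N. Y k i * cnj (Y k j))"

lemma hermitian_gram: "hermitian_on I (gram N Y)"
  by (simp add: hermitian_on_def gram_def mult.commute)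

lemma ip_gram: "ip I w (mv I (gram N Y) w) = of_real (\<Sum>k<N. (cmod (ip I (Y k) w))\<^sup>2)"
proof -
  have "ip I w (mv I (gram N Y) w) = (\<Sum>k<N. (\<Sum>i\<in>I. cnj (w i) * Y k i) * (\<Sum>j\<in>I. cnj (Y k j) * w j))"
  proof -
    have "ip I w (mv I (gram N Y) w) = (\<Sum>i\<in>I. \<Sum>j\<in>I. \<Sum>k<N. cnj (w i) * Y k i * (cnj (Y k j) * w j))"
      by (simp add: ip_def mv_def gram_def sum_distrib_left sum_distrib_right mult_ac)
    also have "\<dots> = (\<Sum>i\<in>I. \<Sum>k<N. \<Sum>j\<in>I. cnj (w i) * Y k i * (cnj (Y k j) * w j))"
      by (intro sum.cong refl sum.swap)
    also have "\<dots> = (\<Sum>k<N. \<Sum>i\<in>I. \<Sum>j\<in>I. cnj (w i) * Y k i * (cnj (Y k j) * w j))"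
      by (rule sum.swap)
    finally show ?thesis by (simp add: sum_product)
  qed
  also have "\<dots> = (\<Sum>k<N. of_real ((cmod (ip I (Y k) w))\<^sup>2))"
  proof (intro sum.cong refl)
    fix k
    have "(\<Sum>i\<in>I. cnj (w i) * Y k i) = cnj (ip I (Y k) w)" by (simp add: ip_def mult.commute)
    moreover have "(\<Sum>j\<in>I. cnj (Y k j) * w j) = ip I (Y k) w" by (simp add: ip_def)
    ultimately show "(\<Sum>i\<in>I. cnj (w i) * Y k i) * (\<Sum>j\<in>I. cnj (Y k j) * w j) = of_real ((cmod (ip I (Y k) w))\<^sup>2)"
      by (simp only: complex_norm_square mult.commute)
  qed
  finally show ?thesis by simp
qed

lemma mat_adjoint_index:
  fixes A :: "complex mat"
  assumes "A \<in> carrier_mat n m"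
  shows "mat_adjoint A \<in> carrier_mat m n"
    and "k < m \<Longrightarrow> j < n \<Longrightarrow> mat_adjoint A $$ (k, j) = cnj (A $$ (j, k))"
  using assms by (auto simp: mat_adjoint_def mat_of_rows_def)

lemma B_mat_eq_gram:
  assumes "N > 0"
  shows "B_mat n N d x = mat n n (\<lambda>(i, j). gram N (\<lambda>k i. complex_of_real (d i k / sqrt N) * x i k) i j)"
proof -
  define Y where "Y = hadamard (mat n N (\<lambda>(j, k). complex_of_real (d j k))) (mat n N (\<lambda>(j, k). x j k))"
  have Y: "Y \<in> carrier_mat n N" by (simp add: Y_def hadamard_def)
  have Yij: "Y $$ (i, k) = complex_of_real (d i k) * x i k" if "i < n" "k < N" for i k
    using that by (simp add: Y_def hadamard_def)
  note adj = mat_adjoint_index[OF Y]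
  have "sqrt N * sqrt N = real N" by simp
  then have sq: "complex_of_real (sqrt N) * complex_of_real (sqrt N) = of_nat N"
    by (simp only: of_real_mult[symmetric]) simp
  have entry: "B_mat n N d x $$ (i, j) = gram N (\<lambda>k i. complex_of_real (d i k / sqrt N) * x i k) i j"
    if ij: "i < n" "j < n" for i j
  proof -
    have "B_mat n N d x $$ (i, j) = 1 / of_nat N * (Y * mat_adjoint Y) $$ (i, j)"
      unfolding B_mat_def Y_def[symmetric] Let_def
      using ij Y adj(1) by (subst index_smult_mat) auto
    also have "(Y * mat_adjoint Y) $$ (i, j) = (\<Sum>k<N. Y $$ (i, k) * mat_adjoint Y $$ (k, j))"
      using ij Y adj(1) by (subst index_mult_mat) (auto simp: scalar_prod_def atLeast0LessThan)
    also have "\<dots> = (\<Sum>k<N. (of_real (d i k) * x i k) * cnj (of_real (d j k) * x j k))"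
      using ij by (intro sum.cong refl) (simp add: adj Yij)
    also have "1 / of_nat N * \<dots> = (\<Sum>k<N. 1 / (complex_of_real (sqrt N) * complex_of_real (sqrt N)) *
        ((of_real (d i k) * x i k) * cnj (of_real (d j k) * x j k)))"
      by (simp only: sq sum_distrib_left)
    also have "\<dots> = gram N (\<lambda>k i. complex_of_real (d i k / sqrt N) * x i k) i j"
      unfolding gram_def by (intro sum.cong refl) (simp add: field_simps)
    finally show ?thesis .
  qed
  have "B_mat n N d x \<in> carrier_mat n n"
    unfolding B_mat_def Y_def[symmetric] Let_def using Y adj(1) by auto
  then show ?thesis by (intro eq_matI) (auto simp: entry)
qed

 

section \<open>Spectral distributions and the vague metric\<close>

definition emp :: "nat \<Rightarrow> (nat \<Rightarrow> real) \<Rightarrow> real measure" where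
  "emp n lam = distr (measure_pmf (pmf_of_set {..<n})) borel lam"

lemma real_distribution_emp: "real_distribution (emp n lam)"
  unfolding emp_def
  by (rule prob_space.real_distribution_distr) (simp_all add: measure_pmf.prob_space_axioms)

lemma integral_emp:
  fixes g :: "real \<Rightarrow> 'b::{banach, second_countable_topology}"
  assumes "n > 0" "g \<in> borel_measurable borel"
  shows "integral\<^sup>L (emp n lam) g = (1 / real n) *\<^sub>R (\<Sum>a<n. g (lam a))"
proof -
  have "integral\<^sup>L (emp n lam) g = integral\<^sup>L (measure_pmf (pmf_of_set {..<n})) (\<lambda>a. g (lam a))"
    unfolding emp_def using assms by (subst integral_distr) auto
  also have "\<dots> = (\<Sum>a<n. pmf (pmf_of_set {..<n}) a *\<^sub>R g (lam a))"
    using assms by (intro integral_measure_pmf) (auto simp: lessThan_empty_iff)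
  also have "\<dots> = (\<Sum>a<n. (1 / real n) *\<^sub>R g (lam a))"
    using assms by (intro sum.cong refl) (auto simp: lessThan_empty_iff)
  finally show ?thesis by (simp add: scaleR_sum_right)
qed

lemma cdf_emp:
  assumes "n > 0"
  shows "cdf (emp n lam) x = real (card {a. a < n \<and> lam a \<le> x}) / real n"
proof -
  have "cdf (emp n lam) x = measure (measure_pmf (pmf_of_set {..<n})) {a. lam a \<le> x}"
    unfolding cdf_def emp_def by (subst measure_distr) (auto intro!: arg_cong[of _ _ "measure _"])
  also have "\<dots> = card ({..<n} \<inter> {a. lam a \<le> x}) / card {..<n}"
    using assms by (intro measure_pmf_of_set) (auto simp: lessThan_empty_iff)
  finally show ?thesis by (simp add: Int_def)
qed

lemma interval_measure_cdf:
  assumes "real_distribution M"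
  shows "interval_measure (cdf M) = M"
proof -
  interpret real_distribution M by fact
  note p = cdf_nondecreasing cdf_is_right_cont cdf_lim_at_bot cdf_lim_at_top_prob
  have rd: "real_distribution (interval_measure (cdf M))"
    by (intro real_distribution_interval_measure p)
  have "cdf (interval_measure (cdf M)) = cdf M"
    by (rule ext) (subst cdf_def, rule measure_interval_measure_Iic, (rule p | assumption)+)
  then show ?thesis using rd assms by (intro cdf_unique) auto
qed

lemma interval_measure_esd:
  assumes "n > 0" "orthonormal {..<n} n u"
    "\<forall>a<n. \<forall>i\<in>{..<n}. mv {..<n} H (u a) i = complex_of_real (lam a) * u a i"
  shows "interval_measure (esd (mat n n (\<lambda>(i, j). H i j))) = emp n lam"
proof -
  have "esd (mat n n (\<lambda>(i, j). H i j)) = cdf (emp n lam)"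
    by (rule ext) (simp add: cdf_emp[OF assms(1)] esd_eq_eigenvalue_count[OF assms])
  then show ?thesis by (simp add: interval_measure_cdf real_distribution_emp)
qed

text \<open>A ramp of height \<open>h\<close> that starts at \<open>s\<close>; a trapezoid is a difference of two ramps.\<close>

definition ramp :: "real \<Rightarrow> real \<Rightarrow> real \<Rightarrow> real" where
  "ramp s h x = max 0 (min (x - s) h)"

lemma trapezoid_eq_ramps:
  assumes "m > 0" "a < b"
  shows "trapezoid m a b x = ramp (a - 1 / m) (1 / m) x - ramp b (1 / m) x"
proof -
  have "(if x \<le> a - h \<or> b + h \<le> x then 0 else if x < a then x - (a - h) else if x \<le> b then h else (b + h) - x)
      = ramp (a - h) h x - ramp b h x" if "0 < h" for h
    using that assms(2) by (auto simp: ramp_def max_def min_def)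
  from this[of "1 / real m"] assms(1) show ?thesis by (simp add: trapezoid_def)
qed

lemma ramp_eq_integral:
  assumes "h \<ge> 0"
  shows "integrable lborel (\<lambda>u. indicator {s..s+h} u * of_bool (u < x) :: real)"
    and "ramp s h x = (LINT u|lborel. indicator {s..s+h} u * of_bool (u < x))"
proof -
  have eq: "(\<lambda>u. indicator {s..s+h} u * of_bool (u < x) :: real) = indicator ({s..s+h} \<inter> {..<x})"
    by (auto simp: indicator_def)
  have "emeasure lborel ({s..s+h} \<inter> {..<x}) \<le> emeasure lborel {s..s+h}"
    by (intro emeasure_mono) auto
  also have "\<dots> < \<infinity>" by (simp add: emeasure_lborel_Icc_eq)
  finally show "integrable lborel (\<lambda>u. indicator {s..s+h} u * of_bool (u < x) :: real)"
    unfolding eq by (subst integrable_indicator_iff) auto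
  have "measure lborel ({s..s+h} \<inter> {..<x}) = ramp s h x"
  proof -
    consider "x \<le> s" | "s < x" "x \<le> s + h" | "s + h < x" by linarith
    then show ?thesis
    proof cases
      case 1
      then have "{s..s+h} \<inter> {..<x} = {}" by auto
      then show ?thesis using 1 by (simp add: ramp_def)
    next
      case 2
      then have "{s..s+h} \<inter> {..<x} = {s..<x}" by auto
      then show ?thesis using 2 by (simp add: ramp_def)
    next
      case 3
      then have "{s..s+h} \<inter> {..<x} = {s..s+h}" by auto
      then show ?thesis using 3 assms by (simp add: ramp_def)
    qed
  qed
  then show "ramp s h x = (LINT u|lborel. indicator {s..s+h} u * of_bool (u < x))"
    unfolding eq by simp
qed

text \<open>A ramp is the integral of the step functions \<open>of_bool (u < x)\<close> over \<open>u \<in> {s..s+h}\<close>, so its sum over the points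
  is the integral of a counting function, and counting functions differ by at most \<open>r\<close>.\<close>

lemma sum_ramp_diff_le:
  fixes lam mu :: "nat \<Rightarrow> real"
  assumes h: "h \<ge> 0" and r: "\<And>x. \<bar>real (card {a. a < n \<and> lam a \<le> x}) - real (card {a. a < n \<and> mu a \<le> x})\<bar> \<le> r"
  shows "\<bar>(\<Sum>a<n. ramp s h (lam a)) - (\<Sum>a<n. ramp s h (mu a))\<bar> \<le> r * h"
proof -
  note int = ramp_eq_integral(1)[OF h] and eq = ramp_eq_integral(2)[OF h]
  have count: "(\<Sum>a<n. of_bool (u < l a) :: real) = n - real (card {a. a < n \<and> l a \<le> u})" for u and l :: "nat \<Rightarrow> real"
  proof -
    have "(\<Sum>a<n. of_bool (u < l a) :: real) = (\<Sum>a<n. 1 - of_bool (l a \<le> u))"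
      by (intro sum.cong) auto
    also have "\<dots> = n - real (card {a. a < n \<and> l a \<le> u})"
      by (simp add: sum_subtractf of_bool_def sum.If_cases Int_def)
    finally show ?thesis .
  qed
  have "(\<Sum>a<n. ramp s h (lam a)) - (\<Sum>a<n. ramp s h (mu a))
      = (LINT u|lborel. (\<Sum>a<n. indicator {s..s+h} u * of_bool (u < lam a)) - (\<Sum>a<n. indicator {s..s+h} u * of_bool (u < mu a)))"
    unfolding eq
    by (subst Bochner_Integration.integral_diff)
      (simp_all only: Bochner_Integration.integral_sum[OF int] Bochner_Integration.integrable_sum[OF int])
  also have "\<bar>\<dots>\<bar> \<le> (LINT u|lborel. indicator {s..s+h} u * r)"
  proof (rule integral_abs_bound_integral)
    show "integrable lborel (\<lambda>u. (\<Sum>a<n. indicator {s..s+h} u * of_bool (u < lam a)) - (\<Sum>a<n. indicator {s..s+h} u * of_bool (u < mu a)) :: real)"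
      by (intro Bochner_Integration.integrable_diff Bochner_Integration.integrable_sum int)
    show "integrable lborel (\<lambda>u. indicator {s..s+h} u * r)"
      by (intro integrable_mult_left) (simp add: integrable_indicator_iff emeasure_lborel_Icc_eq)
    fix u :: real
    show "\<bar>(\<Sum>a<n. indicator {s..s+h} u * of_bool (u < lam a)) - (\<Sum>a<n. indicator {s..s+h} u * of_bool (u < mu a))\<bar>
      \<le> indicator {s..s+h} u * r"
      using r[of u] unfolding sum_distrib_left[symmetric] count by (auto simp: indicator_def)
  qed
  also have "\<dots> = r * h" using h by simp
  finally show ?thesis .
qed

lemma sum_trapezoid_diff_le:
  fixes lam mu :: "nat \<Rightarrow> real"
  assumes m: "m > 0" "a < b"
    and r: "\<And>x. \<bar>real (card {a. a < n \<and> lam a \<le> x}) - real (card {a. a < n \<and> mu a \<le> x})\<bar> \<le> r"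
  shows "\<bar>(\<Sum>i<n. trapezoid m a b (lam i)) - (\<Sum>i<n. trapezoid m a b (mu i))\<bar> \<le> 2 * r * (1 / m)"
proof -
  note b = sum_ramp_diff_le[OF _ r, of "1 / m"]
  show ?thesis
    using b[of "a - 1 / m"] b[of b] unfolding trapezoid_eq_ramps[OF m] sum_subtractf by simp
qed

lemma continuous_on_trapezoid:
  assumes "m > 0" "a < b"
  shows "continuous_on A (trapezoid m a b)"
  unfolding trapezoid_eq_ramps[OF assms, abs_def] ramp_def by (intro continuous_intros)

lemma trapezoidsE:
  assumes "g \<in> trapezoids"
  obtains m a b where "m > 0" "a < b" "g = trapezoid m a b"
  using assms by (auto simp: trapezoids_def)

lemma trapezoids_measurable [measurable]: "g \<in> trapezoids \<Longrightarrow> g \<in> borel_measurable borel"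
  by (elim trapezoidsE) (auto intro!: borel_measurable_continuous_onI continuous_on_trapezoid)

lemma trapezoids_bounds:
  assumes "g \<in> trapezoids"
  shows "0 \<le> g x" "g x \<le> 1" "0 \<le> (SUP x. g x)" "(SUP x. g x) \<le> 1"
proof -
  obtain m a b where g: "m > 0" "a < b" "g = trapezoid m a b" using assms by (rule trapezoidsE)
  have "1 / real m \<le> 1" "0 \<le> 1 / real m" using g(1) by simp_all
  then show "0 \<le> g x" "g x \<le> 1" "0 \<le> (SUP x. g x)" "(SUP x. g x) \<le> 1"
    using trapezoid_bounds[OF g(1), of a b x] SUP_trapezoid[OF g(1,2)] unfolding g(3) by linarith+
qed

lemma integral_trapezoid_diff_le_1:
  assumes "real_distribution \<mu>" "real_distribution \<nu>" and g: "g \<in> trapezoids"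
  shows "\<bar>integral\<^sup>L \<mu> g - integral\<^sup>L \<nu> g\<bar> \<le> 1"
proof -
  have "0 \<le> integral\<^sup>L \<mu> g \<and> integral\<^sup>L \<mu> g \<le> 1" if "real_distribution \<mu>" for \<mu>
  proof -
    interpret real_distribution \<mu> by fact
    have [measurable]: "g \<in> borel_measurable borel" using g by (rule trapezoids_measurable)
    have "integrable \<mu> g"
      by (rule integrable_const_bound[of _ 1]) (use trapezoids_bounds[OF g] in auto)
    then have "integral\<^sup>L \<mu> g \<le> integral\<^sup>L \<mu> (\<lambda>_. 1)"
      by (intro integral_mono) (use trapezoids_bounds[OF g] in auto)
    then show ?thesis using trapezoids_bounds[OF g] by (auto intro!: integral_nonneg_AE simp: prob_space[unfolded space_eq_univ])
  qed
  from this[OF assms(1)] this[OF assms(2)] show ?thesis by linarith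
qed

lemma geometric_half_sums: "(\<lambda>i. 1 / 2 ^ Suc i :: real) sums 1"
  using power_half_series by (simp add: power_one_over)

lemma summable_half_weights:
  assumes "\<And>i. \<bar>g i\<bar> \<le> (1::real)"
  shows "summable (\<lambda>i. g i / 2 ^ Suc i)"
  using assms by (intro summable_comparison_test'[OF sums_summable[OF geometric_half_sums], of 0])
      (auto simp: divide_right_mono)

lemma mean_height_le_1:
  assumes "range f \<subseteq> trapezoids"
  shows "mean_height f \<le> 1"
proof -
  have "f i \<in> trapezoids" for i using assms by auto
  note b = trapezoids_bounds(3,4)[OF this]
  have "mean_height f \<le> (\<Sum>i. 1 / 2 ^ Suc i)"
    unfolding mean_height_def using b
    by (intro suminf_le summable_half_weights sums_summable[OF geometric_half_sums]) (auto simp: divide_right_mono)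
  then show ?thesis using sums_unique[OF geometric_half_sums] by simp
qed

text \<open>Every trapezoid has two slopes, each of which contributes its height times \<open>r / n\<close>.\<close>

lemma vague_dist_emp_le:
  assumes f: "range f \<subseteq> trapezoids" and n: "n > 0"
    and F: "interval_measure F = emp n lam" and G: "interval_measure G = emp n mu"
    and r: "\<And>x. \<bar>real (card {a. a < n \<and> lam a \<le> x}) - real (card {a. a < n \<and> mu a \<le> x})\<bar> \<le> r"
  shows "vague_dist f F G \<le> 2 * (r / n) * mean_height f"
proof -
  have fi: "f i \<in> trapezoids" for i using f by auto
  have b: "0 \<le> (SUP x. f i x)" "(SUP x. f i x) \<le> 1" for i
    using trapezoids_bounds[OF fi] by auto
  have le: "\<bar>integral\<^sup>L (emp n lam) (f i) - integral\<^sup>L (emp n mu) (f i)\<bar> \<le> 2 * (r / n) * (SUP x. f i x)" for i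
  proof -
    obtain m a b where g: "m > 0" "a < b" "f i = trapezoid m a b" using fi by (rule trapezoidsE)
    have [measurable]: "f i \<in> borel_measurable borel" using fi by (rule trapezoids_measurable)
    have "\<bar>integral\<^sup>L (emp n lam) (f i) - integral\<^sup>L (emp n mu) (f i)\<bar>
        = \<bar>(1 / real n) * ((\<Sum>j<n. f i (lam j)) - (\<Sum>j<n. f i (mu j)))\<bar>"
      using n by (simp add: integral_emp right_diff_distrib)
    also have "\<dots> = (1 / real n) * \<bar>(\<Sum>j<n. f i (lam j)) - (\<Sum>j<n. f i (mu j))\<bar>"
      by (simp add: abs_mult)
    also have "\<dots> \<le> (1 / real n) * (2 * r * (1 / m))"
      unfolding g(3) using n by (intro mult_left_mono sum_trapezoid_diff_le g r) auto
    also have "(1 / real n) * (2 * r * (1 / m)) = 2 * (r / n) * (SUP x. f i x)"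
      by (simp add: g SUP_trapezoid)
    finally show ?thesis .
  qed
  have "vague_dist f F G \<le> (\<Sum>i. 2 * (r / n) * ((SUP x. f i x) / 2 ^ Suc i))"
    unfolding vague_dist_def F G
  proof (intro suminf_le summable_half_weights summable_mult)
    fix i
    show "\<bar>integral\<^sup>L (emp n lam) (f i) - integral\<^sup>L (emp n mu) (f i)\<bar> / 2 ^ Suc i \<le> 2 * (r / n) * ((SUP x. f i x) / 2 ^ Suc i)"
      using divide_right_mono[OF le[of i], of "2 ^ Suc i"] by simp
  qed (use b integral_trapezoid_diff_le_1[OF real_distribution_emp real_distribution_emp fi] in auto)
  also have "\<dots> = 2 * (r / n) * mean_height f"
    unfolding mean_height_def using b by (intro suminf_mult summable_half_weights) auto
  finally show ?thesis .
qed

lemma vague_dist_triangle: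
  assumes f: "range f \<subseteq> trapezoids"
    and "real_distribution (interval_measure F)" "real_distribution (interval_measure G)" "real_distribution (interval_measure H)"
  shows "vague_dist f F H \<le> vague_dist f F G + vague_dist f G H"
proof -
  have fi: "f i \<in> trapezoids" for i using f by auto
  note b = integral_trapezoid_diff_le_1[OF _ _ fi]
  have "vague_dist f F H \<le> (\<Sum>i. \<bar>integral\<^sup>L (interval_measure F) (f i) - integral\<^sup>L (interval_measure G) (f i)\<bar> / 2 ^ Suc i
       + \<bar>integral\<^sup>L (interval_measure G) (f i) - integral\<^sup>L (interval_measure H) (f i)\<bar> / 2 ^ Suc i)"
    unfolding vague_dist_def using b assms
    by (intro suminf_le summable_half_weights summable_add) (auto simp: divide_right_mono simp flip: add_divide_distrib)
  also have "\<dots> = vague_dist f F G + vague_dist f G H"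
    unfolding vague_dist_def using b assms by (intro suminf_add[symmetric] summable_half_weights) auto
  finally show ?thesis .
qed

text \<open>Dominated convergence of the defining series: each term is at most \<open>1 / 2 ^ Suc i\<close>.\<close>

lemma vague_dist_tendsto_0:
  assumes f: "range f \<subseteq> trapezoids"
    and F: "\<And>n. real_distribution (interval_measure (F n))" and G: "\<And>n. real_distribution (interval_measure (G n))"
    and lim: "\<And>g. g \<in> trapezoids \<Longrightarrow> (\<lambda>n. integral\<^sup>L (interval_measure (F n)) g - integral\<^sup>L (interval_measure (G n)) g) \<longlonglongrightarrow> 0"
  shows "(\<lambda>n. vague_dist f (F n) (G n)) \<longlonglongrightarrow> 0"
proof -
  have fi: "f i \<in> trapezoids" for i using f by auto
  have "(\<lambda>n. \<Sum>i. \<bar>integral\<^sup>L (interval_measure (F n)) (f i) - integral\<^sup>L (interval_measure (G n)) (f i)\<bar> / 2 ^ Suc i)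
      \<longlonglongrightarrow> (\<Sum>i. (0::real) / 2 ^ Suc i)"
  proof (rule tannerys_theorem[where M = "\<lambda>i. 1 / 2 ^ Suc i", THEN conjunct2, THEN conjunct2])
    show "(\<lambda>n. \<bar>integral\<^sup>L (interval_measure (F n)) (f i) - integral\<^sup>L (interval_measure (G n)) (f i)\<bar> / 2 ^ Suc i) \<longlonglongrightarrow> 0 / 2 ^ Suc i" for i
      using tendsto_divide[OF tendsto_rabs_zero[OF lim[OF fi]] tendsto_const[of "2 ^ Suc i"]] by simp
    show "\<forall>\<^sub>F (i, n) in at_top \<times>\<^sub>F sequentially.
        norm (\<bar>integral\<^sup>L (interval_measure (F n)) (f i) - integral\<^sup>L (interval_measure (G n)) (f i)\<bar> / 2 ^ Suc i) \<le> 1 / 2 ^ Suc i"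
      using integral_trapezoid_diff_le_1[OF F G fi] by (intro always_eventually) (auto simp: divide_right_mono)
    show "summable (\<lambda>i. 1 / 2 ^ Suc i :: real)" by (rule sums_summable[OF geometric_half_sums])
  qed auto
  then show ?thesis by (simp add: vague_dist_def)
qed

section \<open>Stieltjes kernels on the imaginary axis determine vague limits\<close>

text \<open>The Stieltjes kernel at the point \<open>\<i> t\<close>.\<close>

definition kern :: "real \<Rightarrow> real \<Rightarrow> complex" where
  "kern t x = 1 / (complex_of_real x - \<i> * complex_of_real t)"

text \<open>The uniformly closed linear span of the constants and of the kernels at the points \<open>\<i> t\<close>, \<open>\<bar>t\<bar> \<ge> v\<close>. Negative
  \<open>t\<close> are included because they are the conjugates of the others.\<close>

inductive kernel_hull :: "real \<Rightarrow> (real \<Rightarrow> complex) \<Rightarrow> bool" for v :: real where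
  hull_one: "kernel_hull v (\<lambda>_. 1)"
| hull_kern: "v \<le> \<bar>t\<bar> \<Longrightarrow> kernel_hull v (kern t)"
| hull_add: "kernel_hull v f \<Longrightarrow> kernel_hull v g \<Longrightarrow> kernel_hull v (\<lambda>x. f x + g x)"
| hull_scale: "kernel_hull v f \<Longrightarrow> kernel_hull v (\<lambda>x. c * f x)"
| hull_lim: "(\<And>e. e > 0 \<Longrightarrow> \<exists>g. kernel_hull v g \<and> (\<forall>x. cmod (f x - g x) \<le> e)) \<Longrightarrow> kernel_hull v f"

lemma kern_denom:
  assumes "t \<noteq> 0"
  shows "complex_of_real x - \<i> * complex_of_real t \<noteq> 0"
    and "\<bar>t\<bar> \<le> cmod (complex_of_real x - \<i> * complex_of_real t)"
proof -
  show "\<bar>t\<bar> \<le> cmod (complex_of_real x - \<i> * complex_of_real t)"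
    using abs_Im_le_cmod[of "complex_of_real x - \<i> * complex_of_real t"] by simp
  then show "complex_of_real x - \<i> * complex_of_real t \<noteq> 0" using assms by auto
qed

lemma kern_bound:
  assumes "0 < v" "v \<le> \<bar>t\<bar>"
  shows "cmod (kern t x) \<le> 1 / v"
proof -
  have "t \<noteq> 0" using assms by auto
  from kern_denom[OF this, of x] assms show ?thesis
    by (simp add: kern_def norm_divide frac_le)
qed

lemma kern_diff:
  assumes "s \<noteq> 0" "t \<noteq> 0"
  shows "kern s x - kern t x = \<i> * of_real (s - t) * (kern s x * kern t x)"
  using kern_denom(1)[OF assms(1), of x] kern_denom(1)[OF assms(2), of x]
  by (simp add: kern_def field_simps)

lemma kernel_hull_diff: "kernel_hull v f \<Longrightarrow> kernel_hull v g \<Longrightarrow> kernel_hull v (\<lambda>x. f x - g x)"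
  using hull_add[of v f "\<lambda>x. (-1) * g x"] hull_scale[of v g "-1"] by simp

lemma kernel_hull_bounded_measurable:
  assumes "kernel_hull v f" "0 < v"
  shows "\<exists>B. \<forall>x. cmod (f x) \<le> B" and "f \<in> borel_measurable borel"
proof -
  have "(\<exists>B. \<forall>x. cmod (f x) \<le> B) \<and> continuous_on UNIV f"
    using assms
  proof induction
    case hull_one
    then show ?case by (auto intro: exI[of _ 1])
  next
    case (hull_kern t)
    then have "t \<noteq> 0" by auto
    then have "continuous_on UNIV (kern t)"
      unfolding kern_def[abs_def] by (intro continuous_intros) (auto simp: kern_denom(1))
    then show ?case using kern_bound[OF \<open>0 < v\<close> hull_kern(1)] by auto
  next
    case (hull_add f g)
    then obtain B C where "\<forall>x. cmod (f x) \<le> B" "\<forall>x. cmod (g x) \<le> C" by auto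
    then have "\<forall>x. cmod (f x + g x) \<le> B + C" by (meson add_mono norm_triangle_ineq order_trans)
    then show ?case using hull_add by (auto intro!: continuous_intros)
  next
    case (hull_scale f c)
    then obtain B where "\<forall>x. cmod (f x) \<le> B" by auto
    then have "\<forall>x. cmod (c * f x) \<le> cmod c * B" by (simp add: norm_mult mult_left_mono)
    then show ?case using hull_scale by (auto intro!: continuous_intros)
  next
    case (hull_lim f)
    obtain g B where g: "\<forall>x. cmod (f x - g x) \<le> 1" "\<forall>x. cmod (g x) \<le> B"
      using hull_lim(1)[of 1] \<open>0 < v\<close> by auto
    have "cmod (f x) \<le> 1 + B" for x
      using norm_triangle_ineq[of "f x - g x" "g x"] g[rule_format, of x] by simp
    moreover have "\<exists>g. \<forall>n. continuous_on UNIV (g n) \<and> (\<forall>x. cmod (f x - g n x) \<le> 1 / real (Suc n))"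
    proof (intro choice allI)
      fix n :: nat
      have "1 / real (Suc n) > 0" by simp
      from hull_lim(1)[OF this] \<open>0 < v\<close>
      show "\<exists>g. continuous_on UNIV g \<and> (\<forall>x. cmod (f x - g x) \<le> 1 / real (Suc n))" by auto
    qed
    then obtain h where h: "\<And>n. continuous_on UNIV (h n)" "\<And>n x. cmod (f x - h n x) \<le> 1 / real (Suc n)" by auto
    have "uniform_limit UNIV h f sequentially"
      unfolding uniform_limit_iff
    proof (intro allI impI)
      fix e :: real assume "e > 0"
      then obtain n0 where n0: "1 / real (Suc n0) < e" by (metis nat_approx_posE)
      show "\<forall>\<^sub>F n in sequentially. \<forall>x\<in>UNIV. dist (h n x) (f x) < e"
        using eventually_ge_at_top[of n0]
      proof eventually_elim
        case (elim n)
        have "1 / real (Suc n) \<le> 1 / real (Suc n0)" using elim by (intro divide_left_mono) auto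
        then show ?case using h(2)[of _ n] n0
          by (auto simp: dist_norm norm_minus_commute intro: le_less_trans order_trans)
      qed
    qed
    then have "continuous_on UNIV f"
      by (rule uniform_limit_theorem[rotated]) (use h(1) in auto)
    ultimately show ?case by blast
  qed
  then show "\<exists>B. \<forall>x. cmod (f x) \<le> B" "f \<in> borel_measurable borel"
    by (auto intro: borel_measurable_continuous_onI)
qed

text \<open>By the resolvent identity the product of two different kernels is a multiple of their difference; the
  square of a kernel is a uniform limit of such products. So the hull is an algebra.\<close>

lemma kernel_hull_mult:
  assumes v: "0 < v" and f: "kernel_hull v f" and g: "kernel_hull v g"
  shows "kernel_hull v (\<lambda>x. f x * g x)"
proof -
  have distinct: "kernel_hull v (\<lambda>x. kern s x * kern t x)" if "v \<le> \<bar>s\<bar>" "v \<le> \<bar>t\<bar>" "s \<noteq> t" for s t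
  proof -
    have nz: "s \<noteq> 0" "t \<noteq> 0" using that v by auto
    have "kernel_hull v (\<lambda>x. 1 / (\<i> * of_real (s - t)) * (kern s x - kern t x))"
      by (intro hull_scale kernel_hull_diff hull_kern that)
    moreover have "1 / (\<i> * of_real (s - t)) * (kern s x - kern t x) = kern s x * kern t x" for x
      unfolding kern_diff[OF nz] using that(3) by (simp add: field_simps)
    ultimately show ?thesis by simp
  qed
  have same: "kernel_hull v (\<lambda>x. kern t x * kern t x)" if t: "v \<le> \<bar>t\<bar>" for t
  proof (rule hull_lim)
    fix e :: real assume e: "e > 0"
    define \<delta> where "\<delta> = min (e * v ^ 3) 1"
    define s where "s = (if t > 0 then t + \<delta> else t - \<delta>)"
    have \<delta>: "\<delta> > 0" "\<delta> \<le> e * v ^ 3" using e v by (simp_all add: \<delta>_def)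
    have t0: "t \<noteq> 0" using t v by auto
    have d: "\<bar>s - t\<bar> \<le> e * v ^ 3" "s \<noteq> t" using \<delta> by (auto simp: s_def)
    have s: "v \<le> \<bar>s\<bar>" using t \<delta>(1) t0 by (auto simp: s_def)
    then have s0: "s \<noteq> 0" using v by auto
    have "cmod (kern t x * kern t x - kern s x * kern t x) \<le> e" for x
    proof -
      have "kern t x * kern t x - kern s x * kern t x = - (kern s x - kern t x) * kern t x"
        by (simp add: algebra_simps)
      also have "cmod \<dots> = \<bar>s - t\<bar> * (cmod (kern s x) * cmod (kern t x) * cmod (kern t x))"
        unfolding kern_diff[OF s0 t0] by (simp add: norm_mult del: of_real_diff)
      also have "\<dots> \<le> (e * v ^ 3) * (1 / v * (1 / v) * (1 / v))"
        using d kern_bound[OF v s, of x] kern_bound[OF v t, of x] v by (intro mult_mono) auto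
      also have "\<dots> = e" using v by (simp add: field_simps power3_eq_cube)
      finally show ?thesis .
    qed
    then show "\<exists>g. kernel_hull v g \<and> (\<forall>x. cmod (kern t x * kern t x - g x) \<le> e)"
      using distinct[OF s t d(2)] by blast
  qed
  have kern: "kernel_hull v (\<lambda>x. kern t x * g x)" if t: "v \<le> \<bar>t\<bar>" for t
    using g
  proof induction
    case hull_one
    then show ?case using hull_kern[OF t] by simp
  next
    case (hull_kern s)
    then show ?case using same[OF t] distinct[OF t hull_kern] by (cases "s = t") auto
  next
    case (hull_add f g)
    then show ?case using kernel_hull.hull_add[of v "\<lambda>x. kern t x * f x" "\<lambda>x. kern t x * g x"]
      by (simp add: distrib_left)
  next
    case (hull_scale f c)
    then show ?case using kernel_hull.hull_scale[of v "\<lambda>x. kern t x * f x" c]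
      by (simp add: mult.left_commute)
  next
    case (hull_lim f)
    show ?case
    proof (rule kernel_hull.hull_lim)
      fix e :: real assume e: "e > 0"
      then have "e * v > 0" using v by simp
      from hull_lim(1)[OF this] obtain g where g: "kernel_hull v (\<lambda>x. kern t x * g x)" "\<forall>x. cmod (f x - g x) \<le> e * v" by auto
      have "cmod (kern t x * f x - kern t x * g x) \<le> e" for x
      proof -
        have "cmod (kern t x * f x - kern t x * g x) = cmod (kern t x) * cmod (f x - g x)"
          by (simp add: norm_mult[symmetric] right_diff_distrib)
        also have "\<dots> \<le> 1 / v * (e * v)" using g kern_bound[OF v t, of x] v by (intro mult_mono) auto
        finally show ?thesis using v by simp
      qed
      then show "\<exists>h. kernel_hull v h \<and> (\<forall>x. cmod (kern t x * f x - h x) \<le> e)" using g by blast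
    qed
  qed
  from f show ?thesis
  proof induction
    case hull_one
    then show ?case using g by simp
  next
    case (hull_kern s)
    then show ?case using kern by simp
  next
    case (hull_add f f')
    then show ?case using kernel_hull.hull_add[of v "\<lambda>x. f x * g x" "\<lambda>x. f' x * g x"]
      by (simp add: distrib_right)
  next
    case (hull_scale f c)
    then show ?case using kernel_hull.hull_scale[of v "\<lambda>x. f x * g x" c]
      by (simp add: mult.assoc)
  next
    case (hull_lim f)
    obtain B where B: "\<And>x. cmod (g x) \<le> B" using kernel_hull_bounded_measurable(1)[OF g v] by auto
    have B0: "B \<ge> 0" using order_trans[OF norm_ge_zero B[of 0]] .
    show ?case
    proof (rule kernel_hull.hull_lim)
      fix e :: real assume e: "e > 0"
      then have "e / (B + 1) > 0" using B0 by simp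
      from hull_lim(1)[OF this] obtain h where h: "kernel_hull v (\<lambda>x. h x * g x)" "\<forall>x. cmod (f x - h x) \<le> e / (B + 1)" by auto
      have "cmod (f x * g x - h x * g x) \<le> e" for x
      proof -
        have "cmod (f x * g x - h x * g x) = cmod (f x - h x) * cmod (g x)"
          by (simp add: norm_mult[symmetric] left_diff_distrib)
        also have "\<dots> \<le> e / (B + 1) * (B + 1)" using h B[of x] B0 e by (intro mult_mono) auto
        finally show ?thesis using B0 by simp
      qed
      then show "\<exists>k. kernel_hull v k \<and> (\<forall>x. cmod (f x * g x - k x) \<le> e)" using h by blast
    qed
  qed
qed

definition cayley :: "real \<Rightarrow> real \<Rightarrow> complex" where
  "cayley v x = (complex_of_real x + \<i> * complex_of_real v) / (complex_of_real x - \<i> * complex_of_real v)"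

lemma cayley_kern:
  assumes "v > 0"
  shows "cayley v x = 1 + 2 * \<i> * of_real v * kern v x" "cnj (cayley v x) = 1 - 2 * \<i> * of_real v * kern (- v) x"
proof -
  show 1: "cayley v x = 1 + 2 * \<i> * of_real v * kern v x"
    using kern_denom(1)[of v x] assms by (simp add: cayley_def kern_def field_simps)
  show "cnj (cayley v x) = 1 - 2 * \<i> * of_real v * kern (- v) x"
    unfolding 1 by (simp add: kern_def)
qed

lemma cayley_Re_Im:
  assumes "v > 0"
  shows "Re (cayley v x) = (x\<^sup>2 - v\<^sup>2) / (x\<^sup>2 + v\<^sup>2)" "Im (cayley v x) = 2 * x * v / (x\<^sup>2 + v\<^sup>2)"
  by (simp_all add: cayley_def Re_divide Im_divide power2_eq_square)

lemma cayley_circle: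
  assumes "v > 0"
  shows "cayley v x \<in> sphere 0 1" "v * Im (cayley v x) / (1 - Re (cayley v x)) = x" "Re (cayley v x) < 1"
proof -
  have p: "x\<^sup>2 + v\<^sup>2 > 0" using assms by (simp add: sum_power2_gt_zero_iff)
  have c: "cmod (complex_of_real x - \<i> * complex_of_real v) = cmod (complex_of_real x + \<i> * complex_of_real v)"
    by (simp add: cmod_def)
  show "cayley v x \<in> sphere 0 1"
    using kern_denom(1)[of v x] assms by (simp add: cayley_def norm_divide c[symmetric])
  define q where "q = x\<^sup>2 + v\<^sup>2"
  have "q > 0" using p unfolding q_def .
  then have q: "q \<noteq> 0" by simp
  have "Re (cayley v x) = (q - 2 * v\<^sup>2) / q" unfolding cayley_Re_Im(1)[OF assms] by (simp add: q_def)
  then have re: "1 - Re (cayley v x) = 2 * v\<^sup>2 / q" using q by (simp add: diff_divide_distrib)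
  have im: "Im (cayley v x) = 2 * x * v / q" by (simp add: cayley_Re_Im[OF assms] q_def)
  show "v * Im (cayley v x) / (1 - Re (cayley v x)) = x"
    unfolding re im using q assms by (simp add: field_simps power2_eq_square)
  show "Re (cayley v x) < 1" using p assms by (simp add: cayley_Re_Im[OF assms])
qed

text \<open>The Cayley map and its conjugate are affine in the kernels at \<open>\<plusminus> \<i> v\<close>, and the hull is an algebra.\<close>

lemma kernel_hull_polynomial_cayley:
  assumes v: "v > 0" and p: "real_polynomial_function p"
  shows "kernel_hull v (\<lambda>x. complex_of_real (p (cayley v x)))"
  using p
proof induction
  case (linear p)
  interpret bounded_linear p by fact
  have c1: "kernel_hull v (\<lambda>x. cayley v x)"
    unfolding cayley_kern(1)[OF v] by (intro hull_add hull_one hull_scale hull_kern) simp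
  have c2: "kernel_hull v (\<lambda>x. cnj (cayley v x))"
    unfolding cayley_kern(2)[OF v] by (intro kernel_hull_diff hull_one hull_scale hull_kern) simp
  have "complex_of_real (p w) = (complex_of_real (p 1) / 2) * (w + cnj w) + (complex_of_real (p \<i>) / (2 * \<i>)) * (w - cnj w)" for w
  proof -
    have "w = Re w *\<^sub>R 1 + Im w *\<^sub>R \<i>" by (simp add: complex_eq_iff)
    then have "p w = p (Re w *\<^sub>R 1 + Im w *\<^sub>R \<i>)" by simp
    also have "\<dots> = Re w * p 1 + Im w * p \<i>" by (simp only: add scaleR real_scaleR_def)
    finally have "p w = Re w * p 1 + Im w * p \<i>" .
    then show ?thesis by (simp add: complex_eq_iff)
  qed
  then have eq: "(\<lambda>x. complex_of_real (p (cayley v x))) = (\<lambda>x. (complex_of_real (p 1) / 2) * (cayley v x + cnj (cayley v x))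
      + (complex_of_real (p \<i>) / (2 * \<i>)) * (cayley v x - cnj (cayley v x)))"
    by (rule ext)
  show ?case unfolding eq
    by (rule hull_add[OF hull_scale[OF hull_add[OF c1 c2]] hull_scale[OF kernel_hull_diff[OF c1 c2]]])
next
  case (const c)
  then show ?case using hull_scale[OF hull_one, of v "of_real c"] by simp
next
  case (add f g)
  then show ?case using hull_add by fastforce
next
  case (mult f g)
  then show ?case using kernel_hull_mult[OF v mult.IH] by simp
qed

text \<open>The Cayley map carries the line onto the circle without the point \<open>1\<close>. A compactly supported function
  becomes a function on the circle that vanishes near \<open>1\<close>, hence a continuous one, and the Stone--Weierstrass
  theorem approximates it by polynomials in the Cayley map.\<close>

lemma kernel_hull_compact_support:
  assumes v: "v > 0" and f: "continuous_on UNIV f" and K: "\<And>x. \<bar>x\<bar> > K \<Longrightarrow> f x = (0::real)"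
  shows "kernel_hull v (\<lambda>x. complex_of_real (f x))"
proof (rule hull_lim)
  fix e :: real assume e: "e > 0"
  \<comment> \<open>The inverse of the Cayley map is \<open>w \<mapsto> v * Im w / (1 - Re w)\<close>.\<close>
  define h where "h w = (if Re w = 1 then 0 else f (v * Im w / (1 - Re w)))" for w
  define \<delta> where "\<delta> = min 1 (v\<^sup>2 / (K\<^sup>2 + 1))"
  have K1: "K\<^sup>2 + 1 > 0" by (rule add_nonneg_pos) auto
  then have \<delta>: "\<delta> > 0" "\<delta> \<le> 1" "\<delta> \<le> v\<^sup>2 / (K\<^sup>2 + 1)" using v by (auto simp: \<delta>_def)
  define S where "S = sphere (0::complex) 1"
  have zero: "h w = 0" if w: "w \<in> S" "1 - Re w < \<delta>" for w
  proof (cases "Re w = 1")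
    case False
    have sq: "(Re w)\<^sup>2 + (Im w)\<^sup>2 = 1"
      using w(1) by (simp add: S_def cmod_def)
    have "(Re w)\<^sup>2 \<le> 1" using sq zero_le_power2[of "Im w"] by linarith
    then have "Re w \<le> 1" using power2_le_imp_le[of "Re w" 1] by simp
    with False have a: "1 - Re w > 0" by simp
    have b: "Re w > 0" using w(2) \<delta>(2) by simp
    have im: "(Im w)\<^sup>2 = (1 - Re w) * (1 + Re w)" using sq by (simp add: algebra_simps power2_eq_square)
    have "K\<^sup>2 * (1 - Re w) \<le> K\<^sup>2 * \<delta>"
      using w(2) by (intro mult_left_mono) auto
    also have "\<dots> < (K\<^sup>2 + 1) * \<delta>" using \<delta>(1) by (simp add: distrib_right)
    also have "\<dots> \<le> v\<^sup>2" using \<delta>(3) K1 by (simp add: field_simps)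
    also have "\<dots> \<le> v\<^sup>2 * (1 + Re w)" using b by (simp add: mult_le_cancel_left1)
    finally have "K\<^sup>2 * (1 - Re w) * (1 - Re w) < v\<^sup>2 * (1 + Re w) * (1 - Re w)"
      using a by (rule mult_strict_right_mono)
    then have "K\<^sup>2 * ((1 - Re w) * (1 - Re w)) < v\<^sup>2 * (Im w)\<^sup>2"
      unfolding im by (simp add: mult_ac)
    then have "K\<^sup>2 < v\<^sup>2 * (Im w)\<^sup>2 / ((1 - Re w) * (1 - Re w))"
      using a by (subst pos_less_divide_eq) auto
    also have "\<dots> = (v * Im w / (1 - Re w))\<^sup>2"
      by (simp add: power_divide power_mult_distrib power2_eq_square[of "1 - Re w"])
    finally have "K\<^sup>2 < (v * Im w / (1 - Re w))\<^sup>2" .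
    then have "\<bar>K\<bar> < \<bar>v * Im w / (1 - Re w)\<bar>"
      by (metis abs_le_square_iff not_le)
    then have "f (v * Im w / (1 - Re w)) = 0" by (intro K) linarith
    then show ?thesis by (simp add: h_def)
  qed (simp add: h_def)
  have c1: "continuous_on (S \<inter> {w. 1 - Re w < \<delta>}) h"
    by (subst continuous_on_cong[OF refl zero]) auto
  have c2: "continuous_on (S \<inter> {w. Re w < 1}) h"
  proof -
    have "continuous_on (S \<inter> {w. Re w < 1}) (\<lambda>w. f (v * Im w / (1 - Re w)))"
      by (rule continuous_on_compose2[OF f]) (auto intro!: continuous_intros)
    then show ?thesis by (subst continuous_on_cong[OF refl, of _ h]) (auto simp: h_def)
  qed
  have "Re w \<le> 1" if "w \<in> S" for w
    using that complex_Re_le_cmod[of w] by (simp add: S_def)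
  then have S: "S = (S \<inter> {w. 1 - Re w < \<delta>}) \<union> (S \<inter> {w. Re w < 1})"
    using \<delta> by force
  have o1: "openin (top_of_set S) (S \<inter> {w. 1 - Re w < \<delta>})"
    by (intro openin_open_Int open_Collect_less continuous_intros)
  have o2: "openin (top_of_set S) (S \<inter> {w. Re w < 1})"
    by (intro openin_open_Int open_Collect_less continuous_intros)
  have "continuous_on S h"
    using continuous_on_Un_local_open[of "S \<inter> {w. 1 - Re w < \<delta>}" "S \<inter> {w. Re w < 1}" h] c1 c2 o1 o2 S
    by simp
  then obtain p where p: "real_polynomial_function p" "\<And>w. w \<in> S \<Longrightarrow> \<bar>h w - p w\<bar> < e"
    using Stone_Weierstrass_real_polynomial_function[of S h e] e by (auto simp: S_def)
  have "cmod (complex_of_real (f x) - complex_of_real (p (cayley v x))) \<le> e" for x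
  proof -
    have "h (cayley v x) = f x" using cayley_circle[OF v, of x] by (simp add: h_def)
    then have "\<bar>f x - p (cayley v x)\<bar> < e" using p(2)[of "cayley v x"] cayley_circle(1)[OF v] by (simp add: S_def)
    then show ?thesis by (simp flip: of_real_diff)
  qed
  then show "\<exists>g. kernel_hull v g \<and> (\<forall>x. cmod (complex_of_real (f x) - g x) \<le> e)"
    using kernel_hull_polynomial_cayley[OF v p(1)] by blast
qed

lemma kernel_hull_integrable:
  assumes "kernel_hull v f" "0 < v" "real_distribution \<mu>"
  shows "integrable \<mu> f"
proof -
  interpret real_distribution \<mu> by fact
  obtain B where "\<And>x. cmod (f x) \<le> B" using kernel_hull_bounded_measurable(1)[OF assms(1,2)] by auto
  then show ?thesis using kernel_hull_bounded_measurable(2)[OF assms(1,2)]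
    by (intro integrable_const_bound[of _ B]) auto
qed

lemma integral_kernel_hull_tendsto:
  assumes v: "0 < v" and \<mu>: "\<And>n. real_distribution (\<mu> n)" and \<nu>: "\<And>n. real_distribution (\<nu> n)"
    and kern: "\<And>t. v \<le> t \<Longrightarrow> (\<lambda>n. integral\<^sup>L (\<mu> n) (kern t) - integral\<^sup>L (\<nu> n) (kern t)) \<longlonglongrightarrow> 0"
    and f: "kernel_hull v f"
  shows "(\<lambda>n. integral\<^sup>L (\<mu> n) f - integral\<^sup>L (\<nu> n) f) \<longlonglongrightarrow> 0"
  using f
proof induction
  case hull_one
  have "integral\<^sup>L M (\<lambda>_. 1 :: complex) = 1" if "real_distribution M" for M
  proof -
    interpret real_distribution M by fact
    show ?thesis by (simp add: prob_space[unfolded space_eq_univ])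
  qed
  then show ?case using \<mu> \<nu> by simp
next
  case (hull_kern t)
  show ?case
  proof (cases "t > 0")
    case False
    have cnj: "kern t = (\<lambda>x. cnj (kern (- t) x))" by (auto simp: kern_def)
    have "(\<lambda>n. cnj (integral\<^sup>L (\<mu> n) (kern (- t)) - integral\<^sup>L (\<nu> n) (kern (- t)))) \<longlonglongrightarrow> cnj 0"
      by (intro tendsto_cnj kern) (use False hull_kern in auto)
    then show ?thesis unfolding cnj integral_cnj by simp
  qed (use hull_kern kern in auto)
next
  case (hull_add f g)
  show ?case
    using tendsto_add[OF hull_add.IH]
    by (simp add: kernel_hull_integrable[OF hull_add(1) v \<mu>] kernel_hull_integrable[OF hull_add(1) v \<nu>]
        kernel_hull_integrable[OF hull_add(2) v \<mu>] kernel_hull_integrable[OF hull_add(2) v \<nu>] algebra_simps)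
next
  case (hull_scale f c)
  show ?case
    using tendsto_mult_right_zero[OF hull_scale.IH, of c] by (simp add: right_diff_distrib)
next
  case (hull_lim f)
  have f: "kernel_hull v f" using hull_lim by (intro kernel_hull.hull_lim) blast
  show ?case
  proof (rule tendstoI)
    fix e :: real assume e: "e > 0"
    then have "e / 3 > 0" by simp
    from hull_lim(1)[OF this] obtain g where g: "kernel_hull v g" "\<And>x. cmod (f x - g x) \<le> e / 3"
      "(\<lambda>n. integral\<^sup>L (\<mu> n) g - integral\<^sup>L (\<nu> n) g) \<longlonglongrightarrow> 0" by auto
    have close: "cmod (integral\<^sup>L M f - integral\<^sup>L M g) \<le> e / 3" if "real_distribution M" for M
    proof -
      interpret real_distribution M by fact
      note int = kernel_hull_integrable[OF f v that] kernel_hull_integrable[OF g(1) v that]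
      have "cmod (integral\<^sup>L M f - integral\<^sup>L M g) = cmod (integral\<^sup>L M (\<lambda>x. f x - g x))"
        using int by simp
      also have "\<dots> \<le> integral\<^sup>L M (\<lambda>x. e / 3)"
        by (rule Bochner_Integration.integral_norm_bound_integral) (use int g(2) in auto)
      finally show ?thesis by (simp add: prob_space[unfolded space_eq_univ])
    qed
    have "\<forall>\<^sub>F n in sequentially. dist (integral\<^sup>L (\<mu> n) g - integral\<^sup>L (\<nu> n) g) 0 < e / 3"
      using g(3) e by (intro tendstoD) auto
    then show "\<forall>\<^sub>F n in sequentially. dist (integral\<^sup>L (\<mu> n) f - integral\<^sup>L (\<nu> n) f) 0 < e"
    proof eventually_elim
      case (elim n)
      let ?a = "integral\<^sup>L (\<mu> n) f - integral\<^sup>L (\<mu> n) g" and ?b = "integral\<^sup>L (\<nu> n) f - integral\<^sup>L (\<nu> n) g"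
      let ?c = "integral\<^sup>L (\<mu> n) g - integral\<^sup>L (\<nu> n) g"
      have "integral\<^sup>L (\<mu> n) f - integral\<^sup>L (\<nu> n) f = ?a - ?b + ?c" by simp
      also have "cmod \<dots> \<le> cmod ?a + cmod ?b + cmod ?c"
        using norm_triangle_ineq[of "?a - ?b" ?c] norm_triangle_ineq4[of ?a ?b] by linarith
      also have "\<dots> < e" using close[OF \<mu>[of n]] close[OF \<nu>[of n]] elim by (simp add: dist_norm)
      finally show ?case by (simp add: dist_norm)
    qed
  qed
qed

text \<open>Stieltjes transforms far up the imaginary axis suffice for vague convergence, since trapezoids lie in the
  hull. This is what allows the random matrix argument to work with \<open>t\<close> so large that the system of equations is
  a contraction.\<close>

lemma integral_trapezoid_tendsto:
  assumes v: "0 < v" and \<mu>: "\<And>n. real_distribution (\<mu> n)" and \<nu>: "\<And>n. real_distribution (\<nu> n)"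
    and kern: "\<And>t. v \<le> t \<Longrightarrow> (\<lambda>n. integral\<^sup>L (\<mu> n) (kern t) - integral\<^sup>L (\<nu> n) (kern t)) \<longlonglongrightarrow> 0"
    and m: "m > 0" "a < b"
  shows "(\<lambda>n. integral\<^sup>L (\<mu> n) (trapezoid m a b) - integral\<^sup>L (\<nu> n) (trapezoid m a b)) \<longlonglongrightarrow> 0"
proof -
  define K where "K = \<bar>a\<bar> + \<bar>b\<bar> + 1 / real m"
  have "trapezoid m a b x = 0" if "\<bar>x\<bar> > K" for x
    using that m by (auto simp: trapezoid_def K_def)
  then have "kernel_hull v (\<lambda>x. complex_of_real (trapezoid m a b x))"
    by (intro kernel_hull_compact_support[OF v continuous_on_trapezoid[OF m]])
  from integral_kernel_hull_tendsto[OF v \<mu> \<nu> kern this]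
  have "(\<lambda>n. complex_of_real (integral\<^sup>L (\<mu> n) (trapezoid m a b) - integral\<^sup>L (\<nu> n) (trapezoid m a b))) \<longlonglongrightarrow> of_real 0"
    by simp
  then show ?thesis by (simp only: tendsto_of_real_iff)
qed

lemma real_distribution_eqI_kern:
  assumes v: "0 < v" and \<mu>: "real_distribution \<mu>" and \<nu>: "real_distribution \<nu>"
    and kern: "\<And>t. v \<le> t \<Longrightarrow> integral\<^sup>L \<mu> (kern t) = integral\<^sup>L \<nu> (kern t)"
  shows "\<mu> = \<nu>"
proof (rule cdf_unique[OF \<mu> \<nu>])
  have trap: "integral\<^sup>L \<mu> (trapezoid m a b) = integral\<^sup>L \<nu> (trapezoid m a b)" if "m > 0" "a < b" for m a b
    using integral_trapezoid_tendsto[OF v \<mu> \<nu> _ that] kern by (simp add: LIMSEQ_const_iff)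
  have icc: "(\<lambda>m. real (Suc m) * integral\<^sup>L M (trapezoid (Suc m) a b)) \<longlonglongrightarrow> measure M {a..b}"
    if M: "real_distribution M" and ab: "a < b" for M a b
  proof -
    interpret real_distribution M by fact
    have [measurable]: "trapezoid (Suc m) a b \<in> borel_measurable borel" for m
      using ab by (intro borel_measurable_continuous_onI continuous_on_trapezoid) auto
    have "(\<lambda>m. integral\<^sup>L M (\<lambda>x. real (Suc m) * trapezoid (Suc m) a b x)) \<longlonglongrightarrow> integral\<^sup>L M (indicat_real {a..b})"
    proof (rule integral_dominated_convergence[where w = "\<lambda>_. 1"])
      show "AE x in M. (\<lambda>m. real (Suc m) * trapezoid (Suc m) a b x) \<longlonglongrightarrow> indicat_real {a..b} x"
      proof (rule AE_I2, rule tendsto_eventually)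
        fix x
        show "\<forall>\<^sub>F m in sequentially. real (Suc m) * trapezoid (Suc m) a b x = indicat_real {a..b} x"
        proof (cases "x \<in> {a..b}")
          case True
          have "\<not> (x \<le> a - 1 / real (Suc m) \<or> b + 1 / real (Suc m) \<le> x)" for m
          proof -
            have "1 / real (Suc m) > 0" "a \<le> x" "x \<le> b" using True by auto
            then show ?thesis by linarith
          qed
          then show ?thesis using True by (intro always_eventually) (auto simp: trapezoid_def simp del: of_nat_Suc)
        next
          case False
          define \<delta> where "\<delta> = max (a - x) (x - b)"
          have "\<delta> > 0" using False by (auto simp: \<delta>_def)
          then obtain m0 where m0: "1 / real (Suc m0) < \<delta>" by (metis nat_approx_posE)
          show ?thesis using eventually_ge_at_top[of m0]
          proof eventually_elim
            case (elim m)
            have "1 / real (Suc m) \<le> 1 / real (Suc m0)" using elim by (intro divide_left_mono) auto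
            then have "1 / real (Suc m) < \<delta>" using m0 by linarith
            then have "x \<le> a - 1 / real (Suc m) \<or> b + 1 / real (Suc m) \<le> x" by (auto simp: \<delta>_def max_def split: if_splits)
            then show ?case using False by (auto simp: trapezoid_def simp del: of_nat_Suc)
          qed
        qed
      qed
      show "AE x in M. norm (real (Suc m) * trapezoid (Suc m) a b x) \<le> 1" for m
      proof (rule AE_I2)
        fix x
        have "real (Suc m) * trapezoid (Suc m) a b x \<le> real (Suc m) * (1 / real (Suc m))"
          by (intro mult_left_mono trapezoid_bounds) auto
        then show "norm (real (Suc m) * trapezoid (Suc m) a b x) \<le> 1"
          using trapezoid_bounds(1)[of "Suc m" a b x] by (simp add: abs_mult)
      qed
    qed auto
    then show ?thesis by simp
  qed
  have icc_eq: "measure \<mu> {a..b} = measure \<nu> {a..b}" if "a < b" for a b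
    using LIMSEQ_unique[OF icc[OF \<mu> that]] icc[OF \<nu> that] trap[OF _ that] by simp
  show "cdf \<mu> = cdf \<nu>"
  proof
    fix x
    have lim: "(\<lambda>k. measure M {x - real (Suc k)..x}) \<longlonglongrightarrow> cdf M x" if M: "real_distribution M" for M
    proof -
      interpret real_distribution M by fact
      have "(\<Union>k. {x - real (Suc k)..x}) = {..x}"
      proof -
        have "\<exists>k. x - real (Suc k) \<le> y" for y
        proof -
          obtain k where "x - y < real k" using reals_Archimedean2 by blast
          then have "x - real (Suc k) \<le> y" by simp
          then show ?thesis ..
        qed
        then show ?thesis by auto
      qed
      moreover have "(\<lambda>k. measure M {x - real (Suc k)..x}) \<longlonglongrightarrow> measure M (\<Union>k. {x - real (Suc k)..x})"
        by (rule finite_Lim_measure_incseq) (auto simp: incseq_def)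
      ultimately show ?thesis by (simp add: cdf_def)
    qed
    have "measure \<mu> {x - real (Suc k)..x} = measure \<nu> {x - real (Suc k)..x}" for k
      by (rule icc_eq) simp
    then show "cdf \<mu> x = cdf \<nu> x" using LIMSEQ_unique[OF lim[OF \<mu>]] lim[OF \<nu>] by simp
  qed
qed

section \<open>The deterministic system of equations\<close>

lemma Im_of_real_divide: "Im (of_real a / w) = - (a * Im w / (cmod w)\<^sup>2)"
  by (simp add: Im_divide cmod_power2)

lemma Cauchy_Schwarz_sqrt_sum:
  fixes a b :: "'i \<Rightarrow> real"
  assumes "\<And>i. i \<in> A \<Longrightarrow> 0 \<le> a i" "\<And>i. i \<in> A \<Longrightarrow> 0 \<le> b i"
  shows "(\<Sum>i\<in>A. sqrt (a i) * sqrt (b i)) \<le> sqrt (\<Sum>i\<in>A. a i) * sqrt (\<Sum>i\<in>A. b i)"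
proof -
  have "(\<Sum>i\<in>A. sqrt (a i) * sqrt (b i))\<^sup>2 \<le> (\<Sum>i\<in>A. (sqrt (a i))\<^sup>2) * (\<Sum>i\<in>A. (sqrt (b i))\<^sup>2)"
    by (rule Cauchy_Schwarz_ineq_sum)
  also have "\<dots> = (\<Sum>i\<in>A. a i) * (\<Sum>i\<in>A. b i)"
    using assms by (simp cong: sum.cong)
  finally show ?thesis
    by (simp add: real_le_rsqrt flip: real_sqrt_mult)
qed

lemma cmod_real_mult_divide:
  assumes "0 \<le> p"
  shows "cmod (of_real p * w / (a * b)) = p / (cmod a * cmod b) * cmod w"
  using assms by (simp add: norm_mult norm_divide)

lemma Im_of_real_mult: "Im (of_real a * w) = a * Im w"
  by simp

lemma Im_inverse_nat_mult: "Im (1 / of_nat m * w) = 1 / real m * Im w"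
  by simp

text \<open>A single matrix size, with the profile \<open>d\<close> of the truncated matrix in mind: columns of \<open>d\<close> may vanish.\<close>

locale profile_system =
  fixes n N :: nat and d :: "nat \<Rightarrow> nat \<Rightarrow> real"
  assumes n_pos: "0 < n" and N_pos: "0 < N"
begin

definition c :: real where "c = real n / real N"

abbreviation D :: "complex \<Rightarrow> (nat \<Rightarrow> complex) \<Rightarrow> nat \<Rightarrow> complex" where
  "D z e i \<equiv> resolvent_denom n N d z e i"

text \<open>The right-hand side of the system, so that solutions are the fixed points.\<close>

definition sys :: "complex \<Rightarrow> (nat \<Rightarrow> complex) \<Rightarrow> nat \<Rightarrow> complex" where
  "sys z e j = 1 / of_nat n * (\<Sum>i<n. of_real ((d i j)\<^sup>2) / D z e i)"

definition nzcol :: "nat \<Rightarrow> bool" where "nzcol k \<longleftrightarrow> (\<exists>i<n. d i k \<noteq> 0)"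

text \<open>The imaginary part of \<open>sys z e j\<close> splits into the contributions \<open>flow z e j i k\<close> that pass through the imaginary
  parts of the \<open>e k\<close>, and \<open>Im z * source z e j\<close>, which comes from \<open>z\<close> itself. \<open>absorb e k\<close> is
  \<open>- Im (1 / (1 + c * e k))\<close>. The strict positivity of the source is what makes \<open>sys\<close> contract.\<close>

definition absorb :: "(nat \<Rightarrow> complex) \<Rightarrow> nat \<Rightarrow> real" where
  "absorb e k = c * Im (e k) / (cmod (1 + of_real c * e k))\<^sup>2"

definition flow :: "complex \<Rightarrow> (nat \<Rightarrow> complex) \<Rightarrow> nat \<Rightarrow> nat \<Rightarrow> nat \<Rightarrow> real" where
  "flow z e j i k = 1 / real n * (d i j)\<^sup>2 / (cmod (D z e i))\<^sup>2 * (1 / real N * (d i k)\<^sup>2 * absorb e k)"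

definition source :: "complex \<Rightarrow> (nat \<Rightarrow> complex) \<Rightarrow> nat \<Rightarrow> real" where
  "source z e j = 1 / real n * (\<Sum>i<n. (d i j)\<^sup>2 / (cmod (D z e i))\<^sup>2)"

definition upper :: "(nat \<Rightarrow> complex) \<Rightarrow> bool" where
  "upper e \<longleftrightarrow> (\<forall>k<N. nzcol k \<longrightarrow> 0 \<le> Im (e k))"

lemma c_pos: "c > 0" using n_pos N_pos by (simp add: c_def)

lemma of_real_c: "complex_of_real c = of_nat n / of_nat N" by (simp add: c_def)

lemma D_eq: "D z e i = 1 / of_nat N * (\<Sum>k<N. of_real ((d i k)\<^sup>2) / (1 + of_real c * e k)) - z"
  by (simp add: resolvent_denom_def of_real_c)

lemma absorb_nonneg: "upper e \<Longrightarrow> k < N \<Longrightarrow> nzcol k \<Longrightarrow> 0 \<le> absorb e k"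
  using c_pos by (auto simp: absorb_def upper_def)

lemma weighted_absorb_nonneg: "upper e \<Longrightarrow> i < n \<Longrightarrow> k < N \<Longrightarrow> 0 \<le> 1 / real N * (d i k)\<^sup>2 * absorb e k"
proof (cases "d i k = 0")
  case False
  assume "upper e" "i < n" "k < N"
  moreover from this False have "nzcol k" by (auto simp: nzcol_def)
  ultimately have "0 \<le> absorb e k" by (intro absorb_nonneg)
  then show ?thesis by (intro mult_nonneg_nonneg) auto
qed simp

lemma flow_nonneg: "upper e \<Longrightarrow> i < n \<Longrightarrow> k < N \<Longrightarrow> 0 \<le> flow z e j i k"
  unfolding flow_def by (intro mult_nonneg_nonneg[OF _ weighted_absorb_nonneg]) auto

lemma Im_D: "Im (D z e i) = - Im z - (\<Sum>k<N. 1 / real N * (d i k)\<^sup>2 * absorb e k)"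
proof -
  have "Im (D z e i) = 1 / real N * (\<Sum>k<N. Im (of_real ((d i k)\<^sup>2) / (1 + of_real c * e k))) - Im z"
    unfolding D_eq minus_complex.sel Im_inverse_nat_mult Im_sum ..
  also have "\<dots> = - Im z - (\<Sum>k<N. 1 / real N * (d i k)\<^sup>2 * absorb e k)"
    unfolding Im_of_real_divide absorb_def by (simp add: sum_distrib_left sum_negf mult_ac)
  finally show ?thesis .
qed

lemma Im_D_le: "upper e \<Longrightarrow> i < n \<Longrightarrow> Im (D z e i) \<le> - Im z"
  unfolding Im_D using sum_nonneg[of "{..<N}" "\<lambda>k. 1 / real N * (d i k)\<^sup>2 * absorb e k"]
    weighted_absorb_nonneg[of e i] by simp

lemma cmod_D_ge: "upper e \<Longrightarrow> i < n \<Longrightarrow> Im z > 0 \<Longrightarrow> Im z \<le> cmod (D z e i)"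
  using Im_D_le[of e i z] abs_Im_le_cmod[of "D z e i"] by linarith

lemma Im_sys:
  "Im (sys z e j) = (\<Sum>i<n. \<Sum>k<N. flow z e j i k) + Im z * source z e j"
proof -
  have "Im (sys z e j) = 1 / real n * (\<Sum>i<n. Im (of_real ((d i j)\<^sup>2) / D z e i))"
    unfolding sys_def Im_inverse_nat_mult Im_sum ..
  also have "\<dots> = (\<Sum>i<n. 1 / real n * (d i j)\<^sup>2 / (cmod (D z e i))\<^sup>2 * (Im z + (\<Sum>k<N. 1 / real N * (d i k)\<^sup>2 * absorb e k)))"
  proof -
    have alg: "- (a * (- y - S) / C) = a / C * (y + S)" for a y S C :: real
    proof -
      have "a * (- y - S) = - (a * (y + S))" by (simp add: algebra_simps)
      then show ?thesis by simp
    qed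
    show ?thesis unfolding Im_of_real_divide Im_D alg sum_distrib_left[of "1 / n"] by (simp add: mult.assoc)
  qed
  also have "\<dots> = (\<Sum>i<n. (\<Sum>k<N. flow z e j i k) + Im z * (1 / real n * (d i j)\<^sup>2 / (cmod (D z e i))\<^sup>2))"
  proof -
    have alg: "q * (y + S) = q * S + y * q" for q y S :: real by (simp add: algebra_simps)
    show ?thesis unfolding alg flow_def sum_distrib_left ..
  qed
  also have "\<dots> = (\<Sum>i<n. \<Sum>k<N. flow z e j i k) + Im z * source z e j"
    by (simp only: sum.distrib source_def sum_distrib_left times_divide_eq_right)
  finally show ?thesis .
qed

lemma source_pos:
  assumes "upper e" "Im z > 0" "nzcol j"
  shows "0 < source z e j"
proof -
  obtain i where i: "i < n" "d i j \<noteq> 0" using assms(3) by (auto simp: nzcol_def)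
  have "cmod (D z e i) > 0" using cmod_D_ge[OF assms(1) i(1) assms(2)] assms(2) by linarith
  then have "0 < (d i j)\<^sup>2 / (cmod (D z e i))\<^sup>2" using i by simp
  also have "\<dots> \<le> (\<Sum>i<n. (d i j)\<^sup>2 / (cmod (D z e i))\<^sup>2)"
    by (rule member_le_sum) (use i in auto)
  finally show ?thesis using n_pos by (simp add: source_def)
qed

lemma sum_flow_nonneg: "upper e \<Longrightarrow> 0 \<le> (\<Sum>i<n. \<Sum>k<N. flow z e j i k)"
  by (intro sum_nonneg flow_nonneg) auto

lemma Im_sys_pos: "upper e \<Longrightarrow> Im z > 0 \<Longrightarrow> nzcol j \<Longrightarrow> 0 < Im (sys z e j)"
  unfolding Im_sys using sum_flow_nonneg[of e z j] source_pos[of e z j] by (simp add: add_nonneg_pos)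

lemma sys_diff_le:
  assumes e: "upper e" "upper e'" and z: "Im z > 0"
    and nz: "\<forall>k<N. nzcol k \<longrightarrow> 1 + of_real c * e k \<noteq> 0 \<and> 1 + of_real c * e' k \<noteq> 0"
  shows "cmod (sys z e j - sys z e' j) \<le> (\<Sum>i<n. \<Sum>k<N. 1 / real n * (d i j)\<^sup>2 * (1 / real N * (d i k)\<^sup>2) * (c * cmod (e k - e' k))
      / (cmod (D z e i) * cmod (D z e' i) * (cmod (1 + of_real c * e k) * cmod (1 + of_real c * e' k))))"
proof -
  have D0: "D z e i \<noteq> 0" "D z e' i \<noteq> 0" if "i < n" for i
    using cmod_D_ge[OF e(1) that z] cmod_D_ge[OF e(2) that z] z by auto
  have Dd: "D z e' i - D z e i = (\<Sum>k<N. of_real (1 / real N * (d i k)\<^sup>2) * (of_real c * (e k - e' k))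
      / ((1 + of_real c * e k) * (1 + of_real c * e' k)))" if "i < n" for i
  proof -
    have "D z e' i - D z e i = (\<Sum>k<N. 1 / of_nat N * (of_real ((d i k)\<^sup>2) / (1 + of_real c * e' k) - of_real ((d i k)\<^sup>2) / (1 + of_real c * e k)))"
      unfolding D_eq by (simp add: sum_subtractf sum_distrib_left right_diff_distrib)
    also have "\<dots> = (\<Sum>k<N. of_real (1 / real N * (d i k)\<^sup>2) * (of_real c * (e k - e' k))
      / ((1 + of_real c * e k) * (1 + of_real c * e' k)))"
    proof (intro sum.cong refl)
      fix k assume k: "k \<in> {..<N}"
      show "1 / of_nat N * (of_real ((d i k)\<^sup>2) / (1 + of_real c * e' k) - of_real ((d i k)\<^sup>2) / (1 + of_real c * e k))
        = of_real (1 / real N * (d i k)\<^sup>2) * (of_real c * (e k - e' k)) / ((1 + of_real c * e k) * (1 + of_real c * e' k))"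
      proof (cases "d i k = 0")
        case False
        then have "nzcol k" using that by (auto simp: nzcol_def)
        then have "1 + of_real c * e k \<noteq> 0" "1 + of_real c * e' k \<noteq> 0" using nz k by auto
        then show ?thesis using N_pos by (simp add: divide_simps) (simp add: algebra_simps)
      qed simp
    qed
    finally show ?thesis .
  qed
  have eq: "sys z e j - sys z e' j = (\<Sum>i<n. of_real (1 / real n * (d i j)\<^sup>2) * (D z e' i - D z e i) / (D z e i * D z e' i))"
  proof -
    have "sys z e j - sys z e' j = (\<Sum>i<n. 1 / of_nat n * (of_real ((d i j)\<^sup>2) / D z e i - of_real ((d i j)\<^sup>2) / D z e' i))"
      by (simp add: sys_def sum_subtractf sum_distrib_left right_diff_distrib)
    also have "\<dots> = (\<Sum>i<n. of_real (1 / real n * (d i j)\<^sup>2) * (D z e' i - D z e i) / (D z e i * D z e' i))"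
      using D0 n_pos by (intro sum.cong refl) (simp add: diff_frac_eq right_diff_distrib)
    finally show ?thesis .
  qed
  have "cmod (sys z e j - sys z e' j) \<le> (\<Sum>i<n. cmod (of_real (1 / real n * (d i j)\<^sup>2) * (D z e' i - D z e i) / (D z e i * D z e' i)))"
    unfolding eq by (rule norm_sum)
  also have "\<dots> \<le> (\<Sum>i<n. \<Sum>k<N. 1 / real n * (d i j)\<^sup>2 * (1 / real N * (d i k)\<^sup>2) * (c * cmod (e k - e' k))
      / (cmod (D z e i) * cmod (D z e' i) * (cmod (1 + of_real c * e k) * cmod (1 + of_real c * e' k))))"
  proof (rule sum_mono)
    fix i assume i: "i \<in> {..<n}"
    have nn: "0 \<le> 1 / real n * (d i j)\<^sup>2" "0 \<le> 1 / real N * (d i k)\<^sup>2" for k by simp_all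
    have "cmod (of_real (1 / real n * (d i j)\<^sup>2) * (D z e' i - D z e i) / (D z e i * D z e' i))
        = 1 / real n * (d i j)\<^sup>2 / (cmod (D z e i) * cmod (D z e' i)) * cmod (D z e' i - D z e i)"
      by (rule cmod_real_mult_divide[OF nn(1)])
    also have "\<dots> \<le> 1 / real n * (d i j)\<^sup>2 / (cmod (D z e i) * cmod (D z e' i)) *
        (\<Sum>k<N. cmod (of_real (1 / real N * (d i k)\<^sup>2) * (of_real c * (e k - e' k)) / ((1 + of_real c * e k) * (1 + of_real c * e' k))))"
      unfolding Dd[OF i[unfolded lessThan_iff]] by (intro mult_left_mono norm_sum) auto
    also have "\<dots> = (\<Sum>k<N. 1 / real n * (d i j)\<^sup>2 * (1 / real N * (d i k)\<^sup>2) * (c * cmod (e k - e' k))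
      / (cmod (D z e i) * cmod (D z e' i) * (cmod (1 + of_real c * e k) * cmod (1 + of_real c * e' k))))"
    proof -
      have alg: "p / ab * (q / ab' * x) = p * q * x / (ab * ab')" for p q x ab ab' :: real by simp
      have cc: "cmod (of_real c * (e k - e' k)) = c * cmod (e k - e' k)" for k
        using c_pos by (simp add: norm_mult)
      show ?thesis unfolding sum_distrib_left cmod_real_mult_divide[OF nn(2)] cc
        by (intro sum.cong refl alg)
    qed
    finally show "cmod (of_real (1 / real n * (d i j)\<^sup>2) * (D z e' i - D z e i) / (D z e i * D z e' i))
      \<le> (\<Sum>k<N. 1 / real n * (d i j)\<^sup>2 * (1 / real N * (d i k)\<^sup>2) * (c * cmod (e k - e' k))
      / (cmod (D z e i) * cmod (D z e' i) * (cmod (1 + of_real c * e k) * cmod (1 + of_real c * e' k))))" .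
  qed
  finally show ?thesis .
qed

lemma nz_of_Im_nonneg: "0 \<le> Im w \<Longrightarrow> 0 < Im w \<or> w = 0 \<Longrightarrow> 1 + of_real c * w \<noteq> 0"
  using c_pos by (auto simp: complex_eq_iff)

text \<open>The quantity \<open>cmod (u - u') / sqrt (Im u * Im u')\<close> is a form of hyperbolic distance in the upper half plane. Each
  summand of the difference is at most \<open>K\<close> times the geometric mean of the flows of \<open>e\<close> and \<open>e'\<close>, and the Cauchy--Schwarz inequality
  collects them.\<close>

lemma sys_hyperbolic_contraction:
  assumes e: "\<forall>k<N. nzcol k \<longrightarrow> 0 < Im (e k)" and e': "\<forall>k<N. nzcol k \<longrightarrow> 0 < Im (e' k)" and z: "Im z > 0"
    and K: "0 \<le> K" "\<forall>k<N. nzcol k \<longrightarrow> cmod (e k - e' k) \<le> K * sqrt (Im (e k) * Im (e' k))"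
  shows "cmod (sys z e j - sys z e' j)
    \<le> K * (sqrt (\<Sum>i<n. \<Sum>k<N. flow z e j i k) * sqrt (\<Sum>i<n. \<Sum>k<N. flow z e' j i k))"
proof -
  have up: "upper e" "upper e'" using e e' by (auto simp: upper_def less_imp_le)
  have nz: "\<forall>k<N. nzcol k \<longrightarrow> 1 + of_real c * e k \<noteq> 0 \<and> 1 + of_real c * e' k \<noteq> 0"
    using e e' nz_of_Im_nonneg by (metis less_imp_le)
  have "cmod (sys z e j - sys z e' j) \<le> (\<Sum>i<n. \<Sum>k<N. 1 / real n * (d i j)\<^sup>2 * (1 / real N * (d i k)\<^sup>2) * (c * cmod (e k - e' k))
      / (cmod (D z e i) * cmod (D z e' i) * (cmod (1 + of_real c * e k) * cmod (1 + of_real c * e' k))))"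
    by (rule sys_diff_le[OF up z nz])
  also have "\<dots> \<le> (\<Sum>i<n. \<Sum>k<N. K * (sqrt (flow z e j i k) * sqrt (flow z e' j i k)))"
  proof (intro sum_mono)
    fix i k assume ik: "i \<in> {..<n}" "k \<in> {..<N}"
    show "1 / real n * (d i j)\<^sup>2 * (1 / real N * (d i k)\<^sup>2) * (c * cmod (e k - e' k))
      / (cmod (D z e i) * cmod (D z e' i) * (cmod (1 + of_real c * e k) * cmod (1 + of_real c * e' k)))
      \<le> K * (sqrt (flow z e j i k) * sqrt (flow z e' j i k))"
    proof (cases "d i k = 0")
      case True
      then show ?thesis by (simp add: flow_def)
    next
      case False
      then have "nzcol k" using ik by (auto simp: nzcol_def)
      then have kk: "cmod (e k - e' k) \<le> K * sqrt (Im (e k) * Im (e' k))" using K ik by auto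
      define P where "P = 1 / real n * (d i j)\<^sup>2 * (1 / real N * (d i k)\<^sup>2) * c"
      define Q where "Q = cmod (D z e i) * cmod (1 + of_real c * e k)"
      define Q' where "Q' = cmod (D z e' i) * cmod (1 + of_real c * e' k)"
      have P: "P \<ge> 0" "Q \<ge> 0" "Q' \<ge> 0" using c_pos by (auto simp: P_def Q_def Q'_def)
      have f: "flow z e j i k = P * Im (e k) / Q\<^sup>2" "flow z e' j i k = P * Im (e' k) / Q'\<^sup>2"
        by (simp_all add: flow_def absorb_def P_def Q_def Q'_def power_mult_distrib mult_ac)
      have s: "sqrt (flow z e j i k) * sqrt (flow z e' j i k) = P * sqrt (Im (e k) * Im (e' k)) / (Q * Q')"
        unfolding f using P by (simp add: real_sqrt_divide real_sqrt_mult mult_ac power2_eq_square[symmetric])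
      have "1 / real n * (d i j)\<^sup>2 * (1 / real N * (d i k)\<^sup>2) * (c * cmod (e k - e' k))
        / (cmod (D z e i) * cmod (D z e' i) * (cmod (1 + of_real c * e k) * cmod (1 + of_real c * e' k)))
        = P * cmod (e k - e' k) / (Q * Q')"
        by (simp add: P_def Q_def Q'_def mult_ac)
      also have "\<dots> \<le> P * (K * sqrt (Im (e k) * Im (e' k))) / (Q * Q')"
        using kk P by (intro divide_right_mono mult_left_mono) auto
      finally show ?thesis unfolding s by (simp add: mult_ac)
    qed
  qed
  also have "\<dots> = K * (\<Sum>(i, k)\<in>{..<n} \<times> {..<N}. sqrt (flow z e j i k) * sqrt (flow z e' j i k))"
    by (simp add: sum.cartesian_product sum_distrib_left split_def)
  also have "\<dots> \<le> K * (sqrt (\<Sum>(i, k)\<in>{..<n} \<times> {..<N}. flow z e j i k) * sqrt (\<Sum>(i, k)\<in>{..<n} \<times> {..<N}. flow z e' j i k))"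
    using Cauchy_Schwarz_sqrt_sum[of "{..<n} \<times> {..<N}" "\<lambda>(i, k). flow z e j i k" "\<lambda>(i, k). flow z e' j i k"] K
      flow_nonneg[OF up(1)] flow_nonneg[OF up(2)]
    by (intro mult_left_mono) (auto simp: split_def)
  finally show ?thesis by (simp add: sum.cartesian_product)
qed

text \<open>At an index \<open>m\<close> where the hyperbolic distance of \<open>e\<close> and \<open>e'\<close> is maximal, applying \<open>sys\<close> would strictly
  decrease it, because the flow into \<open>m\<close> is smaller than \<open>Im (e m)\<close> by the source.\<close>

lemma fixed_point_unique:
  assumes e: "\<forall>k<N. nzcol k \<longrightarrow> 0 < Im (e k)" and e': "\<forall>k<N. nzcol k \<longrightarrow> 0 < Im (e' k)" and z: "Im z > 0"
    and fp: "\<forall>j<N. e j = sys z e j" and fp': "\<forall>j<N. e' j = sys z e' j"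
  shows "\<forall>j<N. e j = e' j"
proof -
  define S where "S = {k. k < N \<and> nzcol k}"
  define \<rho> where "\<rho> k = cmod (e k - e' k) / sqrt (Im (e k) * Im (e' k))" for k
  have fin: "finite S" by (simp add: S_def)
  have zero: "e j = e' j" if "j < N" "\<not> nzcol j" for j
  proof -
    have "sys z e j = 0" "sys z e' j = 0" using that(2) by (auto simp: sys_def nzcol_def)
    then show ?thesis using fp fp' that by simp
  qed
  have "e j = e' j" if j: "j \<in> S" for j
  proof (rule ccontr)
    assume ne: "e j \<noteq> e' j"
    define K where "K = Max (\<rho> ` S)"
    have "K \<in> \<rho> ` S" unfolding K_def using fin j by (intro Max_in) auto
    then obtain m where m: "m \<in> S" "\<rho> m = K" by blast
    have le: "\<rho> k \<le> K" if "k \<in> S" for k using that fin by (auto simp: K_def)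
    have pos: "0 < sqrt (Im (e k) * Im (e' k))" if "k \<in> S" for k using that e e' by (auto simp: S_def)
    have "\<rho> j > 0" using ne pos[OF j] by (simp add: \<rho>_def)
    then have K: "K > 0" using le[OF j] by linarith
    have Kle: "\<forall>k<N. nzcol k \<longrightarrow> cmod (e k - e' k) \<le> K * sqrt (Im (e k) * Im (e' k))"
      using le pos by (auto simp: \<rho>_def S_def pos_divide_le_eq)
    have up: "upper e" "upper e'" using e e' by (auto simp: upper_def less_imp_le)
    have mN: "m < N" "nzcol m" using m by (auto simp: S_def)
    define a a' where "a = (\<Sum>i<n. \<Sum>k<N. flow z e m i k)" and "a' = (\<Sum>i<n. \<Sum>k<N. flow z e' m i k)"
    have a: "0 \<le> a" "0 \<le> a'" unfolding a_def a'_def using flow_nonneg up by (auto intro!: sum_nonneg)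
    have "Im (e m) = Im (sys z e m)" "Im (e' m) = Im (sys z e' m)" using fp fp' mN by auto
    then have lt: "a < Im (e m)" "a' < Im (e' m)"
      using source_pos[OF up(1) z mN(2)] source_pos[OF up(2) z mN(2)] z
      unfolding Im_sys a_def a'_def by simp_all
    have sne: "sqrt (Im (e m) * Im (e' m)) \<noteq> 0" using pos[OF m(1)] by linarith
    have "cmod (e m - e' m) = K * sqrt (Im (e m) * Im (e' m))"
      using m(2) unfolding \<rho>_def nonzero_divide_eq_eq[OF sne] .
    then have "K * sqrt (Im (e m) * Im (e' m)) = cmod (e m - e' m)" by (rule sym)
    also have "\<dots> = cmod (sys z e m - sys z e' m)" using fp fp' mN by auto
    also have "\<dots> \<le> K * (sqrt a * sqrt a')"
      unfolding a_def a'_def using sys_hyperbolic_contraction[OF e e' z _ Kle] K by simp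
    also have "\<dots> < K * sqrt (Im (e m) * Im (e' m))"
    proof -
      have "a * a' < Im (e m) * Im (e' m)" using lt a by (intro mult_strict_mono') auto
      then show ?thesis using K by (simp flip: real_sqrt_mult)
    qed
    finally show False by simp
  qed
  then show ?thesis using zero by (auto simp: S_def)
qed

text \<open>Values of Stieltjes transforms of measures on the nonnegative half line satisfy both conditions; the second
  one keeps \<open>1 + c * e k\<close> away from zero, uniformly in \<open>e\<close>.\<close>

definition cone :: "complex \<Rightarrow> (nat \<Rightarrow> complex) \<Rightarrow> bool" where
  "cone z e \<longleftrightarrow> (\<forall>k<N. (nzcol k \<longrightarrow> 0 < Im (e k)) \<and> 0 \<le> Im (z * e k))"

lemma upper_cone: "cone z e \<Longrightarrow> upper e"
  by (auto simp: cone_def upper_def less_imp_le)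

lemma cmod_one_plus_ge:
  assumes "Im z > 0" "0 \<le> Im (z * w)"
  shows "Im z / cmod z \<le> cmod (1 + of_real c * w)"
proof -
  have "z \<noteq> 0" using assms(1) by auto
  then have z: "cmod z > 0" by simp
  have "z * (1 + of_real c * w) = z + of_real c * (z * w)" by (simp add: algebra_simps)
  then have "Im (z * (1 + of_real c * w)) = Im z + c * Im (z * w)" by simp
  then have "Im z \<le> Im (z * (1 + of_real c * w))" using assms c_pos by simp
  also have "\<dots> \<le> cmod z * cmod (1 + of_real c * w)"
    using abs_Im_le_cmod[of "z * (1 + of_real c * w)"] by (simp add: norm_mult)
  finally show ?thesis using z by (simp add: pos_divide_le_eq mult.commute)
qed

lemma one_plus_nonzero: "Im z > 0 \<Longrightarrow> 0 \<le> Im (z * w) \<Longrightarrow> 1 + of_real c * w \<noteq> 0"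
  using cmod_one_plus_ge[of z w] by (auto simp: divide_le_0_iff)

lemma Im_mult_cnj_divide: "Im (z * cnj (of_real a / u)) = a * Im (z * u) / (cmod u)\<^sup>2"
proof -
  have "cnj (of_real a / u) = of_real a * u / of_real ((cmod u)\<^sup>2)"
    by (cases "u = 0") (simp_all add: field_simps complex_norm_square del: of_real_power)
  then have "z * cnj (of_real a / u) = of_real (a / (cmod u)\<^sup>2) * (z * u)" by simp
  then have "Im (z * cnj (of_real a / u)) = Im (of_real (a / (cmod u)\<^sup>2) * (z * u))" by (simp only:)
  also have "\<dots> = a / (cmod u)\<^sup>2 * Im (z * u)" by (simp only: Im_of_real_mult)
  finally show ?thesis by simp
qed

lemma Im_z_div_D_nonneg:
  assumes "Im z > 0" "\<forall>k<N. 0 \<le> Im (z * e k)"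
  shows "0 \<le> Im (z / D z e i)"
proof -
  have "z * cnj (D z e i) = 1 / of_nat N * (\<Sum>k<N. z * cnj (of_real ((d i k)\<^sup>2) / (1 + of_real c * e k))) - z * cnj z"
    unfolding D_eq by (simp add: right_diff_distrib sum_distrib_left mult_ac)
  then have "Im (z * cnj (D z e i)) = 1 / real N * (\<Sum>k<N. Im (z * cnj (of_real ((d i k)\<^sup>2) / (1 + of_real c * e k))))"
    by (simp only: minus_complex.sel Im_inverse_nat_mult Im_sum) simp
  also have "\<dots> = 1 / real N * (\<Sum>k<N. (d i k)\<^sup>2 * Im (z * (1 + of_real c * e k)) / (cmod (1 + of_real c * e k))\<^sup>2)"
    by (simp only: Im_mult_cnj_divide)
  also have "\<dots> \<ge> 0"
  proof (intro mult_nonneg_nonneg sum_nonneg divide_nonneg_nonneg)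
    fix k assume "k \<in> {..<N}"
    then have "0 \<le> c * Im (z * e k)" using assms c_pos by auto
    moreover have "z * (1 + of_real c * e k) = z + of_real c * (z * e k)" by (simp add: algebra_simps)
    then have "Im (z * (1 + of_real c * e k)) = Im z + c * Im (z * e k)" by simp
    ultimately show "0 \<le> Im (z * (1 + of_real c * e k))" using assms(1) by simp
  qed auto
  finally have "0 \<le> Im (z * cnj (D z e i))" .
  then show ?thesis by (simp add: complex_div_cnj[of z] divide_nonneg_nonneg flip: of_real_power)
qed

lemma Im_z_sys_nonneg:
  assumes "Im z > 0" "\<forall>k<N. 0 \<le> Im (z * e k)"
  shows "0 \<le> Im (z * sys z e j)"
proof -
  have "z * sys z e j = 1 / of_nat n * (\<Sum>i<n. of_real ((d i j)\<^sup>2) * (z / D z e i))"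
    by (simp add: sys_def sum_distrib_left mult_ac)
  then have "Im (z * sys z e j) = 1 / real n * (\<Sum>i<n. (d i j)\<^sup>2 * Im (z / D z e i))"
    by (simp only: Im_inverse_nat_mult Im_sum Im_of_real_mult)
  also have "\<dots> \<ge> 0"
    using Im_z_div_D_nonneg[OF assms] by (intro mult_nonneg_nonneg sum_nonneg) auto
  finally show ?thesis .
qed

lemma cone_sys: "Im z > 0 \<Longrightarrow> cone z e \<Longrightarrow> cone z (sys z e)"
  using Im_sys_pos[OF upper_cone] Im_z_sys_nonneg[of z e] by (auto simp: cone_def)

lemma cmod_sys_le:
  assumes "upper e" "Im z > 0"
  shows "cmod (sys z e j) \<le> 1 / real n * (\<Sum>i<n. (d i j)\<^sup>2 / Im z)"
proof -
  have "cmod (sys z e j) = 1 / real n * cmod (\<Sum>i<n. of_real ((d i j)\<^sup>2) / D z e i)"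
    by (simp add: sys_def norm_mult norm_divide)
  also have "\<dots> \<le> 1 / real n * (\<Sum>i<n. (d i j)\<^sup>2 / Im z)"
  proof (intro mult_left_mono order_trans[OF norm_sum] sum_mono)
    fix i assume "i \<in> {..<n}"
    then have "Im z \<le> cmod (D z e i)" using cmod_D_ge[OF assms(1) _ assms(2)] by auto
    then show "cmod (of_real ((d i j)\<^sup>2) / D z e i) \<le> (d i j)\<^sup>2 / Im z"
      unfolding norm_divide norm_of_real abs_power2 using assms(2) by (intro frac_le) auto
  qed auto
  finally show ?thesis .
qed

text \<open>\<open>total z\<close> bounds the absorption in a row for every \<open>e\<close> in the cone, so that \<open>rate z\<close> bounds the fraction of
  \<open>Im (sys z e j)\<close> that is flow: a uniform contraction factor.\<close>

definition total :: "complex \<Rightarrow> real" where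
  "total z = (\<Sum>i<n. \<Sum>k<N. 1 / real N * (d i k)\<^sup>2) * (cmod z / Im z)"

definition rate :: "complex \<Rightarrow> real" where "rate z = total z / (total z + Im z)"

lemma rate_bounds:
  assumes "Im z > 0"
  shows "0 \<le> total z" "0 \<le> rate z" "rate z < 1"
proof -
  show t: "0 \<le> total z" using assms by (auto simp: total_def intro!: mult_nonneg_nonneg sum_nonneg divide_nonneg_nonneg)
  then show "0 \<le> rate z" "rate z < 1" using assms by (auto simp: rate_def)
qed

lemma absorbed_le_total:
  assumes z: "Im z > 0" and e: "cone z e" and i: "i < n"
  shows "(\<Sum>k<N. 1 / real N * (d i k)\<^sup>2 * absorb e k) \<le> total z"
proof -
  have "(\<Sum>k<N. 1 / real N * (d i k)\<^sup>2 * absorb e k) \<le> (\<Sum>k<N. 1 / real N * (d i k)\<^sup>2 * (cmod z / Im z))"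
  proof (intro sum_mono mult_left_mono)
    fix k assume k: "k \<in> {..<N}"
    let ?u = "1 + of_real c * e k"
    have ge: "Im z / cmod z \<le> cmod ?u" using e k by (intro cmod_one_plus_ge[OF z]) (auto simp: cone_def)
    have "z \<noteq> 0" using z by auto
    then have "0 < Im z / cmod z" using z by simp
    then have pos: "0 < cmod ?u" using ge by linarith
    have "c * Im (e k) \<le> cmod ?u" using abs_Im_le_cmod[of ?u] by simp
    then have "absorb e k \<le> cmod ?u / (cmod ?u)\<^sup>2" unfolding absorb_def by (intro divide_right_mono) auto
    also have "\<dots> = 1 / cmod ?u" using pos by (simp add: power2_eq_square)
    also have "\<dots> \<le> 1 / (Im z / cmod z)" by (rule frac_le[OF _ _ \<open>0 < Im z / cmod z\<close> ge]) simp_all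
    finally show "absorb e k \<le> cmod z / Im z" by simp
  qed auto
  also have "\<dots> = (\<Sum>k<N. 1 / real N * (d i k)\<^sup>2) * (cmod z / Im z)" by (rule sum_distrib_right[symmetric])
  also have "\<dots> \<le> total z"
    unfolding total_def using i z
    by (intro mult_right_mono member_le_sum[of i "{..<n}" "\<lambda>i. \<Sum>k<N. 1 / real N * (d i k)\<^sup>2"]) (auto intro!: sum_nonneg divide_nonneg_nonneg)
  finally show ?thesis .
qed

lemma flow_le_rate:
  assumes z: "Im z > 0" and e: "cone z e"
  shows "(\<Sum>i<n. \<Sum>k<N. flow z e j i k) \<le> rate z * Im (sys z e j)"
proof -
  define w where "w i = 1 / real n * (d i j)\<^sup>2 / (cmod (D z e i))\<^sup>2" for i
  define S where "S i = (\<Sum>k<N. 1 / real N * (d i k)\<^sup>2 * absorb e k)" for i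
  have f: "(\<Sum>k<N. flow z e j i k) = w i * S i" for i by (simp only: flow_def w_def S_def sum_distrib_left)
  have src: "source z e j = (\<Sum>i<n. w i)" by (simp add: source_def w_def sum_distrib_left)
  note t = rate_bounds[OF z]
  have "S i \<le> rate z * (S i + Im z)" if "i < n" for i
  proof -
    have "S i \<le> total z" unfolding S_def by (rule absorbed_le_total[OF z e that])
    then have "S i * (total z + Im z) \<le> total z * (S i + Im z)" using z by (simp add: algebra_simps)
    then show ?thesis using t(1) z by (simp add: rate_def pos_le_divide_eq)
  qed
  then have "(\<Sum>i<n. w i * S i) \<le> (\<Sum>i<n. w i * (rate z * (S i + Im z)))"
    by (intro sum_mono mult_left_mono) (auto simp: w_def)
  also have "\<dots> = rate z * Im (sys z e j)"
    unfolding Im_sys f src by (simp add: sum_distrib_left sum.distrib algebra_simps)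
  finally show ?thesis unfolding f .
qed

text \<open>The starting point arises when \<open>- 1 / z\<close>, the transform of the point mass at \<open>0\<close>, is put in place of all
  \<open>1 / D z e i\<close>. With this choice every \<open>1 / D z (iter z m) i\<close> is a Stieltjes transform.\<close>

definition iter :: "complex \<Rightarrow> nat \<Rightarrow> nat \<Rightarrow> complex" where
  "iter z m = (sys z ^^ m) (\<lambda>k. 1 / of_nat n * (\<Sum>i<n. of_real ((d i k)\<^sup>2) / (- z)))"

lemma iter_0: "iter z 0 k = 1 / of_nat n * (\<Sum>i<n. of_real ((d i k)\<^sup>2) / (- z))"
  by (simp add: iter_def)

lemma iter_Suc: "iter z (Suc m) = sys z (iter z m)"
  by (simp add: iter_def)

lemma cone_iter:
  assumes z: "Im z > 0"
  shows "cone z (iter z m)"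
proof (induction m)
  case 0
  have "z \<noteq> 0" using z by auto
  then have zz: "cmod z > 0" by simp
  have im: "Im (iter z 0 k) = 1 / real n * (\<Sum>i<n. (d i k)\<^sup>2 * Im z / (cmod z)\<^sup>2)" for k
    unfolding iter_0 Im_inverse_nat_mult Im_sum Im_of_real_divide by simp
  have "0 < Im (iter z 0 k)" if "nzcol k" for k
  proof -
    obtain i where i: "i < n" "d i k \<noteq> 0" using \<open>nzcol k\<close> by (auto simp: nzcol_def)
    have "0 < (d i k)\<^sup>2 * Im z / (cmod z)\<^sup>2" using i z zz by simp
    also have "\<dots> \<le> (\<Sum>i<n. (d i k)\<^sup>2 * Im z / (cmod z)\<^sup>2)"
      by (rule member_le_sum) (use i z in auto)
    finally show ?thesis unfolding im using n_pos by simp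
  qed
  moreover have "z * iter z 0 k = of_real (- (1 / real n * (\<Sum>i<n. (d i k)\<^sup>2)))" for k
    unfolding iter_0 using \<open>z \<noteq> 0\<close> by (simp add: sum_distrib_left sum_negf sum_divide_distrib mult_ac)
  then have "Im (z * iter z 0 k) = 0" for k by (simp only: Im_complex_of_real)
  ultimately show ?case by (simp add: cone_def)
next
  case (Suc m)
  then show ?case unfolding iter_Suc by (intro cone_sys z)
qed

lemma cmod_iter_le:
  assumes z: "Im z > 0"
  shows "cmod (iter z m j) \<le> 1 / real n * (\<Sum>i<n. (d i j)\<^sup>2 / Im z)"
proof (cases m)
  case 0
  have "cmod (iter z 0 j) = 1 / real n * cmod (\<Sum>i<n. of_real ((d i j)\<^sup>2) / (- z))"
    by (simp only: iter_0 norm_mult norm_divide norm_one norm_of_nat)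
  also have "\<dots> \<le> 1 / real n * (\<Sum>i<n. (d i j)\<^sup>2 / Im z)"
  proof (intro mult_left_mono order_trans[OF norm_sum] sum_mono)
    fix i
    have "Im z \<le> cmod z" using abs_Im_le_cmod[of z] by linarith
    then show "cmod (of_real ((d i j)\<^sup>2) / (- z)) \<le> (d i j)\<^sup>2 / Im z"
      unfolding norm_divide norm_of_real abs_power2 norm_minus_cancel using z by (intro frac_le) auto
  qed auto
  finally show ?thesis using 0 by simp
next
  case (Suc m')
  then show ?thesis using cmod_sys_le[OF upper_cone[OF cone_iter[OF z]] z] by (simp add: iter_Suc)
qed

lemma iter_diff_le:
  assumes z: "Im z > 0"
  shows "\<exists>K\<ge>0. \<forall>m k. k < N \<longrightarrow> nzcol k \<longrightarrow>
    cmod (iter z (Suc m) k - iter z m k) \<le> K * rate z ^ m * sqrt (Im (iter z (Suc m) k) * Im (iter z m k))"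
proof -
  have pos: "0 < Im (iter z m k)" if "k < N" "nzcol k" for m k
    using cone_iter[OF z, of m] that by (auto simp: cone_def)
  define \<rho> where "\<rho> k = cmod (iter z 1 k - iter z 0 k) / sqrt (Im (iter z 1 k) * Im (iter z 0 k))" for k
  define K where "K = (\<Sum>k\<in>{k. k < N \<and> nzcol k}. \<rho> k)"
  have \<rho>0: "\<rho> k \<ge> 0" if "k < N" "nzcol k" for k
    unfolding \<rho>_def using pos[OF that, of 0] pos[OF that, of 1] by (intro divide_nonneg_nonneg) auto
  have K0: "K \<ge> 0" unfolding K_def using \<rho>0 by (intro sum_nonneg) auto
  have "\<forall>k<N. nzcol k \<longrightarrow>
    cmod (iter z (Suc m) k - iter z m k) \<le> K * rate z ^ m * sqrt (Im (iter z (Suc m) k) * Im (iter z m k))" for m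
  proof (induction m)
    case 0
    show ?case
    proof (intro allI impI)
      fix k assume k: "k < N" "nzcol k"
      have "0 < sqrt (Im (iter z 1 k) * Im (iter z 0 k))" using pos[OF k] by simp
      moreover have "\<rho> k \<le> K" unfolding K_def using k \<rho>0 by (intro member_le_sum) auto
      ultimately show "cmod (iter z (Suc 0) k - iter z 0 k) \<le> K * rate z ^ 0 * sqrt (Im (iter z (Suc 0) k) * Im (iter z 0 k))"
        by (simp add: \<rho>_def pos_divide_le_eq)
    qed
  next
    case (Suc m)
    show ?case
    proof (intro allI impI)
      fix k assume k: "k < N" "nzcol k"
      let ?e = "iter z (Suc m)" and ?e' = "iter z m"
      have Kp: "0 \<le> K * rate z ^ m" using K0 rate_bounds[OF z] by simp
      have "cmod (sys z ?e k - sys z ?e' k)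
        \<le> K * rate z ^ m * (sqrt (\<Sum>i<n. \<Sum>l<N. flow z ?e k i l) * sqrt (\<Sum>i<n. \<Sum>l<N. flow z ?e' k i l))"
        by (rule sys_hyperbolic_contraction[OF _ _ z Kp Suc]) (use pos in auto)
      also have "\<dots> \<le> K * rate z ^ m * (sqrt (rate z * Im (sys z ?e k)) * sqrt (rate z * Im (sys z ?e' k)))"
      proof -
        note le = flow_le_rate[OF z cone_iter[OF z]]
        have "0 \<le> rate z * Im (sys z (iter z m) k)" for m
          by (rule order_trans[OF sum_flow_nonneg[OF upper_cone[OF cone_iter[OF z]]] le])
        then show ?thesis
          by (intro mult_left_mono[OF _ Kp] mult_mono real_sqrt_le_mono le real_sqrt_ge_zero
              sum_flow_nonneg[OF upper_cone[OF cone_iter[OF z]]])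
      qed
      also have "\<dots> = K * rate z ^ Suc m * sqrt (Im (sys z ?e k) * Im (sys z ?e' k))"
        using rate_bounds(2)[OF z] by (simp add: real_sqrt_mult)
      finally show "cmod (iter z (Suc (Suc m)) k - iter z (Suc m) k)
        \<le> K * rate z ^ Suc m * sqrt (Im (iter z (Suc (Suc m)) k) * Im (iter z (Suc m) k))"
        by (simp only: iter_Suc)
    qed
  qed
  then show ?thesis using K0 by blast
qed

text \<open>Hyperbolic distances of successive iterates decay geometrically and the iterates are bounded, so
  they form a Cauchy sequence.\<close>

lemma iter_convergent:
  assumes z: "Im z > 0" and j: "j < N"
  shows "convergent (\<lambda>m. iter z m j)"
proof (cases "nzcol j")
  case False
  then have "iter z m j = 0" for m by (cases m) (auto simp: iter_0 iter_Suc sys_def nzcol_def)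
  then show ?thesis by (simp add: convergent_const)
next
  case True
  define R where "R = 1 / real n * (\<Sum>i<n. (d i j)\<^sup>2 / Im z)"
  from iter_diff_le[OF z] obtain K where K0: "K \<ge> 0"
    and K1: "\<forall>m k. k < N \<longrightarrow> nzcol k \<longrightarrow> cmod (iter z (Suc m) k - iter z m k)
      \<le> K * rate z ^ m * sqrt (Im (iter z (Suc m) k) * Im (iter z m k))"
    by (elim exE conjE)
  note K = K0 K1[rule_format, OF j True]
  have R: "\<bar>Im (iter z m j)\<bar> \<le> R" for m
    unfolding R_def by (rule order_trans[OF abs_Im_le_cmod cmod_iter_le[OF z]])
  have bound: "cmod (iter z (Suc m) j - iter z m j) \<le> K * R * rate z ^ m" for m
  proof -
    have "\<bar>Im (iter z (Suc m) j) * Im (iter z m j)\<bar> \<le> R * R"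
      unfolding abs_mult using R[of m] R[of "Suc m"] by (intro mult_mono) auto
    then have "sqrt (Im (iter z (Suc m) j) * Im (iter z m j)) \<le> sqrt (R * R)" by (intro real_sqrt_le_mono) simp
    also have "\<dots> = R" using R[of 0] by simp
    finally have "K * rate z ^ m * sqrt (Im (iter z (Suc m) j) * Im (iter z m j)) \<le> K * rate z ^ m * R"
      using K(1) rate_bounds[OF z] by (intro mult_left_mono) auto
    then show ?thesis using K(2)[of m] by (simp add: mult_ac)
  qed
  have "summable (\<lambda>m. K * R * rate z ^ m)"
    using rate_bounds[OF z] by (intro summable_mult summable_geometric) auto
  from summable_comparison_test'[OF this, of 0, OF bound]
  have "summable (\<lambda>m. iter z (Suc m) j - iter z m j)" .
  then have "(\<lambda>m. \<Sum>l<m. iter z (Suc l) j - iter z l j) \<longlonglongrightarrow> (\<Sum>m. iter z (Suc m) j - iter z m j)"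
    by (rule summable_LIMSEQ)
  then have "(\<lambda>m. iter z m j - iter z 0 j) \<longlonglongrightarrow> (\<Sum>m. iter z (Suc m) j - iter z m j)"
    unfolding sum_lessThan_telescope[of "\<lambda>m. iter z m j"] .
  from tendsto_add[OF this tendsto_const[of "iter z 0 j"]]
  have "(\<lambda>m. iter z m j) \<longlonglongrightarrow> (\<Sum>m. iter z (Suc m) j - iter z m j) + iter z 0 j"
    unfolding diff_add_cancel .
  then show ?thesis by (rule convergentI)
qed

lemma e0_solution_iff:
  "e0_solution n N d z e \<longleftrightarrow> e \<in> extensional {..<N} \<and> (\<forall>j<N. (nzcol j \<longrightarrow> 0 < Im (e j)) \<and> e j = sys z e j)"
  by (simp add: e0_solution_def nzcol_def sys_def)

lemma iter_tendsto_solution: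
  assumes z: "Im z > 0"
  shows "\<exists>e. e0_solution n N d z e \<and> cone z e \<and> (\<forall>k<N. (\<lambda>m. iter z m k) \<longlonglongrightarrow> e k)
    \<and> (\<forall>i<n. (\<lambda>m. 1 / D z (iter z m) i) \<longlonglongrightarrow> 1 / D z e i)"
proof -
  define e where "e = restrict (\<lambda>k. lim (\<lambda>m. iter z m k)) {..<N}"
  have lim: "(\<lambda>m. iter z m k) \<longlonglongrightarrow> e k" if "k < N" for k
    using iter_convergent[OF z that] that by (simp add: e_def convergent_LIMSEQ_iff)
  have imz: "0 \<le> Im (z * e k)" if "k < N" for k
  proof (rule tendsto_lowerbound)
    show "(\<lambda>m. Im (z * iter z m k)) \<longlonglongrightarrow> Im (z * e k)" by (intro tendsto_intros lim that)
    show "\<forall>\<^sub>F m in sequentially. 0 \<le> Im (z * iter z m k)"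
      using cone_iter[OF z] that by (intro always_eventually) (auto simp: cone_def)
  qed simp
  have up: "upper e"
    unfolding upper_def
  proof (intro allI impI)
    fix k assume k: "k < N" "nzcol k"
    show "0 \<le> Im (e k)"
    proof (rule tendsto_lowerbound)
      show "(\<lambda>m. Im (iter z m k)) \<longlonglongrightarrow> Im (e k)" by (intro tendsto_intros lim k)
      show "\<forall>\<^sub>F m in sequentially. 0 \<le> Im (iter z m k)"
        using upper_cone[OF cone_iter[OF z]] k by (intro always_eventually) (auto simp: upper_def)
    qed simp
  qed
  have D0: "D z e i \<noteq> 0" if "i < n" for i using cmod_D_ge[OF up that z] z by auto
  have Dlim: "(\<lambda>m. D z (iter z m) i) \<longlonglongrightarrow> D z e i" for i
    unfolding D_eq by (intro tendsto_intros lim one_plus_nonzero[OF z] imz) auto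
  have "(\<lambda>m. sys z (iter z m) j) \<longlonglongrightarrow> sys z e j" for j
    unfolding sys_def by (intro tendsto_intros Dlim D0) auto
  then have fp: "e j = sys z e j" if "j < N" for j
    using LIMSEQ_unique[OF LIMSEQ_Suc[OF lim[OF that]]] by (simp add: iter_Suc)
  have pos: "0 < Im (e j)" if "j < N" "nzcol j" for j
    using Im_sys_pos[OF up z that(2)] fp[OF that(1)] by simp
  have "e \<in> extensional {..<N}" by (simp add: e_def)
  moreover have "(\<lambda>m. 1 / D z (iter z m) i) \<longlonglongrightarrow> 1 / D z e i" if "i < n" for i
    by (intro tendsto_intros Dlim D0 that)
  ultimately show ?thesis using fp pos lim imz by (intro exI[of _ e]) (auto simp: e0_solution_iff cone_def)
qed

lemma e0_solution_unique:
  assumes z: "Im z > 0" and "e0_solution n N d z e" "e0_solution n N d z e'"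
  shows "e = e'"
proof (rule extensionalityI[of _ "{..<N}"])
  show "e \<in> extensional {..<N}" "e' \<in> extensional {..<N}" using assms by (auto simp: e0_solution_iff)
  have e: "\<forall>k<N. nzcol k \<longrightarrow> 0 < Im (e k)" "\<forall>j<N. e j = sys z e j"
    using assms(2) unfolding e0_solution_iff by blast+
  have e': "\<forall>k<N. nzcol k \<longrightarrow> 0 < Im (e' k)" "\<forall>j<N. e' j = sys z e' j"
    using assms(3) unfolding e0_solution_iff by blast+
  show "e k = e' k" if "k \<in> {..<N}" for k
    using fixed_point_unique[OF e(1) e'(1) z e(2) e'(2)] that by blast
qed

lemma ex1_e0_solution: "Im z > 0 \<Longrightarrow> \<exists>!e. e0_solution n N d z e"
  using iter_tendsto_solution e0_solution_unique by blast

lemma e0_properties: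
  assumes z: "Im z > 0"
  shows "e0_solution n N d z (e0 n N d z)" "cone z (e0 n N d z)"
    "i < n \<Longrightarrow> (\<lambda>m. 1 / D z (iter z m) i) \<longlonglongrightarrow> 1 / D z (e0 n N d z) i"
proof -
  obtain e where e: "e0_solution n N d z e" "cone z e" "\<forall>i<n. (\<lambda>m. 1 / D z (iter z m) i) \<longlonglongrightarrow> 1 / D z e i"
    using iter_tendsto_solution[OF z] by blast
  have "e0 n N d z = e" unfolding e0_def
    by (rule the_equality[of "e0_solution n N d z", OF e(1)]) (rule e0_solution_unique[OF z _ e(1)])
  then show "e0_solution n N d z (e0 n N d z)" "cone z (e0 n N d z)"
    "i < n \<Longrightarrow> (\<lambda>m. 1 / D z (iter z m) i) \<longlonglongrightarrow> 1 / D z (e0 n N d z) i" using e by auto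
qed

end

section \<open>The limiting distribution function\<close>

text \<open>Transforms of finitely supported probability measures on the half line with mean at most \<open>A\<close>. The class is closed
  under the iteration of the system, and the bound on the mean survives.\<close>

definition discrete_stieltjes :: "real \<Rightarrow> (complex \<Rightarrow> complex) \<Rightarrow> bool" where
  "discrete_stieltjes A g \<longleftrightarrow> (\<exists>L (p :: nat \<Rightarrow> real) (lam :: nat \<Rightarrow> real).
     (\<forall>a<L. 0 \<le> p a \<and> 0 \<le> lam a) \<and> (\<Sum>a<L. p a) = 1 \<and> (\<Sum>a<L. p a * lam a) \<le> A \<and>
     (\<forall>z. Im z > 0 \<longrightarrow> g z = (\<Sum>a<L. of_real (p a) / (of_real (lam a) - z))))"

lemma discrete_stieltjes_cong:
  "(\<And>z. Im z > 0 \<Longrightarrow> f z = g z) \<Longrightarrow> discrete_stieltjes A g \<Longrightarrow> discrete_stieltjes A f"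
  unfolding discrete_stieltjes_def by simp

lemma Im_kernel:
  "Im (of_real w / (of_real x - z)) = w * Im z / (cmod (of_real x - z))\<^sup>2"
  unfolding Im_of_real_divide by simp

lemma real_minus_complex_nonzero: "Im z > 0 \<Longrightarrow> complex_of_real x - z \<noteq> 0"
  by (auto simp: complex_eq_iff)

lemma one_plus_kernel_sum_nonzero:
  assumes J: "finite J" and w: "\<And>b. b \<in> J \<Longrightarrow> 0 \<le> w b" and z: "Im z > 0"
  shows "1 + (\<Sum>b\<in>J. of_real (w b) / (of_real (x b) - z)) \<noteq> 0"
    "0 \<le> Im (\<Sum>b\<in>J. of_real (w b) / (of_real (x b) - z))"
proof -
  let ?h = "\<Sum>b\<in>J. of_real (w b) / (of_real (x b) - z)"
  have im: "Im ?h = (\<Sum>b\<in>J. w b * Im z / (cmod (of_real (x b) - z))\<^sup>2)"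
    by (simp only: Im_sum Im_kernel)
  have nn: "0 \<le> w b * Im z / (cmod (of_real (x b) - z))\<^sup>2" if "b \<in> J" for b
    using w[OF that] z by simp
  show "0 \<le> Im ?h" unfolding im by (rule sum_nonneg) (rule nn)
  show "1 + ?h \<noteq> 0"
  proof
    assume a: "1 + ?h = 0"
    then have "Im (1 + ?h) = Im 0" by (simp only:)
    then have "Im ?h = 0" by simp
    then have z0: "\<forall>b\<in>J. w b * Im z / (cmod (of_real (x b) - z))\<^sup>2 = 0"
      unfolding im using sum_nonneg_eq_0_iff[OF J, of "\<lambda>b. w b * Im z / (cmod (of_real (x b) - z))\<^sup>2"] nn by simp
    have "w b = 0" if "b \<in> J" for b
      using z0[rule_format, OF that] z real_minus_complex_nonzero[OF z, of "x b"] by simp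
    then have "?h = 0" by (intro sum.neutral) auto
    then show False using a by simp
  qed
qed

text \<open>The function is the entry \<open>(None, None)\<close> of the resolvent of a positive semidefinite matrix: a diagonal matrix
  with entries \<open>0\<close> at \<open>None\<close> and \<open>x b\<close> at \<open>Some (k, b)\<close>, plus the rank one matrices of the vectors \<open>y k\<close>.
  Its spectral decomposition exhibits the poles and weights, and the mean of the weights is the
  diagonal entry \<open>\<Sum>k<N. s k\<close> at \<open>None\<close>.\<close>

lemma discrete_stieltjes_star:
  fixes s :: "nat \<Rightarrow> real" and w :: "nat \<Rightarrow> 'b \<Rightarrow> real" and x :: "'b \<Rightarrow> real"
  assumes J: "finite J" and s: "\<And>k. k < N \<Longrightarrow> 0 \<le> s k"
    and w: "\<And>k b. k < N \<Longrightarrow> b \<in> J \<Longrightarrow> 0 \<le> w k b" and x: "\<And>b. b \<in> J \<Longrightarrow> 0 \<le> x b"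
  shows "discrete_stieltjes (\<Sum>k<N. s k)
    (\<lambda>z. 1 / ((\<Sum>k<N. of_real (s k) / (1 + (\<Sum>b\<in>J. of_real (w k b) / (of_real (x b) - z)))) - z))"
proof -
  define I where "I = insert None (Some ` ({..<N} \<times> J))"
  define lam0 where "lam0 r = (case r of None \<Rightarrow> 0 | Some (k, b) \<Rightarrow> x b)" for r :: "(nat \<times> 'b) option"
  define y where "y k r = (case r of None \<Rightarrow> sqrt (s k) | Some (k', b) \<Rightarrow> if k' = k then sqrt (w k b) else 0)"
    for k and r :: "(nat \<times> 'b) option"
  define H where "H r r' = complex_of_real ((if r = r' then lam0 r else 0) + (\<Sum>k<N. y k r * y k r'))" for r r'
  have fin: "finite I" using J by (simp add: I_def)
  have None: "None \<in> I" by (simp add: I_def)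
  have herm: "hermitian_on I H"
    by (auto simp: hermitian_on_def H_def mult.commute)
  obtain lam u where u: "orthonormal I (card I) u"
    and ev: "\<forall>a<card I. \<forall>r\<in>I. mv I H (u a) r = complex_of_real (lam a) * u a r"
    using spectral_theorem[OF fin herm] by (elim exE conjE)
  define p where "p a = (cmod (u a None))\<^sup>2" for a
  have mvH: "mv I H v r = of_real (lam0 r) * v r + (\<Sum>k<N. of_real (y k r) * (\<Sum>r'\<in>I. of_real (y k r') * v r'))"
    if "r \<in> I" for v r
  proof -
    have "mv I H v r = (\<Sum>r'\<in>I. (if r = r' then of_real (lam0 r) * v r' else 0) + (\<Sum>k<N. of_real (y k r) * (of_real (y k r') * v r')))"
      unfolding mv_def H_def by (intro sum.cong refl) (auto simp: distrib_left sum_distrib_left mult_ac)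
    also have "\<dots> = of_real (lam0 r) * v r + (\<Sum>r'\<in>I. \<Sum>k<N. of_real (y k r) * (of_real (y k r') * v r'))"
      using that fin by (simp add: sum.distrib)
    also have "(\<Sum>r'\<in>I. \<Sum>k<N. of_real (y k r) * (of_real (y k r') * v r')) = (\<Sum>k<N. of_real (y k r) * (\<Sum>r'\<in>I. of_real (y k r') * v r'))"
      by (subst sum.swap) (simp only: sum_distrib_left)
    finally show ?thesis .
  qed
  have lam_nonneg: "0 \<le> lam a" if a: "a < card I" for a
  proof -
    have "complex_of_real (lam a) = complex_of_real (lam a) * ip I (u a) (u a)" using u a by (simp add: orthonormal_def)
    also have "\<dots> = ip I (u a) (mv I H (u a))"
      unfolding ip_scale_right[symmetric] using ev a by (intro ip_cong) auto
    also have "\<dots> = (\<Sum>r\<in>I. cnj (u a r) * (of_real (lam0 r) * u a r + (\<Sum>k<N. of_real (y k r) * (\<Sum>r'\<in>I. of_real (y k r') * u a r'))))"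
      unfolding ip_def by (intro sum.cong refl) (simp only: mvH)
    also have "\<dots> = (\<Sum>r\<in>I. of_real (lam0 r) * (u a r * cnj (u a r))) +
        (\<Sum>r\<in>I. \<Sum>k<N. (of_real (y k r) * cnj (u a r)) * (\<Sum>r'\<in>I. of_real (y k r') * u a r'))"
      by (simp add: distrib_left sum.distrib sum_distrib_left mult_ac)
    also have "(\<Sum>r\<in>I. \<Sum>k<N. (of_real (y k r) * cnj (u a r)) * (\<Sum>r'\<in>I. of_real (y k r') * u a r'))
        = (\<Sum>k<N. (\<Sum>r'\<in>I. of_real (y k r') * u a r') * cnj (\<Sum>r'\<in>I. of_real (y k r') * u a r'))"
      by (subst sum.swap) (simp add: sum_distrib_right[symmetric] mult.commute)
    also have "(\<Sum>r\<in>I. of_real (lam0 r) * (u a r * cnj (u a r))) = of_real (\<Sum>r\<in>I. lam0 r * (cmod (u a r))\<^sup>2)"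
      by (simp add: complex_norm_square[symmetric] del: of_real_power)
    also have "(\<Sum>k<N. (\<Sum>r'\<in>I. of_real (y k r') * u a r') * cnj (\<Sum>r'\<in>I. of_real (y k r') * u a r'))
        = of_real (\<Sum>k<N. (cmod (\<Sum>r'\<in>I. of_real (y k r') * u a r'))\<^sup>2)"
      by (simp only: complex_norm_square[symmetric] of_real_sum)
    finally have "lam a = (\<Sum>r\<in>I. lam0 r * (cmod (u a r))\<^sup>2) + (\<Sum>k<N. (cmod (\<Sum>r'\<in>I. of_real (y k r') * u a r'))\<^sup>2)"
      by (simp only: of_real_add[symmetric] of_real_eq_iff)
    moreover have "0 \<le> lam0 r" if "r \<in> I" for r using that x by (auto simp: lam0_def I_def split: option.splits)
    ultimately show ?thesis by (simp add: sum_nonneg)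
  qed
  have p_sum: "(\<Sum>a<card I. p a) = 1"
  proof -
    have "complex_of_real (\<Sum>a<card I. p a) = (\<Sum>a<card I. u a None * cnj (u a None))"
      by (simp only: p_def complex_norm_square of_real_sum)
    also have "\<dots> = 1" using orthonormal_complete[OF fin u None None] by simp
    finally show ?thesis by (simp only: of_real_eq_1_iff)
  qed
  have mean: "(\<Sum>a<card I. p a * lam a) = (\<Sum>k<N. s k)"
  proof -
    have "complex_of_real (\<Sum>a<card I. p a * lam a) = (\<Sum>a<card I. (of_real (lam a) * u a None) * cnj (u a None))"
      by (simp only: p_def complex_norm_square of_real_sum of_real_mult mult_ac)
    also have "\<dots> = (\<Sum>a<card I. mv I H (u a) None * cnj (u a None))"
      using ev None by (intro sum.cong refl) auto
    also have "\<dots> = (\<Sum>r\<in>I. \<Sum>a<card I. H None r * (u a r * cnj (u a None)))"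
      unfolding mv_def sum_distrib_right by (subst sum.swap) (simp add: mult.assoc)
    also have "\<dots> = (\<Sum>r\<in>I. H None r * (if r = None then 1 else 0))"
      unfolding sum_distrib_left[symmetric] using orthonormal_complete[OF fin u _ None] by (intro sum.cong refl) auto
    also have "\<dots> = (\<Sum>r\<in>I. if r = None then H None r else 0)" by (intro sum.cong refl) auto
    also have "\<dots> = H None None" using fin None by (simp only: sum.delta) simp
    also have "\<dots> = of_real (\<Sum>k<N. s k)" using s by (simp add: H_def lam0_def y_def)
    finally show ?thesis by (simp only: of_real_eq_iff)
  qed
  have repr: "1 / ((\<Sum>k<N. of_real (s k) / (1 + (\<Sum>b\<in>J. of_real (w k b) / (of_real (x b) - z)))) - z)
      = (\<Sum>a<card I. of_real (p a) / (of_real (lam a) - z))" if z: "Im z > 0" for z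
  proof -
    define h where "h k = (\<Sum>b\<in>J. complex_of_real (w k b) / (of_real (x b) - z))" for k
    define den where "den = (\<Sum>k<N. of_real (s k) / (1 + h k)) - z"
    define g where "g = 1 / den"
    define \<tau> where "\<tau> k = of_real (sqrt (s k)) * g / (1 + h k)" for k
    define \<xi> where "\<xi> r = (case r of None \<Rightarrow> g | Some (k, b) \<Rightarrow> - of_real (sqrt (w k b)) * \<tau> k / (of_real (x b) - z))" for r
    have h1: "1 + h k \<noteq> 0" and imh: "0 \<le> Im (h k)" if "k < N" for k
      using one_plus_kernel_sum_nonzero[OF J w[OF that] z, where x = x] by (simp_all add: h_def)
    have "Im (of_real (s k) / (1 + h k)) \<le> 0" if "k < N" for k
      unfolding Im_of_real_divide using imh[OF that] s[OF that] by simp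
    then have "(\<Sum>k<N. Im (of_real (s k) / (1 + h k))) \<le> 0" by (intro sum_nonpos) auto
    then have "Im den \<le> - Im z" unfolding den_def minus_complex.sel Im_sum by linarith
    then have den0: "den \<noteq> 0" using z by auto
    have xz: "of_real (x b) - z \<noteq> 0" for b by (rule real_minus_complex_nonzero[OF z])
    have \<tau>: "(\<Sum>r\<in>I. of_real (y k r) * \<xi> r) = \<tau> k" if k: "k < N" for k
    proof -
      have "(\<Sum>r\<in>I. of_real (y k r) * \<xi> r) = of_real (sqrt (s k)) * g
          + (\<Sum>(k', b)\<in>{..<N} \<times> J. of_real (y k (Some (k', b))) * \<xi> (Some (k', b)))"
        unfolding I_def using J
        by (subst sum.insert) (auto simp: sum.reindex y_def \<xi>_def split_def intro!: sum.cong)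
      also have "(\<Sum>(k', b)\<in>{..<N} \<times> J. of_real (y k (Some (k', b))) * \<xi> (Some (k', b)))
          = (\<Sum>k'<N. if k' = k then - (\<tau> k * h k) else 0)"
        unfolding sum.cartesian_product[symmetric]
      proof (intro sum.cong refl)
        fix k' assume "k' \<in> {..<N}"
        show "(\<Sum>b\<in>J. of_real (y k (Some (k', b))) * \<xi> (Some (k', b))) = (if k' = k then - (\<tau> k * h k) else 0)"
        proof (cases "k' = k")
          case True
          have t: "complex_of_real (sqrt (w k b)) * (- of_real (sqrt (w k b)) * \<tau> k / (of_real (x b) - z))
              = - (\<tau> k * (of_real (w k b) / (of_real (x b) - z)))" if "b \<in> J" for b
          proof -
            have "complex_of_real (sqrt (w k b)) * of_real (sqrt (w k b)) = of_real (w k b)"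
              using w[OF k that] by (simp only: of_real_mult[symmetric] real_sqrt_mult_self abs_of_nonneg)
            then show ?thesis by (simp add: mult.assoc[symmetric])
          qed
          have "(\<Sum>b\<in>J. of_real (y k (Some (k', b))) * \<xi> (Some (k', b)))
              = (\<Sum>b\<in>J. - (\<tau> k * (of_real (w k b) / (of_real (x b) - z))))"
            unfolding True by (intro sum.cong refl) (simp only: y_def \<xi>_def option.case prod.case refl if_True t)
          then show ?thesis unfolding sum_negf sum_distrib_left[symmetric] h_def[symmetric] using True by simp
        qed (simp add: y_def)
      qed
      also have "\<dots> = - (\<tau> k * h k)" using k by simp
      also have "of_real (sqrt (s k)) * g + - (\<tau> k * h k) = \<tau> k"
        using h1[OF k] by (simp add: \<tau>_def field_simps)
      finally show ?thesis .
    qed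
    have Hz: "mv I H \<xi> r - z * \<xi> r = (if r = None then 1 else 0)" if r: "r \<in> I" for r
    proof (cases r)
      case None
      have "mv I H \<xi> r = (\<Sum>k<N. of_real (sqrt (s k)) * \<tau> k)"
        unfolding mvH[OF r] using \<tau> by (simp add: None lam0_def y_def)
      also have "\<dots> = (\<Sum>k<N. of_real (s k) / (1 + h k)) * g"
        unfolding sum_distrib_right
      proof (intro sum.cong refl)
        fix k assume "k \<in> {..<N}"
        then have "complex_of_real (sqrt (s k)) * of_real (sqrt (s k)) = of_real (s k)"
          using s[of k] by (simp only: of_real_mult[symmetric] real_sqrt_mult_self abs_of_nonneg lessThan_iff)
        then show "of_real (sqrt (s k)) * \<tau> k = of_real (s k) / (1 + h k) * g"
          by (simp add: \<tau>_def mult.assoc[symmetric])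
      qed
      finally have "mv I H \<xi> r - z * \<xi> r = den * g"
        by (simp add: None \<xi>_def den_def left_diff_distrib)
      then show ?thesis using None den0 by (simp add: g_def)
    next
      case (Some kb)
      then obtain k b where kb: "r = Some (k, b)" "k < N" "b \<in> J" using r by (auto simp: I_def)
      have "mv I H \<xi> r = of_real (x b) * \<xi> r + (\<Sum>k'<N. of_real (y k' r) * \<tau> k')"
        unfolding mvH[OF r] using \<tau> by (simp add: kb(1) lam0_def)
      also have "(\<Sum>k'<N. of_real (y k' r) * \<tau> k') = (\<Sum>k'<N. if k' = k then of_real (sqrt (w k b)) * \<tau> k else 0)"
        by (intro sum.cong refl) (auto simp: kb(1) y_def)
      also have "\<dots> = of_real (sqrt (w k b)) * \<tau> k" using kb(2) by simp
      finally have "mv I H \<xi> r - z * \<xi> r = (of_real (x b) - z) * \<xi> r + of_real (sqrt (w k b)) * \<tau> k"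
        by (simp add: left_diff_distrib)
      also have "\<dots> = 0" using xz[of b] by (simp add: kb(1) \<xi>_def)
      finally show ?thesis using kb(1) by simp
    qed
    have co: "ip I (u a) \<xi> = cnj (u a None) / (of_real (lam a) - z)" if a: "a < card I" for a
    proof -
      have "cnj (u a None) = (\<Sum>r\<in>I. cnj (u a r) * (if r = None then 1 else 0))"
      proof -
        have "(\<Sum>r\<in>I. cnj (u a r) * (if r = None then 1 else 0)) = (\<Sum>r\<in>I. if r = None then cnj (u a r) else 0)"
          by (intro sum.cong refl) auto
        then show ?thesis using fin None by (simp only: sum.delta) simp
      qed
      also have "\<dots> = (\<Sum>r\<in>I. cnj (u a r) * (mv I H \<xi> r - z * \<xi> r))"
        using Hz by (intro sum.cong refl) auto
      also have "\<dots> = ip I (u a) (mv I H \<xi>) - z * ip I (u a) \<xi>"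
        by (simp add: ip_def right_diff_distrib sum_subtractf sum_distrib_left mult.left_commute)
      also have "ip I (u a) (mv I H \<xi>) = ip I (mv I H (u a)) \<xi>" by (rule ip_mv_hermitian[OF herm, symmetric])
      also have "\<dots> = ip I (\<lambda>r. of_real (lam a) * u a r) \<xi>" using ev a by (intro ip_cong) auto
      also have "\<dots> = of_real (lam a) * ip I (u a) \<xi>" by (simp add: ip_scale_left)
      finally have "cnj (u a None) = (of_real (lam a) - z) * ip I (u a) \<xi>" by (simp add: left_diff_distrib)
      then show ?thesis using real_minus_complex_nonzero[OF z, of "lam a"] by simp
    qed
    have "g = \<xi> None" by (simp add: \<xi>_def)
    also have "\<dots> = (\<Sum>r\<in>I. (if r = None then \<xi> r else 0))" using fin None by (simp only: sum.delta) simp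
    also have "\<dots> = (\<Sum>r\<in>I. (\<Sum>a<card I. u a None * cnj (u a r)) * \<xi> r)"
      using orthonormal_complete[OF fin u None] by (intro sum.cong refl) auto
    also have "\<dots> = (\<Sum>a<card I. u a None * ip I (u a) \<xi>)"
      unfolding ip_def sum_distrib_right sum_distrib_left by (subst sum.swap) (simp add: mult.assoc)
    also have "\<dots> = (\<Sum>a<card I. of_real (p a) / (of_real (lam a) - z))"
      unfolding p_def complex_norm_square by (intro sum.cong refl) (simp add: co)
    finally show ?thesis by (simp only: g_def den_def h_def)
  qed
  show ?thesis
    unfolding discrete_stieltjes_def
    by (rule exI[of _ "card I"], rule exI[of _ p], rule exI[of _ lam])
      (use lam_nonneg p_sum mean repr in \<open>auto simp: p_def\<close>)
qed

text \<open>The tail bound is Markov's inequality for the mean.\<close>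

lemma discrete_stieltjes_measure:
  assumes "discrete_stieltjes A g"
  shows "\<exists>M. real_distribution M \<and> measure M {..<0} = 0 \<and> (\<forall>T>0. measure M {T<..} \<le> A / T) \<and>
    (\<forall>z. Im z > 0 \<longrightarrow> (LINT x|M. 1 / (complex_of_real x - z)) = g z)"
proof -
  obtain L and p lam :: "nat \<Rightarrow> real" where pl: "\<forall>a<L. 0 \<le> p a \<and> 0 \<le> lam a" and p1: "(\<Sum>a<L. p a) = 1"
    and mean: "(\<Sum>a<L. p a * lam a) \<le> A"
    and g: "\<forall>z. Im z > 0 \<longrightarrow> g z = (\<Sum>a<L. of_real (p a) / (of_real (lam a) - z))"
    using assms unfolding discrete_stieltjes_def by (elim exE conjE)
  define q where "q = embed_pmf (\<lambda>a. if a < L then p a else 0)"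
  have q: "pmf q a = (if a < L then p a else 0)" for a
    unfolding q_def
  proof (rule pmf_embed_pmf)
    have "(\<integral>\<^sup>+ x. ennreal (if x < L then p x else 0) \<partial>count_space UNIV) = (\<Sum>x<L. ennreal (p x))"
      by (subst nn_integral_count_space'[of "{..<L}"]) (auto intro!: sum.cong)
    also have "\<dots> = ennreal (\<Sum>x<L. p x)" using pl by (intro sum_ennreal) auto
    finally show "(\<integral>\<^sup>+ x. ennreal (if x < L then p x else 0) \<partial>count_space UNIV) = 1" by (simp add: p1)
  qed (use pl in auto)
  have set_q: "set_pmf q \<subseteq> {..<L}" by (auto simp: set_pmf_eq q)
  define M where "M = distr (measure_pmf q) borel lam"
  have rd: "real_distribution M"
    unfolding M_def by (rule prob_space.real_distribution_distr) (simp_all add: measure_pmf.prob_space_axioms)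
  have int: "integral\<^sup>L M h = (\<Sum>a<L. p a *\<^sub>R h (lam a))" if "h \<in> borel_measurable borel"
    for h :: "real \<Rightarrow> 'c::{banach, second_countable_topology}"
  proof -
    have "integral\<^sup>L M h = integral\<^sup>L (measure_pmf q) (\<lambda>a. h (lam a))"
      unfolding M_def using that by (subst integral_distr) auto
    also have "\<dots> = (\<Sum>a<L. pmf q a *\<^sub>R h (lam a))"
      using set_q by (intro integral_measure_pmf) auto
    also have "\<dots> = (\<Sum>a<L. p a *\<^sub>R h (lam a))" by (intro sum.cong) (auto simp: q)
    finally show ?thesis .
  qed
  interpret M: real_distribution M by fact
  have meas: "measure M S = (\<Sum>a<L. p a * indicator S (lam a))" if "S \<in> sets borel" for S
    using int[of "indicat_real S"] that by simp
  have "measure M {..<0} = 0" using pl by (subst meas) (auto intro!: sum.neutral simp: indicator_def)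
  moreover have "measure M {T<..} \<le> A / T" if "T > 0" for T
  proof -
    have "measure M {T<..} = (\<Sum>a<L. p a * indicator {T<..} (lam a))" by (rule meas) simp
    also have "\<dots> \<le> (\<Sum>a<L. p a * (lam a / T))"
      using pl that by (intro sum_mono mult_left_mono) (auto simp: indicator_def)
    also have "\<dots> = (\<Sum>a<L. p a * lam a) / T" by (simp add: sum_divide_distrib)
    also have "\<dots> \<le> A / T" using mean that by (simp add: divide_right_mono)
    finally show ?thesis .
  qed
  moreover have "(LINT x|M. 1 / (complex_of_real x - z)) = g z" if "Im z > 0" for z
  proof -
    have "(LINT x|M. 1 / (complex_of_real x - z)) = (\<Sum>a<L. p a *\<^sub>R (1 / (complex_of_real (lam a) - z)))"
      by (rule int) measurable
    also have "\<dots> = g z" using g that by (simp add: scaleR_conv_of_real)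
    finally show ?thesis .
  qed
  ultimately show ?thesis using rd by blast
qed

lemma discrete_stieltjes_average:
  assumes n: "n > 0" and g: "\<And>i. i < n \<Longrightarrow> discrete_stieltjes A (g i)"
  shows "discrete_stieltjes A (\<lambda>z. 1 / of_nat n * (\<Sum>i<n. g i z))"
proof -
  have "\<forall>i\<in>{..<n}. \<exists>L (p :: nat \<Rightarrow> real) (lam :: nat \<Rightarrow> real).
     (\<forall>a<L. 0 \<le> p a \<and> 0 \<le> lam a) \<and> (\<Sum>a<L. p a) = 1 \<and> (\<Sum>a<L. p a * lam a) \<le> A \<and>
     (\<forall>z. Im z > 0 \<longrightarrow> g i z = (\<Sum>a<L. of_real (p a) / (of_real (lam a) - z)))"
    using g unfolding discrete_stieltjes_def lessThan_iff Ball_def by (intro allI impI)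
  from bchoice[OF this] obtain L where "\<forall>i\<in>{..<n}. \<exists>(p :: nat \<Rightarrow> real) (lam :: nat \<Rightarrow> real).
     (\<forall>a<L i. 0 \<le> p a \<and> 0 \<le> lam a) \<and> (\<Sum>a<L i. p a) = 1 \<and> (\<Sum>a<L i. p a * lam a) \<le> A \<and>
     (\<forall>z. Im z > 0 \<longrightarrow> g i z = (\<Sum>a<L i. of_real (p a) / (of_real (lam a) - z)))"
    by (elim exE)
  from bchoice[OF this] obtain p :: "nat \<Rightarrow> nat \<Rightarrow> real" where "\<forall>i\<in>{..<n}. \<exists>(lam :: nat \<Rightarrow> real).
     (\<forall>a<L i. 0 \<le> p i a \<and> 0 \<le> lam a) \<and> (\<Sum>a<L i. p i a) = 1 \<and> (\<Sum>a<L i. p i a * lam a) \<le> A \<and>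
     (\<forall>z. Im z > 0 \<longrightarrow> g i z = (\<Sum>a<L i. of_real (p i a) / (of_real (lam a) - z)))"
    by (elim exE)
  from bchoice[OF this] obtain lam :: "nat \<Rightarrow> nat \<Rightarrow> real" where all: "\<forall>i\<in>{..<n}.
     (\<forall>a<L i. 0 \<le> p i a \<and> 0 \<le> lam i a) \<and> (\<Sum>a<L i. p i a) = 1 \<and> (\<Sum>a<L i. p i a * lam i a) \<le> A \<and>
     (\<forall>z. Im z > 0 \<longrightarrow> g i z = (\<Sum>a<L i. of_real (p i a) / (of_real (lam i a) - z)))"
    by (elim exE)
  have pl: "\<And>i a. i < n \<Longrightarrow> a < L i \<Longrightarrow> 0 \<le> p i a \<and> 0 \<le> lam i a"
    and p1: "\<And>i. i < n \<Longrightarrow> (\<Sum>a<L i. p i a) = 1"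
    and mean: "\<And>i. i < n \<Longrightarrow> (\<Sum>a<L i. p i a * lam i a) \<le> A"
    and gz: "\<And>i z. i < n \<Longrightarrow> Im z > 0 \<Longrightarrow> g i z = (\<Sum>a<L i. of_real (p i a) / (of_real (lam i a) - z))"
    using all by auto
  define J where "J = Sigma {..<n} (\<lambda>i. {..<L i})"
  have "finite J" by (simp add: J_def)
  then obtain \<phi> where \<phi>: "bij_betw \<phi> {..<card J} J" using ex_bij_betw_nat_finite[of J] unfolding atLeast0LessThan by blast
  have sumJ: "(\<Sum>a<card J. F (\<phi> a)) = (\<Sum>i<n. \<Sum>a<L i. F (i, a))" for F :: "nat \<times> nat \<Rightarrow> 'c::comm_monoid_add"
  proof -
    have "(\<Sum>a<card J. F (\<phi> a)) = sum F J" by (rule sum.reindex_bij_betw[OF \<phi>])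
    then show ?thesis unfolding J_def by (simp add: sum.Sigma split_def)
  qed
  have inJ: "fst (\<phi> a) < n \<and> snd (\<phi> a) < L (fst (\<phi> a))" if "a < card J" for a
  proof -
    have "\<phi> a \<in> J" using bij_betwE[OF \<phi>] that by blast
    then show ?thesis by (auto simp: J_def)
  qed
  define P where "P a = p (fst (\<phi> a)) (snd (\<phi> a)) / real n" for a
  define Q where "Q a = lam (fst (\<phi> a)) (snd (\<phi> a))" for a
  show ?thesis
    unfolding discrete_stieltjes_def
  proof (rule exI[of _ "card J"], rule exI[of _ P], rule exI[of _ Q], intro conjI allI impI)
    fix a assume "a < card J"
    then show "0 \<le> P a" "0 \<le> Q a" using inJ[of a] pl by (auto simp: P_def Q_def)
  next
    have "(\<Sum>a<card J. P a) = (\<Sum>i<n. \<Sum>a<L i. p i a / real n)"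
      unfolding P_def using sumJ[of "\<lambda>b. p (fst b) (snd b) / real n"] by simp
    also have "\<dots> = (\<Sum>i<n. 1 / real n)" using p1 by (simp add: sum_divide_distrib[symmetric])
    finally show "(\<Sum>a<card J. P a) = 1" using n by simp
  next
    have "(\<Sum>a<card J. P a * Q a) = (\<Sum>i<n. \<Sum>a<L i. p i a / real n * lam i a)"
      unfolding P_def Q_def using sumJ[of "\<lambda>b. p (fst b) (snd b) / real n * lam (fst b) (snd b)"] by simp
    also have "\<dots> = (\<Sum>i<n. (\<Sum>a<L i. p i a * lam i a) / real n)" by (simp add: sum_divide_distrib)
    also have "\<dots> \<le> (\<Sum>i<n. A / real n)" using mean by (intro sum_mono divide_right_mono) auto
    finally show "(\<Sum>a<card J. P a * Q a) \<le> A" using n by simp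
  next
    fix z assume z: "Im z > 0"
    have "1 / of_nat n * (\<Sum>i<n. g i z) = (\<Sum>i<n. \<Sum>a<L i. of_real (p i a / real n) / (of_real (lam i a) - z))"
      unfolding sum_distrib_left using gz z by (intro sum.cong refl) (simp add: sum_distrib_left)
    also have "\<dots> = (\<Sum>a<card J. of_real (P a) / (of_real (Q a) - z))"
      unfolding P_def Q_def using sumJ[of "\<lambda>b. complex_of_real (p (fst b) (snd b) / real n) / (of_real (lam (fst b) (snd b)) - z)"] by simp
    finally show "1 / of_nat n * (\<Sum>i<n. g i z) = (\<Sum>a<card J. of_real (P a) / (of_real (Q a) - z))" .
  qed
qed

context profile_system
begin

text \<open>A bound for the means of all measures that occur in the iteration; it does not grow with the number of steps,
  which gives tightness.\<close>

definition mean_bound :: real where "mean_bound = (\<Sum>i<n. \<Sum>k<N. 1 / real N * (d i k)\<^sup>2)"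

lemma discrete_stieltjes_mono: "discrete_stieltjes A g \<Longrightarrow> A \<le> B \<Longrightarrow> discrete_stieltjes B g"
  unfolding discrete_stieltjes_def by (meson order_trans)

lemma discrete_stieltjes_step:
  assumes g: "\<And>i. i < n \<Longrightarrow> discrete_stieltjes mean_bound (g i)" and i0: "i0 < n"
  shows "discrete_stieltjes mean_bound (\<lambda>z. 1 / D z (\<lambda>k. 1 / of_nat n * (\<Sum>i<n. of_real ((d i k)\<^sup>2) * g i z)) i0)"
proof -
  have "\<forall>i\<in>{..<n}. \<exists>L (p :: nat \<Rightarrow> real) (lam :: nat \<Rightarrow> real).
     (\<forall>a<L. 0 \<le> p a \<and> 0 \<le> lam a) \<and> (\<Sum>a<L. p a) = 1 \<and> (\<Sum>a<L. p a * lam a) \<le> mean_bound \<and>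
     (\<forall>z. Im z > 0 \<longrightarrow> g i z = (\<Sum>a<L. of_real (p a) / (of_real (lam a) - z)))"
    using g unfolding discrete_stieltjes_def lessThan_iff Ball_def by (intro allI impI)
  from bchoice[OF this] obtain L where "\<forall>i\<in>{..<n}. \<exists>(p :: nat \<Rightarrow> real) (lam :: nat \<Rightarrow> real).
     (\<forall>a<L i. 0 \<le> p a \<and> 0 \<le> lam a) \<and> (\<Sum>a<L i. p a) = 1 \<and> (\<Sum>a<L i. p a * lam a) \<le> mean_bound \<and>
     (\<forall>z. Im z > 0 \<longrightarrow> g i z = (\<Sum>a<L i. of_real (p a) / (of_real (lam a) - z)))"
    by (elim exE)
  from bchoice[OF this] obtain p :: "nat \<Rightarrow> nat \<Rightarrow> real" where "\<forall>i\<in>{..<n}. \<exists>(lam :: nat \<Rightarrow> real).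
     (\<forall>a<L i. 0 \<le> p i a \<and> 0 \<le> lam a) \<and> (\<Sum>a<L i. p i a) = 1 \<and> (\<Sum>a<L i. p i a * lam a) \<le> mean_bound \<and>
     (\<forall>z. Im z > 0 \<longrightarrow> g i z = (\<Sum>a<L i. of_real (p i a) / (of_real (lam a) - z)))"
    by (elim exE)
  from bchoice[OF this] obtain lam :: "nat \<Rightarrow> nat \<Rightarrow> real" where all: "\<forall>i\<in>{..<n}.
     (\<forall>a<L i. 0 \<le> p i a \<and> 0 \<le> lam i a) \<and> (\<Sum>a<L i. p i a) = 1 \<and> (\<Sum>a<L i. p i a * lam i a) \<le> mean_bound \<and>
     (\<forall>z. Im z > 0 \<longrightarrow> g i z = (\<Sum>a<L i. of_real (p i a) / (of_real (lam i a) - z)))"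
    by (elim exE)
  have pl: "\<And>i a. i < n \<Longrightarrow> a < L i \<Longrightarrow> 0 \<le> p i a \<and> 0 \<le> lam i a"
    and gz: "\<And>i z. i < n \<Longrightarrow> Im z > 0 \<Longrightarrow> g i z = (\<Sum>a<L i. of_real (p i a) / (of_real (lam i a) - z))"
    using all by auto
  define J where "J = Sigma {..<n} (\<lambda>i. {..<L i})"
  define s where "s k = 1 / real N * (d i0 k)\<^sup>2" for k
  define w where "w k b = 1 / real N * (d (fst b) k)\<^sup>2 * p (fst b) (snd b)" for k b
  define x where "x b = lam (fst b) (snd b)" for b
  have "discrete_stieltjes (\<Sum>k<N. s k)
    (\<lambda>z. 1 / ((\<Sum>k<N. of_real (s k) / (1 + (\<Sum>b\<in>J. of_real (w k b) / (of_real (x b) - z)))) - z))"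
    by (rule discrete_stieltjes_star) (use pl in \<open>auto simp: J_def s_def w_def x_def intro!: mult_nonneg_nonneg divide_nonneg_nonneg\<close>)
  moreover have "(\<Sum>k<N. s k) \<le> mean_bound"
    unfolding s_def mean_bound_def using i0
    by (intro member_le_sum[of i0 "{..<n}" "\<lambda>i. \<Sum>k<N. 1 / real N * (d i k)\<^sup>2"]) (auto intro!: sum_nonneg divide_nonneg_nonneg)
  ultimately have ds: "discrete_stieltjes mean_bound
    (\<lambda>z. 1 / ((\<Sum>k<N. of_real (s k) / (1 + (\<Sum>b\<in>J. of_real (w k b) / (of_real (x b) - z)))) - z))"
    by (rule discrete_stieltjes_mono)
  have eq: "1 / D z (\<lambda>k. 1 / of_nat n * (\<Sum>i<n. of_real ((d i k)\<^sup>2) * g i z)) i0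
      = 1 / ((\<Sum>k<N. of_real (s k) / (1 + (\<Sum>b\<in>J. of_real (w k b) / (of_real (x b) - z)))) - z)"
    if z: "Im z > 0" for z
  proof -
    have inner: "of_real c * (1 / of_nat n * (\<Sum>i<n. of_real ((d i k)\<^sup>2) * g i z))
        = (\<Sum>b\<in>J. of_real (w k b) / (of_real (x b) - z))" for k
    proof -
      have "of_real c * (1 / of_nat n * S) = of_real (1 / real N) * S" for S :: complex
        using n_pos N_pos by (simp add: c_def)
      then have "of_real c * (1 / of_nat n * (\<Sum>i<n. of_real ((d i k)\<^sup>2) * g i z))
          = of_real (1 / real N) * (\<Sum>i<n. of_real ((d i k)\<^sup>2) * g i z)" .
      also have "\<dots> = of_real (1 / real N) * (\<Sum>i<n. of_real ((d i k)\<^sup>2) *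
          (\<Sum>a<L i. of_real (p i a) / (of_real (lam i a) - z)))"
        using gz[OF _ z] by (intro arg_cong2[of _ _ _ _ "(*)"] sum.cong refl) auto
      also have "\<dots> = (\<Sum>i<n. \<Sum>a<L i. of_real (w k (i, a)) / (of_real (x (i, a)) - z))"
        by (simp add: sum_distrib_left w_def x_def mult.assoc)
      also have "\<dots> = (\<Sum>b\<in>J. of_real (w k b) / (of_real (x b) - z))"
        unfolding J_def by (subst sum.Sigma) (auto simp: split_def)
      finally show ?thesis .
    qed
    show ?thesis unfolding D_eq inner by (simp add: s_def sum_distrib_left)
  qed
  show ?thesis
    by (rule discrete_stieltjes_cong[OF eq ds])
qed

lemma discrete_stieltjes_iter:
  "i < n \<Longrightarrow> discrete_stieltjes mean_bound (\<lambda>z. 1 / D z (iter z m) i)"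
proof (induction m arbitrary: i)
  case 0
  have mb: "0 \<le> mean_bound" unfolding mean_bound_def by (intro sum_nonneg) auto
  have "discrete_stieltjes mean_bound (\<lambda>z. 1 / (0 - z))"
    unfolding discrete_stieltjes_def
    by (rule exI[of _ 1], rule exI[of _ "\<lambda>_. 1"], rule exI[of _ "\<lambda>_. 0"]) (simp add: mb)
  from discrete_stieltjes_step[OF this 0] show ?case
    by (simp add: iter_0[abs_def])
next
  case (Suc m)
  have "iter z (Suc m) = (\<lambda>k. 1 / of_nat n * (\<Sum>i<n. of_real ((d i k)\<^sup>2) * (1 / D z (iter z m) i)))" for z
    by (rule ext) (simp add: iter_Suc sys_def)
  then show ?case using discrete_stieltjes_step[OF Suc.IH Suc.prems] by simp
qed

text \<open>The iterates are transforms of probability measures on the half line whose means are bounded, hence of a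
  tight sequence. A weak limit of a subsequence has the transform \<open>G_fun\<close> because the iterates converge to
  the solution pointwise.\<close>

lemma ex_is_F0: "\<exists>F. is_F0 n N d F"
proof -
  define G where "G m z = 1 / of_nat n * (\<Sum>i<n. 1 / D z (iter z m) i)" for m z
  have "discrete_stieltjes mean_bound (G m)" for m
    unfolding G_def by (rule discrete_stieltjes_average[OF n_pos discrete_stieltjes_iter])
  then have "\<exists>\<mu>. \<forall>m. real_distribution (\<mu> m) \<and> measure (\<mu> m) {..<0} = 0 \<and> (\<forall>T>0. measure (\<mu> m) {T<..} \<le> mean_bound / T) \<and>
    (\<forall>z. Im z > 0 \<longrightarrow> (LINT x|\<mu> m. 1 / (complex_of_real x - z)) = G m z)"
    by (intro choice allI discrete_stieltjes_measure)
  then obtain \<mu> where all: "\<forall>m. real_distribution (\<mu> m) \<and> measure (\<mu> m) {..<0} = 0 \<and> (\<forall>T>0. measure (\<mu> m) {T<..} \<le> mean_bound / T) \<and>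
    (\<forall>z. Im z > 0 \<longrightarrow> (LINT x|\<mu> m. 1 / (complex_of_real x - z)) = G m z)"
    by (elim exE)
  have \<mu>: "\<And>m. real_distribution (\<mu> m)" and neg: "\<And>m. measure (\<mu> m) {..<0} = 0"
    and tail: "\<And>m T. T > 0 \<Longrightarrow> measure (\<mu> m) {T<..} \<le> mean_bound / T"
    and st: "\<And>m z. Im z > 0 \<Longrightarrow> (LINT x|\<mu> m. 1 / (complex_of_real x - z)) = G m z"
    using all by auto
  have mb: "0 \<le> mean_bound" unfolding mean_bound_def by (intro sum_nonneg) auto
  have "tight \<mu>"
    unfolding tight_def
  proof (intro conjI allI impI \<mu>)
    fix \<epsilon> :: real assume \<epsilon>: "\<epsilon> > 0"
    define T where "T = (mean_bound + 1) / \<epsilon>"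
    have T: "T > 0" using \<epsilon> mb by (simp add: T_def)
    have "measure (\<mu> m) {-1<..T} > 1 - \<epsilon>" for m
    proof -
      interpret real_distribution "\<mu> m" by (rule \<mu>)
      have "1 = prob ({..<0} \<union> ({-1<..T} \<union> {T<..}))"
      proof -
        have "{..<0} \<union> ({-1<..T} \<union> {T<..}) = (UNIV :: real set)" by auto
        then show ?thesis using prob_space[unfolded space_eq_univ] by simp
      qed
      also have "\<dots> \<le> prob {..<0} + (prob {-1<..T} + prob {T<..})"
        by (intro order_trans[OF measure_Un_le] add_left_mono measure_Un_le) auto
      also have "\<dots> \<le> prob {-1<..T} + mean_bound / T" using neg tail[OF T] by simp
      also have "mean_bound / T < \<epsilon>" using \<epsilon> mb T by (simp add: T_def field_simps)
      finally show ?thesis by simp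
    qed
    then show "\<exists>a b. a < b \<and> (\<forall>m. 1 - \<epsilon> < measure (\<mu> m) {a<..b})" using T
      by (intro exI[of _ "-1"] exI[of _ T]) auto
  qed
  from tight_imp_convergent_subsubsequence[OF this strict_mono_id]
  obtain r M where r: "strict_mono r" and M: "real_distribution M" and wc: "weak_conv_m (\<mu> \<circ> id \<circ> r) M"
    by (elim exE conjE)
  have st_M: "(LINT x|M. 1 / (complex_of_real x - z)) = G_fun n N d z" if z: "Im z > 0" for z
  proof (rule LIMSEQ_unique)
    have nz: "complex_of_real x - z \<noteq> 0" for x by (rule real_minus_complex_nonzero[OF z])
    have bd: "cmod (1 / (complex_of_real x - z)) \<le> 1 / Im z" for x
    proof -
      have "Im z \<le> cmod (complex_of_real x - z)" using abs_Im_le_cmod[of "complex_of_real x - z"] by simp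
      then show ?thesis using z by (simp add: norm_divide frac_le)
    qed
    show "(\<lambda>m. LINT x|(\<mu> \<circ> id \<circ> r) m. 1 / (complex_of_real x - z)) \<longlonglongrightarrow> (LINT x|M. 1 / (complex_of_real x - z))"
    proof (rule weak_conv_imp_integral_bdd_continuous_conv[OF _ M wc _ bd])
      show "real_distribution ((\<mu> \<circ> id \<circ> r) m)" for m by (simp add: \<mu>)
      show "isCont (\<lambda>x. 1 / (complex_of_real x - z)) x" for x by (intro continuous_intros nz)
    qed
    have "(\<lambda>m. G m z) \<longlonglongrightarrow> G_fun n N d z"
      unfolding G_def G_fun_def by (intro tendsto_intros e0_properties(3)[OF z]) auto
    from LIMSEQ_subseq_LIMSEQ[OF this r]
    show "(\<lambda>m. LINT x|(\<mu> \<circ> id \<circ> r) m. 1 / (complex_of_real x - z)) \<longlonglongrightarrow> G_fun n N d z"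
      unfolding comp_def id_def st[OF z] .
  qed
  interpret M: real_distribution M by fact
  have "is_F0 n N d (cdf M)"
    unfolding is_F0_def prob_df_def stieltjes_def interval_measure_cdf[OF M]
    using st_M M.cdf_is_right_cont M.cdf_lim_at_bot M.cdf_lim_at_top_prob M.cdf_nondecreasing by (auto simp: mono_def)
  then show ?thesis by (intro exI[of _ "cdf M"])
qed

end

lemma prob_df_interval_measure:
  assumes "prob_df F"
  shows "real_distribution (interval_measure F)" "cdf (interval_measure F) = F"
proof -
  have p: "\<And>x y. x \<le> y \<Longrightarrow> F x \<le> F y" "\<And>x. continuous (at_right x) F" "(F \<longlongrightarrow> 0) at_bot" "(F \<longlongrightarrow> 1) at_top"
    using assms by (auto simp: prob_df_def mono_def)
  show "real_distribution (interval_measure F)" by (intro real_distribution_interval_measure p)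
  show "cdf (interval_measure F) = F"
    by (rule ext) (subst cdf_def, rule measure_interval_measure_Iic, (rule p | assumption)+)
qed

lemma stieltjes_kern: "stieltjes F (\<i> * of_real t) = integral\<^sup>L (interval_measure F) (kern t)"
  by (simp add: stieltjes_def kern_def[abs_def])

text \<open>Distribution functions with the same transform on the imaginary axis are equal.\<close>

lemma is_F0_unique:
  assumes "is_F0 n N d F" "is_F0 n N d F'"
  shows "F = F'"
proof -
  have F: "prob_df F" "prob_df F'" using assms unfolding is_F0_def by blast+
  have st: "\<forall>z. Im z > 0 \<longrightarrow> stieltjes F z = G_fun n N d z" "\<forall>z. Im z > 0 \<longrightarrow> stieltjes F' z = G_fun n N d z"
    using assms unfolding is_F0_def by blast+
  have "interval_measure F = interval_measure F'"
  proof (rule real_distribution_eqI_kern[of 1])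
    fix t :: real assume "1 \<le> t"
    then have t: "Im (\<i> * complex_of_real t) > 0" by simp
    show "integral\<^sup>L (interval_measure F) (kern t) = integral\<^sup>L (interval_measure F') (kern t)"
      using trans[OF st(1)[rule_format, OF t] st(2)[rule_format, OF t, symmetric]] unfolding stieltjes_kern .
  qed (simp_all add: prob_df_interval_measure(1)[OF F(1)] prob_df_interval_measure(1)[OF F(2)])
  then have "cdf (interval_measure F) = cdf (interval_measure F')" by (rule arg_cong)
  then show ?thesis unfolding prob_df_interval_measure(2)[OF F(1)] prob_df_interval_measure(2)[OF F(2)] .
qed

lemma (in profile_system) ex1_is_F0: "\<exists>!F. is_F0 n N d F"
  using ex_is_F0 is_F0_unique by blast

lemma (in profile_system) is_F0_F0: "is_F0 n N d (F0 n N d)"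
  unfolding F0_def using ex1_is_F0 by (rule theI')

section \<open>Moment bounds on product spaces\<close>

lemma abs_integral_le:
  fixes f g :: "'a \<Rightarrow> real"
  assumes "integrable M f" "integrable M g" "\<And>x. x \<in> space M \<Longrightarrow> \<bar>f x\<bar> \<le> g x"
  shows "\<bar>integral\<^sup>L M f\<bar> \<le> integral\<^sup>L M g"
proof -
  have "\<bar>integral\<^sup>L M f\<bar> \<le> integral\<^sup>L M (\<lambda>x. \<bar>f x\<bar>)" by (rule integral_abs_bound)
  also have "\<dots> \<le> integral\<^sup>L M g" using assms by (intro integral_mono) auto
  finally show ?thesis .
qed

text \<open>McDiarmid's inequality by induction over the coordinates: integrating out coordinate \<open>i\<close> leaves a function of
  the others with the same bounded differences, and Hoeffding's lemma bounds the conditional moment generating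
  function. The oscillation in one coordinate is bounded by \<open>2 * K\<close>, whence the constant.\<close>

lemma mcdiarmid_mgf:
  fixes M :: "'i \<Rightarrow> 'a measure"
  assumes P: "\<And>i. prob_space (M i)" and l: "l > 0" and I: "finite I"
    and "f \<in> borel_measurable (PiM I M)" "\<forall>x\<in>space (PiM I M). \<bar>f x\<bar> \<le> B"
    and "\<forall>i\<in>I. \<forall>x\<in>space (PiM I M). \<forall>y\<in>space (M i). \<bar>f x - f (x(i := y))\<bar> \<le> K"
  shows "(\<integral>\<^sup>+x. ennreal (exp (l * (f x - integral\<^sup>L (PiM I M) f))) \<partial>PiM I M)
    \<le> ennreal (exp (real (card I) * (l\<^sup>2 * (2 * K)\<^sup>2 / 8)))"
  using I assms(4-6)
proof (induction I arbitrary: f rule: finite_induct)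
  case empty
  show ?case by (simp add: PiM_empty lebesgue_integral_count_space_finite nn_integral_count_space_finite)
next
  case (insert i I)
  interpret product_sigma_finite M
    by (intro product_sigma_finite.intro prob_space_imp_sigma_finite P)
  interpret Mi: prob_space "M i" by (rule P)
  interpret PI: prob_space "PiM I M" by (rule prob_space_PiM[OF P])
  interpret PiI: prob_space "PiM (insert i I) M" by (rule prob_space_PiM[OF P])
  note f_meas = insert.prems(1) and f_bd = insert.prems(2)[rule_format] and f_diff = insert.prems(3)[rule_format]
  define F where "F x y = f (x(i := y))" for x y
  have upd: "x(i := y) \<in> space (PiM (insert i I) M)" if "x \<in> space (PiM I M)" "y \<in> space (M i)" for x y
    using that by (auto simp: space_PiM PiE_def extensional_def)
  have F_meas2: "(\<lambda>(x, y). F x y) \<in> borel_measurable (PiM I M \<Otimes>\<^sub>M M i)"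
  proof -
    have "(\<lambda>p. f (case p of (x, y) \<Rightarrow> x(i := y))) \<in> borel_measurable (PiM I M \<Otimes>\<^sub>M M i)"
      by (rule measurable_compose[OF measurable_add_dim f_meas])
    also have "(\<lambda>p. f (case p of (x, y) \<Rightarrow> x(i := y))) = (\<lambda>(x, y). F x y)" by (auto simp: F_def)
    finally show ?thesis .
  qed
  have F_meas [measurable]: "F x \<in> borel_measurable (M i)" if "x \<in> space (PiM I M)" for x
    using measurable_compose[OF measurable_Pair1'[OF that] F_meas2] by simp
  have F_int: "integrable (M i) (F x)" if "x \<in> space (PiM I M)" for x
    by (rule Mi.integrable_const_bound[of _ B]) (use F_meas[OF that] f_bd upd that in \<open>auto simp: F_def intro!: AE_I2\<close>)
  define g where "g x = integral\<^sup>L (M i) (F x)" for x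
  have g_meas: "g \<in> borel_measurable (PiM I M)"
    unfolding g_def by (rule sigma_finite_measure.borel_measurable_lebesgue_integral[OF prob_space_imp_sigma_finite[OF P] F_meas2])
  have g_bd: "\<forall>x\<in>space (PiM I M). \<bar>g x\<bar> \<le> B"
  proof
    fix x assume x: "x \<in> space (PiM I M)"
    have "\<bar>g x\<bar> \<le> integral\<^sup>L (M i) (\<lambda>_. B)"
      unfolding g_def by (rule abs_integral_le) (use F_int f_bd upd x in \<open>auto simp: F_def\<close>)
    then show "\<bar>g x\<bar> \<le> B" by (simp add: Mi.prob_space)
  qed
  have g_diff: "\<forall>j\<in>I. \<forall>x\<in>space (PiM I M). \<forall>y\<in>space (M j). \<bar>g x - g (x(j := y))\<bar> \<le> K"
  proof (intro ballI)
    fix j x y assume j: "j \<in> I" and x: "x \<in> space (PiM I M)" and y: "y \<in> space (M j)"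
    have x': "x(j := y) \<in> space (PiM I M)" using x y j by (auto simp: space_PiM PiE_def extensional_def)
    have ij: "i \<noteq> j" using insert.hyps j by auto
    have "\<bar>g x - g (x(j := y))\<bar> = \<bar>integral\<^sup>L (M i) (\<lambda>t. F x t - F (x(j := y)) t)\<bar>"
      unfolding g_def using F_int[OF x] F_int[OF x'] by simp
    also have "\<dots> \<le> integral\<^sup>L (M i) (\<lambda>_. K)"
    proof (rule abs_integral_le)
      fix t assume t: "t \<in> space (M i)"
      have "F (x(j := y)) t = f ((x(i := t))(j := y))" using ij by (simp add: F_def fun_upd_twist)
      then show "\<bar>F x t - F (x(j := y)) t\<bar> \<le> K"
        using f_diff[of j "x(i := t)" y] j upd[OF x t] y by (simp add: F_def)
    qed (use F_int x x' in auto)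
    finally show "\<bar>g x - g (x(j := y))\<bar> \<le> K" by (simp add: Mi.prob_space)
  qed
  have f_int: "integrable (PiM (insert i I) M) f"
    by (rule PiI.integrable_const_bound[of _ B]) (use f_meas f_bd in auto)
  have Ef: "integral\<^sup>L (PiM (insert i I) M) f = integral\<^sup>L (PiM I M) g"
    unfolding g_def F_def by (rule product_integral_insert[OF insert.hyps(1,2) f_int])
  define m where "m = integral\<^sup>L (PiM I M) g"
  have inner: "(\<integral>\<^sup>+y. ennreal (exp (l * (F x y - m))) \<partial>M i)
      \<le> ennreal (exp (l * (g x - m))) * ennreal (exp (l\<^sup>2 * (2 * K)\<^sup>2 / 8))" if x: "x \<in> space (PiM I M)" for x
  proof -
    obtain y0 where y0: "y0 \<in> space (M i)" using Mi.not_empty by auto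
    have rng: "F x y \<in> {F x y0 - K..F x y0 + K}" if "y \<in> space (M i)" for y
      using f_diff[of i "x(i := y)" y0] upd[OF x that] y0 by (auto simp: F_def abs_le_iff)
    interpret iv: interval_bounded_random_variable "M i" "F x" "F x y0 - K" "F x y0 + K"
      by unfold_locales (use F_meas[OF x] rng in auto)
    have "(\<integral>\<^sup>+y. ennreal (exp (l * (F x y - m))) \<partial>M i)
        = (\<integral>\<^sup>+y. ennreal (exp (l * (g x - m))) * ennreal (exp (l * (F x y - g x))) \<partial>M i)"
      by (intro nn_integral_cong) (simp add: ennreal_mult[symmetric] exp_add[symmetric] algebra_simps)
    also have "\<dots> = ennreal (exp (l * (g x - m))) * (\<integral>\<^sup>+y. ennreal (exp (l * (F x y - g x))) \<partial>M i)"
      by (intro nn_integral_cmult) (use F_meas[OF x] in measurable)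
    also have "\<dots> \<le> ennreal (exp (l * (g x - m))) * ennreal (exp (l\<^sup>2 * (2 * K)\<^sup>2 / 8))"
      using iv.Hoeffdings_lemma_nn_integral[OF l] by (intro mult_left_mono) (auto simp: g_def)
    finally show ?thesis .
  qed
  have "(\<integral>\<^sup>+x. ennreal (exp (l * (f x - integral\<^sup>L (PiM (insert i I) M) f))) \<partial>PiM (insert i I) M)
      = (\<integral>\<^sup>+x. \<integral>\<^sup>+y. ennreal (exp (l * (F x y - m))) \<partial>M i \<partial>PiM I M)"
    unfolding Ef m_def[symmetric] F_def
    by (rule product_nn_integral_insert[OF insert.hyps(1,2)]) (use f_meas in measurable)
  also have "\<dots> \<le> (\<integral>\<^sup>+x. ennreal (exp (l * (g x - m))) * ennreal (exp (l\<^sup>2 * (2 * K)\<^sup>2 / 8)) \<partial>PiM I M)"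
    by (intro nn_integral_mono inner)
  also have "\<dots> = (\<integral>\<^sup>+x. ennreal (exp (l * (g x - m))) \<partial>PiM I M) * ennreal (exp (l\<^sup>2 * (2 * K)\<^sup>2 / 8))"
    by (intro nn_integral_multc) (use g_meas in measurable)
  also have "\<dots> \<le> ennreal (exp (real (card I) * (l\<^sup>2 * (2 * K)\<^sup>2 / 8))) * ennreal (exp (l\<^sup>2 * (2 * K)\<^sup>2 / 8))"
    unfolding m_def by (intro mult_right_mono insert.IH[OF g_meas g_bd g_diff]) auto
  also have "\<dots> = ennreal (exp (real (card (insert i I)) * (l\<^sup>2 * (2 * K)\<^sup>2 / 8)))"
    using insert.hyps by (simp add: ennreal_mult[symmetric] exp_add[symmetric] algebra_simps)
  finally show ?case .
qed

lemma power4_le_exp: "x ^ 4 \<le> 64 * (exp x + exp (- x))" for x :: real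
proof -
  have "y ^ 4 \<le> 64 * exp y" if y: "y \<ge> 0" for y :: real
  proof -
    have "1 + y / 2 + (y / 2)\<^sup>2 / 2 \<le> exp (y / 2)" using y by (intro exp_lower_Taylor_quadratic) simp
    then have "(y / 2)\<^sup>2 / 2 \<le> exp (y / 2)" using y by linarith
    then have "((y / 2)\<^sup>2 / 2)\<^sup>2 \<le> (exp (y / 2))\<^sup>2" by (intro power_mono) auto
    also have "\<dots> = exp y" by (simp add: power2_eq_square exp_add[symmetric])
    finally show ?thesis by (simp add: power_divide)
  qed
  note le = this
  have "0 \<le> exp x" "0 \<le> exp (- x)" by simp_all
  moreover have "x ^ 4 \<le> 64 * exp x \<or> x ^ 4 \<le> 64 * exp (- x)"
    using le[of x] le[of "- x"] by (cases "0 \<le> x") simp_all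
  ultimately show ?thesis by (auto simp: distrib_left intro: order_trans)
qed

text \<open>The exponential moments with parameter \<open>1 / sqrt s\<close>, where \<open>s\<close> is the variance proxy, are at most \<open>exp 1\<close> and
  control the fourth power.\<close>

lemma mcdiarmid_fourth_moment:
  fixes M :: "'i \<Rightarrow> 'a measure"
  assumes P: "\<And>i. prob_space (M i)" and I: "finite I" "I \<noteq> {}" and K: "K > 0"
    and f: "f \<in> borel_measurable (PiM I M)" and bd: "\<forall>x\<in>space (PiM I M). \<bar>f x\<bar> \<le> B"
    and diff: "\<forall>i\<in>I. \<forall>x\<in>space (PiM I M). \<forall>y\<in>space (M i). \<bar>f x - f (x(i := y))\<bar> \<le> K"
  shows "(\<integral>\<^sup>+x. ennreal ((f x - integral\<^sup>L (PiM I M) f) ^ 4) \<partial>PiM I M) \<le> ennreal (96 * (real (card I))\<^sup>2 * K ^ 4)"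
proof -
  define m where "m = integral\<^sup>L (PiM I M) f"
  define s where "s = real (card I) * ((2 * K)\<^sup>2 / 8)"
  have s: "s > 0" using I K by (simp add: s_def card_gt_0_iff)
  define l where "l = 1 / sqrt s"
  have l: "l > 0" "l\<^sup>2 = 1 / s" using s by (simp_all add: l_def power_divide)
  have e: "real (card I) * (l\<^sup>2 * (2 * K)\<^sup>2 / 8) = 1"
  proof -
    have "real (card I) * (l\<^sup>2 * (2 * K)\<^sup>2 / 8) = l\<^sup>2 * s" by (simp add: s_def)
    also have "\<dots> = 1" unfolding l(2) using s by simp
    finally show ?thesis .
  qed
  have plus: "(\<integral>\<^sup>+x. ennreal (exp (l * (f x - m))) \<partial>PiM I M) \<le> ennreal (exp 1)"
    using mcdiarmid_mgf[OF P l(1) I(1) f bd diff] unfolding e m_def .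
  have f': "(\<lambda>x. - f x) \<in> borel_measurable (PiM I M)" using f by measurable
  have "(\<integral>\<^sup>+x. ennreal (exp (l * (- f x - integral\<^sup>L (PiM I M) (\<lambda>x. - f x)))) \<partial>PiM I M) \<le> ennreal (exp 1)"
    using mcdiarmid_mgf[OF P l(1) I(1) f', of B K] bd diff unfolding e by (simp add: abs_minus_commute)
  then have minus: "(\<integral>\<^sup>+x. ennreal (exp (- (l * (f x - m)))) \<partial>PiM I M) \<le> ennreal (exp 1)"
    by (simp add: m_def algebra_simps)
  have "(\<integral>\<^sup>+x. ennreal ((f x - m) ^ 4) \<partial>PiM I M)
      \<le> (\<integral>\<^sup>+x. ennreal (64 * s\<^sup>2) * (ennreal (exp (l * (f x - m))) + ennreal (exp (- (l * (f x - m))))) \<partial>PiM I M)"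
  proof (rule nn_integral_mono)
    fix x
    have "l ^ 4 * (f x - m) ^ 4 \<le> 64 * (exp (l * (f x - m)) + exp (- (l * (f x - m))))"
      using power4_le_exp[of "l * (f x - m)"] by (simp add: power_mult_distrib)
    moreover have "l ^ 4 = 1 / s\<^sup>2"
    proof -
      have "l ^ 4 = (l\<^sup>2)\<^sup>2" by simp
      then show ?thesis unfolding l(2) by (simp add: power_divide)
    qed
    ultimately have "(f x - m) ^ 4 \<le> 64 * s\<^sup>2 * (exp (l * (f x - m)) + exp (- (l * (f x - m))))"
      using s by (simp add: field_simps)
    then show "ennreal ((f x - m) ^ 4) \<le> ennreal (64 * s\<^sup>2) * (ennreal (exp (l * (f x - m))) + ennreal (exp (- (l * (f x - m)))))"
      by (simp add: ennreal_mult[symmetric] ennreal_plus[symmetric] ennreal_leI del: ennreal_plus)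
  qed
  also have "\<dots> = ennreal (64 * s\<^sup>2) * ((\<integral>\<^sup>+x. ennreal (exp (l * (f x - m))) \<partial>PiM I M) + (\<integral>\<^sup>+x. ennreal (exp (- (l * (f x - m)))) \<partial>PiM I M))"
    using f by (subst nn_integral_cmult, measurable, subst nn_integral_add, measurable)
  also have "\<dots> \<le> ennreal (64 * s\<^sup>2) * (ennreal (exp 1) + ennreal (exp 1))"
    by (intro mult_left_mono add_mono plus minus) auto
  also have "\<dots> = ennreal (64 * s\<^sup>2 * (exp 1 + exp 1))"
    by (simp add: ennreal_mult[symmetric] ennreal_plus[symmetric] del: ennreal_plus)
  also have "\<dots> \<le> ennreal (64 * s\<^sup>2 * (3 + 3))"
    using exp_le by (intro ennreal_leI mult_left_mono add_mono) auto
  also have "64 * s\<^sup>2 * (3 + 3) = 96 * (real (card I))\<^sup>2 * K ^ 4"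
    by (simp add: s_def power_mult_distrib power_divide)
  finally show ?thesis unfolding m_def .
qed

text \<open>One step of the induction for sums of independent variables: the cross term with \<open>q\<close> has mean zero.\<close>

lemma nn_integral_shift_sq:
  fixes \<phi> :: "'a \<Rightarrow> complex"
  assumes "prob_space \<mu>" and \<phi> [measurable]: "\<phi> \<in> borel_measurable \<mu>" and sq: "integrable \<mu> (\<lambda>y. (cmod (\<phi> y))\<^sup>2)"
    and mean: "integral\<^sup>L \<mu> \<phi> = 0" and v: "integral\<^sup>L \<mu> (\<lambda>y. (cmod (\<phi> y))\<^sup>2) \<le> v"
  shows "integrable \<mu> \<phi>" "(\<integral>\<^sup>+y. ennreal ((cmod (q + \<phi> y))\<^sup>2) \<partial>\<mu>) \<le> ennreal ((cmod q)\<^sup>2 + v)"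
proof -
  interpret prob_space \<mu> by fact
  show int: "integrable \<mu> \<phi>"
  proof (rule Bochner_Integration.integrable_bound[of \<mu> "\<lambda>y. 1 + (cmod (\<phi> y))\<^sup>2"])
    show "AE y in \<mu>. norm (\<phi> y) \<le> norm (1 + (cmod (\<phi> y))\<^sup>2)"
    proof (rule AE_I2)
      fix y
      have "0 \<le> (cmod (\<phi> y) - 1)\<^sup>2" by simp
      then have "2 * cmod (\<phi> y) \<le> 1 + (cmod (\<phi> y))\<^sup>2" by (simp add: power2_diff)
      then have "cmod (\<phi> y) \<le> 1 + (cmod (\<phi> y))\<^sup>2" using norm_ge_zero[of "\<phi> y"] by linarith
      then show "norm (\<phi> y) \<le> norm (1 + (cmod (\<phi> y))\<^sup>2)" by simp
    qed
  qed (use sq in auto)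
  define R where "R y = Re (cnj q * \<phi> y)" for y
  have eq: "(cmod (q + \<phi> y))\<^sup>2 = (cmod q)\<^sup>2 + 2 * R y + (cmod (\<phi> y))\<^sup>2" for y
    unfolding cmod_power2 R_def by (simp add: power2_eq_square algebra_simps)
  have i1: "integrable \<mu> (\<lambda>y. cnj q * \<phi> y)" using int by simp
  have i2: "integrable \<mu> R" unfolding R_def using i1 by (rule integrable_Re)
  have z: "integral\<^sup>L \<mu> R = 0"
    unfolding R_def using integral_Re[OF i1] by (simp add: mean)
  have i3: "integrable \<mu> (\<lambda>y. (cmod (q + \<phi> y))\<^sup>2)"
    unfolding eq using i2 sq by (intro Bochner_Integration.integrable_add integrable_mult_right) auto
  have "(\<integral>\<^sup>+y. ennreal ((cmod (q + \<phi> y))\<^sup>2) \<partial>\<mu>) = ennreal (LINT y|\<mu>. (cmod (q + \<phi> y))\<^sup>2)"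
    by (intro nn_integral_eq_integral i3) auto
  also have "(LINT y|\<mu>. (cmod (q + \<phi> y))\<^sup>2) = (cmod q)\<^sup>2 + integral\<^sup>L \<mu> (\<lambda>y. (cmod (\<phi> y))\<^sup>2)"
    unfolding eq using i2 sq z by (simp add: prob_space)
  also have "ennreal \<dots> \<le> ennreal ((cmod q)\<^sup>2 + v)" using v by (intro ennreal_leI) simp
  finally show "(\<integral>\<^sup>+y. ennreal ((cmod (q + \<phi> y))\<^sup>2) \<partial>\<mu>) \<le> ennreal ((cmod q)\<^sup>2 + v)" .
qed

lemma independent_sum_second_moment:
  fixes M :: "'i \<Rightarrow> 'a measure" and \<phi> :: "'i \<Rightarrow> 'a \<Rightarrow> complex"
  assumes P: "\<And>i. prob_space (M i)" and J: "finite J"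
    and \<phi>: "\<forall>i\<in>J. \<phi> i \<in> borel_measurable (M i) \<and> integrable (M i) (\<lambda>y. (cmod (\<phi> i y))\<^sup>2)
      \<and> integral\<^sup>L (M i) (\<phi> i) = 0 \<and> integral\<^sup>L (M i) (\<lambda>y. (cmod (\<phi> i y))\<^sup>2) \<le> v i"
  shows "(\<integral>\<^sup>+x. ennreal ((cmod (q + (\<Sum>i\<in>J. \<phi> i (x i))))\<^sup>2) \<partial>PiM J M) \<le> ennreal ((cmod q)\<^sup>2 + (\<Sum>i\<in>J. v i))"
  using J \<phi>
proof (induction J arbitrary: q rule: finite_induct)
  case empty
  show ?case by (simp add: PiM_empty nn_integral_count_space_finite)
next
  case (insert i J)
  interpret product_sigma_finite M
    by (intro product_sigma_finite.intro prob_space_imp_sigma_finite P)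
  interpret Mi: prob_space "M i" by (rule P)
  have [measurable]: "\<phi> j \<in> borel_measurable (M j)" if "j \<in> insert i J" for j using insert.prems that by blast
  have v0: "0 \<le> v j" if "j \<in> insert i J" for j
  proof -
    have "0 \<le> integral\<^sup>L (M j) (\<lambda>y. (cmod (\<phi> j y))\<^sup>2)" by simp
    also have "\<dots> \<le> v j" using insert.prems that by blast
    finally show ?thesis .
  qed
  have "(\<lambda>x. \<phi> j (x j)) \<in> borel_measurable (PiM (insert i J) M)" if "j \<in> insert i J" for j
    by (rule measurable_compose[OF measurable_component_singleton[OF that]]) (use that in measurable)
  then have meas: "(\<lambda>x. ennreal ((cmod (q + (\<Sum>j\<in>insert i J. \<phi> j (x j))))\<^sup>2)) \<in> borel_measurable (PiM (insert i J) M)"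
    by (intro measurable_compose[OF _ measurable_ennreal] borel_measurable_power borel_measurable_norm borel_measurable_add borel_measurable_const borel_measurable_sum) auto
  have upd: "(\<Sum>j\<in>insert i J. \<phi> j ((x(i := y)) j)) = \<phi> i y + (\<Sum>j\<in>J. \<phi> j (x j))" for x y
    using insert.hyps by (subst sum.insert) (auto intro!: sum.cong arg_cong2[of _ _ _ _ "(+)"])
  have "(\<integral>\<^sup>+x. ennreal ((cmod (q + (\<Sum>j\<in>insert i J. \<phi> j (x j))))\<^sup>2) \<partial>PiM (insert i J) M)
      = (\<integral>\<^sup>+y. \<integral>\<^sup>+x. ennreal ((cmod ((q + \<phi> i y) + (\<Sum>j\<in>J. \<phi> j (x j))))\<^sup>2) \<partial>PiM J M \<partial>M i)"
    by (subst product_nn_integral_insert_rev[OF insert.hyps(1,2) meas]) (simp only: upd add.assoc)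
  also have "\<dots> \<le> (\<integral>\<^sup>+y. ennreal ((cmod (q + \<phi> i y))\<^sup>2 + (\<Sum>j\<in>J. v j)) \<partial>M i)"
    using insert.prems by (intro nn_integral_mono insert.IH) auto
  also have "\<dots> = (\<integral>\<^sup>+y. ennreal ((cmod (q + \<phi> i y))\<^sup>2) + ennreal (\<Sum>j\<in>J. v j) \<partial>M i)"
    using v0 by (intro nn_integral_cong ennreal_plus) (auto intro!: sum_nonneg)
  also have "\<dots> = (\<integral>\<^sup>+y. ennreal ((cmod (q + \<phi> i y))\<^sup>2) \<partial>M i) + ennreal (\<Sum>j\<in>J. v j)"
    by (subst nn_integral_add) (simp_all add: Mi.emeasure_space_1)
  also have "\<dots> \<le> ennreal ((cmod q)\<^sup>2 + v i) + ennreal (\<Sum>j\<in>J. v j)"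
    using insert.prems by (intro add_right_mono nn_integral_shift_sq(2)[OF P]) auto
  also have "\<dots> = ennreal ((cmod q)\<^sup>2 + (\<Sum>j\<in>insert i J. v j))"
    using insert.hyps v0 by (subst ennreal_plus[symmetric]) (auto intro!: sum_nonneg add_nonneg_nonneg simp: add.assoc)
  finally show ?case .
qed

lemma nn_integral_norm_le_of_sq:
  assumes "s > 0" "f \<in> borel_measurable \<mu>" "prob_space \<mu>" "(\<integral>\<^sup>+x. ennreal ((cmod (f x))\<^sup>2) \<partial>\<mu>) \<le> ennreal (s\<^sup>2)"
  shows "(\<integral>\<^sup>+x. ennreal (cmod (f x)) \<partial>\<mu>) \<le> ennreal s"
proof -
  interpret prob_space \<mu> by fact
  have [measurable]: "f \<in> borel_measurable \<mu>" by fact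
  have "(\<integral>\<^sup>+x. ennreal (cmod (f x)) \<partial>\<mu>) \<le> (\<integral>\<^sup>+x. ennreal (s / 2) + ennreal (1 / (2 * s)) * ennreal ((cmod (f x))\<^sup>2) \<partial>\<mu>)"
  proof (rule nn_integral_mono)
    fix x
    have "0 \<le> (cmod (f x) - s)\<^sup>2" by simp
    then have "2 * s * cmod (f x) \<le> s\<^sup>2 + (cmod (f x))\<^sup>2" by (simp add: power2_diff mult_ac)
    then have "cmod (f x) \<le> s / 2 + 1 / (2 * s) * (cmod (f x))\<^sup>2"
      using \<open>s > 0\<close> by (simp add: field_simps power2_eq_square)
    then show "ennreal (cmod (f x)) \<le> ennreal (s / 2) + ennreal (1 / (2 * s)) * ennreal ((cmod (f x))\<^sup>2)"
      using \<open>s > 0\<close> by (simp add: ennreal_mult[symmetric] ennreal_plus[symmetric] ennreal_leI del: ennreal_plus)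
  qed
  also have "\<dots> = ennreal (s / 2) + ennreal (1 / (2 * s)) * (\<integral>\<^sup>+x. ennreal ((cmod (f x))\<^sup>2) \<partial>\<mu>)"
    by (subst nn_integral_add, measurable, subst nn_integral_cmult, measurable) (simp add: emeasure_space_1)
  also have "\<dots> \<le> ennreal (s / 2) + ennreal (1 / (2 * s)) * ennreal (s\<^sup>2)"
    using assms(4) by (intro add_left_mono mult_left_mono) auto
  also have "\<dots> = ennreal s"
    using \<open>s > 0\<close> by (simp add: ennreal_mult[symmetric] ennreal_plus[symmetric] power2_eq_square del: ennreal_plus)
  finally show ?thesis .
qed

section \<open>Quadratic forms in independent entries\<close>

lemma sum_insert_insert:
  fixes g :: "'i \<Rightarrow> 'i \<Rightarrow> 'b::comm_monoid_add"
  assumes "finite J" "m \<notin> J"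
  shows "(\<Sum>i\<in>insert m J. \<Sum>l\<in>insert m J. g i l)
    = (\<Sum>i\<in>J. \<Sum>l\<in>J. g i l) + (\<Sum>i\<in>J. g i m) + (\<Sum>l\<in>J. g m l) + g m m"
  using assms by (simp add: sum.distrib add_ac)

text \<open>The quadratic form of \<open>A\<close> without its diagonal. Its second moment involves only second moments of the
  entries.\<close>

definition offdiag :: "('i \<Rightarrow> 'i \<Rightarrow> complex) \<Rightarrow> 'i set \<Rightarrow> ('i \<Rightarrow> complex) \<Rightarrow> complex" where
  "offdiag A J x = (\<Sum>i\<in>J. \<Sum>l\<in>J. if i = l then 0 else cnj (x i) * A i l * x l)"

text \<open>Centred entries with unit variance; the laws may differ from entry to entry.\<close>

definition standard_on :: "'i set \<Rightarrow> ('i \<Rightarrow> complex measure) \<Rightarrow> bool" where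
  "standard_on J M \<longleftrightarrow> (\<forall>i\<in>J. sets (M i) = sets borel \<and> integrable (M i) (\<lambda>y. (cmod y)\<^sup>2)
     \<and> integral\<^sup>L (M i) (\<lambda>y. y) = 0 \<and> integral\<^sup>L (M i) (\<lambda>y. (cmod y)\<^sup>2) = 1)"

lemma component_measurable:
  assumes "i \<in> J" "sets (M i) = sets borel"
  shows "(\<lambda>x. x i) \<in> borel_measurable (PiM J M)"
  using measurable_component_singleton[OF assms(1), of M] assms(2) by (simp cong: measurable_cong_sets)

lemma borel_measurable_cnj_comp:
  "f \<in> borel_measurable M \<Longrightarrow> (\<lambda>x. cnj (f x)) \<in> borel_measurable M"
  by (rule measurable_compose[OF _ borel_measurable_continuous_onI]) (auto intro: continuous_intros)

lemma offdiag_measurable: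
  assumes "\<And>i. i \<in> J \<Longrightarrow> (\<lambda>x. x i) \<in> borel_measurable M"
  shows "offdiag A J \<in> borel_measurable M"
proof -
  have "(\<lambda>x. if i = l then 0 else cnj (x i) * A i l * x l) \<in> borel_measurable M" if "i \<in> J" "l \<in> J" for i l
    using assms that by (cases "i = l") (auto intro!: borel_measurable_times borel_measurable_cnj_comp)
  then show ?thesis unfolding offdiag_def[abs_def] by (intro borel_measurable_sum)
qed

text \<open>Adding the coordinate \<open>m\<close> adds two terms, linear in \<open>x m\<close> and in its conjugate, whose coefficients are
  independent of \<open>x m\<close>; the cross terms with the earlier part vanish since \<open>x m\<close> is centred. The factor 2 is the
  price for estimating these two terms separately.\<close>

lemma offdiag_second_moment:
  fixes M :: "'i \<Rightarrow> complex measure" and A :: "'i \<Rightarrow> 'i \<Rightarrow> complex"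
  assumes P: "\<And>i. prob_space (M i)" and J: "finite J" and std: "standard_on J M"
  shows "(\<integral>\<^sup>+x. ennreal ((cmod (offdiag A J x))\<^sup>2) \<partial>PiM J M) \<le> ennreal (2 * (\<Sum>i\<in>J. \<Sum>l\<in>J. (cmod (A i l))\<^sup>2))"
  using J std
proof (induction J rule: finite_induct)
  case empty
  show ?case by (simp add: offdiag_def)
next
  case (insert m J)
  interpret product_sigma_finite M
    by (intro product_sigma_finite.intro prob_space_imp_sigma_finite P)
  interpret Mm: prob_space "M m" by (rule P)
  have stdJ: "standard_on J M" using insert.prems by (simp add: standard_on_def)
  have std: "sets (M i) = sets borel" "integrable (M i) (\<lambda>y. (cmod y)\<^sup>2)"
     "integral\<^sup>L (M i) (\<lambda>y. y) = 0" "integral\<^sup>L (M i) (\<lambda>y. (cmod y)\<^sup>2) = 1" if "i \<in> insert m J" for i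
    using insert.prems that by (auto simp: standard_on_def)
  have bm: "borel_measurable (M i) = borel_measurable borel" if "i \<in> insert m J" for i
    by (rule measurable_cong_sets) (simp_all add: std(1)[OF that])
  have idm: "(\<lambda>y. y) \<in> borel_measurable (M i)" if "i \<in> insert m J" for i
    unfolding bm[OF that] by simp
  have comp: "(\<lambda>x. x i) \<in> borel_measurable (PiM K M)" if "i \<in> K" "K \<subseteq> insert m J" for i K
    using that std(1) by (intro component_measurable) auto
  define \<alpha> where "\<alpha> x = (\<Sum>i\<in>J. cnj (x i) * A i m)" for x
  define \<beta> where "\<beta> x = (\<Sum>l\<in>J. A m l * x l)" for x
  have off_meas: "(\<lambda>x. ennreal ((cmod (offdiag A K x))\<^sup>2)) \<in> borel_measurable (PiM K M)" if "K \<subseteq> insert m J" for K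
  proof -
    have [measurable]: "offdiag A K \<in> borel_measurable (PiM K M)" by (intro offdiag_measurable comp that)
    show ?thesis by measurable
  qed
  have [measurable]: "(\<lambda>x. x i) \<in> borel_measurable (PiM J M)" if "i \<in> J" for i
    using that by (intro comp) auto
  have \<alpha>\<beta> [measurable]: "\<alpha> \<in> borel_measurable (PiM J M)" "\<beta> \<in> borel_measurable (PiM J M)"
    unfolding \<alpha>_def[abs_def] \<beta>_def[abs_def]
    by (intro borel_measurable_sum borel_measurable_times borel_measurable_cnj_comp borel_measurable_const comp; blast)+
  have upd: "offdiag A (insert m J) (x(m := y)) = offdiag A J x + (cnj y * \<beta> x + y * \<alpha> x)" for x y
  proof -
    define g where "g i l = (if i = l then 0 else cnj ((x(m := y)) i) * A i l * (x(m := y)) l)" for i l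
    have "offdiag A (insert m J) (x(m := y)) = (\<Sum>i\<in>J. \<Sum>l\<in>J. g i l) + (\<Sum>i\<in>J. g i m) + (\<Sum>l\<in>J. g m l) + g m m"
      unfolding offdiag_def g_def[symmetric] by (rule sum_insert_insert[OF insert.hyps(1,2)])
    also have "(\<Sum>i\<in>J. \<Sum>l\<in>J. g i l) = offdiag A J x"
      unfolding offdiag_def g_def using insert.hyps by (intro sum.cong refl) auto
    also have "(\<Sum>i\<in>J. g i m) = y * \<alpha> x"
      unfolding \<alpha>_def g_def sum_distrib_left using insert.hyps by (intro sum.cong refl) auto
    also have "(\<Sum>l\<in>J. g m l) = cnj y * \<beta> x"
      unfolding \<beta>_def g_def sum_distrib_left using insert.hyps by (intro sum.cong refl) auto
    also have "g m m = 0" by (simp add: g_def)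
    finally have "offdiag A (insert m J) (x(m := y)) = offdiag A J x + y * \<alpha> x + cnj y * \<beta> x + 0" .
    then show ?thesis by (simp only: add_0_right add.assoc add.commute[of "y * \<alpha> x"])
  qed
  have inner: "(\<integral>\<^sup>+y. ennreal ((cmod (q + (cnj y * b + y * a)))\<^sup>2) \<partial>M m) \<le> ennreal ((cmod q)\<^sup>2 + 2 * ((cmod a)\<^sup>2 + (cmod b)\<^sup>2))" for q a b
  proof (rule nn_integral_shift_sq(2)[OF P])
    note i0 = insertI1[of m J]
    have int: "integrable (M m) (\<lambda>y. y)"
      by (rule nn_integral_shift_sq(1)[OF P idm[OF i0] std(2)[OF i0] std(3)[OF i0] order_refl])
    have bd: "(cmod (cnj y * b + y * a))\<^sup>2 \<le> 2 * ((cmod a)\<^sup>2 + (cmod b)\<^sup>2) * (cmod y)\<^sup>2" for y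
    proof -
      have "cmod (cnj y * b + y * a) \<le> cmod y * (cmod b + cmod a)"
        using norm_triangle_ineq[of "cnj y * b" "y * a"] by (simp add: norm_mult distrib_left)
      then have "(cmod (cnj y * b + y * a))\<^sup>2 \<le> (cmod y * (cmod b + cmod a))\<^sup>2" by (intro power_mono) auto
      also have "\<dots> = (cmod y)\<^sup>2 * (cmod b + cmod a)\<^sup>2" by (rule power_mult_distrib)
      also have "\<dots> \<le> (cmod y)\<^sup>2 * (2 * ((cmod a)\<^sup>2 + (cmod b)\<^sup>2))"
      proof (intro mult_left_mono)
        have "0 \<le> (cmod b - cmod a)\<^sup>2" by simp
        then show "(cmod b + cmod a)\<^sup>2 \<le> 2 * ((cmod a)\<^sup>2 + (cmod b)\<^sup>2)" by (simp add: power2_sum power2_diff)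
      qed simp
      finally show ?thesis by (simp add: mult.commute)
    qed
    show meas: "(\<lambda>y. cnj y * b + y * a) \<in> borel_measurable (M m)" unfolding bm[OF i0]
      by (intro borel_measurable_add borel_measurable_times borel_measurable_cnj_comp) auto
    show "integral\<^sup>L (M m) (\<lambda>y. cnj y * b + y * a) = 0"
      using int by (simp add: std(3)[OF i0])
    show sq: "integrable (M m) (\<lambda>y. (cmod (cnj y * b + y * a))\<^sup>2)"
    proof (rule Bochner_Integration.integrable_bound)
      show "integrable (M m) (\<lambda>y. 2 * ((cmod a)\<^sup>2 + (cmod b)\<^sup>2) * (cmod y)\<^sup>2)" using std(2)[OF i0] by simp
      show "(\<lambda>y. (cmod (cnj y * b + y * a))\<^sup>2) \<in> borel_measurable (M m)" using meas by measurable
      show "AE y in M m. norm ((cmod (cnj y * b + y * a))\<^sup>2) \<le> norm (2 * ((cmod a)\<^sup>2 + (cmod b)\<^sup>2) * (cmod y)\<^sup>2)"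
        using bd by (intro AE_I2) (simp add: abs_mult)
    qed
    have "(LINT y|M m. (cmod (cnj y * b + y * a))\<^sup>2) \<le> (LINT y|M m. 2 * ((cmod a)\<^sup>2 + (cmod b)\<^sup>2) * (cmod y)\<^sup>2)"
      by (intro integral_mono sq bd) (use std(2)[OF i0] in simp)
    then show "(LINT y|M m. (cmod (cnj y * b + y * a))\<^sup>2) \<le> 2 * ((cmod a)\<^sup>2 + (cmod b)\<^sup>2)"
      by (simp add: std(4)[OF i0])
  qed
  have lin\<alpha>: "(\<integral>\<^sup>+x. ennreal ((cmod (\<alpha> x))\<^sup>2) \<partial>PiM J M) \<le> ennreal (\<Sum>i\<in>J. (cmod (A i m))\<^sup>2)"
  proof -
    have "\<forall>i\<in>J. (\<lambda>y. cnj y * A i m) \<in> borel_measurable (M i) \<and> integrable (M i) (\<lambda>y. (cmod (cnj y * A i m))\<^sup>2)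
      \<and> integral\<^sup>L (M i) (\<lambda>y. cnj y * A i m) = 0 \<and> integral\<^sup>L (M i) (\<lambda>y. (cmod (cnj y * A i m))\<^sup>2) \<le> (cmod (A i m))\<^sup>2"
    proof
      fix i assume "i \<in> J"
      then have i: "i \<in> insert m J" by simp
      show "(\<lambda>y. cnj y * A i m) \<in> borel_measurable (M i) \<and> integrable (M i) (\<lambda>y. (cmod (cnj y * A i m))\<^sup>2)
        \<and> integral\<^sup>L (M i) (\<lambda>y. cnj y * A i m) = 0 \<and> integral\<^sup>L (M i) (\<lambda>y. (cmod (cnj y * A i m))\<^sup>2) \<le> (cmod (A i m))\<^sup>2"
      proof -
        have "(\<lambda>y. cnj y * A i m) \<in> borel_measurable borel"
          by (intro borel_measurable_times borel_measurable_cnj_comp) auto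
        then show ?thesis unfolding bm[OF i] using std[OF i] by (simp add: norm_mult power_mult_distrib)
      qed
    qed
    from independent_sum_second_moment[OF P insert.hyps(1) this, of 0]
    show ?thesis by (simp add: \<alpha>_def)
  qed
  have lin\<beta>: "(\<integral>\<^sup>+x. ennreal ((cmod (\<beta> x))\<^sup>2) \<partial>PiM J M) \<le> ennreal (\<Sum>l\<in>J. (cmod (A m l))\<^sup>2)"
  proof -
    have "\<forall>l\<in>J. (\<lambda>y. A m l * y) \<in> borel_measurable (M l) \<and> integrable (M l) (\<lambda>y. (cmod (A m l * y))\<^sup>2)
      \<and> integral\<^sup>L (M l) (\<lambda>y. A m l * y) = 0 \<and> integral\<^sup>L (M l) (\<lambda>y. (cmod (A m l * y))\<^sup>2) \<le> (cmod (A m l))\<^sup>2"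
    proof
      fix l assume "l \<in> J"
      then have l: "l \<in> insert m J" by simp
      show "(\<lambda>y. A m l * y) \<in> borel_measurable (M l) \<and> integrable (M l) (\<lambda>y. (cmod (A m l * y))\<^sup>2)
        \<and> integral\<^sup>L (M l) (\<lambda>y. A m l * y) = 0 \<and> integral\<^sup>L (M l) (\<lambda>y. (cmod (A m l * y))\<^sup>2) \<le> (cmod (A m l))\<^sup>2"
        unfolding bm[OF l] using std[OF l] by (simp add: norm_mult power_mult_distrib)
    qed
    from independent_sum_second_moment[OF P insert.hyps(1) this, of 0]
    show ?thesis by (simp add: \<beta>_def)
  qed
  have "(\<integral>\<^sup>+x. ennreal ((cmod (offdiag A (insert m J) x))\<^sup>2) \<partial>PiM (insert m J) M)
      = (\<integral>\<^sup>+x. \<integral>\<^sup>+y. ennreal ((cmod (offdiag A J x + (cnj y * \<beta> x + y * \<alpha> x)))\<^sup>2) \<partial>M m \<partial>PiM J M)"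
    by (subst product_nn_integral_insert[OF insert.hyps(1,2) off_meas[OF order_refl]]) (simp only: upd)
  also have "\<dots> \<le> (\<integral>\<^sup>+x. ennreal ((cmod (offdiag A J x))\<^sup>2 + 2 * ((cmod (\<alpha> x))\<^sup>2 + (cmod (\<beta> x))\<^sup>2)) \<partial>PiM J M)"
    by (intro nn_integral_mono inner)
  also have "\<dots> = (\<integral>\<^sup>+x. ennreal ((cmod (offdiag A J x))\<^sup>2) + (2 * ennreal ((cmod (\<alpha> x))\<^sup>2) + 2 * ennreal ((cmod (\<beta> x))\<^sup>2)) \<partial>PiM J M)"
    by (intro nn_integral_cong) (simp add: ennreal_plus ennreal_mult distrib_left)
  also have "\<dots> = (\<integral>\<^sup>+x. ennreal ((cmod (offdiag A J x))\<^sup>2) \<partial>PiM J M) +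
      (2 * (\<integral>\<^sup>+x. ennreal ((cmod (\<alpha> x))\<^sup>2) \<partial>PiM J M) + 2 * (\<integral>\<^sup>+x. ennreal ((cmod (\<beta> x))\<^sup>2) \<partial>PiM J M))"
    by (subst nn_integral_add, rule off_meas, blast, measurable, subst nn_integral_add, measurable,
        subst nn_integral_cmult, measurable, subst nn_integral_cmult, measurable)
  also have "\<dots> \<le> ennreal (2 * (\<Sum>i\<in>J. \<Sum>l\<in>J. (cmod (A i l))\<^sup>2)) +
      (2 * ennreal (\<Sum>i\<in>J. (cmod (A i m))\<^sup>2) + 2 * ennreal (\<Sum>l\<in>J. (cmod (A m l))\<^sup>2))"
    by (intro add_mono mult_left_mono insert.IH[OF stdJ] lin\<alpha> lin\<beta>) auto
  also have "\<dots> = ennreal (2 * (\<Sum>i\<in>J. \<Sum>l\<in>J. (cmod (A i l))\<^sup>2) + (2 * (\<Sum>i\<in>J. (cmod (A i m))\<^sup>2) + 2 * (\<Sum>l\<in>J. (cmod (A m l))\<^sup>2)))"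
    by (simp add: ennreal_plus ennreal_mult sum_nonneg)
  also have "\<dots> \<le> ennreal (2 * (\<Sum>i\<in>insert m J. \<Sum>l\<in>insert m J. (cmod (A i l))\<^sup>2))"
    unfolding sum_insert_insert[OF insert.hyps(1,2)] by (intro ennreal_leI) simp
  finally show ?case .
qed

text \<open>Truncate at \<open>H\<close>: the small part of \<open>(cmod (x i))\<^sup>2\<close> has second moment at most \<open>H\<^sup>2\<close>, and the sum of the centred small
  parts is estimated in mean square; the large part is estimated in mean, together with its expectation.\<close>

lemma diagonal_fluctuation:
  fixes M :: "'i \<Rightarrow> complex measure" and b :: "'i \<Rightarrow> complex"
  assumes prob: "\<And>i. prob_space (M i)" and J: "finite J" "J \<noteq> {}" and std: "standard_on J M"
    and a: "a > 0" "\<And>i. i \<in> J \<Longrightarrow> cmod (b i) \<le> a" and H: "H > 0"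
  shows "(\<integral>\<^sup>+x. ennreal (cmod (\<Sum>i\<in>J. b i * of_real ((cmod (x i))\<^sup>2 - 1))) \<partial>PiM J M)
    \<le> ennreal (a * H * sqrt (card J) + 2 * a * (\<Sum>i\<in>J. LINT y|M i. (cmod y)\<^sup>2 * of_bool (cmod y \<ge> H)))"
proof -
  interpret product_prob_space M J
    by (intro product_prob_space.intro product_prob_space_axioms.intro product_sigma_finite.intro prob_space_imp_sigma_finite prob)
  have std: "sets (M i) = sets borel" "integrable (M i) (\<lambda>y. (cmod y)\<^sup>2)"
     "integral\<^sup>L (M i) (\<lambda>y. y) = 0" "integral\<^sup>L (M i) (\<lambda>y. (cmod y)\<^sup>2) = 1" if "i \<in> J" for i
    using std that by (auto simp: standard_on_def)
  have bm: "borel_measurable (M i) = borel_measurable borel" if "i \<in> J" for i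
    by (rule measurable_cong_sets) (simp_all add: std(1)[OF that])
  have bm': "borel_measurable (M i) = borel_measurable borel" if "i \<in> J" for i
    by (rule measurable_cong_sets) (simp_all add: std(1)[OF that])
  define T where "T y = (cmod y)\<^sup>2 * of_bool (cmod y < H)" for y :: complex
  define R where "R y = (cmod y)\<^sup>2 * of_bool (cmod y \<ge> H)" for y :: complex
  have TR: "(cmod y)\<^sup>2 = T y + R y" for y by (simp add: T_def R_def)
  have T0: "0 \<le> T y" "0 \<le> R y" for y by (simp_all add: T_def R_def)
  have TH: "T y \<le> H\<^sup>2" for y using H by (auto simp: T_def intro!: power_mono)
  have Tm: "T \<in> borel_measurable borel" "R \<in> borel_measurable borel"
    unfolding T_def R_def by measurable
  have intT: "integrable (M i) T" "integrable (M i) R" if "i \<in> J" for i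
  proof -
    show "integrable (M i) T"
      by (rule Bochner_Integration.integrable_bound[OF std(2)[OF that]])
        (use Tm T0 in \<open>auto simp: bm[OF that] TR\<close>)
    show "integrable (M i) R"
      by (rule Bochner_Integration.integrable_bound[OF std(2)[OF that]])
        (use Tm T0 in \<open>auto simp: bm[OF that] TR\<close>)
  qed
  define t where "t i = integral\<^sup>L (M i) T" for i
  define r where "r i = integral\<^sup>L (M i) R" for i
  have tr: "t i + r i = 1" if "i \<in> J" for i
    using std(4)[OF that] intT[OF that] by (simp add: t_def r_def TR)
  have r0: "0 \<le> r i" "0 \<le> t i" for i unfolding r_def t_def using T0 by (auto intro!: integral_nonneg_AE)
  have t1: "t i \<le> 1" if "i \<in> J" for i using tr[OF that] r0(1)[of i] by linarith
  have comp [measurable]: "(\<lambda>x. x i) \<in> borel_measurable (PiM J M)" if "i \<in> J" for i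
    using that std(1) by (intro component_measurable) auto
  have Tc [measurable]: "(\<lambda>x. T (x i)) \<in> borel_measurable (PiM J M)" "(\<lambda>x. R (x i)) \<in> borel_measurable (PiM J M)" if "i \<in> J" for i
    using measurable_compose[OF comp[OF that] Tm(1)] measurable_compose[OF comp[OF that] Tm(2)] by auto
  define X where "X x = (\<Sum>i\<in>J. b i * of_real (T (x i) - t i))" for x
  have Xm [measurable]: "X \<in> borel_measurable (PiM J M)" unfolding X_def by measurable
  define s where "s = a * H * sqrt (card J)"
  have s: "s > 0" using a H J by (simp add: s_def card_gt_0_iff)
  have X2: "(\<integral>\<^sup>+x. ennreal ((cmod (X x))\<^sup>2) \<partial>PiM J M) \<le> ennreal (s\<^sup>2)"
  proof -
    have "\<forall>i\<in>J. (\<lambda>y. b i * of_real (T y - t i)) \<in> borel_measurable (M i)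
      \<and> integrable (M i) (\<lambda>y. (cmod (b i * of_real (T y - t i)))\<^sup>2)
      \<and> integral\<^sup>L (M i) (\<lambda>y. b i * of_real (T y - t i)) = 0
      \<and> integral\<^sup>L (M i) (\<lambda>y. (cmod (b i * of_real (T y - t i)))\<^sup>2) \<le> a\<^sup>2 * H\<^sup>2"
    proof
      fix i assume i: "i \<in> J"
      have mass: "measure (M i) (space (M i)) = 1" by (rule prob_space.prob_space[OF prob])
      have intT2: "integrable (M i) (\<lambda>y. (T y)\<^sup>2)"
      proof (rule Bochner_Integration.integrable_bound[of _ "\<lambda>y. H\<^sup>2 * T y"])
        show "AE y in M i. norm ((T y)\<^sup>2) \<le> norm (H\<^sup>2 * T y)"
          using TH T0 by (intro AE_I2) (simp add: power2_eq_square mult_right_mono abs_mult)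
      qed (use intT[OF i] Tm in \<open>auto simp: bm[OF i]\<close>)
      have eq: "(\<lambda>y. (cmod (b i * of_real (T y - t i)))\<^sup>2) = (\<lambda>y. (cmod (b i))\<^sup>2 * ((T y)\<^sup>2 - 2 * t i * T y + (t i)\<^sup>2))"
        by (rule ext) (simp add: norm_mult power_mult_distrib power2_diff del: of_real_diff)
      have m1: "(\<lambda>y. b i * of_real (T y - t i)) \<in> borel_measurable (M i)"
        unfolding bm'[OF i] using Tm by measurable
      have m2: "integrable (M i) (\<lambda>y. (cmod (b i * of_real (T y - t i)))\<^sup>2)"
        unfolding eq using intT2 intT[OF i] by simp
      have m3: "integral\<^sup>L (M i) (\<lambda>y. b i * of_real (T y - t i)) = 0"
        using intT[OF i] by (simp add: t_def mass)
      have "integral\<^sup>L (M i) (\<lambda>y. (cmod (b i * of_real (T y - t i)))\<^sup>2) = (cmod (b i))\<^sup>2 * (integral\<^sup>L (M i) (\<lambda>y. (T y)\<^sup>2) - (t i)\<^sup>2)"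
        unfolding eq using intT2 intT[OF i] by (simp add: t_def[symmetric] mass power2_eq_square)
      also have "\<dots> \<le> a\<^sup>2 * H\<^sup>2"
      proof (intro mult_mono power_mono a(2)[OF i])
        have "integral\<^sup>L (M i) (\<lambda>y. (T y)\<^sup>2) \<le> integral\<^sup>L (M i) (\<lambda>y. H\<^sup>2 * T y)"
          using TH T0 intT2 intT[OF i] by (intro integral_mono) (auto simp: power2_eq_square intro!: mult_right_mono)
        also have "\<dots> = H\<^sup>2 * t i" by (simp add: t_def)
        also have "\<dots> \<le> H\<^sup>2" using t1[OF i] by (simp add: mult_left_le)
        finally show "integral\<^sup>L (M i) (\<lambda>y. (T y)\<^sup>2) - (t i)\<^sup>2 \<le> H\<^sup>2" using zero_le_power2[of "t i"] by linarith
        have "0 \<le> integral\<^sup>L (M i) (\<lambda>y. (T y - t i)\<^sup>2)" by simp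
        also have "\<dots> = integral\<^sup>L (M i) (\<lambda>y. (T y)\<^sup>2) - (t i)\<^sup>2"
          unfolding power2_diff using intT2 intT[OF i] by (simp add: t_def[symmetric] mass power2_eq_square)
        finally show "0 \<le> integral\<^sup>L (M i) (\<lambda>y. (T y)\<^sup>2) - (t i)\<^sup>2" .
      qed auto
      finally show "(\<lambda>y. b i * of_real (T y - t i)) \<in> borel_measurable (M i)
        \<and> integrable (M i) (\<lambda>y. (cmod (b i * of_real (T y - t i)))\<^sup>2)
        \<and> integral\<^sup>L (M i) (\<lambda>y. b i * of_real (T y - t i)) = 0
        \<and> integral\<^sup>L (M i) (\<lambda>y. (cmod (b i * of_real (T y - t i)))\<^sup>2) \<le> a\<^sup>2 * H\<^sup>2"
        using m1 m2 m3 by blast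
    qed
    from independent_sum_second_moment[OF prob J(1) this, of 0]
    show ?thesis by (simp add: X_def s_def power_mult_distrib mult_ac)
  qed
  have X1: "(\<integral>\<^sup>+x. ennreal (cmod (X x)) \<partial>PiM J M) \<le> ennreal s"
    by (rule nn_integral_norm_le_of_sq[OF s Xm P.prob_space_axioms X2])
  have Rint: "(\<integral>\<^sup>+x. ennreal (R (x i)) \<partial>PiM J M) = ennreal (r i)" if i: "i \<in> J" for i
  proof -
    have "(\<integral>\<^sup>+x. ennreal (R (x i)) \<partial>PiM J M) = (\<integral>\<^sup>+y. ennreal (R y) \<partial>distr (PiM J M) (M i) (\<lambda>x. x i))"
      using Tm by (intro nn_integral_distr[symmetric]) (auto simp: i bm'[OF i])
    also have "distr (PiM J M) (M i) (\<lambda>x. x i) = M i" by (rule PiM_component[OF i])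
    also have "(\<integral>\<^sup>+y. ennreal (R y) \<partial>M i) = ennreal (r i)"
      unfolding r_def using T0 intT[OF i] by (intro nn_integral_eq_integral) auto
    finally show ?thesis .
  qed
  have "(\<integral>\<^sup>+x. ennreal (cmod (\<Sum>i\<in>J. b i * of_real ((cmod (x i))\<^sup>2 - 1))) \<partial>PiM J M)
      \<le> (\<integral>\<^sup>+x. ennreal (cmod (X x)) + (\<Sum>i\<in>J. ennreal a * ennreal (R (x i)) + ennreal (a * r i)) \<partial>PiM J M)"
  proof (rule nn_integral_mono)
    fix x
    have eq: "(\<Sum>i\<in>J. b i * of_real ((cmod (x i))\<^sup>2 - 1)) = X x + (\<Sum>i\<in>J. b i * of_real (R (x i) - r i))"
      unfolding X_def sum.distrib[symmetric]
    proof (intro sum.cong refl)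
      fix i assume i: "i \<in> J"
      have "(cmod (x i))\<^sup>2 - 1 = (T (x i) - t i) + (R (x i) - r i)" using tr[OF i] TR[of "x i"] by linarith
      then show "b i * of_real ((cmod (x i))\<^sup>2 - 1) = b i * of_real (T (x i) - t i) + b i * of_real (R (x i) - r i)"
        by (simp only: of_real_add distrib_left)
    qed
    have "cmod (\<Sum>i\<in>J. b i * of_real ((cmod (x i))\<^sup>2 - 1)) \<le> cmod (X x) + cmod (\<Sum>i\<in>J. b i * of_real (R (x i) - r i))"
      unfolding eq by (rule norm_triangle_ineq)
    moreover have "cmod (\<Sum>i\<in>J. b i * of_real (R (x i) - r i)) \<le> (\<Sum>i\<in>J. a * R (x i) + a * r i)"
    proof (intro order_trans[OF norm_sum] sum_mono)
      fix i assume i: "i \<in> J"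
      have "cmod (b i * of_real (R (x i) - r i)) = cmod (b i) * \<bar>R (x i) - r i\<bar>"
        by (simp only: norm_mult norm_of_real)
      also have "\<dots> \<le> a * (R (x i) + r i)"
        using a(2)[OF i] a(1) T0(2)[of "x i"] r0(1)[of i] by (intro mult_mono) auto
      finally show "cmod (b i * of_real (R (x i) - r i)) \<le> a * R (x i) + a * r i" by (simp add: distrib_left)
    qed
    ultimately have "cmod (\<Sum>i\<in>J. b i * of_real ((cmod (x i))\<^sup>2 - 1)) \<le> cmod (X x) + (\<Sum>i\<in>J. a * R (x i) + a * r i)" by linarith
    then have "ennreal (cmod (\<Sum>i\<in>J. b i * of_real ((cmod (x i))\<^sup>2 - 1))) \<le> ennreal (cmod (X x) + (\<Sum>i\<in>J. a * R (x i) + a * r i))"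
      by (rule ennreal_leI)
    also have "\<dots> = ennreal (cmod (X x)) + (\<Sum>i\<in>J. ennreal (a * R (x i) + a * r i))"
    proof -
      have e0: "0 \<le> a * R (x i) + a * r i" for i
        using a(1) T0 r0 by (intro add_nonneg_nonneg mult_nonneg_nonneg) auto
      show ?thesis unfolding sum_ennreal[OF e0]
        by (rule ennreal_plus[OF norm_ge_zero sum_nonneg[OF e0]])
    qed
    also have "(\<Sum>i\<in>J. ennreal (a * R (x i) + a * r i)) = (\<Sum>i\<in>J. ennreal a * ennreal (R (x i)) + ennreal (a * r i))"
      using a(1) T0 r0 by (intro sum.cong refl) (simp add: ennreal_plus ennreal_mult)
    finally show "ennreal (cmod (\<Sum>i\<in>J. b i * of_real ((cmod (x i))\<^sup>2 - 1)))
      \<le> ennreal (cmod (X x)) + (\<Sum>i\<in>J. ennreal a * ennreal (R (x i)) + ennreal (a * r i))" .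
  qed
  also have "\<dots> = (\<integral>\<^sup>+x. ennreal (cmod (X x)) \<partial>PiM J M) + (\<Sum>i\<in>J. \<integral>\<^sup>+x. ennreal a * ennreal (R (x i)) + ennreal (a * r i) \<partial>PiM J M)"
    by (subst nn_integral_add, measurable, subst nn_integral_sum) measurable
  also have "(\<Sum>i\<in>J. \<integral>\<^sup>+x. ennreal a * ennreal (R (x i)) + ennreal (a * r i) \<partial>PiM J M) = (\<Sum>i\<in>J. ennreal (2 * a * r i))"
  proof (intro sum.cong refl)
    fix i assume i: "i \<in> J"
    have "(\<integral>\<^sup>+x. ennreal a * ennreal (R (x i)) + ennreal (a * r i) \<partial>PiM J M) = ennreal a * ennreal (r i) + ennreal (a * r i)"
      using i by (subst nn_integral_add, measurable, subst nn_integral_cmult, measurable) (simp add: Rint P.emeasure_space_1)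
    then show "(\<integral>\<^sup>+x. ennreal a * ennreal (R (x i)) + ennreal (a * r i) \<partial>PiM J M) = ennreal (2 * a * r i)"
      using a(1) r0 by (simp add: ennreal_mult[symmetric] ennreal_plus[symmetric] del: ennreal_plus)
  qed
  also have "(\<Sum>i\<in>J. ennreal (2 * a * r i)) = ennreal (2 * a * (\<Sum>i\<in>J. r i))"
    using a(1) r0 by (simp add: sum_ennreal sum_distrib_left)
  also have "(\<integral>\<^sup>+x. ennreal (cmod (X x)) \<partial>PiM J M) + ennreal (2 * a * (\<Sum>i\<in>J. r i)) \<le> ennreal s + ennreal (2 * a * (\<Sum>i\<in>J. r i))"
    by (intro add_right_mono X1)
  also have "\<dots> = ennreal (s + 2 * a * (\<Sum>i\<in>J. r i))"
    using s a(1) r0 by (intro ennreal_plus[symmetric]) (auto intro!: mult_nonneg_nonneg sum_nonneg)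
  finally show ?thesis unfolding s_def r_def R_def[abs_def] .
qed

text \<open>The trace approximates the quadratic form: the off-diagonal part is small in mean square and the diagonal
  part is a sum of independent variables. With \<open>a\<close> of order \<open>1 / n\<close> the three terms are of order \<open>1 / sqrt n\<close>,
  of order \<open>h\<close>, and of the order of the mean of the tails in the Lindeberg condition.\<close>

lemma quadratic_form_concentration:
  fixes M :: "nat \<Rightarrow> complex measure" and A :: "nat \<Rightarrow> nat \<Rightarrow> complex"
  assumes P: "\<And>i. prob_space (M i)" and n: "n > 0" and std: "standard_on {..<n} M"
    and a: "a > 0" "\<And>i. i < n \<Longrightarrow> (\<Sum>l<n. (cmod (A i l))\<^sup>2) \<le> a\<^sup>2" and h: "h > 0"
  shows "(\<integral>\<^sup>+x. ennreal (cmod ((\<Sum>i<n. \<Sum>l<n. cnj (x i) * A i l * x l) - (\<Sum>i<n. A i i))) \<partial>PiM {..<n} M)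
    \<le> ennreal (2 * a * sqrt n + a * h * n + 2 * a * (\<Sum>i<n. LINT y|M i. (cmod y)\<^sup>2 * of_bool (cmod y \<ge> h * sqrt n)))"
proof -
  let ?J = "{..<n}"
  have [measurable]: "(\<lambda>x. x i) \<in> borel_measurable (PiM ?J M)" if "i \<in> ?J" for i
    using that std by (intro component_measurable) (auto simp: standard_on_def)
  have om: "offdiag A ?J \<in> borel_measurable (PiM ?J M)" by (rule offdiag_measurable) measurable
  define r where "r i = (LINT y|M i. (cmod y)\<^sup>2 * of_bool (cmod y \<ge> h * sqrt n))" for i
  have r0: "0 \<le> r i" for i unfolding r_def by (intro integral_nonneg_AE) auto
  have Aii: "cmod (A i i) \<le> a" if "i \<in> ?J" for i
  proof -
    have "(cmod (A i i))\<^sup>2 \<le> (\<Sum>l<n. (cmod (A i l))\<^sup>2)" using that by (intro member_le_sum) auto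
    also have "\<dots> \<le> a\<^sup>2" using a(2) that by auto
    finally show ?thesis using a(1) by (simp add: power2_le_iff_abs_le)
  qed
  have split: "(\<Sum>i<n. \<Sum>l<n. cnj (x i) * A i l * x l) - (\<Sum>i<n. A i i)
      = offdiag A ?J x + (\<Sum>i<n. A i i * of_real ((cmod (x i))\<^sup>2 - 1))" for x
  proof -
    have "(\<Sum>i<n. \<Sum>l<n. cnj (x i) * A i l * x l) = (\<Sum>i<n. \<Sum>l<n. (if i = l then 0 else cnj (x i) * A i l * x l) + (if i = l then cnj (x i) * A i l * x l else 0))"
      by (intro sum.cong refl) auto
    also have "\<dots> = offdiag A ?J x + (\<Sum>i<n. cnj (x i) * A i i * x i)"
      by (simp add: sum.distrib offdiag_def)
    also have "(\<Sum>i<n. cnj (x i) * A i i * x i) = (\<Sum>i<n. A i i * of_real ((cmod (x i))\<^sup>2))"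
      by (intro sum.cong refl) (simp only: complex_norm_square mult_ac)
    finally show ?thesis by (simp add: sum_subtractf right_diff_distrib)
  qed
  have s: "2 * a * sqrt n > 0" using a n by simp
  have "(\<integral>\<^sup>+x. ennreal ((cmod (offdiag A ?J x))\<^sup>2) \<partial>PiM ?J M) \<le> ennreal (2 * (\<Sum>i<n. \<Sum>l<n. (cmod (A i l))\<^sup>2))"
    by (rule offdiag_second_moment[OF P _ std]) simp
  also have "\<dots> \<le> ennreal ((2 * a * sqrt n)\<^sup>2)"
  proof (rule ennreal_leI)
    have "(\<Sum>i<n. \<Sum>l<n. (cmod (A i l))\<^sup>2) \<le> (\<Sum>i<n. a\<^sup>2)" using a(2) by (intro sum_mono) auto
    then have "(\<Sum>i<n. \<Sum>l<n. (cmod (A i l))\<^sup>2) \<le> real n * a\<^sup>2" by simp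
    moreover have "(2 * a * sqrt n)\<^sup>2 = 4 * (real n * a\<^sup>2)" by (simp add: power_mult_distrib)
    moreover have "0 \<le> real n * a\<^sup>2" by simp
    ultimately show "2 * (\<Sum>i<n. \<Sum>l<n. (cmod (A i l))\<^sup>2) \<le> (2 * a * sqrt n)\<^sup>2" by linarith
  qed
  finally have off: "(\<integral>\<^sup>+x. ennreal (cmod (offdiag A ?J x)) \<partial>PiM ?J M) \<le> ennreal (2 * a * sqrt n)"
    by (rule nn_integral_norm_le_of_sq[OF s om prob_space_PiM[OF P]])
  have "(\<integral>\<^sup>+x. ennreal (cmod (\<Sum>i\<in>?J. A i i * of_real ((cmod (x i))\<^sup>2 - 1))) \<partial>PiM ?J M)
    \<le> ennreal (a * (h * sqrt n) * sqrt (card ?J) + 2 * a * (\<Sum>i\<in>?J. LINT y|M i. (cmod y)\<^sup>2 * of_bool (cmod y \<ge> h * sqrt n)))"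
    by (rule diagonal_fluctuation[OF P _ _ std a(1) Aii]) (use n h in \<open>auto simp: lessThan_empty_iff\<close>)
  also have "a * (h * sqrt n) * sqrt (card ?J) = a * h * n" by simp
  finally have diag: "(\<integral>\<^sup>+x. ennreal (cmod (\<Sum>i\<in>?J. A i i * of_real ((cmod (x i))\<^sup>2 - 1))) \<partial>PiM ?J M)
    \<le> ennreal (a * h * n + 2 * a * (\<Sum>i<n. r i))" unfolding r_def .
  have "(\<integral>\<^sup>+x. ennreal (cmod ((\<Sum>i<n. \<Sum>l<n. cnj (x i) * A i l * x l) - (\<Sum>i<n. A i i))) \<partial>PiM ?J M)
    \<le> (\<integral>\<^sup>+x. ennreal (cmod (offdiag A ?J x)) + ennreal (cmod (\<Sum>i\<in>?J. A i i * of_real ((cmod (x i))\<^sup>2 - 1))) \<partial>PiM ?J M)"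
    unfolding split by (intro nn_integral_mono) (simp add: ennreal_plus[symmetric] norm_triangle_ineq ennreal_leI del: ennreal_plus)
  also have "\<dots> = (\<integral>\<^sup>+x. ennreal (cmod (offdiag A ?J x)) \<partial>PiM ?J M) + (\<integral>\<^sup>+x. ennreal (cmod (\<Sum>i\<in>?J. A i i * of_real ((cmod (x i))\<^sup>2 - 1))) \<partial>PiM ?J M)"
  proof (rule nn_integral_add)
    note [measurable] = om
    show "(\<lambda>x. ennreal (cmod (offdiag A ?J x))) \<in> borel_measurable (PiM ?J M)"
      by (rule measurable_compose[OF measurable_compose[OF om borel_measurable_norm] measurable_ennreal])
    show "(\<lambda>x. ennreal (cmod (\<Sum>i<n. A i i * of_real ((cmod (x i))\<^sup>2 - 1)))) \<in> borel_measurable (PiM ?J M)"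
      by (intro measurable_compose[OF _ measurable_ennreal] measurable_compose[OF _ borel_measurable_norm] borel_measurable_sum) measurable
  qed
  also have "\<dots> \<le> ennreal (2 * a * sqrt n) + ennreal (a * h * n + 2 * a * (\<Sum>i<n. r i))"
    by (intro add_mono off diag)
  also have "\<dots> = ennreal (2 * a * sqrt n + (a * h * n + 2 * a * (\<Sum>i<n. r i)))"
    using a(1) h r0 by (intro ennreal_plus[symmetric]) (auto intro!: add_nonneg_nonneg mult_nonneg_nonneg sum_nonneg)
  finally show ?thesis by (simp add: r_def add.assoc)
qed

section \<open>Resolvents of Gram matrices\<close>

text \<open>\<open>R\<close> is a two-sided inverse of \<open>H - z\<close>, as far as indices below \<open>n\<close> are concerned.\<close>

definition is_resolvent :: "nat \<Rightarrow> (nat \<Rightarrow> nat \<Rightarrow> complex) \<Rightarrow> complex \<Rightarrow> (nat \<Rightarrow> nat \<Rightarrow> complex) \<Rightarrow> bool" where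
  "is_resolvent n H z R \<longleftrightarrow> (\<forall>i<n. \<forall>j<n.
     (\<Sum>l<n. H i l * R l j) - z * R i j = (if i = j then 1 else 0) \<and>
     (\<Sum>l<n. R i l * H l j) - z * R i j = (if i = j then 1 else 0))"

lemma is_resolvent_mv:
  assumes R: "is_resolvent n H z R" and i: "i < n"
  shows "mv {..<n} H (mv {..<n} R u) i - z * mv {..<n} R u i = u i"
proof -
  have "mv {..<n} H (mv {..<n} R u) i = (\<Sum>j<n. (\<Sum>l<n. H i l * R l j) * u j)"
    unfolding mv_def sum_distrib_left sum_distrib_right by (subst sum.swap) (simp add: mult.assoc)
  then have "mv {..<n} H (mv {..<n} R u) i - z * mv {..<n} R u i = (\<Sum>j<n. ((\<Sum>l<n. H i l * R l j) - z * R i j) * u j)"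
    by (simp add: mv_def left_diff_distrib sum_subtractf sum_distrib_left mult.assoc)
  also have "\<dots> = (\<Sum>j<n. if i = j then u j else 0)"
    using R i by (intro sum.cong refl) (auto simp: is_resolvent_def)
  finally show ?thesis using i by simp
qed

lemma is_resolvent_unique:
  assumes R: "is_resolvent n H z R" and R': "is_resolvent n H z R'" and ij: "i < n" "j < n"
  shows "R i j = R' i j"
proof -
  define G where "G a b = H a b - (if a = b then z else 0)" for a b
  have GR: "(\<Sum>l<n. G a l * S l b) = (if a = b then 1 else 0)" "(\<Sum>l<n. S a l * G l b) = (if a = b then 1 else 0)"
    if "is_resolvent n H z S" "a < n" "b < n" for a b S
  proof -
    have "(\<Sum>l<n. G a l * S l b) = (\<Sum>l<n. H a l * S l b) - (\<Sum>l<n. if a = l then z * S l b else 0)"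
      unfolding sum_subtractf[symmetric] by (intro sum.cong refl) (auto simp: G_def left_diff_distrib)
    then show "(\<Sum>l<n. G a l * S l b) = (if a = b then 1 else 0)" using that by (auto simp: is_resolvent_def)
    have "(\<Sum>l<n. S a l * G l b) = (\<Sum>l<n. S a l * H l b) - (\<Sum>l<n. if l = b then z * S a l else 0)"
      unfolding sum_subtractf[symmetric] by (intro sum.cong refl) (auto simp: G_def right_diff_distrib mult.commute)
    then show "(\<Sum>l<n. S a l * G l b) = (if a = b then 1 else 0)" using that by (auto simp: is_resolvent_def)
  qed
  have "R i j = (\<Sum>b<n. R i b * (\<Sum>l<n. G b l * R' l j))"
  proof -
    have "(\<Sum>b<n. R i b * (\<Sum>l<n. G b l * R' l j)) = (\<Sum>b<n. if b = j then R i b else 0)"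
      using GR(1)[OF R' _ ij(2)] by (intro sum.cong refl) auto
    then show ?thesis using ij by simp
  qed
  also have "\<dots> = (\<Sum>l<n. (\<Sum>b<n. R i b * G b l) * R' l j)"
    unfolding sum_distrib_left sum_distrib_right by (subst sum.swap) (simp add: mult.assoc)
  also have "\<dots> = (\<Sum>l<n. if i = l then R' l j else 0)"
    using GR(2)[OF R ij(1)] by (intro sum.cong refl) auto
  finally show ?thesis using ij by simp
qed

lemma is_resolvent_transpose: "is_resolvent n H z R \<Longrightarrow> is_resolvent n (\<lambda>i j. H j i) z (\<lambda>i j. R j i)"
  by (auto simp: is_resolvent_def mult.commute)

definition psd :: "nat \<Rightarrow> (nat \<Rightarrow> nat \<Rightarrow> complex) \<Rightarrow> bool" where
  "psd n H \<longleftrightarrow> hermitian_on {..<n} H \<and> (\<forall>w. Im (ip {..<n} w (mv {..<n} H w)) = 0 \<and> 0 \<le> Re (ip {..<n} w (mv {..<n} H w)))"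

lemma psd_gram: "psd n (gram N Y)"
  by (simp add: psd_def hermitian_gram ip_gram sum_nonneg)

lemma psd_transpose:
  assumes "psd n H"
  shows "psd n (\<lambda>i j. H j i)"
proof -
  have eq: "ip {..<n} w (mv {..<n} (\<lambda>i j. H j i) w) = ip {..<n} (\<lambda>i. cnj (w i)) (mv {..<n} H (\<lambda>i. cnj (w i)))" for w
    unfolding ip_def mv_def sum_distrib_left by (subst sum.swap) (simp add: mult_ac)
  have herm: "hermitian_on {..<n} (\<lambda>i j. H j i)"
  proof -
    have "\<forall>i\<in>{..<n}. \<forall>j\<in>{..<n}. H j i = cnj (H i j)" using assms unfolding psd_def hermitian_on_def by blast
    then show ?thesis unfolding hermitian_on_def by blast
  qed
  have "Im (ip {..<n} w (mv {..<n} H w)) = 0" "0 \<le> Re (ip {..<n} w (mv {..<n} H w))" for w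
    using assms unfolding psd_def by blast+
  then show ?thesis using herm unfolding psd_def eq by blast
qed

text \<open>With \<open>w = R u\<close> one has \<open>u = H w - z w\<close>, and \<open>ip w (H w)\<close> is a nonnegative real number.\<close>

lemma resolvent_quadratic_form:
  fixes u :: "nat \<Rightarrow> complex"
  assumes R: "is_resolvent n H z R" and H: "psd n H"
  defines "w \<equiv> mv {..<n} R u"
  shows "Im (ip {..<n} u w) = Im z * (\<Sum>i<n. (cmod (w i))\<^sup>2)"
    and "Im z > 0 \<Longrightarrow> 0 \<le> Im (z * ip {..<n} u w)"
proof -
  define s where "s = (\<Sum>i<n. (cmod (w i))\<^sup>2)"
  define t where "t = Re (ip {..<n} w (mv {..<n} H w))"
  have t: "ip {..<n} w (mv {..<n} H w) = of_real t" "0 \<le> t"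
    using H by (auto simp: psd_def t_def complex_eq_iff)
  have "ip {..<n} u w = ip {..<n} (\<lambda>i. mv {..<n} H w i - z * w i) w"
    unfolding w_def using is_resolvent_mv[OF R] by (intro ip_cong) auto
  also have "\<dots> = ip {..<n} (mv {..<n} H w) w - cnj z * ip {..<n} w w"
    by (simp add: ip_def left_diff_distrib sum_subtractf sum_distrib_left mult.assoc)
  also have "ip {..<n} (mv {..<n} H w) w = of_real t"
    using H t(1) ip_mv_hermitian[of "{..<n}" H w w] by (simp add: psd_def)
  also have "ip {..<n} w w = of_real s" by (simp add: ip_self s_def)
  finally have q: "ip {..<n} u w = of_real t - cnj z * of_real s" .
  show "Im (ip {..<n} u w) = Im z * (\<Sum>i<n. (cmod (w i))\<^sup>2)" unfolding q s_def by simp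
  have "z * ip {..<n} u w = of_real t * z - of_real s * (z * cnj z)" unfolding q by (simp add: algebra_simps)
  then have "z * ip {..<n} u w = of_real t * z - of_real (s * (cmod z)\<^sup>2)"
    by (simp only: complex_norm_square[symmetric] of_real_mult)
  then have "Im (z * ip {..<n} u w) = t * Im z" by simp
  then show "0 \<le> Im (z * ip {..<n} u w)" if "Im z > 0" using t(2) that by simp
qed

lemma Cauchy_Schwarz_cmod_sum:
  fixes a b :: "nat \<Rightarrow> complex"
  shows "(\<Sum>i<n. cmod (a i) * cmod (b i)) \<le> sqrt (\<Sum>i<n. (cmod (a i))\<^sup>2) * sqrt (\<Sum>i<n. (cmod (b i))\<^sup>2)"
  using Cauchy_Schwarz_sqrt_sum[of "{..<n}" "\<lambda>i. (cmod (a i))\<^sup>2" "\<lambda>i. (cmod (b i))\<^sup>2"] by simp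

lemma cmod_ip_le:
  fixes a b :: "nat \<Rightarrow> complex"
  shows "cmod (ip {..<n} a b) \<le> sqrt (\<Sum>i<n. (cmod (a i))\<^sup>2) * sqrt (\<Sum>i<n. (cmod (b i))\<^sup>2)"
proof -
  have "cmod (ip {..<n} a b) \<le> (\<Sum>i<n. cmod (cnj (a i) * b i))" unfolding ip_def by (rule norm_sum)
  also have "\<dots> = (\<Sum>i<n. cmod (a i) * cmod (b i))" by (simp add: norm_mult)
  finally show ?thesis using Cauchy_Schwarz_cmod_sum[of a b n] by linarith
qed

lemma resolvent_norm_le:
  assumes R: "is_resolvent n H z R" and H: "psd n H" and z: "Im z > 0"
  shows "(\<Sum>i<n. (cmod (mv {..<n} R u i))\<^sup>2) \<le> (\<Sum>i<n. (cmod (u i))\<^sup>2) / (Im z)\<^sup>2"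
proof -
  define s where "s = sqrt (\<Sum>i<n. (cmod (mv {..<n} R u i))\<^sup>2)"
  define t where "t = sqrt (\<Sum>i<n. (cmod (u i))\<^sup>2)"
  have st: "0 \<le> s" "0 \<le> t" "s\<^sup>2 = (\<Sum>i<n. (cmod (mv {..<n} R u i))\<^sup>2)" "t\<^sup>2 = (\<Sum>i<n. (cmod (u i))\<^sup>2)"
    by (simp_all add: s_def t_def sum_nonneg)
  have "Im z * s\<^sup>2 = Im (ip {..<n} u (mv {..<n} R u))"
    using resolvent_quadratic_form(1)[OF R H] by (simp add: st)
  also have "\<dots> \<le> cmod (ip {..<n} u (mv {..<n} R u))" using abs_Im_le_cmod[of "ip {..<n} u (mv {..<n} R u)"] by linarith
  also have "\<dots> \<le> t * s" unfolding s_def t_def by (rule cmod_ip_le)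
  finally have "s * (Im z * s) \<le> s * t" by (simp add: power2_eq_square mult_ac)
  then have "Im z * s \<le> t" using st(1,2) z by (cases "s = 0") (auto simp: mult_le_cancel_left)
  then have "(Im z * s)\<^sup>2 \<le> t\<^sup>2" using st z by (intro power_mono) auto
  then show ?thesis using z st by (simp add: power_mult_distrib pos_le_divide_eq mult.commute)
qed

lemma mv_unit: "j < (n::nat) \<Longrightarrow> mv {..<n} R (\<lambda>l. if l = j then 1 else 0) i = R i j"
proof -
  assume j: "j < n"
  have "mv {..<n} R (\<lambda>l. if l = j then 1 else 0) i = (\<Sum>l<n. if l = j then R i l else 0)"
    unfolding mv_def by (intro sum.cong refl) auto
  then show ?thesis using j by simp
qed

lemma sum_unit: "j < (n::nat) \<Longrightarrow> (\<Sum>i<n. (cmod (if i = j then 1 else 0 :: complex))\<^sup>2) = 1"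
proof -
  assume j: "j < n"
  have "(\<Sum>i<n. (cmod (if i = j then 1 else 0 :: complex))\<^sup>2) = (\<Sum>i<n. if i = j then 1 else 0)"
    by (intro sum.cong refl) auto
  then show ?thesis using j by simp
qed

lemma resolvent_row_norm_le:
  assumes R: "is_resolvent n H z R" and H: "psd n H" and z: "Im z > 0" and i: "i < n"
  shows "(\<Sum>l<n. (cmod (R i l))\<^sup>2) \<le> 1 / (Im z)\<^sup>2"
  using resolvent_norm_le[OF is_resolvent_transpose[OF R] psd_transpose[OF H] z, of "\<lambda>l. if l = i then 1 else 0"]
  unfolding mv_unit[OF i] sum_unit[OF i] .

lemma resolvent_diag:
  assumes R: "is_resolvent n H z R" and H: "psd n H" and z: "Im z > 0" and i: "i < n"
  shows "cmod (R i i) \<le> 1 / Im z" "0 \<le> Im (R i i)" "0 \<le> Im (z * R i i)"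
proof -
  have "(cmod (R i i))\<^sup>2 \<le> (\<Sum>l<n. (cmod (R i l))\<^sup>2)" using i by (intro member_le_sum) auto
  also have "\<dots> \<le> (1 / Im z)\<^sup>2" unfolding power_divide power_one by (rule resolvent_row_norm_le[OF assms])
  finally have "(cmod (R i i))\<^sup>2 \<le> (1 / Im z)\<^sup>2" .
  then show "cmod (R i i) \<le> 1 / Im z" using z by (intro power2_le_imp_le[of "cmod (R i i)" "1 / Im z"]) simp_all
  have q: "ip {..<n} (\<lambda>l. if l = i then 1 else 0) (mv {..<n} R (\<lambda>l. if l = i then 1 else 0)) = R i i"
  proof -
    have "ip {..<n} (\<lambda>l. if l = i then 1 else 0) (mv {..<n} R (\<lambda>l. if l = i then 1 else 0)) = (\<Sum>l<n. if l = i then R l i else 0)"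
      unfolding ip_def mv_unit[OF i] by (intro sum.cong refl) auto
    then show ?thesis using i by simp
  qed
  show "0 \<le> Im (R i i)"
    using resolvent_quadratic_form(1)[OF R H, of "\<lambda>l. if l = i then 1 else 0"] z unfolding q by (simp add: sum_nonneg)
  show "0 \<le> Im (z * R i i)"
    using resolvent_quadratic_form(2)[OF R H z, of "\<lambda>l. if l = i then 1 else 0"] unfolding q .
qed

definition quad :: "nat \<Rightarrow> (nat \<Rightarrow> nat \<Rightarrow> complex) \<Rightarrow> (nat \<Rightarrow> complex) \<Rightarrow> complex" where
  "quad n R y = (\<Sum>i<n. \<Sum>l<n. cnj (y i) * R i l * y l)"

lemma quad_eq_ip: "quad n R y = ip {..<n} y (mv {..<n} R y)"
  by (simp add: quad_def ip_def mv_def sum_distrib_left mult.assoc)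

text \<open>The denominators of the Sherman--Morrison formula never vanish: \<open>z * (1 + quad n R y)\<close> has imaginary part at least
  \<open>Im z\<close>.\<close>

lemma one_plus_quad_ge:
  assumes R: "is_resolvent n H z R" and H: "psd n H" and z: "Im z > 0"
  shows "Im z / cmod z \<le> cmod (1 + quad n R y)" "1 + quad n R y \<noteq> 0"
proof -
  have "z \<noteq> 0" using z by auto
  then have z0: "cmod z > 0" by simp
  have "Im z \<le> Im (z * (1 + quad n R y))"
    using resolvent_quadratic_form(2)[OF R H z, of y] by (simp add: quad_eq_ip distrib_left)
  also have "\<dots> \<le> cmod z * cmod (1 + quad n R y)"
    using abs_Im_le_cmod[of "z * (1 + quad n R y)"] by (simp add: norm_mult)
  finally have le: "Im z \<le> cmod z * cmod (1 + quad n R y)" .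
  then show "Im z / cmod z \<le> cmod (1 + quad n R y)" using z0 by (simp add: pos_divide_le_eq mult.commute)
  show "1 + quad n R y \<noteq> 0" using le z by auto
qed

text \<open>The Sherman--Morrison formula for the resolvent of \<open>H + y y\<^sup>*\<close>.\<close>

definition rank_one_update :: "nat \<Rightarrow> (nat \<Rightarrow> nat \<Rightarrow> complex) \<Rightarrow> (nat \<Rightarrow> complex) \<Rightarrow> nat \<Rightarrow> nat \<Rightarrow> complex" where
  "rank_one_update n R y i j = R i j - (\<Sum>l<n. R i l * y l) * (\<Sum>l<n. cnj (y l) * R l j) / (1 + quad n R y)"

lemma is_resolvent_rank_one_update:
  assumes R: "is_resolvent n H z R" and q: "1 + quad n R y \<noteq> 0"
  shows "is_resolvent n (\<lambda>i j. H i j + y i * cnj (y j)) z (rank_one_update n R y)"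
proof -
  define a where "a i = (\<Sum>l<n. R i l * y l)" for i
  define b where "b j = (\<Sum>l<n. cnj (y l) * R l j)" for j
  define Q where "Q = 1 + quad n R y"
  have ya: "(\<Sum>l<n. cnj (y l) * a l) = Q - 1" and yb: "(\<Sum>l<n. b l * y l) = Q - 1"
  proof -
    show "(\<Sum>l<n. cnj (y l) * a l) = Q - 1" by (simp add: Q_def quad_def a_def sum_distrib_left mult.assoc)
    have "(\<Sum>l<n. b l * y l) = (\<Sum>i<n. \<Sum>l<n. cnj (y i) * R i l * y l)"
      unfolding b_def sum_distrib_right by (rule sum.swap)
    then show "(\<Sum>l<n. b l * y l) = Q - 1" by (simp add: Q_def quad_def)
  qed
  have Ha: "(\<Sum>l<n. H i l * a l) = y i + z * a i" if "i < n" for i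
    using is_resolvent_mv[OF R that, of y] by (simp add: mv_def a_def algebra_simps)
  have bH: "(\<Sum>l<n. b l * H l j) = cnj (y j) + z * b j" if "j < n" for j
    using is_resolvent_mv[OF is_resolvent_transpose[OF R] that, of "\<lambda>l. cnj (y l)"]
    by (simp add: mv_def b_def algebra_simps)
  have upd: "rank_one_update n R y i j = R i j - a i * b j / Q" for i j
    by (simp add: rank_one_update_def a_def b_def Q_def)
  show ?thesis
    unfolding is_resolvent_def
  proof (intro allI impI conjI)
    fix i j assume ij: "i < n" "j < n"
    have HR: "(\<Sum>l<n. H i l * R l j) = z * R i j + (if i = j then 1 else 0)"
      and RH: "(\<Sum>l<n. R i l * H l j) = z * R i j + (if i = j then 1 else 0)"
      using R ij by (simp_all add: is_resolvent_def algebra_simps)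
    define \<delta> :: complex where "\<delta> = (if i = j then 1 else 0)"
    define \<beta> where "\<beta> = b j / Q"
    define \<alpha> where "\<alpha> = a i / Q"
    have Q: "Q * \<beta> = b j" "Q * \<alpha> = a i" using q by (simp_all add: \<beta>_def \<alpha>_def Q_def[symmetric])
    have "(\<Sum>l<n. (H i l + y i * cnj (y l)) * rank_one_update n R y l j)
        = (\<Sum>l<n. H i l * R l j + y i * (cnj (y l) * R l j) - (H i l * a l) * \<beta> - y i * ((cnj (y l) * a l) * \<beta>))"
    proof (intro sum.cong refl)
      fix l
      have "rank_one_update n R y l j = R l j - a l * \<beta>" by (simp add: upd \<beta>_def)
      then show "(H i l + y i * cnj (y l)) * rank_one_update n R y l j
        = H i l * R l j + y i * (cnj (y l) * R l j) - (H i l * a l) * \<beta> - y i * ((cnj (y l) * a l) * \<beta>)"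
        by (simp only:) (simp add: algebra_simps)
    qed
    also have "\<dots> = (\<Sum>l<n. H i l * R l j) + y i * (\<Sum>l<n. cnj (y l) * R l j) - (\<Sum>l<n. H i l * a l) * \<beta> - y i * ((\<Sum>l<n. cnj (y l) * a l) * \<beta>)"
      by (simp only: sum.distrib sum_subtractf sum_distrib_left[symmetric] sum_distrib_right[symmetric])
    also have "\<dots> = (z * R i j + \<delta>) + y i * (Q * \<beta>) - (y i + z * a i) * \<beta> - y i * ((Q - 1) * \<beta>)"
      unfolding HR Ha[OF ij(1)] ya b_def[symmetric] Q(1) \<delta>_def ..
    also have "\<dots> = z * (R i j - a i * \<beta>) + \<delta>" by (simp add: algebra_simps)
    also have "R i j - a i * \<beta> = rank_one_update n R y i j" by (simp add: upd \<beta>_def)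
    finally show "(\<Sum>l<n. (H i l + y i * cnj (y l)) * rank_one_update n R y l j) - z * rank_one_update n R y i j = (if i = j then 1 else 0)"
      by (simp add: \<delta>_def)
    have "(\<Sum>l<n. rank_one_update n R y i l * (H l j + y l * cnj (y j)))
        = (\<Sum>l<n. R i l * H l j + (R i l * y l) * cnj (y j) - \<alpha> * (b l * H l j) - \<alpha> * ((b l * y l) * cnj (y j)))"
    proof (intro sum.cong refl)
      fix l
      have "rank_one_update n R y i l = R i l - \<alpha> * b l" by (simp add: upd \<alpha>_def)
      then show "rank_one_update n R y i l * (H l j + y l * cnj (y j))
        = R i l * H l j + (R i l * y l) * cnj (y j) - \<alpha> * (b l * H l j) - \<alpha> * ((b l * y l) * cnj (y j))"
        by (simp only:) (simp add: algebra_simps)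
    qed
    also have "\<dots> = (\<Sum>l<n. R i l * H l j) + (\<Sum>l<n. R i l * y l) * cnj (y j) - \<alpha> * (\<Sum>l<n. b l * H l j) - \<alpha> * ((\<Sum>l<n. b l * y l) * cnj (y j))"
      by (simp only: sum.distrib sum_subtractf sum_distrib_left[symmetric] sum_distrib_right[symmetric])
    also have "\<dots> = (z * R i j + \<delta>) + (Q * \<alpha>) * cnj (y j) - \<alpha> * (cnj (y j) + z * b j) - \<alpha> * ((Q - 1) * cnj (y j))"
      unfolding RH bH[OF ij(2)] yb a_def[symmetric] Q(2) \<delta>_def ..
    also have "\<dots> = z * (R i j - \<alpha> * b j) + \<delta>" by (simp add: algebra_simps)
    also have "R i j - \<alpha> * b j = rank_one_update n R y i j" by (simp add: upd \<alpha>_def)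
    finally show "(\<Sum>l<n. rank_one_update n R y i l * (H l j + y l * cnj (y j))) - z * rank_one_update n R y i j = (if i = j then 1 else 0)"
      by (simp add: \<delta>_def)
  qed
qed

text \<open>The resolvent of a Gram matrix, by adding one column after the other. The explicit recursion makes
  measurability in the columns evident and avoids determinants.\<close>

primrec gram_resolvent :: "nat \<Rightarrow> complex \<Rightarrow> nat \<Rightarrow> (nat \<Rightarrow> nat \<Rightarrow> complex) \<Rightarrow> nat \<Rightarrow> nat \<Rightarrow> complex" where
  "gram_resolvent n z 0 Y = (\<lambda>i j. if i = j then - 1 / z else 0)"
| "gram_resolvent n z (Suc m) Y = rank_one_update n (gram_resolvent n z m Y) (Y m)"

lemma is_resolvent_gram_resolvent:
  assumes z: "Im z > 0"
  shows "is_resolvent n (gram m Y) z (gram_resolvent n z m Y)"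
proof (induction m)
  case 0
  have "z \<noteq> 0" using z by auto
  then show ?case by (auto simp: is_resolvent_def gram_def)
next
  case (Suc m)
  have g: "gram (Suc m) Y = (\<lambda>i j. gram m Y i j + Y m i * cnj (Y m j))"
    by (intro ext) (simp add: gram_def)
  show ?case unfolding g gram_resolvent.simps
    by (rule is_resolvent_rank_one_update[OF Suc one_plus_quad_ge(2)[OF Suc psd_gram z]])
qed

text \<open>Removing a column is replacing it by zero.\<close>

lemma gram_remove_column:
  assumes "k < N"
  shows "gram N Y i j = gram N (Y(k := \<lambda>_. 0)) i j + Y k i * cnj (Y k j)"
proof -
  have k: "k \<in> {..<N}" using assms by simp
  define g where "g l = Y l i * cnj (Y l j)" for l
  define g' where "g' l = (if l = k then 0 else g l)" for l
  have "gram N (Y(k := \<lambda>_. 0)) i j = sum g' {..<N}"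
    unfolding gram_def by (rule sum.cong[OF refl]) (simp add: g'_def g_def)
  also have "\<dots> = sum g ({..<N} - {k})"
  proof -
    have "sum g' ({..<N} - {k}) = sum g ({..<N} - {k})" by (rule sum.cong[OF refl]) (simp add: g'_def)
    moreover have "g' k = 0" by (simp add: g'_def)
    ultimately show ?thesis using sum.remove[OF finite_lessThan k, of g'] by simp
  qed
  finally have "gram N (Y(k := \<lambda>_. 0)) i j = sum g ({..<N} - {k})" .
  moreover have "gram N Y i j = sum g {..<N}" by (simp add: gram_def g_def)
  moreover have "sum g {..<N} = g k + sum g ({..<N} - {k})" by (rule sum.remove[OF finite_lessThan k])
  ultimately show ?thesis by (simp add: g_def)
qed

text \<open>Any column can be regarded as the last one: a column that is set to zero does not contribute.\<close>

lemma gram_resolvent_remove_column: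
  assumes z: "Im z > 0" and k: "k < N" and ij: "i < n" "j < n"
  shows "gram_resolvent n z N Y i j = rank_one_update n (gram_resolvent n z N (Y(k := \<lambda>_. 0))) (Y k) i j"
proof -
  let ?R = "gram_resolvent n z N (Y(k := \<lambda>_. 0))"
  note R = is_resolvent_gram_resolvent[OF z, of n N "Y(k := \<lambda>_. 0)"]
  have "is_resolvent n (\<lambda>i j. gram N (Y(k := \<lambda>_. 0)) i j + Y k i * cnj (Y k j)) z (rank_one_update n ?R (Y k))"
    by (rule is_resolvent_rank_one_update[OF R one_plus_quad_ge(2)[OF R psd_gram z]])
  moreover have "(\<lambda>i j. gram N (Y(k := \<lambda>_. 0)) i j + Y k i * cnj (Y k j)) = gram N Y"
    by (intro ext) (rule gram_remove_column[OF k, symmetric])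
  ultimately have "is_resolvent n (gram N Y) z (rank_one_update n ?R (Y k))" by simp
  from is_resolvent_unique[OF is_resolvent_gram_resolvent[OF z] this ij] show ?thesis .
qed

text \<open>The difference is \<open>- (R y) (y\<^sup>* R) / (1 + quad n R y)\<close>, and both vectors have square norm
  \<open>Im (quad n R y) / Im z\<close>. So one column changes a weighted trace by a bounded amount, whatever its size.\<close>

lemma weighted_trace_rank_one_update:
  assumes R: "is_resolvent n H z R" and H: "psd n H" and z: "Im z > 0" and w: "\<And>i. i < n \<Longrightarrow> cmod (w i) \<le> W"
    and W: "0 \<le> W"
  shows "cmod (\<Sum>i<n. w i * (rank_one_update n R y i i - R i i)) \<le> W / Im z"
proof -
  define a where "a i = mv {..<n} R y i" for i
  define b where "b i = mv {..<n} (\<lambda>i j. R j i) (\<lambda>l. cnj (y l)) i" for i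
  define Q where "Q = 1 + quad n R y"
  have diff: "rank_one_update n R y i i - R i i = - (a i * b i / Q)" for i
    by (simp add: rank_one_update_def a_def b_def Q_def mv_def mult.commute)
  have q': "ip {..<n} (\<lambda>l. cnj (y l)) (mv {..<n} (\<lambda>i j. R j i) (\<lambda>l. cnj (y l))) = quad n R y"
    unfolding ip_def mv_def quad_def sum_distrib_left by (subst sum.swap) (simp add: mult_ac)
  have A: "Im z * (\<Sum>i<n. (cmod (a i))\<^sup>2) = Im (quad n R y)"
    unfolding a_def using resolvent_quadratic_form(1)[OF R H, of y] by (simp add: quad_eq_ip)
  have B: "Im z * (\<Sum>i<n. (cmod (b i))\<^sup>2) = Im (quad n R y)"
    unfolding b_def using resolvent_quadratic_form(1)[OF is_resolvent_transpose[OF R] psd_transpose[OF H], of "\<lambda>l. cnj (y l)"]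
    by (simp add: q')
  have AB: "(\<Sum>i<n. (cmod (b i))\<^sup>2) = (\<Sum>i<n. (cmod (a i))\<^sup>2)"
    using z by (intro mult_left_cancel[THEN iffD1, OF _ trans[OF B sym[OF A]]]) simp
  have Q0: "cmod Q > 0" using one_plus_quad_ge(2)[OF R H z, of y] by (simp add: Q_def)
  have "(\<Sum>i<n. w i * (rank_one_update n R y i i - R i i)) = (\<Sum>i<n. - (w i * a i * b i / Q))"
    unfolding diff by (simp add: mult.assoc)
  then have "cmod (\<Sum>i<n. w i * (rank_one_update n R y i i - R i i)) \<le> (\<Sum>i<n. cmod (- (w i * a i * b i / Q)))"
    by (simp only: norm_sum)
  also have "\<dots> \<le> (\<Sum>i<n. W * (cmod (a i) * cmod (b i)) / cmod Q)"
  proof (rule sum_mono)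
    fix i assume "i \<in> {..<n}"
    then have "cmod (w i) * (cmod (a i) * cmod (b i)) \<le> W * (cmod (a i) * cmod (b i))" using w by (intro mult_right_mono) auto
    then show "cmod (- (w i * a i * b i / Q)) \<le> W * (cmod (a i) * cmod (b i)) / cmod Q"
      using Q0 by (simp add: norm_mult norm_divide divide_right_mono mult.assoc)
  qed
  also have "\<dots> = W / cmod Q * (\<Sum>i<n. cmod (a i) * cmod (b i))" by (simp add: sum_distrib_left)
  also have "\<dots> \<le> W / cmod Q * (\<Sum>i<n. (cmod (a i))\<^sup>2)"
    using Cauchy_Schwarz_cmod_sum[of a b n] W unfolding AB by (intro mult_left_mono) (auto simp: sum_nonneg)
  also have "(\<Sum>i<n. (cmod (a i))\<^sup>2) = Im Q / Im z" using A z by (simp add: Q_def field_simps)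
  also have "W / cmod Q * (Im Q / Im z) \<le> W / cmod Q * (cmod Q / Im z)"
    using abs_Im_le_cmod[of Q] z W Q0 by (intro mult_left_mono divide_right_mono) auto
  also have "\<dots> = W / Im z" using Q0 by simp
  finally show ?thesis .
qed

section \<open>Concentration of resolvent traces\<close>

lemma gram_resolvent_measurable:
  assumes Y: "\<And>k i. k < N \<Longrightarrow> i < n \<Longrightarrow> (\<lambda>\<omega>. Y \<omega> k i) \<in> borel_measurable M"
  shows "m \<le> N \<Longrightarrow> i < n \<Longrightarrow> j < n \<Longrightarrow> (\<lambda>\<omega>. gram_resolvent n z m (Y \<omega>) i j) \<in> borel_measurable M"
proof (induction m arbitrary: i j)
  case 0
  then show ?case by simp
next
  case (Suc m)
  have IH: "(\<lambda>\<omega>. gram_resolvent n z m (Y \<omega>) a b) \<in> borel_measurable M" if "a < n" "b < n" for a b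
    using Suc that by simp
  have Ym: "(\<lambda>\<omega>. Y \<omega> m a) \<in> borel_measurable M" if "a < n" for a using Y Suc.prems that by simp
  show ?case unfolding gram_resolvent.simps rank_one_update_def quad_def using Suc.prems
    by (intro borel_measurable_diff borel_measurable_divide borel_measurable_add borel_measurable_sum borel_measurable_times
        borel_measurable_const borel_measurable_cnj_comp IH Ym) auto
qed

lemma gram_resolvent_apply_column:
  fixes Y :: "nat \<Rightarrow> nat \<Rightarrow> complex"
  assumes z: "Im z > 0" and k: "k < N" and i: "i < n"
  defines "R' \<equiv> gram_resolvent n z N (Y(k := \<lambda>_. 0))"
  shows "(\<Sum>l<n. gram_resolvent n z N Y i l * Y k l) = (\<Sum>l<n. R' i l * Y k l) / (1 + quad n R' (Y k))"
proof -
  define a where "a = (\<Sum>l<n. R' i l * Y k l)"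
  define b where "b j = (\<Sum>l<n. cnj (Y k l) * R' l j)" for j
  define Q where "Q = 1 + quad n R' (Y k)"
  have Q0: "Q \<noteq> 0" unfolding Q_def R'_def
    by (rule one_plus_quad_ge(2)[OF is_resolvent_gram_resolvent[OF z] psd_gram z])
  have by0: "(\<Sum>l<n. b l * Y k l) = Q - 1"
    unfolding b_def Q_def quad_def sum_distrib_right by (subst sum.swap) simp
  have "(\<Sum>l<n. gram_resolvent n z N Y i l * Y k l) = (\<Sum>l<n. R' i l * Y k l - a / Q * (b l * Y k l))"
  proof (intro sum.cong refl)
    fix l assume "l \<in> {..<n}"
    then have "gram_resolvent n z N Y i l = R' i l - a * b l / Q"
      using gram_resolvent_remove_column[OF z k i, of l Y] by (simp add: rank_one_update_def a_def b_def Q_def R'_def)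
    then show "gram_resolvent n z N Y i l * Y k l = R' i l * Y k l - a / Q * (b l * Y k l)"
      by (simp add: left_diff_distrib)
  qed
  also have "\<dots> = a - a / Q * (Q - 1)"
    unfolding sum_subtractf sum_distrib_left[symmetric] by0 a_def ..
  also have "\<dots> = a / Q" using Q0 by (simp add: field_simps)
  finally show ?thesis by (simp add: a_def Q_def)
qed

text \<open>\<open>1 + z R = R Y Y\<^sup>*\<close>, column by column, with each column separated from the resolvent of the others.\<close>

lemma gram_resolvent_weighted_trace:
  assumes z: "Im z > 0"
  shows "(\<Sum>i<n. w i * (1 + z * gram_resolvent n z N Y i i))
    = (\<Sum>k<N. (\<Sum>i<n. w i * (\<Sum>l<n. gram_resolvent n z N (Y(k := \<lambda>_. 0)) i l * Y k l) * cnj (Y k i))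
        / (1 + quad n (gram_resolvent n z N (Y(k := \<lambda>_. 0))) (Y k)))"
proof -
  let ?R = "gram_resolvent n z N Y"
  have "(\<Sum>i<n. w i * (1 + z * ?R i i)) = (\<Sum>i<n. \<Sum>k<N. w i * (\<Sum>l<n. ?R i l * Y k l) * cnj (Y k i))"
  proof (intro sum.cong refl)
    fix i assume i: "i \<in> {..<n}"
    have "(\<Sum>l<n. ?R i l * gram N Y l i) - z * ?R i i = 1"
      using is_resolvent_gram_resolvent[OF z, of n N Y] i by (auto simp: is_resolvent_def)
    then have "1 + z * ?R i i = (\<Sum>l<n. ?R i l * gram N Y l i)" by (simp add: algebra_simps)
    also have "\<dots> = (\<Sum>k<N. (\<Sum>l<n. ?R i l * Y k l) * cnj (Y k i))"
      unfolding gram_def sum_distrib_left sum_distrib_right by (subst sum.swap) (simp add: mult.assoc)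
    finally have "1 + z * ?R i i = (\<Sum>k<N. (\<Sum>l<n. ?R i l * Y k l) * cnj (Y k i))" .
    then show "w i * (1 + z * ?R i i) = (\<Sum>k<N. w i * (\<Sum>l<n. ?R i l * Y k l) * cnj (Y k i))"
      by (simp only: sum_distrib_left[of "w i" _ "{..<N}"] mult.assoc)
  qed
  also have "\<dots> = (\<Sum>k<N. \<Sum>i<n. w i * (\<Sum>l<n. ?R i l * Y k l) * cnj (Y k i))" by (rule sum.swap)
  also have "\<dots> = (\<Sum>k<N. (\<Sum>i<n. w i * (\<Sum>l<n. gram_resolvent n z N (Y(k := \<lambda>_. 0)) i l * Y k l) * cnj (Y k i))
        / (1 + quad n (gram_resolvent n z N (Y(k := \<lambda>_. 0))) (Y k)))"
    unfolding sum_divide_distrib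
    by (intro sum.cong refl) (simp add: gram_resolvent_apply_column[OF z])
  finally show ?thesis .
qed

text \<open>One matrix of the sequence. The entries live on a product space whose factors are columns, which are products
  themselves, so that a single column can be integrated out. The point \<open>z\<close> lies on the imaginary axis: then
  \<open>1 + c * u\<close> has modulus at least 1 whenever \<open>z * u\<close> has nonnegative imaginary part.\<close>

locale gram_model = profile_system n N d for n N :: nat and d :: "nat \<Rightarrow> nat \<Rightarrow> real" +
  fixes \<nu> :: "nat \<Rightarrow> nat \<Rightarrow> complex measure" and S :: real and z :: complex
  assumes prob_entry: "\<And>i k. prob_space (\<nu> i k)"
    and standard: "\<And>k. k < N \<Longrightarrow> standard_on {..<n} (\<lambda>i. \<nu> i k)"
    and S_pos: "S > 0" and d_le: "\<And>i k. i < n \<Longrightarrow> k < N \<Longrightarrow> (d i k)\<^sup>2 \<le> S"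
    and z_pos: "Im z > 0" and z_imag: "cmod z = Im z"
begin

definition column :: "nat \<Rightarrow> (nat \<Rightarrow> complex) measure" where "column k = PiM {..<n} (\<lambda>i. \<nu> i k)"
definition array :: "(nat \<Rightarrow> nat \<Rightarrow> complex) measure" where "array = PiM {..<N} column"
definition Y :: "(nat \<Rightarrow> nat \<Rightarrow> complex) \<Rightarrow> nat \<Rightarrow> nat \<Rightarrow> complex" where
  "Y \<omega> k i = of_real (d i k / sqrt N) * \<omega> k i"
definition R :: "(nat \<Rightarrow> nat \<Rightarrow> complex) \<Rightarrow> nat \<Rightarrow> nat \<Rightarrow> complex" where
  "R \<omega> = gram_resolvent n z N (Y \<omega>)"
text \<open>The resolvent without column \<open>k\<close>, which is independent of that column.\<close>

definition R' :: "nat \<Rightarrow> (nat \<Rightarrow> nat \<Rightarrow> complex) \<Rightarrow> nat \<Rightarrow> nat \<Rightarrow> complex" where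
  "R' k \<omega> = gram_resolvent n z N ((Y \<omega>)(k := \<lambda>_. 0))"

lemma prob_column: "prob_space (column k)"
  unfolding column_def by (rule prob_space_PiM[OF prob_entry])

lemma prob_array: "prob_space array"
  unfolding array_def by (rule prob_space_PiM[OF prob_column])

lemma entry_measurable: "k < N \<Longrightarrow> i < n \<Longrightarrow> (\<lambda>\<omega>. \<omega> k i) \<in> borel_measurable array"
proof -
  assume k: "k < N" and i: "i < n"
  have 1: "(\<lambda>\<omega>. \<omega> k) \<in> measurable array (column k)"
    unfolding array_def using k by (intro measurable_component_singleton) simp
  have 2: "(\<lambda>y. y i) \<in> borel_measurable (column k)"
    unfolding column_def using i standard[OF k] by (intro component_measurable) (auto simp: standard_on_def)
  show ?thesis by (rule measurable_compose[OF 1 2])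
qed

lemma Y_measurable: "k < N \<Longrightarrow> i < n \<Longrightarrow> (\<lambda>\<omega>. Y \<omega> k i) \<in> borel_measurable array"
  unfolding Y_def by (intro borel_measurable_times borel_measurable_const entry_measurable)

lemma R_measurable: "i < n \<Longrightarrow> j < n \<Longrightarrow> (\<lambda>\<omega>. R \<omega> i j) \<in> borel_measurable array"
  unfolding R_def by (rule gram_resolvent_measurable[OF Y_measurable]) auto

lemma R'_measurable: "i < n \<Longrightarrow> j < n \<Longrightarrow> (\<lambda>\<omega>. R' k \<omega> i j) \<in> borel_measurable array"
proof -
  have "(\<lambda>\<omega>. ((Y \<omega>)(k := \<lambda>_. 0)) l a) \<in> borel_measurable array" if "l < N" "a < n" for l a
    using Y_measurable[OF that] by (cases "l = k") auto
  from gram_resolvent_measurable[of N n "\<lambda>\<omega>. (Y \<omega>)(k := \<lambda>_. 0)", OF this]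
  show "i < n \<Longrightarrow> j < n \<Longrightarrow> ?thesis" unfolding R'_def by simp
qed

lemma is_resolvent_R: "is_resolvent n (gram N (Y \<omega>)) z (R \<omega>)"
  unfolding R_def by (rule is_resolvent_gram_resolvent[OF z_pos])

lemma is_resolvent_R': "is_resolvent n (gram N ((Y \<omega>)(k := \<lambda>_. 0))) z (R' k \<omega>)"
  unfolding R'_def by (rule is_resolvent_gram_resolvent[OF z_pos])

lemmas R_diag = resolvent_diag[OF is_resolvent_R psd_gram z_pos]

lemma R'_upd: "R' k (x(k := y)) = R' k x"
proof -
  have "(Y (x(k := y)))(k := \<lambda>_. 0) = (Y x)(k := \<lambda>_. 0)" by (auto simp: Y_def fun_eq_iff)
  then show ?thesis by (simp add: R'_def)
qed

lemma weighted_trace_remove_column: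
  assumes "k < N" "\<And>i. i < n \<Longrightarrow> cmod (w i) \<le> W" "0 \<le> W"
  shows "cmod (\<Sum>i<n. w i * (R \<omega> i i - R' k \<omega> i i)) \<le> W / Im z"
proof -
  have "(\<Sum>i<n. w i * (R \<omega> i i - R' k \<omega> i i)) = (\<Sum>i<n. w i * (rank_one_update n (R' k \<omega>) (Y \<omega> k) i i - R' k \<omega> i i))"
    unfolding R_def R'_def using gram_resolvent_remove_column[OF z_pos assms(1), of _ n _ "Y \<omega>"] by (intro sum.cong refl) simp
  also have "cmod (\<Sum>i<n. w i * (rank_one_update n (R' k \<omega>) (Y \<omega> k) i i - R' k \<omega> i i)) \<le> W / Im z"
    by (rule weighted_trace_rank_one_update[OF is_resolvent_R' psd_gram z_pos assms(2,3)])
  finally show ?thesis .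
qed

text \<open>Compare both traces with the one without the column.\<close>

lemma weighted_trace_change_column:
  assumes k: "k < N" and w: "\<And>i. i < n \<Longrightarrow> cmod (w i) \<le> W" "0 \<le> W"
  shows "cmod ((\<Sum>i<n. w i * R x i i) - (\<Sum>i<n. w i * R (x(k := y)) i i)) \<le> 2 * W / Im z"
proof -
  have eq: "(\<Sum>i<n. w i * R x i i) - (\<Sum>i<n. w i * R (x(k := y)) i i)
    = (\<Sum>i<n. w i * (R x i i - R' k x i i)) - (\<Sum>i<n. w i * (R (x(k := y)) i i - R' k (x(k := y)) i i))"
    unfolding R'_upd right_diff_distrib sum_subtractf by simp
  show ?thesis unfolding eq
    using norm_triangle_ineq4[of "\<Sum>i<n. w i * (R x i i - R' k x i i)" "\<Sum>i<n. w i * (R (x(k := y)) i i - R' k (x(k := y)) i i)"]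
      weighted_trace_remove_column[OF k, of w W x, OF w] weighted_trace_remove_column[OF k, of w W "x(k := y)", OF w] by simp
qed

lemma weighted_trace_bound:
  assumes w: "\<And>i. i < n \<Longrightarrow> cmod (w i) \<le> W"
  shows "cmod (\<Sum>i<n. w i * R \<omega> i i) \<le> real n * (W / Im z)"
proof -
  have "cmod (\<Sum>i<n. w i * R \<omega> i i) \<le> (\<Sum>i<n. W * (1 / Im z))"
  proof (rule sum_norm_le)
    fix i assume "i \<in> {..<n}"
    then show "cmod (w i * R \<omega> i i) \<le> W * (1 / Im z)"
      unfolding norm_mult using w[of i] R_diag(1)[of i \<omega>] order_trans[OF norm_ge_zero w[of i]] by (intro mult_mono) auto
  qed
  then show ?thesis by simp
qed

lemma weighted_trace_measurable: "(\<lambda>\<omega>. \<Sum>i<n. w i * R \<omega> i i) \<in> borel_measurable array"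
  by (intro borel_measurable_sum borel_measurable_times borel_measurable_const R_measurable) auto

lemma bounded_integrable:
  fixes f :: "_ \<Rightarrow> 'b::{banach, second_countable_topology}"
  assumes "f \<in> borel_measurable array" "\<And>\<omega>. norm (f \<omega>) \<le> B"
  shows "integrable array f"
proof -
  interpret prob_space array by (rule prob_array)
  show ?thesis by (rule integrable_const_bound[of _ B]) (use assms in auto)
qed

definition mean_R :: "nat \<Rightarrow> complex" where "mean_R i = (LINT \<omega>|array. R \<omega> i i)"

lemma R_integrable: "i < n \<Longrightarrow> integrable array (\<lambda>\<omega>. R \<omega> i i)"
  by (rule bounded_integrable[OF R_measurable]) (auto intro: R_diag(1))

lemma integral_weighted_trace: "(LINT \<omega>|array. (\<Sum>i<n. w i * R \<omega> i i)) = (\<Sum>i<n. w i * mean_R i)"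
  unfolding mean_R_def by (subst Bochner_Integration.integral_sum) (auto intro: R_integrable)

lemma mean_R_bounds:
  assumes "i < n"
  shows "cmod (mean_R i) \<le> 1 / Im z" "0 \<le> Im (mean_R i)" "0 \<le> Im (z * mean_R i)"
proof -
  interpret prob_space array by (rule prob_array)
  have int: "integrable array (\<lambda>\<omega>. R \<omega> i i)" by (rule R_integrable[OF assms])
  have "cmod (mean_R i) \<le> (LINT \<omega>|array. cmod (R \<omega> i i))" unfolding mean_R_def by (rule integral_norm_bound)
  also have "\<dots> \<le> (LINT \<omega>|array. 1 / Im z)"
    using int R_diag(1)[OF assms] by (intro integral_mono integrable_norm) auto
  finally show "cmod (mean_R i) \<le> 1 / Im z" by (simp add: prob_space)
  have "Im (mean_R i) = (LINT \<omega>|array. Im (R \<omega> i i))"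
    unfolding mean_R_def by (rule integral_bounded_linear[OF bounded_linear_Im int, symmetric])
  then show "0 \<le> Im (mean_R i)" using R_diag(2)[OF assms] by (auto intro!: Bochner_Integration.integral_nonneg)
  have "Im (z * mean_R i) = (LINT \<omega>|array. Im (z * R \<omega> i i))"
    unfolding mean_R_def using integral_bounded_linear[OF bounded_linear_Im integrable_mult_right[OF int, of z]] int by simp
  then show "0 \<le> Im (z * mean_R i)" using R_diag(3)[OF assms] by (auto intro!: Bochner_Integration.integral_nonneg)
qed

lemma weighted_trace_fourth_moment:
  assumes w: "\<And>i. i < n \<Longrightarrow> cmod (w i) \<le> W" and W: "W > 0" and g: "g = Re \<or> g = Im"
  shows "(\<integral>\<^sup>+\<omega>. ennreal ((g (\<Sum>i<n. w i * R \<omega> i i) - g (\<Sum>i<n. w i * mean_R i)) ^ 4) \<partial>array)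
    \<le> ennreal (96 * (real N)\<^sup>2 * (2 * W / Im z) ^ 4)"
proof -
  let ?f = "\<lambda>\<omega>. g (\<Sum>i<n. w i * R \<omega> i i)"
  have bl: "bounded_linear g" using g bounded_linear_Re bounded_linear_Im by auto
  have gle: "\<bar>g u\<bar> \<le> cmod u" for u using g abs_Re_le_cmod abs_Im_le_cmod by auto
  have gd: "g u - g u' = g (u - u')" for u u' using g by auto
  have m: "?f \<in> borel_measurable array"
    by (rule measurable_compose[OF weighted_trace_measurable borel_measurable_continuous_onI[OF linear_continuous_on[OF bl]]])
  have int: "integrable array (\<lambda>\<omega>. \<Sum>i<n. w i * R \<omega> i i)"
    by (rule bounded_integrable[OF weighted_trace_measurable weighted_trace_bound[OF w]])
  have "integral\<^sup>L array ?f = g (\<Sum>i<n. w i * mean_R i)"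
    using integral_bounded_linear[OF bl int] by (simp add: integral_weighted_trace)
  moreover have "(\<integral>\<^sup>+\<omega>. ennreal ((?f \<omega> - integral\<^sup>L (PiM {..<N} column) ?f) ^ 4) \<partial>PiM {..<N} column)
    \<le> ennreal (96 * (real (card {..<N}))\<^sup>2 * (2 * W / Im z) ^ 4)"
  proof (rule mcdiarmid_fourth_moment[OF prob_column])
    show "{..<N} \<noteq> {}" using N_pos by auto
    show "2 * W / Im z > 0" using W z_pos by simp
    show "?f \<in> borel_measurable (PiM {..<N} column)" using m by (simp add: array_def)
    show "\<forall>x\<in>space (PiM {..<N} column). \<bar>?f x\<bar> \<le> real n * (W / Im z)"
      using order_trans[OF gle weighted_trace_bound[OF w]] by auto
    show "\<forall>i\<in>{..<N}. \<forall>x\<in>space (PiM {..<N} column). \<forall>y\<in>space (column i). \<bar>?f x - ?f (x(i := y))\<bar> \<le> 2 * W / Im z"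
      unfolding gd using order_trans[OF gle weighted_trace_change_column[OF _ w]] W by auto
  qed auto
  ultimately show ?thesis by (simp add: array_def)
qed

end

section \<open>The mean resolvent almost solves the system\<close>

text \<open>A bound of the first moment by the fourth that is linear in the latter.\<close>

lemma abs_le_fourth_power:
  fixes t :: real
  assumes "s > 0"
  shows "\<bar>t\<bar> \<le> s + t ^ 4 / s ^ 3"
proof (cases "\<bar>t\<bar> \<le> s")
  case True
  have "0 \<le> t ^ 4 / s ^ 3" using assms by (intro divide_nonneg_nonneg) auto
  then show ?thesis using True by linarith
next
  case False
  have "\<bar>t\<bar> * s ^ 3 \<le> \<bar>t\<bar> * \<bar>t\<bar> ^ 3" using False assms by (intro mult_left_mono power_mono) auto
  also have "\<dots> = t ^ 4" by (simp add: power_even_abs power_Suc[symmetric] del: power_Suc flip: power_Suc)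
  finally have "\<bar>t\<bar> \<le> t ^ 4 / s ^ 3" using assms by (simp add: pos_le_divide_eq)
  then show ?thesis using assms by simp
qed

lemma inverse_le_inverse_sqrt: "N > 0 \<Longrightarrow> 1 / real N \<le> 1 / sqrt (real N)"
proof -
  assume N: "N > 0"
  then have "sqrt N * 1 \<le> sqrt N * sqrt N" by (intro mult_left_mono) auto
  then show ?thesis using N by (intro frac_le) auto
qed

lemma ennreal_le_add: "0 \<le> a \<Longrightarrow> 0 \<le> b \<Longrightarrow> x \<le> a + b \<Longrightarrow> ennreal x \<le> ennreal a + ennreal b"
  by (simp add: ennreal_plus[symmetric] ennreal_leI del: ennreal_plus)

lemma ennreal_add_mult: "0 \<le> a \<Longrightarrow> 0 \<le> B \<Longrightarrow> 0 \<le> b \<Longrightarrow> ennreal (a + B * b) = ennreal a + ennreal B * ennreal b"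
  by (simp add: ennreal_mult)

lemma cmod_quotient_diff_le:
  assumes "1 \<le> cmod a" "1 \<le> cmod b" "cmod p \<le> B"
  shows "cmod (p / a - p' / b) \<le> cmod (p' - p) + B * cmod (b - a)"
proof -
  have a0: "a \<noteq> 0" "b \<noteq> 0" using assms by auto
  have "p / a - p' / b = (p - p') / b + p * (b - a) / (a * b)" using a0 by (simp add: field_simps)
  moreover have "cmod ((p - p') / b) \<le> cmod (p' - p)"
    using assms(2) a0 by (simp add: norm_divide norm_minus_commute divide_le_eq mult_left_le_one_le mult_le_cancel_left1)
  moreover have "cmod (p * (b - a) / (a * b)) \<le> B * cmod (b - a)"
  proof -
    have "1 * 1 \<le> cmod a * cmod b" using assms by (intro mult_mono) auto
    then have "cmod (p * (b - a) / (a * b)) \<le> cmod p * cmod (b - a) / 1"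
      unfolding norm_divide norm_mult by (intro divide_left_mono) auto
    also have "\<dots> \<le> B * cmod (b - a)" using assms(3) by (simp add: mult_right_mono)
    finally show ?thesis .
  qed
  ultimately show ?thesis using norm_triangle_ineq[of "(p - p') / b" "p * (b - a) / (a * b)"] by simp
qed

context gram_model
begin

lemma weighted_trace_deviation:
  assumes w: "\<And>i. i < n \<Longrightarrow> cmod (w i) \<le> W" and W: "W > 0"
  shows "(\<integral>\<^sup>+\<omega>. ennreal (cmod ((\<Sum>i<n. w i * R \<omega> i i) - (\<Sum>i<n. w i * mean_R i))) \<partial>array) \<le> ennreal (28 * (sqrt N * (W / Im z)))"
proof -
  interpret prob_space array by (rule prob_array)
  define t where "t = sqrt N * (W / Im z)"
  \<comment> \<open>The factor 6 roughly balances \<open>s\<close> against \<open>1536 * t ^ 4 / s ^ 3\<close>.\<close>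
  define s where "s = 6 * t"
  have t0: "t > 0" using N_pos W z_pos by (simp add: t_def)
  then have s0: "s > 0" by (simp add: s_def)
  have t4: "(real N)\<^sup>2 * (2 * W / Im z) ^ 4 = 16 * t ^ 4"
  proof -
    have "sqrt N ^ 4 = ((sqrt N)\<^sup>2)\<^sup>2" by (simp only: power_mult[symmetric]) simp
    then have "sqrt N ^ 4 = (real N)\<^sup>2" by simp
    then show ?thesis by (simp add: t_def power_mult_distrib power_divide)
  qed
  have one: "(\<integral>\<^sup>+\<omega>. ennreal \<bar>g (\<Sum>i<n. w i * R \<omega> i i) - g (\<Sum>i<n. w i * mean_R i)\<bar> \<partial>array) \<le> ennreal (14 * t)"
    if g: "g = Re \<or> g = Im" for g
  proof -
    have bl: "bounded_linear g" using g bounded_linear_Re bounded_linear_Im by auto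
    have m: "(\<lambda>\<omega>. g (\<Sum>i<n. w i * R \<omega> i i)) \<in> borel_measurable array"
      by (rule measurable_compose[OF weighted_trace_measurable borel_measurable_continuous_onI[OF linear_continuous_on[OF bl]]])
    let ?X = "\<lambda>\<omega>. g (\<Sum>i<n. w i * R \<omega> i i) - g (\<Sum>i<n. w i * mean_R i)"
    have "(\<integral>\<^sup>+\<omega>. ennreal \<bar>?X \<omega>\<bar> \<partial>array) \<le> (\<integral>\<^sup>+\<omega>. ennreal s + ennreal (1 / s ^ 3) * ennreal (?X \<omega> ^ 4) \<partial>array)"
    proof (rule nn_integral_mono)
      fix \<omega>
      have "\<bar>?X \<omega>\<bar> \<le> s + 1 / s ^ 3 * ?X \<omega> ^ 4" using abs_le_fourth_power[OF s0, of "?X \<omega>"] by simp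
      then have "ennreal \<bar>?X \<omega>\<bar> \<le> ennreal (s + 1 / s ^ 3 * ?X \<omega> ^ 4)" by (rule ennreal_leI)
      also have "\<dots> = ennreal s + ennreal (1 / s ^ 3) * ennreal (?X \<omega> ^ 4)"
        by (rule ennreal_add_mult) (use s0 in auto)
      finally show "ennreal \<bar>?X \<omega>\<bar> \<le> ennreal s + ennreal (1 / s ^ 3) * ennreal (?X \<omega> ^ 4)" .
    qed
    also have "\<dots> = ennreal s + ennreal (1 / s ^ 3) * (\<integral>\<^sup>+\<omega>. ennreal (?X \<omega> ^ 4) \<partial>array)"
      using m by (subst nn_integral_add, simp, simp, subst nn_integral_cmult) (auto simp: emeasure_space_1)
    also have "\<dots> \<le> ennreal s + ennreal (1 / s ^ 3) * ennreal (96 * (real N)\<^sup>2 * (2 * W / Im z) ^ 4)"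
      by (intro add_left_mono mult_left_mono weighted_trace_fourth_moment[OF w W g]) auto
    also have "\<dots> = ennreal (s + 1 / s ^ 3 * (96 * (16 * t ^ 4)))"
    proof -
      have "96 * (real N)\<^sup>2 * (2 * W / Im z) ^ 4 = 96 * (16 * t ^ 4)" using t4 by (simp add: mult.assoc)
      then show ?thesis unfolding \<open>96 * (real N)\<^sup>2 * (2 * W / Im z) ^ 4 = 96 * (16 * t ^ 4)\<close>
        by (intro ennreal_add_mult[symmetric]) (use s0 t0 in auto)
    qed
    also have "\<dots> \<le> ennreal (14 * t)"
    proof (rule ennreal_leI)
      have "1 / s ^ 3 * (96 * (16 * t ^ 4)) = 1536 / 216 * t"
        using t0 unfolding s_def by (simp add: power_mult_distrib power3_eq_cube power4_eq_xxxx)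
      then show "s + 1 / s ^ 3 * (96 * (16 * t ^ 4)) \<le> 14 * t" using t0 by (simp add: s_def)
    qed
    finally show ?thesis .
  qed
  have mg: "(\<lambda>\<omega>. ennreal \<bar>g (\<Sum>i<n. w i * R \<omega> i i) - g (\<Sum>i<n. w i * mean_R i)\<bar>) \<in> borel_measurable array"
    if "bounded_linear g" for g :: "complex \<Rightarrow> real"
    by (intro measurable_compose[OF _ measurable_ennreal] borel_measurable_abs borel_measurable_diff borel_measurable_const
      measurable_compose[OF weighted_trace_measurable borel_measurable_continuous_onI[OF linear_continuous_on[OF that]]])
  have "(\<integral>\<^sup>+\<omega>. ennreal (cmod ((\<Sum>i<n. w i * R \<omega> i i) - (\<Sum>i<n. w i * mean_R i))) \<partial>array)
    \<le> (\<integral>\<^sup>+\<omega>. ennreal \<bar>Re (\<Sum>i<n. w i * R \<omega> i i) - Re (\<Sum>i<n. w i * mean_R i)\<bar>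
         + ennreal \<bar>Im (\<Sum>i<n. w i * R \<omega> i i) - Im (\<Sum>i<n. w i * mean_R i)\<bar> \<partial>array)"
  proof (rule nn_integral_mono)
    fix \<omega>
    have "cmod ((\<Sum>i<n. w i * R \<omega> i i) - (\<Sum>i<n. w i * mean_R i))
      \<le> \<bar>Re (\<Sum>i<n. w i * R \<omega> i i) - Re (\<Sum>i<n. w i * mean_R i)\<bar> + \<bar>Im (\<Sum>i<n. w i * R \<omega> i i) - Im (\<Sum>i<n. w i * mean_R i)\<bar>"
      unfolding minus_complex.sel[symmetric] by (rule cmod_le)
    then show "ennreal (cmod ((\<Sum>i<n. w i * R \<omega> i i) - (\<Sum>i<n. w i * mean_R i)))
      \<le> ennreal \<bar>Re (\<Sum>i<n. w i * R \<omega> i i) - Re (\<Sum>i<n. w i * mean_R i)\<bar>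
         + ennreal \<bar>Im (\<Sum>i<n. w i * R \<omega> i i) - Im (\<Sum>i<n. w i * mean_R i)\<bar>"
      by (rule ennreal_le_add[rotated 2]) auto
  qed
  also have "\<dots> = (\<integral>\<^sup>+\<omega>. ennreal \<bar>Re (\<Sum>i<n. w i * R \<omega> i i) - Re (\<Sum>i<n. w i * mean_R i)\<bar> \<partial>array)
     + (\<integral>\<^sup>+\<omega>. ennreal \<bar>Im (\<Sum>i<n. w i * R \<omega> i i) - Im (\<Sum>i<n. w i * mean_R i)\<bar> \<partial>array)"
    by (rule nn_integral_add[OF mg[OF bounded_linear_Re] mg[OF bounded_linear_Im]])
  also have "\<dots> \<le> ennreal (14 * t) + ennreal (14 * t)" by (intro add_mono one) auto
  also have "\<dots> = ennreal (28 * t)" using t0 by (subst ennreal_plus[symmetric]) auto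
  finally show ?thesis by (simp add: t_def)
qed

text \<open>The tails in the Lindeberg condition, with \<open>h\<close> in place of \<open>\<eta>\<close>; \<open>\<kappa>\<close> is the error of the trace
  approximation for a single column.\<close>

definition tail :: "real \<Rightarrow> nat \<Rightarrow> nat \<Rightarrow> real" where
  "tail h i k = (LINT y|\<nu> i k. (cmod y)\<^sup>2 * of_bool (cmod y \<ge> h * sqrt n))"

definition \<kappa> :: "real \<Rightarrow> nat \<Rightarrow> real" where
  "\<kappa> h k = (2 * sqrt n + h * n + 2 * (\<Sum>i<n. tail h i k)) / N"

text \<open>The contribution of column \<open>k\<close> to \<open>\<Sum>i<n. w i * (1 + z * R i i)\<close> before division by \<open>1 + quad\<close>. With unit weights
  it is the quadratic form \<open>quad\<close> itself.\<close>

definition p :: "(nat \<Rightarrow> complex) \<Rightarrow> nat \<Rightarrow> (nat \<Rightarrow> nat \<Rightarrow> complex) \<Rightarrow> complex" where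
  "p w k \<omega> = (\<Sum>i<n. w i * (\<Sum>l<n. R' k \<omega> i l * Y \<omega> k l) * cnj (Y \<omega> k i))"

lemma tail_nonneg: "0 \<le> tail h i k"
  unfolding tail_def by (intro Bochner_Integration.integral_nonneg) auto

lemma \<kappa>_nonneg: "h > 0 \<Longrightarrow> 0 \<le> \<kappa> h k"
  unfolding \<kappa>_def by (intro divide_nonneg_nonneg add_nonneg_nonneg mult_nonneg_nonneg sum_nonneg tail_nonneg) auto

lemma p_measurable: "k < N \<Longrightarrow> p w k \<in> borel_measurable array"
  unfolding p_def[abs_def]
  by (intro borel_measurable_sum borel_measurable_times borel_measurable_const borel_measurable_cnj_comp R'_measurable Y_measurable) auto

lemma quad_eq_p: "quad n (R' k \<omega>) (Y \<omega> k) = p (\<lambda>_. 1) k \<omega>"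
  by (simp add: quad_def p_def sum_distrib_left sum_distrib_right mult_ac)

text \<open>For fixed other columns this is the concentration of a quadratic form in column \<open>k\<close>; Fubini's theorem
  integrates over the others.\<close>

lemma removed_column_form:
  assumes k: "k < N" and w: "\<And>i. i < n \<Longrightarrow> cmod (w i) \<le> W" and W: "W > 0" and h: "h > 0"
  shows "(\<integral>\<^sup>+\<omega>. ennreal (cmod (p w k \<omega> - (\<Sum>i<n. w i * of_real ((d i k)\<^sup>2 / N) * R' k \<omega> i i))) \<partial>array)
    \<le> ennreal (W * S / Im z * \<kappa> h k)"
proof -
  define a where "a = W * S / (N * Im z)"
  have a0: "a > 0" using W S_pos N_pos z_pos by (simp add: a_def)
  define A where "A x i l = w i * of_real (d i k / sqrt N * (d l k / sqrt N)) * R' k x i l" for x :: "nat \<Rightarrow> nat \<Rightarrow> complex" and i l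
  define J where "J = {..<N} - {k}"
  have J: "finite J" "k \<notin> J" "{..<N} = insert k J" using k by (auto simp: J_def)
  interpret product_sigma_finite column
    by (intro product_sigma_finite.intro prob_space_imp_sigma_finite prob_column)
  let ?g = "\<lambda>\<omega>. p w k \<omega> - (\<Sum>i<n. w i * of_real ((d i k)\<^sup>2 / N) * R' k \<omega> i i)"
  have gm: "(\<lambda>\<omega>. ennreal (cmod (?g \<omega>))) \<in> borel_measurable array"
    by (intro measurable_compose[OF _ measurable_ennreal] measurable_compose[OF _ borel_measurable_norm] borel_measurable_diff
      borel_measurable_sum borel_measurable_times borel_measurable_const R'_measurable p_measurable k) auto
  have sq: "of_real (d i k / sqrt N * (d i k / sqrt N)) = (of_real ((d i k)\<^sup>2 / N) :: complex)" for i
    by (simp add: power2_eq_square flip: of_real_mult)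
  have form: "?g (x(k := y)) = (\<Sum>i<n. \<Sum>l<n. cnj (y i) * A x i l * y l) - (\<Sum>i<n. A x i i)" for x y
  proof -
    have "p w k (x(k := y)) = (\<Sum>i<n. \<Sum>l<n. cnj (y i) * A x i l * y l)"
      unfolding p_def R'_upd A_def Y_def
      by (simp only: fun_upd_same sum_distrib_left sum_distrib_right complex_cnj_mult complex_cnj_complex_of_real of_real_mult mult_ac)
    then show ?thesis unfolding R'_upd A_def sq by simp
  qed
  have d2: "(d i k / sqrt N)\<^sup>2 \<le> S / N" if "i < n" for i
    using d_le[OF that k] N_pos by (simp add: power_divide divide_right_mono)
  have row: "(\<Sum>l<n. (cmod (A x i l))\<^sup>2) \<le> a\<^sup>2" if i: "i < n" for x i
  proof -
    have "(\<Sum>l<n. (cmod (A x i l))\<^sup>2) \<le> (\<Sum>l<n. (W * (S / N))\<^sup>2 * (cmod (R' k x i l))\<^sup>2)"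
    proof (rule sum_mono)
      fix l assume l: "l \<in> {..<n}"
      have "(cmod (A x i l))\<^sup>2 = (cmod (w i))\<^sup>2 * ((d i k / sqrt N)\<^sup>2 * (d l k / sqrt N)\<^sup>2) * (cmod (R' k x i l))\<^sup>2"
        unfolding A_def norm_mult norm_of_real power_mult_distrib power2_abs ..
      also have "\<dots> \<le> W\<^sup>2 * (S / N * (S / N)) * (cmod (R' k x i l))\<^sup>2"
        using w[OF i] d2[OF i] d2[of l] l S_pos by (intro mult_right_mono mult_mono power_mono) auto
      finally show "(cmod (A x i l))\<^sup>2 \<le> (W * (S / N))\<^sup>2 * (cmod (R' k x i l))\<^sup>2"
        by (simp add: power_mult_distrib power2_eq_square mult_ac)
    qed
    also have "\<dots> = (W * (S / N))\<^sup>2 * (\<Sum>l<n. (cmod (R' k x i l))\<^sup>2)" by (simp add: sum_distrib_left)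
    also have "\<dots> \<le> (W * (S / N))\<^sup>2 * (1 / (Im z)\<^sup>2)"
      by (intro mult_left_mono resolvent_row_norm_le[OF is_resolvent_R' psd_gram z_pos i]) auto
    also have "\<dots> = a\<^sup>2" by (simp add: a_def power_mult_distrib power_divide)
    finally show ?thesis .
  qed
  have "(\<integral>\<^sup>+\<omega>. ennreal (cmod (?g \<omega>)) \<partial>array)
      = (\<integral>\<^sup>+x. (\<integral>\<^sup>+y. ennreal (cmod (?g (x(k := y)))) \<partial>column k) \<partial>PiM J column)"
    unfolding array_def J(3) by (rule product_nn_integral_insert[OF J(1,2)]) (use gm in \<open>simp add: array_def J(3)\<close>)
  also have "\<dots> \<le> (\<integral>\<^sup>+x. ennreal (W * S / Im z * \<kappa> h k) \<partial>PiM J column)"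
  proof (rule nn_integral_mono)
    fix x
    have "(\<integral>\<^sup>+y. ennreal (cmod (?g (x(k := y)))) \<partial>column k)
      \<le> ennreal (2 * a * sqrt n + a * h * n + 2 * a * (\<Sum>i<n. LINT y|\<nu> i k. (cmod y)\<^sup>2 * of_bool (cmod y \<ge> h * sqrt n)))"
      unfolding form column_def by (rule quadratic_form_concentration[OF prob_entry n_pos standard[OF k] a0 row h])
    also have "2 * a * sqrt n + a * h * n + 2 * a * (\<Sum>i<n. LINT y|\<nu> i k. (cmod y)\<^sup>2 * of_bool (cmod y \<ge> h * sqrt n))
      = W * S / Im z * \<kappa> h k"
      unfolding a_def \<kappa>_def tail_def by (simp add: add_divide_distrib distrib_left mult_ac)
    finally show "(\<integral>\<^sup>+y. ennreal (cmod (?g (x(k := y)))) \<partial>column k) \<le> ennreal (W * S / Im z * \<kappa> h k)" .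
  qed
  also have "\<dots> = ennreal (W * S / Im z * \<kappa> h k)"
    using prob_space.emeasure_space_1[OF prob_space_PiM[OF prob_column], of J] by simp
  finally show ?thesis .
qed

lemma column_form:
  assumes k: "k < N" and w: "\<And>i. i < n \<Longrightarrow> cmod (w i) \<le> W" and W: "W > 0" and h: "h > 0"
  shows "(\<integral>\<^sup>+\<omega>. ennreal (cmod (p w k \<omega> - (\<Sum>i<n. w i * of_real ((d i k)\<^sup>2 / N) * R \<omega> i i))) \<partial>array)
    \<le> ennreal (W * S / Im z * (\<kappa> h k + 1 / N))"
proof -
  interpret prob_space array by (rule prob_array)
  let ?u = "\<lambda>i. w i * of_real ((d i k)\<^sup>2 / N)"
  have u: "cmod (?u i) \<le> W * (S / N)" if "i < n" for i
    unfolding norm_mult norm_of_real using w[OF that] d_le[OF that k] W S_pos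
    by (intro mult_mono) (auto simp: divide_right_mono)
  let ?g = "\<lambda>\<omega>. p w k \<omega> - (\<Sum>i<n. ?u i * R' k \<omega> i i)"
  have "(\<integral>\<^sup>+\<omega>. ennreal (cmod (p w k \<omega> - (\<Sum>i<n. ?u i * R \<omega> i i))) \<partial>array)
    \<le> (\<integral>\<^sup>+\<omega>. ennreal (cmod (?g \<omega>)) + ennreal (W * (S / N) / Im z) \<partial>array)"
  proof (rule nn_integral_mono)
    fix \<omega>
    have e: "p w k \<omega> - (\<Sum>i<n. ?u i * R \<omega> i i) = ?g \<omega> - (\<Sum>i<n. ?u i * (R \<omega> i i - R' k \<omega> i i))"
      unfolding right_diff_distrib sum_subtractf by simp
    have "cmod (p w k \<omega> - (\<Sum>i<n. ?u i * R \<omega> i i)) \<le> cmod (?g \<omega>) + W * (S / N) / Im z"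
      unfolding e using norm_triangle_ineq4[of "?g \<omega>" "\<Sum>i<n. ?u i * (R \<omega> i i - R' k \<omega> i i)"]
        weighted_trace_remove_column[OF k, of ?u "W * (S / N)" \<omega>] u W S_pos by auto
    then show "ennreal (cmod (p w k \<omega> - (\<Sum>i<n. ?u i * R \<omega> i i))) \<le> ennreal (cmod (?g \<omega>)) + ennreal (W * (S / N) / Im z)"
      by (rule ennreal_le_add[rotated 2]) (use W S_pos z_pos in auto)
  qed
  also have "\<dots> = (\<integral>\<^sup>+\<omega>. ennreal (cmod (?g \<omega>)) \<partial>array) + ennreal (W * (S / N) / Im z)"
  proof -
    have gm: "(\<lambda>\<omega>. ennreal (cmod (?g \<omega>))) \<in> borel_measurable array"
      by (intro measurable_compose[OF _ measurable_ennreal] measurable_compose[OF _ borel_measurable_norm] borel_measurable_diff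
        borel_measurable_sum borel_measurable_times borel_measurable_const R'_measurable p_measurable k) auto
    show ?thesis by (subst nn_integral_add[OF gm]) (auto simp: emeasure_space_1)
  qed
  also have "\<dots> \<le> ennreal (W * S / Im z * \<kappa> h k) + ennreal (W * (S / N) / Im z)"
    by (intro add_right_mono removed_column_form[OF k w W h])
  also have "\<dots> = ennreal (W * S / Im z * \<kappa> h k + W * (S / N) / Im z)"
    using W S_pos z_pos \<kappa>_nonneg[OF h, of k] by (intro ennreal_plus[symmetric]) auto
  also have "W * S / Im z * \<kappa> h k + W * (S / N) / Im z = W * S / Im z * (\<kappa> h k + 1 / N)"
    by (simp add: distrib_left)
  finally show ?thesis .
qed

text \<open>The empirical counterpart of the solution of the system, with the mean resolvent in place of the unknown.\<close>

definition e_hat :: "nat \<Rightarrow> complex" where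
  "e_hat k = 1 / of_nat n * (\<Sum>i<n. of_real ((d i k)\<^sup>2) * mean_R i)"

lemma of_real_c_e_hat: "of_real c * e_hat k = (\<Sum>i<n. of_real ((d i k)\<^sup>2 / N) * mean_R i)"
  using n_pos by (simp add: e_hat_def c_def sum_distrib_left sum_divide_distrib)

text \<open>The form is close to the weighted trace of \<open>R\<close>, which is close to its mean by concentration. The constant 29 is
  28 from the concentration and 1 from putting the column back.\<close>

lemma column_quad:
  assumes k: "k < N" and h: "h > 0"
  shows "(\<integral>\<^sup>+\<omega>. ennreal (cmod (p (\<lambda>_. 1) k \<omega> - of_real c * e_hat k)) \<partial>array) \<le> ennreal (S / Im z * (\<kappa> h k + 29 / sqrt N))"
proof -
  let ?u = "\<lambda>i. complex_of_real ((d i k)\<^sup>2 / N)"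
  let ?T = "\<lambda>\<omega>. \<Sum>i<n. ?u i * R \<omega> i i"
  have u: "cmod (?u i) \<le> S / N" if "i < n" for i
    unfolding norm_of_real using d_le[OF that k] by (auto simp: divide_right_mono)
  have m1: "(\<lambda>\<omega>. ennreal (cmod (p (\<lambda>_. 1) k \<omega> - ?T \<omega>))) \<in> borel_measurable array"
    by (intro measurable_compose[OF _ measurable_ennreal] measurable_compose[OF _ borel_measurable_norm] borel_measurable_diff
        weighted_trace_measurable p_measurable k)
  have m2: "(\<lambda>\<omega>. ennreal (cmod (?T \<omega> - of_real c * e_hat k))) \<in> borel_measurable array"
    by (intro measurable_compose[OF _ measurable_ennreal] measurable_compose[OF _ borel_measurable_norm] borel_measurable_diff
        weighted_trace_measurable borel_measurable_const)
  have "(\<integral>\<^sup>+\<omega>. ennreal (cmod (p (\<lambda>_. 1) k \<omega> - of_real c * e_hat k)) \<partial>array)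
    \<le> (\<integral>\<^sup>+\<omega>. ennreal (cmod (p (\<lambda>_. 1) k \<omega> - ?T \<omega>)) + ennreal (cmod (?T \<omega> - of_real c * e_hat k)) \<partial>array)"
  proof (rule nn_integral_mono)
    fix \<omega>
    have "cmod (p (\<lambda>_. 1) k \<omega> - of_real c * e_hat k) \<le> cmod (p (\<lambda>_. 1) k \<omega> - ?T \<omega>) + cmod (?T \<omega> - of_real c * e_hat k)"
      using norm_triangle_ineq[of "p (\<lambda>_. 1) k \<omega> - ?T \<omega>" "?T \<omega> - of_real c * e_hat k"] by (simp only: diff_add_cancel add_diff_eq)
    then show "ennreal (cmod (p (\<lambda>_. 1) k \<omega> - of_real c * e_hat k))
      \<le> ennreal (cmod (p (\<lambda>_. 1) k \<omega> - ?T \<omega>)) + ennreal (cmod (?T \<omega> - of_real c * e_hat k))"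
      by (rule ennreal_le_add[OF norm_ge_zero norm_ge_zero])
  qed
  also have "\<dots> = (\<integral>\<^sup>+\<omega>. ennreal (cmod (p (\<lambda>_. 1) k \<omega> - ?T \<omega>)) \<partial>array) + (\<integral>\<^sup>+\<omega>. ennreal (cmod (?T \<omega> - of_real c * e_hat k)) \<partial>array)"
    by (rule nn_integral_add[OF m1 m2])
  also have "\<dots> \<le> ennreal (1 * S / Im z * (\<kappa> h k + 1 / N)) + ennreal (28 * (sqrt N * (S / N / Im z)))"
  proof (rule add_mono)
    show "(\<integral>\<^sup>+\<omega>. ennreal (cmod (p (\<lambda>_. 1) k \<omega> - ?T \<omega>)) \<partial>array) \<le> ennreal (1 * S / Im z * (\<kappa> h k + 1 / N))"
      using column_form[OF k, of "\<lambda>_. 1" 1 h] h by simp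
    show "(\<integral>\<^sup>+\<omega>. ennreal (cmod (?T \<omega> - of_real c * e_hat k)) \<partial>array) \<le> ennreal (28 * (sqrt N * (S / N / Im z)))"
      unfolding of_real_c_e_hat by (rule weighted_trace_deviation[OF u]) (use S_pos N_pos in auto)
  qed
  also have "\<dots> = ennreal (1 * S / Im z * (\<kappa> h k + 1 / N) + 28 * (sqrt N * (S / N / Im z)))"
    using S_pos z_pos \<kappa>_nonneg[OF h, of k] by (intro ennreal_plus[symmetric]) auto
  also have "\<dots> \<le> ennreal (S / Im z * (\<kappa> h k + 29 / sqrt N))"
  proof (rule ennreal_leI)
    have "1 / real N \<le> 1 / sqrt N" by (rule inverse_le_inverse_sqrt[OF N_pos])
    moreover have "sqrt N * (S / N / Im z) = S / Im z * (1 / sqrt N)"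
    proof -
      have "sqrt N / N = 1 / sqrt N" using N_pos by (simp add: divide_simps)
      moreover have "sqrt N * (S / N / Im z) = S / Im z * (sqrt N / N)" by (simp add: mult_ac)
      ultimately show ?thesis by simp
    qed
    ultimately have "1 * S / Im z * (\<kappa> h k + 1 / N) + 28 * (sqrt N * (S / N / Im z)) \<le> S / Im z * (\<kappa> h k + 1 / sqrt N) + S / Im z * (28 * (1 / sqrt N))"
      using S_pos z_pos by (intro add_mono mult_left_mono) (auto simp: divide_right_mono)
    also have "\<dots> = S / Im z * (\<kappa> h k + 29 / sqrt N)" unfolding distrib_left[symmetric] by simp
    finally show "1 * S / Im z * (\<kappa> h k + 1 / N) + 28 * (sqrt N * (S / N / Im z)) \<le> S / Im z * (\<kappa> h k + 29 / sqrt N)" .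
  qed
  finally show ?thesis .
qed

lemma e_hat_cone: "0 \<le> Im (e_hat k)" "0 \<le> Im (z * e_hat k)"
proof -
  show "0 \<le> Im (e_hat k)" unfolding e_hat_def Im_inverse_nat_mult Im_sum Im_of_real_mult
    using mean_R_bounds(2) by (intro mult_nonneg_nonneg sum_nonneg) auto
  have e: "z * e_hat k = 1 / of_nat n * (\<Sum>i<n. of_real ((d i k)\<^sup>2) * (z * mean_R i))"
    unfolding e_hat_def by (simp add: sum_distrib_left mult_ac)
  show "0 \<le> Im (z * e_hat k)" unfolding e Im_inverse_nat_mult Im_sum Im_of_real_mult
    using mean_R_bounds(3) by (intro mult_nonneg_nonneg sum_nonneg) auto
qed

lemma one_le_one_plus: "0 \<le> Im (z * u) \<Longrightarrow> 1 \<le> cmod (1 + of_real c * u)"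
  using cmod_one_plus_ge[OF z_pos, of u] z_imag z_pos by simp

lemma one_le_one_plus_p: "1 \<le> cmod (1 + p (\<lambda>_. 1) k \<omega>)"
  using one_plus_quad_ge(1)[OF is_resolvent_R' psd_gram z_pos, of k \<omega> "Y \<omega> k"] z_imag z_pos by (simp add: quad_eq_p)

definition \<rho> :: "real \<Rightarrow> real" where
  "\<rho> h = ((\<Sum>k<N. \<kappa> h k) + 29 * sqrt N) / n"

lemma \<rho>_nonneg: "h > 0 \<Longrightarrow> 0 \<le> \<rho> h"
  unfolding \<rho>_def by (intro divide_nonneg_nonneg add_nonneg_nonneg sum_nonneg \<kappa>_nonneg) auto

lemma upper_e_hat: "upper e_hat" using e_hat_cone(1) by (simp add: upper_def)

text \<open>Both \<open>D z e_hat i\<close> times \<open>R i i\<close> and \<open>1 + z R i i\<close> are sums over columns. Their summands agree up to replacing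
  the form \<open>p w k\<close> by its trace and \<open>quad\<close> by \<open>c * e_hat k\<close>, and both replacements are small in mean. Free
  weights \<open>w\<close> are essential: suitable choices give the equations for \<open>e_hat\<close> and for the mean trace.\<close>

lemma defect_bound:
  assumes w: "\<And>i. i < n \<Longrightarrow> cmod (w i) \<le> W" and W: "W > 0" and h: "h > 0"
  shows "cmod (1 / of_nat n * (\<Sum>i<n. w i * (mean_R i * D z e_hat i - 1))) \<le> W * S / Im z * (1 + c * S / Im z) * \<rho> h"
proof -
  interpret prob_space array by (rule prob_array)
  let ?Q = "\<lambda>k. 1 + of_real c * e_hat k"
  let ?\<pi> = "\<lambda>k \<omega>. \<Sum>i<n. w i * of_real ((d i k)\<^sup>2 / N) * R \<omega> i i"
  let ?B = "W * S * c / Im z"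
  have B0: "?B \<ge> 0" using W S_pos c_pos z_pos by simp
  have ident: "(\<Sum>i<n. w i * (R \<omega> i i * D z e_hat i - 1)) = (\<Sum>k<N. ?\<pi> k \<omega> / ?Q k - p w k \<omega> / (1 + p (\<lambda>_. 1) k \<omega>))" for \<omega>
  proof -
    have "(\<Sum>i<n. w i * (R \<omega> i i * D z e_hat i - 1))
      = (\<Sum>i<n. w i * R \<omega> i i * (1 / of_nat N * (\<Sum>k<N. of_real ((d i k)\<^sup>2) / ?Q k))) - (\<Sum>i<n. w i * (1 + z * R \<omega> i i))"
      unfolding D_eq sum_subtractf[symmetric] by (intro sum.cong refl) (simp add: algebra_simps)
    also have "(\<Sum>i<n. w i * R \<omega> i i * (1 / of_nat N * (\<Sum>k<N. of_real ((d i k)\<^sup>2) / ?Q k))) = (\<Sum>k<N. ?\<pi> k \<omega> / ?Q k)"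
      unfolding sum_distrib_left sum_divide_distrib by (subst sum.swap) (simp add: mult_ac)
    also have "(\<Sum>i<n. w i * (1 + z * R \<omega> i i)) = (\<Sum>k<N. p w k \<omega> / (1 + p (\<lambda>_. 1) k \<omega>))"
      unfolding R_def gram_resolvent_weighted_trace[OF z_pos] quad_eq_p[symmetric] p_def R'_def ..
    finally show ?thesis by (simp only: sum_subtractf)
  qed
  have term_le: "cmod (?\<pi> k \<omega> / ?Q k - p w k \<omega> / (1 + p (\<lambda>_. 1) k \<omega>))
      \<le> cmod (p w k \<omega> - ?\<pi> k \<omega>) + ?B * cmod (p (\<lambda>_. 1) k \<omega> - of_real c * e_hat k)" if k: "k < N" for k \<omega>
  proof -
    have "cmod (w i * of_real ((d i k)\<^sup>2 / N)) \<le> W * (S / N)" if "i < n" for i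
      unfolding norm_mult norm_of_real using w[OF that] d_le[OF that k] W S_pos
      by (intro mult_mono) (auto simp: divide_right_mono)
    from weighted_trace_bound[of "\<lambda>i. w i * of_real ((d i k)\<^sup>2 / N)", OF this]
    have "cmod (?\<pi> k \<omega>) \<le> real n * (W * (S / N) / Im z)" .
    then have "cmod (?\<pi> k \<omega>) \<le> ?B" by (simp add: c_def mult_ac)
    from cmod_quotient_diff_le[OF one_le_one_plus[OF e_hat_cone(2)] one_le_one_plus_p this]
    show ?thesis by simp
  qed
  let ?F = "\<lambda>\<omega>. \<Sum>i<n. w i * (R \<omega> i i * D z e_hat i - 1)"
  have Fint: "integrable array ?F" using R_integrable by (intro Bochner_Integration.integrable_sum integrable_mult_right Bochner_Integration.integrable_diff integrable_mult_left) auto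
  have EF: "(LINT \<omega>|array. ?F \<omega>) = (\<Sum>i<n. w i * (mean_R i * D z e_hat i - 1))"
  proof -
    have "(LINT \<omega>|array. ?F \<omega>) = (\<Sum>i<n. LINT \<omega>|array. w i * (R \<omega> i i * D z e_hat i - 1))"
      using R_integrable by (intro Bochner_Integration.integral_sum integrable_mult_right Bochner_Integration.integrable_diff integrable_mult_left) auto
    also have "\<dots> = (\<Sum>i<n. w i * (mean_R i * D z e_hat i - 1))"
      using R_integrable by (intro sum.cong refl) (simp add: mean_R_def prob_space)
    finally show ?thesis .
  qed
  have m1: "(\<lambda>\<omega>. ennreal (cmod (p w k \<omega> - ?\<pi> k \<omega>))) \<in> borel_measurable array" if "k < N" for k
    by (intro measurable_compose[OF _ measurable_ennreal] measurable_compose[OF _ borel_measurable_norm] borel_measurable_diff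
        weighted_trace_measurable p_measurable that)
  have m2: "(\<lambda>\<omega>. ennreal (cmod (p (\<lambda>_. 1) k \<omega> - of_real c * e_hat k))) \<in> borel_measurable array" if "k < N" for k
    by (intro measurable_compose[OF _ measurable_ennreal] measurable_compose[OF _ borel_measurable_norm] borel_measurable_diff
        p_measurable that borel_measurable_const)
  have "ennreal (cmod (\<Sum>i<n. w i * (mean_R i * D z e_hat i - 1))) \<le> (\<integral>\<^sup>+\<omega>. ennreal (cmod (?F \<omega>)) \<partial>array)"
    unfolding EF[symmetric] by (rule integral_norm_bound_ennreal[OF Fint])
  also have "\<dots> \<le> (\<integral>\<^sup>+\<omega>. (\<Sum>k<N. ennreal (cmod (p w k \<omega> - ?\<pi> k \<omega>)) + ennreal ?B * ennreal (cmod (p (\<lambda>_. 1) k \<omega> - of_real c * e_hat k))) \<partial>array)"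
  proof (rule nn_integral_mono)
    fix \<omega>
    have "cmod (?F \<omega>) \<le> (\<Sum>k<N. cmod (p w k \<omega> - ?\<pi> k \<omega>) + ?B * cmod (p (\<lambda>_. 1) k \<omega> - of_real c * e_hat k))"
      unfolding ident by (rule sum_norm_le) (use term_le in auto)
    then have "ennreal (cmod (?F \<omega>)) \<le> ennreal (\<Sum>k<N. cmod (p w k \<omega> - ?\<pi> k \<omega>) + ?B * cmod (p (\<lambda>_. 1) k \<omega> - of_real c * e_hat k))"
      by (rule ennreal_leI)
    also have "\<dots> = (\<Sum>k<N. ennreal (cmod (p w k \<omega> - ?\<pi> k \<omega>) + ?B * cmod (p (\<lambda>_. 1) k \<omega> - of_real c * e_hat k)))"
      using B0 by (intro sum_ennreal[symmetric] add_nonneg_nonneg mult_nonneg_nonneg) auto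
    also have "\<dots> = (\<Sum>k<N. ennreal (cmod (p w k \<omega> - ?\<pi> k \<omega>)) + ennreal ?B * ennreal (cmod (p (\<lambda>_. 1) k \<omega> - of_real c * e_hat k)))"
      by (intro sum.cong refl ennreal_add_mult B0 norm_ge_zero)
    finally show "ennreal (cmod (?F \<omega>)) \<le> (\<Sum>k<N. ennreal (cmod (p w k \<omega> - ?\<pi> k \<omega>)) + ennreal ?B * ennreal (cmod (p (\<lambda>_. 1) k \<omega> - of_real c * e_hat k)))" .
  qed
  also have "\<dots> = (\<Sum>k<N. (\<integral>\<^sup>+\<omega>. ennreal (cmod (p w k \<omega> - ?\<pi> k \<omega>)) \<partial>array) + ennreal ?B * (\<integral>\<^sup>+\<omega>. ennreal (cmod (p (\<lambda>_. 1) k \<omega> - of_real c * e_hat k)) \<partial>array))"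
    using m1 m2 by (subst nn_integral_sum) (auto simp: nn_integral_add nn_integral_cmult intro!: sum.cong)
  also have "\<dots> \<le> (\<Sum>k<N. ennreal (W * S / Im z * (\<kappa> h k + 1 / N)) + ennreal ?B * ennreal (S / Im z * (\<kappa> h k + 29 / sqrt N)))"
    by (intro sum_mono add_mono mult_left_mono column_form column_quad w W h) auto
  also have "\<dots> \<le> (\<Sum>k<N. ennreal (W * S / Im z * (1 + c * S / Im z) * (\<kappa> h k + 29 / sqrt N)))"
  proof (rule sum_mono)
    fix k
    have "1 / real N \<le> 1 / sqrt N" by (rule inverse_le_inverse_sqrt[OF N_pos])
    also have "\<dots> \<le> 29 / sqrt N" by (intro divide_right_mono) auto
    finally have le: "1 / real N \<le> 29 / sqrt N" .
    have "W * S / Im z * (\<kappa> h k + 1 / N) + ?B * (S / Im z * (\<kappa> h k + 29 / sqrt N))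
      \<le> W * S / Im z * (\<kappa> h k + 29 / sqrt N) + ?B * (S / Im z * (\<kappa> h k + 29 / sqrt N))"
      using le W S_pos z_pos by (intro add_right_mono mult_left_mono) auto
    also have "\<dots> = W * S / Im z * (1 + c * S / Im z) * (\<kappa> h k + 29 / sqrt N)" by (simp add: distrib_right distrib_left mult_ac)
    finally have le2: "W * S / Im z * (\<kappa> h k + 1 / N) + ?B * (S / Im z * (\<kappa> h k + 29 / sqrt N)) \<le> W * S / Im z * (1 + c * S / Im z) * (\<kappa> h k + 29 / sqrt N)" .
    have nn: "0 \<le> W * S / Im z * (\<kappa> h k + 1 / N)" "0 \<le> S / Im z * (\<kappa> h k + 29 / sqrt N)"
      using W S_pos z_pos \<kappa>_nonneg[OF h, of k] by (auto intro!: mult_nonneg_nonneg add_nonneg_nonneg)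
    show "ennreal (W * S / Im z * (\<kappa> h k + 1 / N)) + ennreal ?B * ennreal (S / Im z * (\<kappa> h k + 29 / sqrt N))
      \<le> ennreal (W * S / Im z * (1 + c * S / Im z) * (\<kappa> h k + 29 / sqrt N))"
      unfolding ennreal_mult[OF B0 nn(2), symmetric] ennreal_plus[OF nn(1) mult_nonneg_nonneg[OF B0 nn(2)], symmetric]
      by (rule ennreal_leI[OF le2])
  qed
  also have "\<dots> = ennreal (\<Sum>k<N. W * S / Im z * (1 + c * S / Im z) * (\<kappa> h k + 29 / sqrt N))"
    using W S_pos z_pos \<kappa>_nonneg[OF h] c_pos by (intro sum_ennreal mult_nonneg_nonneg add_nonneg_nonneg) auto
  also have "(\<Sum>k<N. W * S / Im z * (1 + c * S / Im z) * (\<kappa> h k + 29 / sqrt N)) = W * S / Im z * (1 + c * S / Im z) * (n * \<rho> h)"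
  proof -
    have "(\<Sum>k<N. \<kappa> h k + 29 / sqrt N) = n * \<rho> h"
      using n_pos N_pos by (simp add: sum.distrib \<rho>_def real_div_sqrt flip: times_divide_eq_left)
    then show ?thesis by (simp only: sum_distrib_left[symmetric])
  qed
  finally have "cmod (\<Sum>i<n. w i * (mean_R i * D z e_hat i - 1)) \<le> W * S / Im z * (1 + c * S / Im z) * (n * \<rho> h)"
    using W S_pos z_pos \<rho>_nonneg[OF h] c_pos by (subst (asm) ennreal_le_iff) auto
  then have "cmod (\<Sum>i<n. w i * (mean_R i * D z e_hat i - 1)) / n \<le> W * S / Im z * (1 + c * S / Im z) * (n * \<rho> h) / n"
    by (rule divide_right_mono) simp
  then show ?thesis using n_pos by (simp add: norm_mult norm_divide)
qed

end

section \<open>Stability of the system\<close>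

context gram_model
begin

lemma D_e_hat_ge: "i < n \<Longrightarrow> Im z \<le> cmod (D z e_hat i)"
  by (rule cmod_D_ge[OF upper_e_hat _ z_pos])

text \<open>The common size of the errors in the two equations; it is small when \<open>\<rho> h\<close> is.\<close>

definition \<delta> :: "real \<Rightarrow> real" where
  "\<delta> h = S / (Im z * Im z) * ((1 + c * S / Im z) * \<rho> h)"

lemma \<delta>_nonneg: "h > 0 \<Longrightarrow> 0 \<le> \<delta> h"
  unfolding \<delta>_def using S_pos z_pos c_pos \<rho>_nonneg by (intro mult_nonneg_nonneg) auto

text \<open>The weights \<open>(d i j)\<^sup>2 / D z e_hat i\<close> turn the defect into the defect of equation \<open>j\<close> of the system.\<close>

lemma e_hat_defect:
  assumes j: "j < N" and h: "h > 0"
  shows "cmod (e_hat j - sys z e_hat j) \<le> S * \<delta> h"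
proof -
  let ?w = "\<lambda>i. of_real ((d i j)\<^sup>2) / D z e_hat i"
  have w: "cmod (?w i) \<le> S / Im z" if "i < n" for i
    unfolding norm_divide norm_of_real using d_le[OF that j] D_e_hat_ge[OF that] z_pos S_pos by (intro frac_le) auto
  have "?w i * (mean_R i * D z e_hat i - 1) = of_real ((d i j)\<^sup>2) * mean_R i - of_real ((d i j)\<^sup>2) / D z e_hat i" if "i < n" for i
  proof -
    have "D z e_hat i \<noteq> 0" using D_e_hat_ge[OF that] z_pos by auto
    then show ?thesis by (simp add: field_simps)
  qed
  then have "(\<Sum>i<n. ?w i * (mean_R i * D z e_hat i - 1)) = (\<Sum>i<n. of_real ((d i j)\<^sup>2) * mean_R i) - (\<Sum>i<n. of_real ((d i j)\<^sup>2) / D z e_hat i)"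
    unfolding sum_subtractf[symmetric] by (intro sum.cong refl) auto
  then have "e_hat j - sys z e_hat j = 1 / of_nat n * (\<Sum>i<n. ?w i * (mean_R i * D z e_hat i - 1))"
    unfolding e_hat_def sys_def by (simp only: right_diff_distrib)
  also have "cmod (1 / of_nat n * (\<Sum>i<n. ?w i * (mean_R i * D z e_hat i - 1))) \<le> S / Im z * S / Im z * (1 + c * S / Im z) * \<rho> h"
    by (rule defect_bound[OF w _ h]) (use S_pos z_pos in auto)
  also have "\<dots> = S * \<delta> h" by (simp add: \<delta>_def)
  finally show ?thesis .
qed

lemma sys_lipschitz:
  assumes e: "upper e" "\<forall>k<N. 0 \<le> Im (z * e k)" and e': "upper e'" "\<forall>k<N. 0 \<le> Im (z * e' k)"
    and B: "\<forall>k<N. cmod (e k - e' k) \<le> B" and j: "j < N"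
  shows "cmod (sys z e j - sys z e' j) \<le> c * S\<^sup>2 / (Im z)\<^sup>2 * B"
proof -
  have nz: "\<forall>k<N. nzcol k \<longrightarrow> 1 + of_real c * e k \<noteq> 0 \<and> 1 + of_real c * e' k \<noteq> 0"
    using one_plus_nonzero[OF z_pos] e(2) e'(2) by blast
  have B0: "B \<ge> 0" using B N_pos order_trans[OF norm_ge_zero] by blast
  note sys_diff_le[OF e(1) e'(1) z_pos nz, of j]
  also have "(\<Sum>i<n. \<Sum>k<N. 1 / real n * (d i j)\<^sup>2 * (1 / real N * (d i k)\<^sup>2) * (c * cmod (e k - e' k))
      / (cmod (D z e i) * cmod (D z e' i) * (cmod (1 + of_real c * e k) * cmod (1 + of_real c * e' k))))
    \<le> (\<Sum>i<n. \<Sum>k<N. 1 / real n * S * (1 / real N * S) * (c * B) / (Im z * Im z * (1 * 1)))"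
  proof (intro sum_mono frac_le)
    fix i k assume ik: "i \<in> {..<n}" "k \<in> {..<N}"
    show "0 \<le> 1 / real n * S * (1 / real N * S) * (c * B)" using S_pos c_pos B0 by simp
    show "1 / real n * (d i j)\<^sup>2 * (1 / real N * (d i k)\<^sup>2) * (c * cmod (e k - e' k)) \<le> 1 / real n * S * (1 / real N * S) * (c * B)"
      using ik j d_le S_pos c_pos B by (intro mult_mono mult_left_mono mult_nonneg_nonneg) auto
    show "0 < Im z * Im z * (1 * 1)" using z_pos by simp
    show "Im z * Im z * (1 * 1) \<le> cmod (D z e i) * cmod (D z e' i) * (cmod (1 + of_real c * e k) * cmod (1 + of_real c * e' k))"
      using ik z_pos cmod_D_ge[OF e(1) _ z_pos] cmod_D_ge[OF e'(1) _ z_pos] one_le_one_plus e(2) e'(2)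
      by (intro mult_mono) auto
  qed
  also have "\<dots> = c * S\<^sup>2 / (Im z)\<^sup>2 * B" using n_pos N_pos by (simp add: power2_eq_square)
  finally show ?thesis .
qed

lemma e0_facts:
  shows "upper (e0 n N d z)" "\<forall>k<N. 0 \<le> Im (z * e0 n N d z k)" "j < N \<Longrightarrow> e0 n N d z j = sys z (e0 n N d z) j"
proof -
  show "upper (e0 n N d z)" by (rule upper_cone[OF e0_properties(2)[OF z_pos]])
  show "\<forall>k<N. 0 \<le> Im (z * e0 n N d z k)" using e0_properties(2)[OF z_pos] unfolding cone_def by blast
  show "j < N \<Longrightarrow> e0 n N d z j = sys z (e0 n N d z) j"
    using e0_properties(1)[OF z_pos] unfolding e0_solution_def sys_def by blast
qed

text \<open>Far up the imaginary axis \<open>sys\<close> halves the largest error, so an approximate solution is near the solution.\<close>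

lemma e_hat_near_e0:
  assumes contr: "c * S\<^sup>2 / (Im z)\<^sup>2 \<le> 1 / 2" and h: "h > 0" and k: "k < N"
  shows "cmod (e_hat k - e0 n N d z k) \<le> 2 * (S * \<delta> h)"
proof -
  define m where "m = Max ((\<lambda>k. cmod (e_hat k - e0 n N d z k)) ` {..<N})"
  have ne: "(\<lambda>k. cmod (e_hat k - e0 n N d z k)) ` {..<N} \<noteq> {}" using N_pos by auto
  have le: "cmod (e_hat l - e0 n N d z l) \<le> m" if "l < N" for l
    unfolding m_def using that by (intro Max_ge) auto
  have "m \<in> (\<lambda>k. cmod (e_hat k - e0 n N d z k)) ` {..<N}" unfolding m_def using ne by (intro Max_in) auto
  then obtain l where l: "l < N" "m = cmod (e_hat l - e0 n N d z l)" by auto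
  have m0: "m \<ge> 0" using l by simp
  have "e_hat l - e0 n N d z l = (e_hat l - sys z e_hat l) + (sys z e_hat l - sys z (e0 n N d z) l)"
    using e0_facts(3)[OF l(1)] by simp
  then have "m \<le> cmod (e_hat l - sys z e_hat l) + cmod (sys z e_hat l - sys z (e0 n N d z) l)"
    unfolding l(2) using norm_triangle_ineq by metis
  moreover have "cmod (sys z e_hat l - sys z (e0 n N d z) l) \<le> c * S\<^sup>2 / (Im z)\<^sup>2 * m"
    by (rule sys_lipschitz[OF upper_e_hat _ e0_facts(1,2) _ l(1)]) (use le e_hat_cone in auto)
  moreover have "c * S\<^sup>2 / (Im z)\<^sup>2 * m \<le> 1 / 2 * m" using contr m0 by (rule mult_right_mono)
  ultimately have "m \<le> 2 * (S * \<delta> h)" using e_hat_defect[OF l(1) h] by linarith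
  then show ?thesis using le[OF k] by linarith
qed

lemma D_lipschitz:
  assumes "\<forall>k<N. 0 \<le> Im (z * e k)" "\<forall>k<N. 0 \<le> Im (z * e' k)" "\<forall>k<N. cmod (e k - e' k) \<le> B" "i < n"
  shows "cmod (D z e i - D z e' i) \<le> S * (c * B)"
proof -
  have "D z e i - D z e' i = 1 / of_nat N * (\<Sum>k<N. of_real ((d i k)\<^sup>2) * (1 / (1 + of_real c * e k) - 1 / (1 + of_real c * e' k)))"
    unfolding D_eq by (simp add: right_diff_distrib sum_subtractf)
  also have "cmod (1 / of_nat N * (\<Sum>k<N. of_real ((d i k)\<^sup>2) * (1 / (1 + of_real c * e k) - 1 / (1 + of_real c * e' k))))
    \<le> 1 / N * (\<Sum>k<N. S * (c * B))"
  proof -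
    have "cmod (\<Sum>k<N. of_real ((d i k)\<^sup>2) * (1 / (1 + of_real c * e k) - 1 / (1 + of_real c * e' k))) \<le> (\<Sum>k<N. S * (c * B))"
    proof (rule sum_norm_le)
      fix k assume "k \<in> {..<N}"
      then have k: "k < N" by simp
      have "cmod (1 / (1 + of_real c * e k) - 1 / (1 + of_real c * e' k)) \<le> cmod (1 - 1) + 1 * cmod ((1 + of_real c * e' k) - (1 + of_real c * e k))"
        by (rule cmod_quotient_diff_le) (use one_le_one_plus assms k in auto)
      also have "\<dots> = c * cmod (e k - e' k)"
        using c_pos by (simp add: norm_mult norm_minus_commute flip: right_diff_distrib)
      also have "\<dots> \<le> c * B" using assms k c_pos by (intro mult_left_mono) auto
      finally have "cmod (1 / (1 + of_real c * e k) - 1 / (1 + of_real c * e' k)) \<le> c * B" .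
      then show "cmod (of_real ((d i k)\<^sup>2) * (1 / (1 + of_real c * e k) - 1 / (1 + of_real c * e' k))) \<le> S * (c * B)"
        unfolding norm_mult norm_of_real using d_le[OF assms(4) k] S_pos by (intro mult_mono) auto
    qed
    then have "1 / N * cmod (\<Sum>k<N. of_real ((d i k)\<^sup>2) * (1 / (1 + of_real c * e k) - 1 / (1 + of_real c * e' k))) \<le> 1 / N * (\<Sum>k<N. S * (c * B))"
      by (rule mult_left_mono) simp
    then show ?thesis by (simp only: norm_mult norm_divide norm_one norm_of_nat)
  qed
  also have "\<dots> = S * (c * B)" using N_pos by simp
  finally show ?thesis .
qed

text \<open>The weights \<open>1 / D z e_hat i\<close> compare the mean trace with the value of \<open>G_fun\<close> at \<open>e_hat\<close>; the
  nearness of \<open>e_hat\<close> to the solution does the rest.\<close>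

lemma mean_trace_near_G:
  assumes contr: "c * S\<^sup>2 / (Im z)\<^sup>2 \<le> 1 / 2" and h: "h > 0"
  shows "cmod (1 / of_nat n * (\<Sum>i<n. mean_R i) - G_fun n N d z) \<le> 2 * \<delta> h"
proof -
  let ?w = "\<lambda>i. 1 / D z e_hat i"
  have w: "cmod (?w i) \<le> 1 / Im z" if "i < n" for i
    unfolding norm_divide norm_one by (rule frac_le) (use D_e_hat_ge[OF that] z_pos in auto)
  have "?w i * (mean_R i * D z e_hat i - 1) = mean_R i - 1 / D z e_hat i" if "i < n" for i
  proof -
    have "D z e_hat i \<noteq> 0" using D_e_hat_ge[OF that] z_pos by auto
    then show ?thesis by (simp add: field_simps)
  qed
  then have s1: "(\<Sum>i<n. ?w i * (mean_R i * D z e_hat i - 1)) = (\<Sum>i<n. mean_R i) - (\<Sum>i<n. 1 / D z e_hat i)"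
    unfolding sum_subtractf[symmetric] by (intro sum.cong refl) auto
  have A: "cmod (1 / of_nat n * ((\<Sum>i<n. mean_R i) - (\<Sum>i<n. 1 / D z e_hat i))) \<le> \<delta> h"
  proof -
    have "cmod (1 / of_nat n * (\<Sum>i<n. ?w i * (mean_R i * D z e_hat i - 1))) \<le> 1 / Im z * S / Im z * (1 + c * S / Im z) * \<rho> h"
      by (rule defect_bound[OF w _ h]) (use z_pos in auto)
    then show ?thesis unfolding s1 by (simp add: \<delta>_def)
  qed
  let ?E = "e0 n N d z"
  have Bc: "cmod (1 / of_nat n * (\<Sum>i<n. 1 / D z e_hat i - 1 / D z ?E i)) \<le> \<delta> h"
  proof -
    have "cmod (\<Sum>i<n. 1 / D z e_hat i - 1 / D z ?E i) \<le> (\<Sum>i<n. \<delta> h)"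
    proof (rule sum_norm_le)
      fix i assume "i \<in> {..<n}"
      then have i: "i < n" by simp
      have ge: "Im z \<le> cmod (D z e_hat i)" "Im z \<le> cmod (D z ?E i)" using cmod_D_ge upper_e_hat e0_facts(1) z_pos i by auto
      then have "D z e_hat i \<noteq> 0" "D z ?E i \<noteq> 0" using z_pos by auto
      then have "1 / D z e_hat i - 1 / D z ?E i = (D z ?E i - D z e_hat i) / (D z e_hat i * D z ?E i)" by (simp add: field_simps)
      then have "cmod (1 / D z e_hat i - 1 / D z ?E i) = cmod (D z e_hat i - D z ?E i) / (cmod (D z e_hat i) * cmod (D z ?E i))"
        by (simp add: norm_divide norm_mult norm_minus_commute)
      also have "\<dots> \<le> S * (c * (2 * (S * \<delta> h))) / (Im z * Im z)"
      proof (rule frac_le)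
        show "0 \<le> S * (c * (2 * (S * \<delta> h)))" using S_pos c_pos \<delta>_nonneg[OF h] by simp
        show "cmod (D z e_hat i - D z ?E i) \<le> S * (c * (2 * (S * \<delta> h)))"
          by (rule D_lipschitz[OF _ e0_facts(2) _ i]) (use e_hat_cone e_hat_near_e0[OF contr h] in auto)
        show "0 < Im z * Im z" using z_pos by simp
        show "Im z * Im z \<le> cmod (D z e_hat i) * cmod (D z ?E i)" using ge z_pos by (intro mult_mono) auto
      qed
      also have "\<dots> = 2 * (c * S\<^sup>2 / (Im z)\<^sup>2) * \<delta> h" by (simp add: power2_eq_square)
      also have "\<dots> \<le> 2 * (1 / 2) * \<delta> h" using contr \<delta>_nonneg[OF h] by (intro mult_right_mono mult_left_mono) auto
      finally show "cmod (1 / D z e_hat i - 1 / D z ?E i) \<le> \<delta> h" by simp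
    qed
    then have "cmod (\<Sum>i<n. 1 / D z e_hat i - 1 / D z ?E i) \<le> n * \<delta> h" by simp
    then show ?thesis using n_pos by (simp add: norm_mult norm_divide divide_le_eq mult.commute)
  qed
  have "1 / of_nat n * (\<Sum>i<n. mean_R i) - G_fun n N d z
    = 1 / of_nat n * ((\<Sum>i<n. mean_R i) - (\<Sum>i<n. 1 / D z e_hat i)) + 1 / of_nat n * (\<Sum>i<n. 1 / D z e_hat i - 1 / D z ?E i)"
    unfolding G_fun_def sum_subtractf right_diff_distrib by simp
  also have "cmod \<dots> \<le> \<delta> h + \<delta> h" by (rule norm_triangle_le[OF add_mono[OF A Bc]])
  finally show ?thesis by simp
qed

lemma \<rho>_eq: "\<rho> h = 2 / sqrt n + h + 2 * (1 / (real n * real N) * (\<Sum>i<n. \<Sum>k<N. tail h i k)) + 29 * sqrt N / n"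
proof -
  have "(\<Sum>k<N. \<kappa> h k) = 2 * sqrt n + h * n + 2 * (\<Sum>k<N. \<Sum>i<n. tail h i k) / N"
    unfolding \<kappa>_def sum_divide_distrib[symmetric] sum.distrib sum_distrib_left[symmetric] using N_pos by (simp add: field_simps)
  also have "(\<Sum>k<N. \<Sum>i<n. tail h i k) = (\<Sum>i<n. \<Sum>k<N. tail h i k)" by (rule sum.swap)
  finally have "\<rho> h = (2 * sqrt n + h * n + 2 * (\<Sum>i<n. \<Sum>k<N. tail h i k) / N + 29 * sqrt N) / n" unfolding \<rho>_def by simp
  also have "\<dots> = 2 * (sqrt n / n) + h + 2 * (1 / (real n * real N) * (\<Sum>i<n. \<Sum>k<N. tail h i k)) + 29 * sqrt N / n"
    using n_pos by (simp add: add_divide_distrib mult_ac)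
  also have "sqrt n / n = 1 / sqrt n" using n_pos by (simp add: real_div_sqrt divide_simps)
  finally show ?thesis by simp
qed

end

section \<open>From matrices to vague distances\<close>

text \<open>Independence of all entries is independence of the columns together with independence within each column.\<close>

lemma (in prob_space) distr_array:
  fixes x :: "nat \<Rightarrow> nat \<Rightarrow> 'a \<Rightarrow> complex"
  assumes n: "n > 0" and N: "N > 0"
    and ind: "indep_vars (\<lambda>_. borel) (\<lambda>(j, k). x j k) ({..<n} \<times> {..<N})"
  shows "distr M (PiM {..<N} (\<lambda>_. PiM {..<n} (\<lambda>_. borel))) (\<lambda>\<omega>. \<lambda>k\<in>{..<N}. \<lambda>j\<in>{..<n}. x j k \<omega>)
    = PiM {..<N} (\<lambda>k. PiM {..<n} (\<lambda>j. distr M borel (x j k)))"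
proof -
  have rv: "random_variable borel (x j k)" if "j < n" "k < N" for j k
    using ind that unfolding indep_vars_def2 by auto
  have rvc: "random_variable (PiM {..<n} (\<lambda>_. borel)) (\<lambda>\<omega>. \<lambda>j\<in>{..<n}. x j k \<omega>)" if "k < N" for k
    using rv that by (intro measurable_restrict) auto
  have "indep_vars (\<lambda>k. PiM ({..<n} \<times> {k}) (\<lambda>_. borel)) (\<lambda>k \<omega>. restrict (\<lambda>i. (case i of (j, k) \<Rightarrow> x j k) \<omega>) ({..<n} \<times> {k})) {..<N}"
    by (rule indep_vars_restrict[OF ind]) (auto simp: disjoint_family_on_def)
  from indep_vars_compose2[OF this, of "\<lambda>k g. \<lambda>j\<in>{..<n}. g (j, k)" "\<lambda>_. PiM {..<n} (\<lambda>_. borel)"]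
  have "indep_vars (\<lambda>_. PiM {..<n} (\<lambda>_. borel)) (\<lambda>k \<omega>. \<lambda>j\<in>{..<n}. restrict (\<lambda>i. (case i of (j, k) \<Rightarrow> x j k) \<omega>) ({..<n} \<times> {k}) (j, k)) {..<N}"
    by (auto intro!: measurable_restrict measurable_component_singleton)
  moreover have "(\<lambda>k \<omega>. \<lambda>j\<in>{..<n}. restrict (\<lambda>i. (case i of (j, k) \<Rightarrow> x j k) \<omega>) ({..<n} \<times> {k}) (j, k)) = (\<lambda>k \<omega>. \<lambda>j\<in>{..<n}. x j k \<omega>)"
    by (auto simp: fun_eq_iff restrict_def)
  ultimately have "indep_vars (\<lambda>_. PiM {..<n} (\<lambda>_. borel)) (\<lambda>k \<omega>. \<lambda>j\<in>{..<n}. x j k \<omega>) {..<N}" by simp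
  moreover have "{..<N} \<noteq> {}" using N by auto
  ultimately have "distr M (PiM {..<N} (\<lambda>_. PiM {..<n} (\<lambda>_. borel))) (\<lambda>\<omega>. \<lambda>k\<in>{..<N}. \<lambda>j\<in>{..<n}. x j k \<omega>)
    = PiM {..<N} (\<lambda>k. distr M (PiM {..<n} (\<lambda>_. borel)) (\<lambda>\<omega>. \<lambda>j\<in>{..<n}. x j k \<omega>))"
    using rvc by (subst indep_vars_iff_distr_eq_PiM'[symmetric]) auto
  also have "\<dots> = PiM {..<N} (\<lambda>k. PiM {..<n} (\<lambda>j. distr M borel (x j k)))"
  proof (rule PiM_cong[OF refl])
    fix k assume k: "k \<in> {..<N}"
    have "indep_vars (\<lambda>j. PiM {(j, k)} (\<lambda>_. borel)) (\<lambda>j \<omega>. restrict (\<lambda>i. (case i of (j, k) \<Rightarrow> x j k) \<omega>) {(j, k)}) {..<n}"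
      by (rule indep_vars_restrict[OF ind]) (use k in \<open>auto simp: disjoint_family_on_def\<close>)
    from indep_vars_compose2[OF this, of "\<lambda>j g. g (j, k)" "\<lambda>_. borel"]
    have "indep_vars (\<lambda>_. borel) (\<lambda>j \<omega>. restrict (\<lambda>i. (case i of (j, k) \<Rightarrow> x j k) \<omega>) {(j, k)} (j, k)) {..<n}"
      by (auto intro!: measurable_component_singleton)
    then have "indep_vars (\<lambda>_. borel) (\<lambda>j. x j k) {..<n}" by simp
    moreover have "{..<n} \<noteq> {}" using n by auto
    ultimately show "distr M (PiM {..<n} (\<lambda>_. borel)) (\<lambda>\<omega>. \<lambda>j\<in>{..<n}. x j k \<omega>) = PiM {..<n} (\<lambda>j. distr M borel (x j k))"
      using rv k by (subst indep_vars_iff_distr_eq_PiM'[symmetric]) auto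
  qed
  finally show ?thesis .
qed

text \<open>Each \<open>u a\<close> is an eigenvector of \<open>R\<close> with eigenvalue \<open>1 / (lam a - z)\<close>, and the trace can be computed in the
  orthonormal basis of the \<open>u a\<close>.\<close>

lemma resolvent_trace_eq:
  assumes R: "is_resolvent n H z R" and z: "Im z > 0"
    and u: "orthonormal {..<n} n u"
    and ev: "\<forall>a<n. \<forall>i\<in>{..<n}. mv {..<n} H (u a) i = complex_of_real (lam a) * u a i"
  shows "(\<Sum>i<n. R i i) = (\<Sum>a<n. 1 / (complex_of_real (lam a) - z))"
proof -
  have Ru: "mv {..<n} R (u a) i = u a i / (complex_of_real (lam a) - z)" if a: "a < n" and i: "i < n" for a i
  proof -
    have "(\<Sum>j<n. ((\<Sum>l<n. R i l * H l j) - z * R i j) * u a j) = (\<Sum>j<n. if i = j then u a j else 0)"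
      using R i unfolding is_resolvent_def by (intro sum.cong refl) auto
    also have "\<dots> = u a i" using i by simp
    finally have "(\<Sum>j<n. ((\<Sum>l<n. R i l * H l j) - z * R i j) * u a j) = u a i" .
    moreover have "(\<Sum>j<n. ((\<Sum>l<n. R i l * H l j) - z * R i j) * u a j)
      = (\<Sum>l<n. R i l * mv {..<n} H (u a) l) - z * mv {..<n} R (u a) i"
    proof -
      have "(\<Sum>j<n. (\<Sum>l<n. R i l * H l j) * u a j) = (\<Sum>l<n. R i l * mv {..<n} H (u a) l)"
        unfolding mv_def sum_distrib_left sum_distrib_right by (subst sum.swap) (simp add: mult.assoc)
      then show ?thesis by (simp add: left_diff_distrib sum_subtractf mv_def sum_distrib_left mult.assoc)
    qed
    moreover have "(\<Sum>l<n. R i l * mv {..<n} H (u a) l) = of_real (lam a) * mv {..<n} R (u a) i"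
    proof -
      have "(\<Sum>l<n. R i l * mv {..<n} H (u a) l) = (\<Sum>l<n. R i l * (of_real (lam a) * u a l))"
        using ev a by (intro sum.cong refl) auto
      then show ?thesis by (simp add: mv_def sum_distrib_left mult_ac)
    qed
    ultimately have "(of_real (lam a) - z) * mv {..<n} R (u a) i = u a i" by (simp add: left_diff_distrib)
    moreover have "complex_of_real (lam a) - z \<noteq> 0" using z by (auto simp: complex_eq_iff)
    ultimately show ?thesis by (simp add: eq_divide_eq mult.commute)
  qed
  have "(\<Sum>i<n. R i i) = (\<Sum>i<n. \<Sum>j<n. R i j * (\<Sum>a<n. u a j * cnj (u a i)))"
  proof (rule sum.cong[OF refl])
    fix i assume i: "i \<in> {..<n}"
    have "(\<Sum>j<n. R i j * (\<Sum>a<n. u a j * cnj (u a i))) = (\<Sum>j<n. if j = i then R i j else 0)"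
      using orthonormal_complete[of "{..<n}" u _ i] u i by (intro sum.cong refl) auto
    then show "R i i = (\<Sum>j<n. R i j * (\<Sum>a<n. u a j * cnj (u a i)))" using i by simp
  qed
  also have "\<dots> = (\<Sum>i<n. \<Sum>a<n. cnj (u a i) * mv {..<n} R (u a) i)"
  proof (rule sum.cong[OF refl])
    fix i
    show "(\<Sum>j<n. R i j * (\<Sum>a<n. u a j * cnj (u a i))) = (\<Sum>a<n. cnj (u a i) * mv {..<n} R (u a) i)"
      unfolding mv_def sum_distrib_left by (subst sum.swap) (simp add: mult_ac)
  qed
  also have "\<dots> = (\<Sum>a<n. \<Sum>i<n. cnj (u a i) * mv {..<n} R (u a) i)" by (rule sum.swap)
  also have "\<dots> = (\<Sum>a<n. ip {..<n} (u a) (u a) / (complex_of_real (lam a) - z))"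
    unfolding ip_def sum_divide_distrib using Ru by (intro sum.cong refl) simp
  also have "\<dots> = (\<Sum>a<n. 1 / (complex_of_real (lam a) - z))"
    using u unfolding orthonormal_def by (intro sum.cong refl) auto
  finally show ?thesis .
qed

lemma gram_resolvent_cong:
  assumes "\<And>k i. k < N \<Longrightarrow> i < n \<Longrightarrow> Y k i = Y' k i"
  shows "m \<le> N \<Longrightarrow> i < n \<Longrightarrow> j < n \<Longrightarrow> gram_resolvent n z m Y i j = gram_resolvent n z m Y' i j"
proof (induction m arbitrary: i j)
  case 0
  then show ?case by simp
next
  case (Suc m)
  then show ?case using assms[of m] by (simp add: rank_one_update_def quad_def)
qed

definition column_vectors :: "nat \<Rightarrow> (nat \<Rightarrow> nat \<Rightarrow> real) \<Rightarrow> (nat \<Rightarrow> nat \<Rightarrow> complex) \<Rightarrow> nat \<Rightarrow> nat \<Rightarrow> complex" where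
  "column_vectors N d x k i = complex_of_real (d i k / sqrt N) * x i k"

lemma gram_spectral:
  obtains lam u where "orthonormal {..<n} n u"
    "\<forall>a<n. \<forall>i\<in>{..<n}. mv {..<n} (gram N Y) (u a) i = complex_of_real (lam a) * u a i"
  using spectral_theorem[OF finite_lessThan hermitian_gram, of n N Y] by auto

lemma B_mat_column_vectors: "N > 0 \<Longrightarrow> B_mat n N d x = mat n n (\<lambda>(i, j). gram N (column_vectors N d x) i j)"
  by (simp add: B_mat_eq_gram column_vectors_def[abs_def])

lemma esd_B_mat:
  assumes n: "n > 0" and N: "N > 0"
  shows "real_distribution (interval_measure (esd (B_mat n N d x)))"
    and "v > 0 \<Longrightarrow> integral\<^sup>L (interval_measure (esd (B_mat n N d x))) (kern v)
      = 1 / of_nat n * (\<Sum>i<n. gram_resolvent n (\<i> * of_real v) N (column_vectors N d x) i i)"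
proof -
  obtain lam u where lu: "orthonormal {..<n} n u"
    "\<forall>a<n. \<forall>i\<in>{..<n}. mv {..<n} (gram N (column_vectors N d x)) (u a) i = complex_of_real (lam a) * u a i"
    by (rule gram_spectral)
  have im: "interval_measure (esd (B_mat n N d x)) = emp n lam"
    unfolding B_mat_column_vectors[OF N] by (rule interval_measure_esd[OF n lu])
  show "real_distribution (interval_measure (esd (B_mat n N d x)))" unfolding im by (rule real_distribution_emp)
  assume v: "v > 0"
  have m: "kern v \<in> borel_measurable borel"
    by (rule kernel_hull_bounded_measurable(2)[OF hull_kern[of v v] v]) simp
  have "integral\<^sup>L (interval_measure (esd (B_mat n N d x))) (kern v) = (1 / real n) *\<^sub>R (\<Sum>a<n. kern v (lam a))"
    unfolding im by (rule integral_emp[OF n m])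
  also have "(\<Sum>a<n. kern v (lam a)) = (\<Sum>i<n. gram_resolvent n (\<i> * of_real v) N (column_vectors N d x) i i)"
    unfolding kern_def using v by (intro resolvent_trace_eq[OF is_resolvent_gram_resolvent _ lu, symmetric]) auto
  finally show "integral\<^sup>L (interval_measure (esd (B_mat n N d x))) (kern v)
      = 1 / of_nat n * (\<Sum>i<n. gram_resolvent n (\<i> * of_real v) N (column_vectors N d x) i i)"
    by (simp add: scaleR_conv_of_real)
qed

lemma ip_gram_cong:
  assumes "\<And>k. k < N \<Longrightarrow> ip I (Y k) w = ip I (Y' k) w"
  shows "ip I w (mv I (gram N Y) w) = ip I w (mv I (gram N Y') w)"
  unfolding ip_gram using assms by simp

text \<open>On the vectors that vanish at the rows in \<open>Er\<close> and on which, for each \<open>k \<in> Ec\<close>, the original and the truncated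
  column act equally, both Gram matrices have the same quadratic form. These are \<open>card Er + card Ec\<close> linear
  conditions, so the rank inequality applies without any bound on the removed entries.\<close>

lemma vague_dist_truncate_le:
  assumes f: "range f \<subseteq> trapezoids" and n: "n > 0" and N: "N > 0"
    and Er: "Er \<subseteq> {..<n}" and Ec: "Ec \<subseteq> {..<N}" and card: "real (card Er) + real (card Ec) \<le> \<epsilon> * real n"
    and le: "\<forall>j\<in>{..<n} - Er. \<forall>k\<in>{..<N} - Ec. d j k \<le> c"
  shows "vague_dist f (esd (B_mat n N d x)) (esd (B_mat n N (truncate_profile c d) x)) \<le> 2 * \<epsilon> * mean_height f"
proof -
  define Y where "Y = column_vectors N d x"
  define Y' where "Y' = column_vectors N (truncate_profile c d) x"
  have fin: "finite Er" "finite Ec" using Er Ec finite_subset by auto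
  \<comment> \<open>The constraints: \<open>Inl r\<close> kills row \<open>r\<close>, \<open>Inr k\<close> identifies the two versions of column \<open>k\<close>.\<close>
  define m where "m e i = (case e of Inl r \<Rightarrow> (if i = r then 1 else 0) | Inr k \<Rightarrow> cnj (Y k i) - cnj (Y' k i))" for e :: "nat + nat" and i :: nat
  obtain lam u where lu: "orthonormal {..<n} n u" "\<forall>a<n. \<forall>i\<in>{..<n}. mv {..<n} (gram N Y) (u a) i = complex_of_real (lam a) * u a i"
    by (rule gram_spectral)
  obtain lam' u' where lu': "orthonormal {..<n} n u'" "\<forall>a<n. \<forall>i\<in>{..<n}. mv {..<n} (gram N Y') (u' a) i = complex_of_real (lam' a) * u' a i"
    by (rule gram_spectral)
  have agree: "ip {..<n} w (mv {..<n} (gram N Y) w) = ip {..<n} w (mv {..<n} (gram N Y') w)"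
    if w: "\<forall>e\<in>Er <+> Ec. (\<Sum>i\<in>{..<n}. m e i * w i) = 0" for w
  proof (rule ip_gram_cong)
    have wr: "w r = 0" if r: "r \<in> Er" for r
    proof -
      have "(\<Sum>i\<in>{..<n}. m (Inl r) i * w i) = (\<Sum>i<n. if i = r then w i else 0)"
        by (intro sum.cong refl) (auto simp: m_def)
      also have "\<dots> = w r" using r Er by auto
      finally show ?thesis using w[rule_format, OF InlI[OF r]] by simp
    qed
    fix k assume k: "k < N"
    show "ip {..<n} (Y k) w = ip {..<n} (Y' k) w"
    proof (cases "k \<in> Ec")
      case True
      have "(\<Sum>i\<in>{..<n}. m (Inr k) i * w i) = 0" by (rule w[rule_format, OF InrI[OF True]])
      then show ?thesis by (simp add: m_def ip_def left_diff_distrib sum_subtractf)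
    next
      case False
      show ?thesis unfolding ip_def
      proof (rule sum.cong[OF refl])
        fix i assume i: "i \<in> {..<n}"
        show "cnj (Y k i) * w i = cnj (Y' k i) * w i"
        proof (cases "i \<in> Er")
          case True then show ?thesis using wr by simp
        next
          case f: False
          then have "d i k \<le> c" using le i k False by auto
          then show ?thesis by (simp add: Y_def Y'_def column_vectors_def truncate_profile_def)
        qed
      qed
    qed
  qed
  have cE: "real (card (Er <+> Ec)) \<le> \<epsilon> * real n" using card fin by (simp add: card_Plus)
  have fE: "finite (Er <+> Ec)" using fin by simp
  have r: "\<bar>real (card {a. a < n \<and> lam a \<le> y}) - real (card {a. a < n \<and> lam' a \<le> y})\<bar> \<le> \<epsilon> * real n" for y
  proof -
    have "card {a. a < n \<and> lam a \<le> y} \<le> card {a. a < n \<and> lam' a \<le> y} + card (Er <+> Ec)"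
      by (rule eigenvalue_count_le[OF finite_lessThan _ fE lu lu' agree]) auto
    moreover have "card {a. a < n \<and> lam' a \<le> y} \<le> card {a. a < n \<and> lam a \<le> y} + card (Er <+> Ec)"
      by (rule eigenvalue_count_le[OF finite_lessThan _ fE lu' lu agree[symmetric]]) auto
    ultimately show ?thesis using cE by linarith
  qed
  have "vague_dist f (esd (B_mat n N d x)) (esd (B_mat n N (truncate_profile c d) x)) \<le> 2 * (\<epsilon> * real n / real n) * mean_height f"
    by (rule vague_dist_emp_le[OF f n _ _ r])
      (simp_all only: B_mat_column_vectors[OF N] Y_def[symmetric] Y'_def[symmetric] interval_measure_esd[OF n lu] interval_measure_esd[OF n lu'])
  then show ?thesis using n by simp
qed

lemma kern_lipschitz:
  assumes "v > 0" "v \<le> s" "v \<le> t"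
  shows "cmod (kern s x - kern t x) \<le> \<bar>s - t\<bar> / v\<^sup>2"
proof -
  have "cmod (kern s x) * cmod (kern t x) \<le> 1 / v * (1 / v)"
    using kern_bound[of v s x] kern_bound[of v t x] assms by (intro mult_mono) auto
  then have "\<bar>s - t\<bar> * (cmod (kern s x) * cmod (kern t x)) \<le> \<bar>s - t\<bar> * (1 / v * (1 / v))" by (intro mult_left_mono) auto
  moreover have "cmod (kern s x - kern t x) = \<bar>s - t\<bar> * (cmod (kern s x) * cmod (kern t x))"
    using assms by (subst kern_diff) (auto simp: norm_mult simp del: of_real_diff)
  ultimately show ?thesis by (simp add: power2_eq_square)
qed

lemma integral_kern_lipschitz:
  assumes "real_distribution \<mu>" "v > 0" "v \<le> s" "v \<le> t"
  shows "cmod (integral\<^sup>L \<mu> (kern s) - integral\<^sup>L \<mu> (kern t)) \<le> \<bar>s - t\<bar> / v\<^sup>2"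
proof -
  interpret real_distribution \<mu> by fact
  have int: "integrable \<mu> (kern r)" if "v \<le> r" for r
    by (rule kernel_hull_integrable[OF hull_kern[of v r] assms(2,1)]) (use that assms(2) in auto)
  have "integral\<^sup>L \<mu> (kern s) - integral\<^sup>L \<mu> (kern t) = (LINT x|\<mu>. kern s x - kern t x)"
    using int assms by (intro Bochner_Integration.integral_diff[symmetric]) auto
  also have "cmod (LINT x|\<mu>. kern s x - kern t x) \<le> (LINT x|\<mu>. cmod (kern s x - kern t x))" by (rule integral_norm_bound)
  also have "\<dots> \<le> (LINT x|\<mu>. \<bar>s - t\<bar> / v\<^sup>2)"
    using int assms kern_lipschitz[OF assms(2-4)] by (intro integral_mono integrable_norm Bochner_Integration.integrable_diff) auto
  finally show ?thesis using prob_space by simp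
qed

text \<open>Countably many points suffice, as the transforms are Lipschitz functions of \<open>t\<close>, uniformly in the
  measure.\<close>

lemma vague_dist_tendsto_0_kern:
  assumes f: "range f \<subseteq> trapezoids" and v: "v > 0"
    and F: "\<And>n. real_distribution (interval_measure (F n))" and G: "\<And>n. real_distribution (interval_measure (G n))"
    and lim: "\<And>t. t \<in> \<rat> \<Longrightarrow> v \<le> t \<Longrightarrow> (\<lambda>n. integral\<^sup>L (interval_measure (F n)) (kern t) - integral\<^sup>L (interval_measure (G n)) (kern t)) \<longlonglongrightarrow> 0"
  shows "(\<lambda>n. vague_dist f (F n) (G n)) \<longlonglongrightarrow> 0"
proof (rule vague_dist_tendsto_0[OF f F G])
  fix g assume "g \<in> trapezoids"
  then obtain m a b where g: "m > 0" "a < b" "g = trapezoid m a b" by (rule trapezoidsE)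
  show "(\<lambda>n. integral\<^sup>L (interval_measure (F n)) g - integral\<^sup>L (interval_measure (G n)) g) \<longlonglongrightarrow> 0"
    unfolding g(3)
  proof (rule integral_trapezoid_tendsto[OF v F G _ g(1,2)])
    fix t assume t: "v \<le> t"
    let ?D = "\<lambda>t n. integral\<^sup>L (interval_measure (F n)) (kern t) - integral\<^sup>L (interval_measure (G n)) (kern t)"
    show "?D t \<longlonglongrightarrow> 0"
    proof (rule LIMSEQ_I)
      fix e :: real assume e: "e > 0"
      have "t < t + e * v\<^sup>2 / 4" using e v by simp
      then obtain s where s: "s \<in> \<rat>" "t < s" "s < t + e * v\<^sup>2 / 4" using Rats_dense_in_real by blast
      have "v \<le> s" using s t by simp
      have st: "\<bar>t - s\<bar> / v\<^sup>2 < e / 4" using s v by (simp add: divide_less_eq)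
      obtain n0 where n0: "\<forall>n\<ge>n0. norm (?D s n - 0) < e / 2" using LIMSEQ_D[OF lim[OF s(1) \<open>v \<le> s\<close>], of "e / 2"] e by auto
      have "norm (?D t n - 0) < e" if n: "n \<ge> n0" for n
      proof -
        let ?a = "integral\<^sup>L (interval_measure (F n)) (kern t) - integral\<^sup>L (interval_measure (F n)) (kern s)"
        let ?b = "integral\<^sup>L (interval_measure (G n)) (kern t) - integral\<^sup>L (interval_measure (G n)) (kern s)"
        have "cmod ?a < e / 4" "cmod ?b < e / 4"
          by (rule le_less_trans[OF integral_kern_lipschitz[OF F v t \<open>v \<le> s\<close>] st])
            (rule le_less_trans[OF integral_kern_lipschitz[OF G v t \<open>v \<le> s\<close>] st])
        moreover have "cmod (?D s n) < e / 2" using n0 n by auto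
        moreover have "cmod (?D t n) \<le> cmod ?a + cmod (?D s n) + cmod ?b"
        proof -
          have e: "?D t n = (?a + ?D s n) - ?b" by simp
          show ?thesis unfolding e by (rule order_trans[OF norm_triangle_ineq4 add_right_mono[OF norm_triangle_ineq]])
        qed
        ultimately have "cmod (?D t n) < e" by linarith
        then show ?thesis by simp
      qed
      then show "\<exists>no. \<forall>n\<ge>no. norm (?D t n - 0) < e" by blast
    qed
  qed
qed

text \<open>The series of the fourth moments converges, so almost surely the series of the fourth powers does.\<close>

lemma (in prob_space) AE_tendsto_0_fourth_moment:
  assumes X [measurable]: "\<And>n. n0 \<le> n \<Longrightarrow> X n \<in> borel_measurable M"
    and mom: "\<And>n. n0 \<le> n \<Longrightarrow> (\<integral>\<^sup>+\<omega>. ennreal (X n \<omega> ^ 4) \<partial>M) \<le> ennreal (C / (real n)\<^sup>2)" and C: "C \<ge> 0"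
  shows "AE \<omega> in M. (\<lambda>n. X n \<omega>) \<longlonglongrightarrow> (0::real)"
proof -
  define g where "g n \<omega> = (if n0 \<le> n then X n \<omega> ^ 4 else 0)" for n \<omega>
  have g0: "0 \<le> g n \<omega>" for n \<omega> by (simp add: g_def)
  have gm: "g n \<in> borel_measurable M" for n
    by (cases "n0 \<le> n") (auto simp: g_def[abs_def])
  have gm': "(\<lambda>\<omega>. ennreal (g n \<omega>)) \<in> borel_measurable M" for n by (rule measurable_compose[OF gm measurable_ennreal])
  have "(\<integral>\<^sup>+\<omega>. (\<Sum>n. ennreal (g n \<omega>)) \<partial>M) = (\<Sum>n. \<integral>\<^sup>+\<omega>. ennreal (g n \<omega>) \<partial>M)"
    by (rule nn_integral_suminf[OF gm'])
  also have "\<dots> \<le> (\<Sum>n. ennreal (C * inverse ((real n)\<^sup>2)))"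
  proof (rule suminf_le)
    fix n show "(\<integral>\<^sup>+\<omega>. ennreal (g n \<omega>) \<partial>M) \<le> ennreal (C * inverse ((real n)\<^sup>2))"
      using mom[of n] by (cases "n0 \<le> n") (auto simp: g_def divide_inverse)
  qed auto
  finally have le: "(\<integral>\<^sup>+\<omega>. (\<Sum>n. ennreal (g n \<omega>)) \<partial>M) \<le> (\<Sum>n. ennreal (C * inverse ((real n)\<^sup>2)))" .
  have sm: "summable (\<lambda>n. C * inverse ((real n)\<^sup>2))" by (rule summable_mult[OF inverse_power_summable]) simp
  have C0: "0 \<le> C * inverse ((real n)\<^sup>2)" for n using C by simp
  have "(\<integral>\<^sup>+\<omega>. (\<Sum>n. ennreal (g n \<omega>)) \<partial>M) \<noteq> \<infinity>"
    unfolding infinity_ennreal_def by (rule neq_top_trans[OF ennreal_suminf_neq_top[OF sm C0] le])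
  moreover have "(\<lambda>\<omega>. \<Sum>n. ennreal (g n \<omega>)) \<in> borel_measurable M" using gm' by (intro borel_measurable_suminf_order) auto
  ultimately have "AE \<omega> in M. (\<Sum>n. ennreal (g n \<omega>)) \<noteq> \<infinity>" by (intro nn_integral_PInf_AE)
  then show ?thesis
  proof (rule AE_mp, intro AE_I2 impI)
    fix \<omega> assume fin: "(\<Sum>n. ennreal (g n \<omega>)) \<noteq> \<infinity>"
    have "summable (\<lambda>n. g n \<omega>)"
      using fin summable_suminf_not_top[of "\<lambda>n. g n \<omega>", OF g0] by (simp only: infinity_ennreal_def not_False_eq_True simp_thms)
    then have g: "(\<lambda>n. g n \<omega>) \<longlonglongrightarrow> 0" by (rule summable_LIMSEQ_zero)
    show "(\<lambda>n. X n \<omega>) \<longlonglongrightarrow> 0"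
    proof (rule LIMSEQ_I)
      fix e :: real assume e: "e > 0"
      obtain n1 where n1: "\<forall>n\<ge>n1. norm (g n \<omega> - 0) < e ^ 4" using LIMSEQ_D[OF g, of "e ^ 4"] e by auto
      have "norm (X n \<omega> - 0) < e" if "n \<ge> max n0 n1" for n
      proof -
        have "\<bar>X n \<omega>\<bar> ^ 4 < e ^ 4" using n1 that g0[of n \<omega>] by (auto simp: g_def power_even_abs)
        from power_less_imp_less_base[OF this less_imp_le[OF e]] show ?thesis by simp
      qed
      then show "\<exists>no. \<forall>n\<ge>no. norm (X n \<omega> - 0) < e" by blast
    qed
  qed
qed

section \<open>Almost sure convergence of Stieltjes transforms\<close>

text \<open>The estimates on the product space, carried over to the given probability space. The first part concerns the
  fluctuation of the trace and the second one its mean.\<close>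

lemma (in prob_space) normalized_trace_estimates:
  fixes x :: "nat \<Rightarrow> nat \<Rightarrow> 'a \<Rightarrow> complex" and d :: "nat \<Rightarrow> nat \<Rightarrow> real"
  defines "T \<equiv> (\<lambda>n N v \<omega>. 1 / of_nat n * (\<Sum>i<n. gram_resolvent n (\<i> * complex_of_real v) N (column_vectors N d (\<lambda>j k. x j k \<omega>)) i i))"
  assumes n: "n > 0" and N: "N > 0"
    and ind: "indep_vars (\<lambda>_. borel) (\<lambda>(j, k). x j k) ({..<n} \<times> {..<N})"
    and mean: "\<forall>j<n. \<forall>k<N. (LINT \<omega>|M. x j k \<omega>) = 0"
    and var: "\<forall>j<n. \<forall>k<N. (LINT \<omega>|M. (cmod (x j k \<omega>))\<^sup>2) = 1"
    and S: "S > 0" "\<forall>j<n. \<forall>k<N. (d j k)\<^sup>2 \<le> S" and v: "v > 0"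
  shows "\<exists>E. (\<forall>g. g = Re \<or> g = Im \<longrightarrow> (\<lambda>\<omega>. g (T n N v \<omega>) - g E) \<in> borel_measurable M \<and>
        (\<integral>\<^sup>+\<omega>. ennreal ((g (T n N v \<omega>) - g E) ^ 4) \<partial>M) \<le> ennreal (96 * (real N)\<^sup>2 * (2 * (1 / real n) / v) ^ 4)) \<and>
      (real n / real N * S\<^sup>2 / v\<^sup>2 \<le> 1 / 2 \<longrightarrow> (\<forall>h>0. cmod (E - G_fun n N d (\<i> * of_real v))
        \<le> 2 * (S / (v * v) * ((1 + real n / real N * S / v) * (2 / sqrt n + h
           + 2 * (1 / (real n * real N) * (\<Sum>j<n. \<Sum>k<N. LINT \<omega>|M. (cmod (x j k \<omega>))\<^sup>2 * of_bool (cmod (x j k \<omega>) \<ge> h * sqrt n)))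
           + 29 * sqrt N / n)))))"
proof -
  define z where "z = \<i> * complex_of_real v"
  have z: "Im z = v" "cmod z = v" using v by (auto simp: z_def norm_mult)
  \<comment> \<open>Outside of the array any probability measure will do.\<close>
  define \<nu> where "\<nu> j k = (if j < n \<and> k < N then distr M borel (x j k) else return borel 0)" for j k
  have rv: "x j k \<in> borel_measurable M" if "j < n" "k < N" for j k
    using ind that unfolding indep_vars_def2 by auto
  have nu: "\<nu> j k = distr M borel (x j k)" if "j < n" "k < N" for j k using that by (simp add: \<nu>_def)
  have msq: "(\<lambda>y::complex. (cmod y)\<^sup>2) \<in> borel_measurable borel" by measurable
  have prob: "prob_space (\<nu> j k)" for j k
    unfolding \<nu>_def using prob_space_distr[OF rv] prob_space_return[of "0::complex" borel] by auto
  have std: "standard_on {..<n} (\<lambda>j. \<nu> j k)" if k: "k < N" for k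
    unfolding standard_on_def
  proof (intro ballI)
    fix j assume "j \<in> {..<n}"
    then have j: "j < n" by simp
    have "integrable M (\<lambda>\<omega>. (cmod (x j k \<omega>))\<^sup>2)"
    proof (rule ccontr)
      assume "\<not> ?thesis"
      from not_integrable_integral_eq[OF this] show False using var j k by auto
    qed
    then have 1: "integrable (\<nu> j k) (\<lambda>y. (cmod y)\<^sup>2)"
      unfolding nu[OF j k] by (rule iffD2[OF integrable_distr_eq[OF rv[OF j k] msq]])
    have "integral\<^sup>L (\<nu> j k) (\<lambda>y. y) = (LINT \<omega>|M. x j k \<omega>)"
      unfolding nu[OF j k] by (rule integral_distr[OF rv[OF j k] measurable_ident_sets[OF refl]])
    then have 2: "integral\<^sup>L (\<nu> j k) (\<lambda>y. y) = 0" using mean j k by auto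
    have "integral\<^sup>L (\<nu> j k) (\<lambda>y. (cmod y)\<^sup>2) = (LINT \<omega>|M. (cmod (x j k \<omega>))\<^sup>2)"
      unfolding nu[OF j k] by (rule integral_distr[OF rv[OF j k] msq])
    then have 3: "integral\<^sup>L (\<nu> j k) (\<lambda>y. (cmod y)\<^sup>2) = 1" using var j k by auto
    have 4: "sets (\<nu> j k) = sets borel" unfolding nu[OF j k] by (rule sets_distr)
    show "sets (\<nu> j k) = sets borel \<and> integrable (\<nu> j k) (\<lambda>y. (cmod y)\<^sup>2)
      \<and> integral\<^sup>L (\<nu> j k) (\<lambda>y. y) = 0 \<and> integral\<^sup>L (\<nu> j k) (\<lambda>y. (cmod y)\<^sup>2) = 1"
      using 1 2 3 4 by (intro conjI)
  qed
  have dS: "(d i k)\<^sup>2 \<le> S" if "i < n" "k < N" for i k using S(2) that by blast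
  have zp: "0 < Im z" "cmod z = Im z" using z v by simp_all
  have "gram_model n N d \<nu> S z"
    by (intro gram_model.intro profile_system.intro gram_model_axioms.intro n N prob std S(1) dS zp)
  then interpret gm: gram_model n N d \<nu> S z .
  define X where "X \<omega> = (\<lambda>k\<in>{..<N}. \<lambda>j\<in>{..<n}. x j k \<omega>)" for \<omega>
  let ?B = "PiM {..<N} (\<lambda>_. PiM {..<n} (\<lambda>_. borel :: complex measure))"
  have arr: "gm.array = distr M ?B X"
  proof -
    have "gm.array = PiM {..<N} (\<lambda>k. PiM {..<n} (\<lambda>j. distr M borel (x j k)))"
      unfolding gm.array_def gm.column_def by (intro PiM_cong refl) (simp add: nu)
    then show ?thesis unfolding X_def using distr_array[OF n N ind] by simp
  qed
  have Xm: "X \<in> measurable M ?B"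
    unfolding X_def[abs_def] using rv by (intro measurable_restrict) auto
  define w where "w i = 1 / complex_of_nat n" for i :: nat
  define E where "E = (\<Sum>i<n. w i * gm.mean_R i)"
  have TX: "T n N v \<omega> = (\<Sum>i<n. w i * gm.R (X \<omega>) i i)" for \<omega>
  proof -
    have "gram_resolvent n z N (column_vectors N d (\<lambda>j k. x j k \<omega>)) i i = gm.R (X \<omega>) i i" if "i < n" for i
      unfolding gm.R_def by (rule gram_resolvent_cong[OF _ order_refl that that]) (simp add: column_vectors_def gm.Y_def X_def)
    then show ?thesis by (simp add: T_def w_def sum_divide_distrib z_def[symmetric])
  qed
  have ww: "cmod (w i) \<le> 1 / real n" if "i < n" for i by (simp add: w_def norm_divide)
  have mom: "(\<lambda>\<omega>. g (T n N v \<omega>) - g E) \<in> borel_measurable M \<and>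
        (\<integral>\<^sup>+\<omega>. ennreal ((g (T n N v \<omega>) - g E) ^ 4) \<partial>M) \<le> ennreal (96 * (real N)\<^sup>2 * (2 * (1 / real n) / v) ^ 4)"
    if g: "g = Re \<or> g = Im" for g
  proof -
    have bl: "bounded_linear g" using g bounded_linear_Re bounded_linear_Im by auto
    let ?f = "\<lambda>\<xi>. g (\<Sum>i<n. w i * gm.R \<xi> i i) - g E"
    have fm: "?f \<in> borel_measurable gm.array"
      by (intro borel_measurable_diff borel_measurable_const
        measurable_compose[OF gm.weighted_trace_measurable borel_measurable_continuous_onI[OF linear_continuous_on[OF bl]]])
    then have fB: "?f \<in> borel_measurable ?B" unfolding arr by simp
    have m: "(\<lambda>\<omega>. g (T n N v \<omega>) - g E) \<in> borel_measurable M"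
      unfolding TX by (rule measurable_compose[OF Xm fB])
    have f4: "(\<lambda>\<xi>. ennreal (?f \<xi> ^ 4)) \<in> borel_measurable (distr M ?B X)"
      unfolding arr[symmetric] by (rule measurable_compose[OF borel_measurable_power[OF fm] measurable_ennreal])
    have "(\<integral>\<^sup>+\<omega>. ennreal ((g (T n N v \<omega>) - g E) ^ 4) \<partial>M) = (\<integral>\<^sup>+\<xi>. ennreal (?f \<xi> ^ 4) \<partial>gm.array)"
      unfolding arr TX by (rule nn_integral_distr[OF Xm f4, symmetric])
    also have "\<dots> \<le> ennreal (96 * (real N)\<^sup>2 * (2 * (1 / real n) / Im z) ^ 4)"
      unfolding E_def by (rule gm.weighted_trace_fourth_moment[OF ww _ g]) (use n in auto)
    finally show ?thesis using m by (simp add: z)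
  qed
  have tl: "gm.tail h j k = (LINT \<omega>|M. (cmod (x j k \<omega>))\<^sup>2 * of_bool (cmod (x j k \<omega>) \<ge> h * sqrt n))" if "j < n" "k < N" for h j k
    unfolding gm.tail_def nu[OF that] by (rule integral_distr[OF rv[OF that]]) measurable
  have det: "cmod (E - G_fun n N d z) \<le> 2 * (S / (v * v) * ((1 + real n / real N * S / v) * (2 / sqrt n + h
           + 2 * (1 / (real n * real N) * (\<Sum>j<n. \<Sum>k<N. LINT \<omega>|M. (cmod (x j k \<omega>))\<^sup>2 * of_bool (cmod (x j k \<omega>) \<ge> h * sqrt n)))
           + 29 * sqrt N / n)))" if c: "real n / real N * S\<^sup>2 / v\<^sup>2 \<le> 1 / 2" and h: "h > 0" for h
  proof -
    have "E = 1 / of_nat n * (\<Sum>i<n. gm.mean_R i)" by (simp only: E_def w_def sum_distrib_left)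
    moreover have "cmod (1 / of_nat n * (\<Sum>i<n. gm.mean_R i) - G_fun n N d z) \<le> 2 * gm.\<delta> h"
      by (rule gm.mean_trace_near_G) (use c h in \<open>auto simp: z gm.c_def\<close>)
    moreover have "(\<Sum>j<n. \<Sum>k<N. gm.tail h j k) = (\<Sum>j<n. \<Sum>k<N. LINT \<omega>|M. (cmod (x j k \<omega>))\<^sup>2 * of_bool (cmod (x j k \<omega>) \<ge> h * sqrt n))"
      using tl by (intro sum.cong refl) auto
    ultimately show ?thesis unfolding gm.\<delta>_def gm.\<rho>_eq gm.c_def z by simp
  qed
  show ?thesis
    unfolding z_def[symmetric]
    by (rule exI[of _ E], rule conjI, intro allI impI, erule mom, intro impI allI, rule det)
qed

text \<open>The fluctuation has fourth moment of order \<open>1 / n\<^sup>2\<close>, as \<open>n / N n\<close> is bounded below. The mean is within a multiple of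
  \<open>h\<close> of \<open>G_fun\<close>, up to a null sequence, for every \<open>h > 0\<close>.\<close>

lemma (in prob_space) normalized_trace_tendsto:
  fixes x :: "nat \<Rightarrow> nat \<Rightarrow> nat \<Rightarrow> 'a \<Rightarrow> complex" and d :: "nat \<Rightarrow> nat \<Rightarrow> nat \<Rightarrow> real"
  assumes N: "\<forall>n\<ge>1. N n > 0"
    and ind: "\<forall>n\<ge>1. indep_vars (\<lambda>_. borel) (\<lambda>(j, k). x n j k) ({..<n} \<times> {..<N n})"
    and mean: "\<forall>n\<ge>1. \<forall>j<n. \<forall>k<N n. (LINT \<omega>|M. x n j k \<omega>) = 0"
    and var: "\<forall>n\<ge>1. \<forall>j<n. \<forall>k<N n. (LINT \<omega>|M. (cmod (x n j k \<omega>))\<^sup>2) = 1"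
    and lind: "\<forall>h>0. (\<lambda>n. 1 / (real n * real (N n)) *
           (\<Sum>j<n. \<Sum>k<N n. LINT \<omega>|M. (cmod (x n j k \<omega>))\<^sup>2 * of_bool (cmod (x n j k \<omega>) \<ge> h * sqrt n))) \<longlonglongrightarrow> 0"
    and lo: "lo > 0" and ratio: "\<forall>\<^sub>F n in sequentially. lo \<le> real n / real (N n) \<and> real n / real (N n) \<le> hi"
    and S: "S > 0" "\<forall>n\<ge>1. \<forall>j<n. \<forall>k<N n. (d n j k)\<^sup>2 \<le> S" and v: "v > 0" and contr: "hi * S\<^sup>2 / v\<^sup>2 \<le> 1 / 2"
  shows "AE \<omega> in M. (\<lambda>n. 1 / of_nat n * (\<Sum>i<n. gram_resolvent n (\<i> * complex_of_real v) (N n) (column_vectors (N n) (d n) (\<lambda>j k. x n j k \<omega>)) i i)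
      - G_fun n (N n) (d n) (\<i> * complex_of_real v)) \<longlonglongrightarrow> 0"
proof -
  define T where "T n \<omega> = 1 / of_nat n * (\<Sum>i<n. gram_resolvent n (\<i> * complex_of_real v) (N n) (column_vectors (N n) (d n) (\<lambda>j k. x n j k \<omega>)) i i)" for n \<omega>
  define tails where "tails h n = 1 / (real n * real (N n)) *
           (\<Sum>j<n. \<Sum>k<N n. LINT \<omega>|M. (cmod (x n j k \<omega>))\<^sup>2 * of_bool (cmod (x n j k \<omega>) \<ge> h * sqrt n))" for h n
  define G where "G n = G_fun n (N n) (d n) (\<i> * complex_of_real v)" for n
  obtain n0 where n0: "\<forall>n\<ge>n0. lo \<le> real n / real (N n) \<and> real n / real (N n) \<le> hi"
    using ratio unfolding eventually_sequentially by (elim exE)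
  have "\<exists>E. n \<ge> 1 \<longrightarrow> ((\<forall>g. g = Re \<or> g = Im \<longrightarrow> (\<lambda>\<omega>. g (T n \<omega>) - g E) \<in> borel_measurable M \<and>
        (\<integral>\<^sup>+\<omega>. ennreal ((g (T n \<omega>) - g E) ^ 4) \<partial>M) \<le> ennreal (96 * (real (N n))\<^sup>2 * (2 * (1 / real n) / v) ^ 4)) \<and>
      (real n / real (N n) * S\<^sup>2 / v\<^sup>2 \<le> 1 / 2 \<longrightarrow> (\<forall>h>0. cmod (E - G n)
        \<le> 2 * (S / (v * v) * ((1 + real n / real (N n) * S / v) * (2 / sqrt n + h
           + 2 * tails h n + 29 * sqrt (N n) / n))))))" for n
  proof (cases "n \<ge> 1")
    case True
    have "n > 0" "N n > 0" "\<forall>j<n. \<forall>k<N n. (LINT \<omega>|M. x n j k \<omega>) = 0" "\<forall>j<n. \<forall>k<N n. (LINT \<omega>|M. (cmod (x n j k \<omega>))\<^sup>2) = 1"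
      "indep_vars (\<lambda>_. borel) (\<lambda>(j, k). x n j k) ({..<n} \<times> {..<N n})" "\<forall>j<n. \<forall>k<N n. (d n j k)\<^sup>2 \<le> S"
      using True N mean var ind S by auto
    from normalized_trace_estimates[OF this(1,2,5,3,4) S(1) this(6) v]
    show ?thesis using True unfolding T_def tails_def G_def by simp
  qed simp
  then have "\<exists>E. \<forall>n. n \<ge> 1 \<longrightarrow> ((\<forall>g. g = Re \<or> g = Im \<longrightarrow> (\<lambda>\<omega>. g (T n \<omega>) - g (E n)) \<in> borel_measurable M \<and>
        (\<integral>\<^sup>+\<omega>. ennreal ((g (T n \<omega>) - g (E n)) ^ 4) \<partial>M) \<le> ennreal (96 * (real (N n))\<^sup>2 * (2 * (1 / real n) / v) ^ 4)) \<and>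
      (real n / real (N n) * S\<^sup>2 / v\<^sup>2 \<le> 1 / 2 \<longrightarrow> (\<forall>h>0. cmod (E n - G n)
        \<le> 2 * (S / (v * v) * ((1 + real n / real (N n) * S / v) * (2 / sqrt n + h
           + 2 * tails h n + 29 * sqrt (N n) / n))))))"
    by (intro choice allI)
  then obtain E where E: "\<forall>n\<ge>1. ((\<forall>g. g = Re \<or> g = Im \<longrightarrow> (\<lambda>\<omega>. g (T n \<omega>) - g (E n)) \<in> borel_measurable M \<and>
        (\<integral>\<^sup>+\<omega>. ennreal ((g (T n \<omega>) - g (E n)) ^ 4) \<partial>M) \<le> ennreal (96 * (real (N n))\<^sup>2 * (2 * (1 / real n) / v) ^ 4)) \<and>
      (real n / real (N n) * S\<^sup>2 / v\<^sup>2 \<le> 1 / 2 \<longrightarrow> (\<forall>h>0. cmod (E n - G n)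
        \<le> 2 * (S / (v * v) * ((1 + real n / real (N n) * S / v) * (2 / sqrt n + h
           + 2 * tails h n + 29 * sqrt (N n) / n))))))"
    by (elim exE)
  have Nle: "real (N n) \<le> real n / lo" if "n \<ge> max 1 n0" for n
  proof -
    have "N n > 0" "lo \<le> real n / real (N n)" using that N n0 by auto
    then show ?thesis using lo by (simp add: field_simps)
  qed
  have random: "AE \<omega> in M. (\<lambda>n. g (T n \<omega>) - g (E n)) \<longlonglongrightarrow> 0" if g: "g = Re \<or> g = Im" for g
  proof (rule AE_tendsto_0_fourth_moment[of "max 1 n0" "\<lambda>n \<omega>. g (T n \<omega>) - g (E n)" "1536 / (lo\<^sup>2 * v ^ 4)"])
    fix n assume n: "max 1 n0 \<le> n"
    then show "(\<lambda>\<omega>. g (T n \<omega>) - g (E n)) \<in> borel_measurable M" using E g by auto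
    have "(\<integral>\<^sup>+\<omega>. ennreal ((g (T n \<omega>) - g (E n)) ^ 4) \<partial>M) \<le> ennreal (96 * (real (N n))\<^sup>2 * (2 * (1 / real n) / v) ^ 4)"
      using E g n by auto
    also have "\<dots> \<le> ennreal (96 * (real n / lo)\<^sup>2 * (2 * (1 / real n) / v) ^ 4)"
      using Nle[OF n] v by (intro ennreal_leI mult_right_mono mult_left_mono power_mono) auto
    also have "96 * (real n / lo)\<^sup>2 * (2 * (1 / real n) / v) ^ 4 = 1536 / (lo\<^sup>2 * v ^ 4) / (real n)\<^sup>2"
    proof -
      have "real n > 0" using n by simp
      then show ?thesis by (simp add: power_mult_distrib power_divide power2_eq_square power4_eq_xxxx)
    qed
    finally show "(\<integral>\<^sup>+\<omega>. ennreal ((g (T n \<omega>) - g (E n)) ^ 4) \<partial>M) \<le> ennreal (1536 / (lo\<^sup>2 * v ^ 4) / (real n)\<^sup>2)" .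
  qed (use lo v in auto)
  have hi: "hi > 0"
  proof -
    have "lo \<le> hi" using n0[rule_format, OF order_refl] by linarith
    then show ?thesis using lo by simp
  qed
  define K where "K = 2 * (S / (v * v) * (1 + hi * S / v))"
  have K: "K > 0" unfolding K_def using S(1) v hi by (intro mult_pos_pos divide_pos_pos add_pos_pos) auto
  have det_le: "cmod (E n - G n) \<le> K * (h + ((2 + 29 / sqrt lo) * (1 / sqrt n) + 2 * tails h n))" if n: "max 1 n0 \<le> n" and h: "h > 0" for n h
  proof -
    have r: "real n / real (N n) \<le> hi" using n n0 by auto
    have n1: "real n > 0" using n by simp
    have "real n / real (N n) * S\<^sup>2 / v\<^sup>2 \<le> hi * S\<^sup>2 / v\<^sup>2" using r by (intro divide_right_mono mult_right_mono) auto
    then have "real n / real (N n) * S\<^sup>2 / v\<^sup>2 \<le> 1 / 2" using contr by linarith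
    then have "cmod (E n - G n) \<le> 2 * (S / (v * v) * ((1 + real n / real (N n) * S / v) * (2 / sqrt n + h + 2 * tails h n + 29 * sqrt (N n) / n)))"
      using E n h by auto
    also have "\<dots> \<le> 2 * (S / (v * v) * ((1 + hi * S / v) * (h + ((2 + 29 / sqrt lo) * (1 / sqrt n) + 2 * tails h n))))"
    proof (intro mult_left_mono mult_mono)
      show "1 + real n / real (N n) * S / v \<le> 1 + hi * S / v" using r S(1) v by (intro add_left_mono divide_right_mono mult_right_mono) auto
      have "sqrt (N n) \<le> sqrt (real n / lo)" using Nle[OF n] by simp
      then have "29 * sqrt (N n) / n \<le> 29 * sqrt (real n / lo) / n" by (intro divide_right_mono mult_left_mono) auto
      also have "\<dots> = 29 / sqrt lo * (sqrt n / n)" by (simp add: real_sqrt_divide)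
      also have "sqrt n / n = 1 / sqrt n" using n1 by (simp add: divide_simps)
      finally have "29 * sqrt (N n) / n \<le> 29 / sqrt lo * (1 / sqrt n)" .
      moreover have "(2 + 29 / sqrt lo) * (1 / sqrt n) = 2 / sqrt n + 29 / sqrt lo * (1 / sqrt n)" by (simp add: distrib_right add_divide_distrib)
      ultimately show "2 / sqrt n + h + 2 * tails h n + 29 * sqrt (N n) / n \<le> h + ((2 + 29 / sqrt lo) * (1 / sqrt n) + 2 * tails h n)"
        by linarith
      show "0 \<le> 1 + hi * S / v" using hi S(1) v by simp
      have "0 \<le> tails h n" unfolding tails_def
        by (intro mult_nonneg_nonneg sum_nonneg Bochner_Integration.integral_nonneg) auto
      then show "0 \<le> 2 / sqrt n + h + 2 * tails h n + 29 * sqrt (N n) / n" using h by (intro add_nonneg_nonneg) auto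
    qed (use S(1) v in auto)
    finally show ?thesis by (simp add: K_def mult.assoc)
  qed
  have det: "(\<lambda>n. E n - G n) \<longlonglongrightarrow> 0"
  proof (rule LIMSEQ_I)
    fix e :: real assume e: "e > 0"
    define h where "h = e / (2 * K)"
    have h: "h > 0" using e K by (simp add: h_def)
    have "(\<lambda>n. 1 / sqrt (real n)) \<longlonglongrightarrow> 0"
      unfolding divide_inverse mult_1 by (rule tendsto_inverse_0_at_top[OF filterlim_compose[OF sqrt_at_top filterlim_real_sequentially]])
    then have "(\<lambda>n. (2 + 29 / sqrt lo) * (1 / sqrt n) + 2 * tails h n) \<longlonglongrightarrow> (2 + 29 / sqrt lo) * 0 + 2 * 0"
      using lind h unfolding tails_def by (intro tendsto_add tendsto_mult tendsto_const) auto
    then have lim: "(\<lambda>n. (2 + 29 / sqrt lo) * (1 / sqrt n) + 2 * tails h n) \<longlonglongrightarrow> 0" by simp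
    obtain n1 where n1: "\<forall>n\<ge>n1. norm ((2 + 29 / sqrt lo) * (1 / sqrt n) + 2 * tails h n - 0) < h" using LIMSEQ_D[OF lim h] by auto
    have "norm (E n - G n - 0) < e" if n: "n \<ge> max n1 (max 1 n0)" for n
    proof -
      have "(2 + 29 / sqrt lo) * (1 / sqrt n) + 2 * tails h n < h" using n1[rule_format, of n] n unfolding real_norm_def by linarith
      then have "K * (h + ((2 + 29 / sqrt lo) * (1 / sqrt n) + 2 * tails h n)) < K * (h + h)" using K by (intro mult_strict_left_mono) auto
      also have "K * (h + h) = e" using K by (simp add: h_def)
      finally show ?thesis using det_le[of n h] n h by simp
    qed
    then show "\<exists>no. \<forall>n\<ge>no. norm (E n - G n - 0) < e" by blast
  qed
  from random[OF disjI1[OF refl]] random[OF disjI2[OF refl]]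
  have "AE \<omega> in M. (\<lambda>n. T n \<omega> - G n) \<longlonglongrightarrow> 0"
  proof eventually_elim
    case (elim \<omega>)
    have "(\<lambda>n. T n \<omega> - E n) \<longlonglongrightarrow> 0"
      unfolding tendsto_complex_iff using elim by simp
    from tendsto_add[OF this det] show ?case by simp
  qed
  then show ?thesis by (simp only: T_def G_def)
qed

section \<open>Vague convergence up to truncation\<close>

theorem theorem1p1:
  fixes \<Omega> :: "'a measure"
    and N :: "nat \<Rightarrow> nat"
    and x :: "nat \<Rightarrow> nat \<Rightarrow> nat \<Rightarrow> 'a \<Rightarrow> complex"
    and d :: "nat \<Rightarrow> nat \<Rightarrow> nat \<Rightarrow> real"
    and \<eta> :: "nat \<Rightarrow> real"
    and M :: "real \<Rightarrow> real"
    and c :: "real \<Rightarrow> real"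
    and f :: "nat \<Rightarrow> real \<Rightarrow> real"
  assumes "prob_space \<Omega>"
    and "\<forall>n\<ge>1. N n > 0"
    and "0 < liminf (\<lambda>n. ereal (real n / real (N n)))"
    and "limsup (\<lambda>n. ereal (real n / real (N n))) < \<infinity>"
    and "\<forall>n\<ge>1. prob_space.indep_vars \<Omega> (\<lambda>_. borel) (\<lambda>(j, k). x n j k) ({..<n} \<times> {..<N n})"
    and "\<forall>n\<ge>1. \<forall>j<n. \<forall>k<N n. (LINT \<omega>|\<Omega>. x n j k \<omega>) = 0"
    and "\<forall>n\<ge>1. \<forall>j<n. \<forall>k<N n. (LINT \<omega>|\<Omega>. (cmod (x n j k \<omega>))\<^sup>2) = 1"
    and "\<forall>h>0. (\<lambda>n. 1 / (real n * real (N n)) *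
           (\<Sum>j<n. \<Sum>k<N n. LINT \<omega>|\<Omega>.
              (cmod (x n j k \<omega>))\<^sup>2 * of_bool (cmod (x n j k \<omega>) \<ge> h * sqrt n))) \<longlonglongrightarrow> 0"
    and "\<forall>n\<ge>1. \<eta> n > 0"
    and "\<forall>m\<ge>1. \<forall>n\<ge>m. \<eta> n \<le> \<eta> m"
    and "\<eta> \<longlonglongrightarrow> 0"
    and "(\<lambda>n. 1 / ((\<eta> n)\<^sup>2 * real n * real (N n)) *
           (\<Sum>j<n. \<Sum>k<N n. LINT \<omega>|\<Omega>.
              (cmod (x n j k \<omega>))\<^sup>2 * of_bool (cmod (x n j k \<omega>) \<ge> \<eta> n * sqrt n))) \<longlonglongrightarrow> 0"
    and "\<exists>e>0. \<exists>v>0. \<forall>\<^sub>F n in sequentially. e < \<eta> n * sqrt n \<and>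
           (\<forall>j<n. \<forall>k<N n.
              (LINT \<omega>|\<Omega>. (cmod (x n j k \<omega> * of_bool (cmod (x n j k \<omega>) \<le> e)
                 - (LINT \<omega>'|\<Omega>. x n j k \<omega>' * of_bool (cmod (x n j k \<omega>') \<le> e))))\<^sup>2) > v)"
    and "\<forall>n\<ge>1. \<forall>j<n. \<forall>k<N n. d n j k \<ge> 0"
    and "\<forall>n\<ge>1. \<forall>k<N n. \<exists>j<n. d n j k \<noteq> 0"
    and "\<forall>\<epsilon>>0. M \<epsilon> > 0 \<and>
           (\<forall>n\<ge>1. \<exists>E\<^sub>r E\<^sub>c. E\<^sub>r \<subseteq> {..<n} \<and> E\<^sub>c \<subseteq> {..<N n} \<and>
              real (card E\<^sub>r) + real (card E\<^sub>c) \<le> \<epsilon> * real n \<and>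
              (\<forall>j\<in>{..<n} - E\<^sub>r. \<forall>k\<in>{..<N n} - E\<^sub>c. d n j k \<le> M \<epsilon>))"
    and "\<forall>\<epsilon>>0. c \<epsilon> \<ge> M \<epsilon>"
    and "bij_betw f UNIV trapezoids"
  shows "\<forall>\<epsilon>>0.
    (\<forall>n\<ge>1. \<forall>z. Im z > 0 \<longrightarrow> (\<exists>!e. e0_solution n (N n) (truncate_profile (c \<epsilon>) (d n)) z e)) \<and>
    (\<forall>n\<ge>1. \<exists>!F. is_F0 n (N n) (truncate_profile (c \<epsilon>) (d n)) F) \<and>
    (mean_height f \<le> 1 / 2 \<longrightarrow>
      (AE \<omega> in \<Omega>. limsup (\<lambda>n. ereal (vague_dist f
           (esd (B_mat n (N n) (d n) (\<lambda>j k. x n j k \<omega>)))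
           (F0 n (N n) (truncate_profile (c \<epsilon>) (d n))))) \<le> ereal \<epsilon>)) \<and>
    (AE \<omega> in \<Omega>. limsup (\<lambda>n. ereal (vague_dist f
         (esd (B_mat n (N n) (d n) (\<lambda>j k. x n j k \<omega>)))
         (F0 n (N n) (truncate_profile (c \<epsilon>) (d n))))) \<le> ereal (2 * \<epsilon>))"
proof (intro allI impI)
  fix \<epsilon> :: real assume \<epsilon>: "\<epsilon> > 0"
  interpret prob_space \<Omega> by fact
  let ?d = "\<lambda>n. truncate_profile (c \<epsilon>) (d n)"
  have c0: "0 < M \<epsilon>" "M \<epsilon> \<le> c \<epsilon>" "0 < c \<epsilon>" using assms(16,17) \<epsilon> by (auto intro: less_le_trans)
  have ps: "profile_system n (N n)" if "n \<ge> 1" for n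
    by unfold_locales (use that assms(2) in auto)
  have f: "range f \<subseteq> trapezoids" using bij_betw_imp_surj_on[OF assms(18)] by simp
  have F0: "real_distribution (interval_measure (F0 n (N n) (?d n)))"
      "t > 0 \<Longrightarrow> integral\<^sup>L (interval_measure (F0 n (N n) (?d n))) (kern t) = G_fun n (N n) (?d n) (\<i> * of_real t)" if n: "n \<ge> 1" for n t
  proof -
    have F: "is_F0 n (N n) (?d n) (F0 n (N n) (?d n))" by (rule profile_system.is_F0_F0[OF ps[OF n]])
    then show "real_distribution (interval_measure (F0 n (N n) (?d n)))"
      unfolding is_F0_def by (intro prob_df_interval_measure(1)) simp
    show "t > 0 \<Longrightarrow> integral\<^sup>L (interval_measure (F0 n (N n) (?d n))) (kern t) = G_fun n (N n) (?d n) (\<i> * of_real t)"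
      using F unfolding is_F0_def stieltjes_kern[symmetric] by simp
  qed
  define S where "S = (c \<epsilon>)\<^sup>2"
  have S: "S > 0" "\<forall>n\<ge>1. \<forall>j<n. \<forall>k<N n. (?d n j k)\<^sup>2 \<le> S"
  proof -
    show "S > 0" using c0 by (simp add: S_def)
    have "(?d n j k)\<^sup>2 \<le> S" if "n \<ge> 1" "j < n" "k < N n" for n j k
    proof -
      have "0 \<le> ?d n j k" "?d n j k \<le> c \<epsilon>" using assms(14) that c0 by (auto simp: truncate_profile_def)
      then show ?thesis unfolding S_def by (intro power_mono) auto
    qed
    then show "\<forall>n\<ge>1. \<forall>j<n. \<forall>k<N n. (?d n j k)\<^sup>2 \<le> S" by blast
  qed
  obtain lo where lo: "0 < lo" "\<forall>\<^sub>F n in sequentially. lo \<le> real n / real (N n)"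
  proof -
    obtain lo where lo: "0 < ereal lo" "ereal lo < liminf (\<lambda>n. ereal (real n / real (N n)))" using ereal_dense2[OF assms(3)] by blast
    have "\<forall>\<^sub>F n in sequentially. lo \<le> real n / real (N n)"
      using less_LiminfD[OF lo(2)] by eventually_elim simp
    then show ?thesis using that lo(1) by simp
  qed
  obtain hi where hi: "\<forall>\<^sub>F n in sequentially. real n / real (N n) \<le> hi"
  proof -
    obtain hi where hi: "limsup (\<lambda>n. ereal (real n / real (N n))) < ereal hi" using ereal_dense2[OF assms(4)] by blast
    have "\<forall>\<^sub>F n in sequentially. real n / real (N n) \<le> hi"
      using Limsup_lessD[OF hi] by eventually_elim simp
    then show ?thesis using that by blast
  qed
  have ratio: "\<forall>\<^sub>F n in sequentially. lo \<le> real n / real (N n) \<and> real n / real (N n) \<le> hi"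
    using lo(2) hi by eventually_elim simp
  then obtain n0 where "\<forall>n\<ge>n0. lo \<le> real n / real (N n) \<and> real n / real (N n) \<le> hi"
    unfolding eventually_sequentially by (elim exE)
  then have "lo \<le> real n0 / real (N n0)" "real n0 / real (N n0) \<le> hi" by auto
  then have hi0: "hi > 0" using lo(1) by linarith
  \<comment> \<open>From here on up the imaginary axis the contraction factor is at most \<open>1 / 2\<close>.\<close>
  define v0 where "v0 = 2 * (hi * S\<^sup>2) + 1"
  have v0: "v0 > 0" using hi0 S(1) by (simp add: v0_def add_pos_pos)
  have contr: "hi * S\<^sup>2 / t\<^sup>2 \<le> 1 / 2" if t: "v0 \<le> t" for t
  proof -
    have p: "0 \<le> hi * S\<^sup>2" using hi0 by simp
    then have t1: "1 \<le> t" "2 * (hi * S\<^sup>2) \<le> t" using t by (auto simp: v0_def)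
    then have "t * 1 \<le> t * t" by (intro mult_left_mono) auto
    then have "2 * (hi * S\<^sup>2) \<le> t\<^sup>2" using t1(2) by (simp add: power2_eq_square)
    then show ?thesis using t1(1) by (simp add: divide_le_eq)
  qed
  let ?T = "\<lambda>t n \<omega>. 1 / of_nat n * (\<Sum>i<n. gram_resolvent n (\<i> * complex_of_real t) (N n) (column_vectors (N n) (?d n) (\<lambda>j k. x n j k \<omega>)) i i)
      - G_fun n (N n) (?d n) (\<i> * complex_of_real t)"
  have "\<forall>t\<in>\<rat> \<inter> {v0..}. AE \<omega> in \<Omega>. (\<lambda>n. ?T t n \<omega>) \<longlonglongrightarrow> 0"
  proof
    fix t assume "t \<in> \<rat> \<inter> {v0..}"
    then have t: "v0 \<le> t" "0 < t" using v0 by auto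
    show "AE \<omega> in \<Omega>. (\<lambda>n. ?T t n \<omega>) \<longlonglongrightarrow> 0"
      by (rule normalized_trace_tendsto[OF assms(2,5,6,7,8) lo(1) ratio S t(2) contr[OF t(1)]])
  qed
  then have ae: "AE \<omega> in \<Omega>. \<forall>t\<in>\<rat> \<inter> {v0..}. (\<lambda>n. ?T t n \<omega>) \<longlonglongrightarrow> 0"
    by (subst AE_ball_countable) (auto intro: countable_subset[OF _ countable_rat])
  let ?B = "\<lambda>n \<omega>. esd (B_mat n (N n) (d n) (\<lambda>j k. x n j k \<omega>))"
  let ?B' = "\<lambda>n \<omega>. esd (B_mat n (N n) (?d n) (\<lambda>j k. x n j k \<omega>))"
  let ?F = "\<lambda>n. F0 n (N n) (?d n)"
  have trunc: "vague_dist f (?B n \<omega>) (?F n) \<le> 2 * \<epsilon> * mean_height f + vague_dist f (?B' n \<omega>) (?F n)" if n: "n \<ge> 1" for n \<omega>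
  proof -
    have np: "n > 0" "N n > 0" using n assms(2) by auto
    from assms(16)[rule_format, OF \<epsilon>, THEN conjunct2, rule_format, OF n]
    obtain Er Ec where E: "Er \<subseteq> {..<n}" "Ec \<subseteq> {..<N n}" "real (card Er) + real (card Ec) \<le> \<epsilon> * real n"
        "\<forall>j\<in>{..<n} - Er. \<forall>k\<in>{..<N n} - Ec. d n j k \<le> M \<epsilon>"
      by (elim exE conjE)
    have le: "\<forall>j\<in>{..<n} - Er. \<forall>k\<in>{..<N n} - Ec. d n j k \<le> c \<epsilon>"
    proof (intro ballI)
      fix j k assume jk: "j \<in> {..<n} - Er" "k \<in> {..<N n} - Ec"
      show "d n j k \<le> c \<epsilon>" by (rule order_trans[OF E(4)[rule_format, OF jk] c0(2)])
    qed
    have "vague_dist f (?B n \<omega>) (?F n) \<le> vague_dist f (?B n \<omega>) (?B' n \<omega>) + vague_dist f (?B' n \<omega>) (?F n)"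
      by (rule vague_dist_triangle[OF f esd_B_mat(1)[OF np] esd_B_mat(1)[OF np] F0(1)[OF n]])
    moreover have "vague_dist f (?B n \<omega>) (?B' n \<omega>) \<le> 2 * \<epsilon> * mean_height f"
      by (rule vague_dist_truncate_le[OF f np E(1-3) le])
    ultimately show ?thesis by linarith
  qed
  have key: "AE \<omega> in \<Omega>. limsup (\<lambda>n. ereal (vague_dist f (?B n \<omega>) (?F n))) \<le> ereal (2 * \<epsilon> * mean_height f)"
    using ae
  proof eventually_elim
    case (elim \<omega>)
    \<comment> \<open>The shift avoids \<open>n = 0\<close>, where there are no eigenvalues.\<close>
    have "(\<lambda>n. vague_dist f (?B' (Suc n) \<omega>) (?F (Suc n))) \<longlonglongrightarrow> 0"
    proof (rule vague_dist_tendsto_0_kern[OF f v0])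
      have np: "Suc n > 0" "N (Suc n) > 0" for n using assms(2) by auto
      show "real_distribution (interval_measure (?B' (Suc n) \<omega>))" for n by (rule esd_B_mat(1)[OF np])
      show "real_distribution (interval_measure (?F (Suc n)))" for n by (rule F0(1)) simp
      fix t assume t: "t \<in> \<rat>" "v0 \<le> t"
      then have t0: "t > 0" using v0 by simp
      have "(\<lambda>n. ?T t n \<omega>) \<longlonglongrightarrow> 0" using elim t by simp
      then have "(\<lambda>n. ?T t (Suc n) \<omega>) \<longlonglongrightarrow> 0" by (rule LIMSEQ_Suc)
      moreover have "integral\<^sup>L (interval_measure (?B' (Suc n) \<omega>)) (kern t) - integral\<^sup>L (interval_measure (?F (Suc n))) (kern t) = ?T t (Suc n) \<omega>" for n
        using esd_B_mat(2)[where n = "Suc n" and N = "N (Suc n)" and d = "?d (Suc n)" and x = "\<lambda>j k. x (Suc n) j k \<omega>", OF np t0] F0(2)[OF _ t0, of "Suc n"] by simp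
      ultimately show "(\<lambda>n. integral\<^sup>L (interval_measure (?B' (Suc n) \<omega>)) (kern t) - integral\<^sup>L (interval_measure (?F (Suc n))) (kern t)) \<longlonglongrightarrow> 0"
        by simp
    qed
    then have "(\<lambda>n. vague_dist f (?B' n \<omega>) (?F n)) \<longlonglongrightarrow> 0" by (rule LIMSEQ_imp_Suc)
    then have "(\<lambda>n. 2 * \<epsilon> * mean_height f + vague_dist f (?B' n \<omega>) (?F n)) \<longlonglongrightarrow> 2 * \<epsilon> * mean_height f + 0"
      by (intro tendsto_add tendsto_const)
    then have "(\<lambda>n. ereal (2 * \<epsilon> * mean_height f + vague_dist f (?B' n \<omega>) (?F n))) \<longlonglongrightarrow> ereal (2 * \<epsilon> * mean_height f)"
      by simp
    then have lim: "limsup (\<lambda>n. ereal (2 * \<epsilon> * mean_height f + vague_dist f (?B' n \<omega>) (?F n))) = ereal (2 * \<epsilon> * mean_height f)"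
      by (intro lim_imp_Limsup) auto
    have "\<forall>\<^sub>F n in sequentially. ereal (vague_dist f (?B n \<omega>) (?F n)) \<le> ereal (2 * \<epsilon> * mean_height f + vague_dist f (?B' n \<omega>) (?F n))"
      using eventually_ge_at_top[of 1] by eventually_elim (use trunc in simp)
    from Limsup_mono[OF this] show ?case unfolding lim .
  qed
  have weaken: "AE \<omega> in \<Omega>. limsup (\<lambda>n. ereal (vague_dist f (?B n \<omega>) (?F n))) \<le> ereal b" if "2 * \<epsilon> * mean_height f \<le> b" for b
    using key by eventually_elim (use that in \<open>auto intro: order_trans\<close>)
  have "2 * \<epsilon> * mean_height f \<le> 2 * \<epsilon> * 1" using mean_height_le_1[OF f] \<epsilon> by (intro mult_left_mono) auto
  then have p4: "AE \<omega> in \<Omega>. limsup (\<lambda>n. ereal (vague_dist f (?B n \<omega>) (?F n))) \<le> ereal (2 * \<epsilon>)" by (intro weaken) simp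
  have p3: "AE \<omega> in \<Omega>. limsup (\<lambda>n. ereal (vague_dist f (?B n \<omega>) (?F n))) \<le> ereal \<epsilon>" if "mean_height f \<le> 1 / 2"
  proof (rule weaken)
    have "2 * \<epsilon> * mean_height f \<le> 2 * \<epsilon> * (1 / 2)" using that \<epsilon> by (intro mult_left_mono) auto
    then show "2 * \<epsilon> * mean_height f \<le> \<epsilon>" by simp
  qed
  have p1: "\<forall>n\<ge>1. \<forall>z. Im z > 0 \<longrightarrow> (\<exists>!e. e0_solution n (N n) (?d n) z e)"
    by (intro allI impI profile_system.ex1_e0_solution[OF ps])
  have p2: "\<forall>n\<ge>1. \<exists>!F. is_F0 n (N n) (?d n) F"
    by (intro allI impI profile_system.ex1_is_F0[OF ps])
  show "(\<forall>n\<ge>1. \<forall>z. Im z > 0 \<longrightarrow> (\<exists>!e. e0_solution n (N n) (?d n) z e)) \<and>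
    (\<forall>n\<ge>1. \<exists>!F. is_F0 n (N n) (?d n) F) \<and>
    (mean_height f \<le> 1 / 2 \<longrightarrow> (AE \<omega> in \<Omega>. limsup (\<lambda>n. ereal (vague_dist f (?B n \<omega>) (?F n))) \<le> ereal \<epsilon>)) \<and>
    (AE \<omega> in \<Omega>. limsup (\<lambda>n. ereal (vague_dist f (?B n \<omega>) (?F n))) \<le> ereal (2 * \<epsilon>))"
    using p1 p2 p3 p4 by (intro conjI impI)
qed

end
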